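(* Let $n\ge4$. The algebras $A_o(n)\to A_h(n)\to A_s(n)$ correspond by Tannakian duality to the categories of Temperley-Lieb diagrams $TL_o(n)\subset TL_h(n)\subset TL_s(n)$. That is, for each $x\in\{o,h,s\}$, with $u$ the fundamental $n\times n$ corepresentation of $A_x(n)$, and for all integers $l,k\geq0$, $$Hom(u^{\otimes l},u^{\otimes k})=\mathrm{span}\{T_p\mid p\in TL_x(l,k)\},$$ and the inclusions of Hom spaces induced by the canonical quotient maps $A_o(n)\to A_h(n)\to A_s(n)$ are those induced by the inclusions of sets of diagrams $TL_o(l,k)\subset TL_h(l,k)\subset TL_s(l,k)$.
   Context: A square matrix over a unital $C^*$-algebra is orthogonal if its entries are self-adjoint and it is unitary. It is cubic if it is orthogonal and $u_{ij}u_{ik}=u_{ji}u_{ki}=0$ for $j\neq k$. It is a magic unitary if its entries are projections which on each row and column are mutually orthogonal and sum to $1$. For $x=o,h,s$, $A_x(n)$ is the universal $C^*$-algebra generated by the entries $u_{ij}$ of an $n\times n$ matrix $u$ which is respectively orthogonal, cubic, magic unitary; it is a Hopf algebra with $\Delta(u_{ij})=\sum_ku_{ik}\otimes u_{kj}$, $\varepsilon(u_{ij})=\delta_{ij}$, $S(u_{ij})=u_{ji}$. The canonical quotient maps $A_o(n)\to A_h(n)\to A_s(n)$ send $u_{ij}\mapsto u_{ij}$. $u^{\otimes k}$ is the corepresentation on $(\mathbb C^n)^{\otimes k}$ with matrix entries $u_{i_1j_1}\cdots u_{i_kj_k}$, and $Hom(u^{\otimes l},u^{\otimes k})$ is the space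 of linear maps $T:(\mathbb C^n)^{\otimes l}\to(\mathbb C^n)^{\otimes k}$ with $(T\otimes1)u^{\otimes l}=u^{\otimes k}(T\otimes1)$. Diagrams: $TL_s(l,k)$ is the set of Temperley-Lieb diagrams with $2l$ upper points and $2k$ lower points, i.e. planar (non-crossing) pairings of these $2l+2k$ points by $l+k$ strings drawn between the two rows, up to isotopy. $TL_h(l,k)$ is the subset of colored diagrams: color each row of points from left to right $abbaabba\ldots$ (pattern $abba$ repeated, with an extra $ab$ block at the end if needed); a diagram is colored if every string joins two points of the same color. $TL_o(l,k)$ is the subset of double diagrams: group the points of each row into consecutive pairs (first and second, third and fourth, etc.); a diagram is double if its strings can be collapsed correspondingly in pairs, i.e. it is obtained from a non-crossing pairing of $l$ upper and $k$ lower points by doubling every point and every string into two parallel ones. Action: with $e_1,\ldots,e_n$ the standard basis of $\mathbb C^n$, a diagram $p\in TL_s(l,k)$ acts by $$T_p(e_{i_1}\otimes\cdots\otimes e_{i_l})=\sum_{j_1\ldots j_k}\begin{pmatrix}i_1\,i_1\ldots i_l\,i_l\\ p\\ j_1\,j_1\ldots j_k\,j_k\end{pmatrix}e_{j_1}\otimes\cdots\otimes e_{j_k},$$ where, the doubled indices being placed on the upper and lower points of $p$, the middle symbol is $1$ if all strings of $p$ join pairs of equal indices, and $0$ otherwise. *)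

theory Defs
  imports Complex_Main "HOL-Library.Poly_Mapping" "HOL-Library.Function_Algebras"
    "HOL-Library.Disjoint_Sets" "HOL-Library.Cardinality" "HOL-Algebra.Ring"
begin

section \<open>Unital C*-algebras and their homomorphisms\<close>

record 'a cstar = "'a ring" +
  cscale :: "complex \<Rightarrow> 'a \<Rightarrow> 'a"
  adj :: "'a \<Rightarrow> 'a"
  cnorm :: "'a \<Rightarrow> real"

locale cstar_algebra = ring A for A :: "'a cstar" (structure) +
  assumes cscale_closed: "x \<in> carrier A \<Longrightarrow> cscale A c x \<in> carrier A"
    and cscale_add_right: "\<lbrakk>x \<in> carrier A; y \<in> carrier A\<rbrakk> \<Longrightarrow>
      cscale A c (x \<oplus> y) = cscale A c x \<oplus> cscale A c y"
    and cscale_add_left: "x \<in> carrier A \<Longrightarrow> cscale A (c + d) x = cscale A c x \<oplus> cscale A d x"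
    and cscale_cscale: "x \<in> carrier A \<Longrightarrow> cscale A c (cscale A d x) = cscale A (c * d) x"
    and cscale_one: "x \<in> carrier A \<Longrightarrow> cscale A 1 x = x"
    and cscale_mult_left: "\<lbrakk>x \<in> carrier A; y \<in> carrier A\<rbrakk> \<Longrightarrow>
      cscale A c x \<otimes> y = cscale A c (x \<otimes> y)"
    and cscale_mult_right: "\<lbrakk>x \<in> carrier A; y \<in> carrier A\<rbrakk> \<Longrightarrow>
      x \<otimes> cscale A c y = cscale A c (x \<otimes> y)"
    and adj_closed: "x \<in> carrier A \<Longrightarrow> adj A x \<in> carrier A"
    and adj_adj: "x \<in> carrier A \<Longrightarrow> adj A (adj A x) = x"
    and adj_add: "\<lbrakk>x \<in> carrier A; y \<in> carrier A\<rbrakk> \<Longrightarrow> adj A (x \<oplus> y) = adj A x \<oplus> adj A y"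
    and adj_cscale: "x \<in> carrier A \<Longrightarrow> adj A (cscale A c x) = cscale A (cnj c) (adj A x)"
    and adj_mult: "\<lbrakk>x \<in> carrier A; y \<in> carrier A\<rbrakk> \<Longrightarrow> adj A (x \<otimes> y) = adj A y \<otimes> adj A x"
    and cnorm_definite: "\<lbrakk>x \<in> carrier A; cnorm A x = 0\<rbrakk> \<Longrightarrow> x = \<zero>"
    and cnorm_triangle: "\<lbrakk>x \<in> carrier A; y \<in> carrier A\<rbrakk> \<Longrightarrow>
      cnorm A (x \<oplus> y) \<le> cnorm A x + cnorm A y"
    and cnorm_cscale: "x \<in> carrier A \<Longrightarrow> cnorm A (cscale A c x) = cmod c * cnorm A x"
    and cnorm_mult: "\<lbrakk>x \<in> carrier A; y \<in> carrier A\<rbrakk> \<Longrightarrow>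
      cnorm A (x \<otimes> y) \<le> cnorm A x * cnorm A y"
    and cstar_identity: "x \<in> carrier A \<Longrightarrow> cnorm A (adj A x \<otimes> x) = (cnorm A x)\<^sup>2"
    and complete: "\<lbrakk>\<And>m. X m \<in> carrier A;
        \<And>e. e > 0 \<Longrightarrow> \<exists>N. \<forall>i\<ge>N. \<forall>j\<ge>N. cnorm A (X i \<ominus> X j) < e\<rbrakk> \<Longrightarrow>
      \<exists>x\<in>carrier A. (\<lambda>m. cnorm A (X m \<ominus> x)) \<longlonglongrightarrow> 0"

definition cstar_hom :: "'a cstar \<Rightarrow> 'b cstar \<Rightarrow> ('a \<Rightarrow> 'b) \<Rightarrow> bool" where
  "cstar_hom A B \<pi> \<longleftrightarrow> \<pi> \<in> ring_hom A B \<and>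
     (\<forall>c. \<forall>x\<in>carrier A. \<pi> (cscale A c x) = cscale B c (\<pi> x)) \<and>
     (\<forall>x\<in>carrier A. \<pi> (adj A x) = adj B (\<pi> x))"

section \<open>Orthogonal, cubic and magic unitary matrices\<close>

definition unitary_matrix :: "'a cstar \<Rightarrow> ('n::finite \<times> 'n \<Rightarrow> 'a) \<Rightarrow> bool" where
  "unitary_matrix A u \<longleftrightarrow> range u \<subseteq> carrier A \<and>
     (\<forall>i j. (\<Oplus>\<^bsub>A\<^esub>k\<in>UNIV. u (i, k) \<otimes>\<^bsub>A\<^esub> adj A (u (j, k))) = (if i = j then \<one>\<^bsub>A\<^esub> else \<zero>\<^bsub>A\<^esub>)) \<and>
     (\<forall>i j. (\<Oplus>\<^bsub>A\<^esub>k\<in>UNIV. adj A (u (k, i)) \<otimes>\<^bsub>A\<^esub> u (k, j)) = (if i = j then \<one>\<^bsub>A\<^esub> else \<zero>\<^bsub>A\<^esub>))"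

definition orthogonal_matrix :: "'a cstar \<Rightarrow> ('n::finite \<times> 'n \<Rightarrow> 'a) \<Rightarrow> bool" where
  "orthogonal_matrix A u \<longleftrightarrow> unitary_matrix A u \<and> (\<forall>i j. adj A (u (i, j)) = u (i, j))"

definition cubic_matrix :: "'a cstar \<Rightarrow> ('n::finite \<times> 'n \<Rightarrow> 'a) \<Rightarrow> bool" where
  "cubic_matrix A u \<longleftrightarrow> orthogonal_matrix A u \<and>
     (\<forall>i j k. j \<noteq> k \<longrightarrow> u (i, j) \<otimes>\<^bsub>A\<^esub> u (i, k) = \<zero>\<^bsub>A\<^esub> \<and> u (j, i) \<otimes>\<^bsub>A\<^esub> u (k, i) = \<zero>\<^bsub>A\<^esub>)"

definition projection :: "'a cstar \<Rightarrow> 'a \<Rightarrow> bool" where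
  "projection A x \<longleftrightarrow> x \<in> carrier A \<and> adj A x = x \<and> x \<otimes>\<^bsub>A\<^esub> x = x"

definition magic_matrix :: "'a cstar \<Rightarrow> ('n::finite \<times> 'n \<Rightarrow> 'a) \<Rightarrow> bool" where
  "magic_matrix A u \<longleftrightarrow> (\<forall>i j. projection A (u (i, j))) \<and>
     (\<forall>i j k. j \<noteq> k \<longrightarrow> u (i, j) \<otimes>\<^bsub>A\<^esub> u (i, k) = \<zero>\<^bsub>A\<^esub> \<and> u (j, i) \<otimes>\<^bsub>A\<^esub> u (k, i) = \<zero>\<^bsub>A\<^esub>) \<and>
     (\<forall>i. (\<Oplus>\<^bsub>A\<^esub>j\<in>UNIV. u (i, j)) = \<one>\<^bsub>A\<^esub> \<and> (\<Oplus>\<^bsub>A\<^esub>j\<in>UNIV. u (j, i)) = \<one>\<^bsub>A\<^esub>)"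

datatype species = Ortho | Cubic | Magic

fun is_matrix :: "species \<Rightarrow> 'a cstar \<Rightarrow> ('n::finite \<times> 'n \<Rightarrow> 'a) \<Rightarrow> bool" where
  "is_matrix Ortho = orthogonal_matrix"
| "is_matrix Cubic = cubic_matrix"
| "is_matrix Magic = magic_matrix"

section \<open>Universal C*-algebras\<close>

text \<open>The free unital *-algebra on a set of generators: finitely supported complex functions on
  words in the letters \<open>(g, False)\<close>, standing for the generator \<open>g\<close>, and \<open>(g, True)\<close>, standing
  for its adjoint.  The type of words carries the concatenation monoid, so that the
  convolution product of \<^theory>\<open>HOL-Library.Poly_Mapping\<close> is the product of the free algebra.\<close>

datatype 'g star_word = Word (letters: "('g \<times> bool) list")

instantiation star_word :: (type) monoid_add
begin
definition zero_star_word :: "'a star_word" where "0 = Word []"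
definition plus_star_word :: "'a star_word \<Rightarrow> 'a star_word \<Rightarrow> 'a star_word" where
  "v + w = Word (letters v @ letters w)"
instance
  by standard (simp_all add: zero_star_word_def plus_star_word_def)
end

type_synonym 'g free_star = "'g star_word \<Rightarrow>\<^sub>0 complex"

definition fgen :: "'g \<Rightarrow> 'g free_star" where
  "fgen g = Poly_Mapping.single (Word [(g, False)]) 1"

definition fscale :: "complex \<Rightarrow> 'g free_star \<Rightarrow> 'g free_star" where
  "fscale c a = Poly_Mapping.single 0 c * a"

definition word_star :: "'g star_word \<Rightarrow> 'g star_word" where
  "word_star w = Word (rev (map (\<lambda>(g, b). (g, \<not> b)) (letters w)))"

definition fstar :: "'g free_star \<Rightarrow> 'g free_star" where
  "fstar a = (\<Sum>w\<in>Poly_Mapping.keys a.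
     Poly_Mapping.single (word_star w) (cnj (Poly_Mapping.lookup a w)))"

definition cstar_seminorm :: "('g free_star \<Rightarrow> real) \<Rightarrow> bool" where
  "cstar_seminorm p \<longleftrightarrow>
     (\<forall>a b. p (a + b) \<le> p a + p b) \<and> (\<forall>c a. p (fscale c a) = cmod c * p a) \<and>
     (\<forall>a b. p (a * b) \<le> p a * p b) \<and> (\<forall>a. p (fstar a * a) = (p a)\<^sup>2)"

text \<open>The separated completion of the free *-algebra for a C*-seminorm: Cauchy sequences
  modulo null sequences, with the operations defined on representatives.\<close>

type_synonym 'g completed = "(nat \<Rightarrow> 'g free_star) set"

definition cauchy_seq :: "('g free_star \<Rightarrow> real) \<Rightarrow> (nat \<Rightarrow> 'g free_star) \<Rightarrow> bool" where
  "cauchy_seq p X \<longleftrightarrow> (\<forall>e>0. \<exists>N. \<forall>i\<ge>N. \<forall>j\<ge>N. p (X i - X j) < e)"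

definition seq_class :: "('g free_star \<Rightarrow> real) \<Rightarrow> (nat \<Rightarrow> 'g free_star) \<Rightarrow> 'g completed" where
  "seq_class p X = {Y. cauchy_seq p Y \<and> (\<lambda>m. p (X m - Y m)) \<longlonglongrightarrow> 0}"

definition seq_rep :: "'g completed \<Rightarrow> nat \<Rightarrow> 'g free_star" where
  "seq_rep \<alpha> = (SOME X. X \<in> \<alpha>)"

definition completion :: "('g free_star \<Rightarrow> real) \<Rightarrow> 'g completed cstar" where
  "completion p =
     \<lparr>carrier = seq_class p ` {X. cauchy_seq p X},
      mult = (\<lambda>\<alpha> \<beta>. seq_class p (\<lambda>m. seq_rep \<alpha> m * seq_rep \<beta> m)),
      one = seq_class p (\<lambda>m. 1),
      zero = seq_class p (\<lambda>m. 0),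
      add = (\<lambda>\<alpha> \<beta>. seq_class p (\<lambda>m. seq_rep \<alpha> m + seq_rep \<beta> m)),
      cscale = (\<lambda>c \<alpha>. seq_class p (\<lambda>m. fscale c (seq_rep \<alpha> m))),
      adj = (\<lambda>\<alpha>. seq_class p (\<lambda>m. fstar (seq_rep \<alpha> m))),
      cnorm = (\<lambda>\<alpha>. lim (\<lambda>m. p (seq_rep \<alpha> m)))\<rparr>"

definition completion_gen :: "('g free_star \<Rightarrow> real) \<Rightarrow> 'g \<Rightarrow> 'g completed" where
  "completion_gen p g = seq_class p (\<lambda>m. fgen g)"

text \<open>The universal C*-algebra for a condition \<open>R\<close> on generators: the completion for the
  supremum of all C*-seminorms whose completion satisfies \<open>R\<close>.  The supremum is taken over a
  nonempty set, and for the conditions used here over a pointwise bounded one, since the entries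
  of a unitary matrix have norm at most 1.\<close>

definition universal_seminorm ::
  "('g completed cstar \<Rightarrow> ('g \<Rightarrow> 'g completed) \<Rightarrow> bool) \<Rightarrow> 'g free_star \<Rightarrow> real" where
  "universal_seminorm R a =
     (SUP p\<in>{p. cstar_seminorm p \<and> R (completion p) (completion_gen p)}. p a)"

definition qalg :: "species \<Rightarrow> ('n::finite \<times> 'n) completed cstar" where
  "qalg x = completion (universal_seminorm (is_matrix x))"

definition fund :: "species \<Rightarrow> 'n::finite \<times> 'n \<Rightarrow> ('n \<times> 'n) completed" where
  "fund x = completion_gen (universal_seminorm (is_matrix x))"

section \<open>Tensor powers and intertwiners\<close>

text \<open>With \<open>'n\<close> indexing the standard basis of \<open>\<complex>\<^sup>n\<close>, a vector of its \<open>k\<close>-th tensor power is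
  given by its coordinates, indexed by the words of length \<open>k\<close> over \<open>'n\<close>.  Linear maps are
  extended by 0 outside of their domain, so that equality of maps is equality of functions.\<close>

type_synonym 'n tensor = "'n list \<Rightarrow> complex"

definition tensor_power :: "nat \<Rightarrow> 'n tensor set" where
  "tensor_power k = {v. \<forall>w. length w \<noteq> k \<longrightarrow> v w = 0}"

definition basis_tensor :: "'n list \<Rightarrow> 'n tensor" where
  "basis_tensor i = (\<lambda>w. if w = i then 1 else 0)"

definition linear_maps :: "nat \<Rightarrow> nat \<Rightarrow> ('n tensor \<Rightarrow> 'n tensor) set" where
  "linear_maps l k = {T. T ` tensor_power l \<subseteq> tensor_power k \<and>
     (\<forall>v\<in>tensor_power l. \<forall>w\<in>tensor_power l. T (v + w) = T v + T w) \<and>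
     (\<forall>c. \<forall>v\<in>tensor_power l. T (\<lambda>i. c * v i) = (\<lambda>j. c * T v j)) \<and>
     (\<forall>v. v \<notin> tensor_power l \<longrightarrow> T v = 0)}"

text \<open>The entry of \<open>u\<^sup>\<otimes>\<^sup>k\<close> in row \<open>i\<close> and column \<open>j\<close>, for words \<open>i\<close> and \<open>j\<close> of length \<open>k\<close>.\<close>

definition upow :: "'a cstar \<Rightarrow> ('n \<times> 'n \<Rightarrow> 'a) \<Rightarrow> 'n list \<Rightarrow> 'n list \<Rightarrow> 'a" where
  "upow A u i j = foldr (\<lambda>ij x. u ij \<otimes>\<^bsub>A\<^esub> x) (zip i j) \<one>\<^bsub>A\<^esub>"

text \<open>The identity \<open>(T \<otimes> 1) u\<^sup>\<otimes>\<^sup>l = u\<^sup>\<otimes>\<^sup>k (T \<otimes> 1)\<close> is one between matrices over \<open>A\<close>; it is compared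
  entry by entry, the scalar entry of \<open>T\<close> in row \<open>j\<close> and column \<open>i\<close> being \<open>T (basis_tensor i) j\<close>.\<close>

definition Hom :: "'a cstar \<Rightarrow> ('n::finite \<times> 'n \<Rightarrow> 'a) \<Rightarrow> nat \<Rightarrow> nat \<Rightarrow>
    ('n tensor \<Rightarrow> 'n tensor) set" where
  "Hom A u l k = {T \<in> linear_maps l k. \<forall>i j. length i = l \<and> length j = k \<longrightarrow>
     (\<Oplus>\<^bsub>A\<^esub>i'\<in>{w. length w = l}. cscale A (T (basis_tensor i') j) (upow A u i' i)) =
     (\<Oplus>\<^bsub>A\<^esub>j'\<in>{w. length w = k}. cscale A (T (basis_tensor i) j') (upow A u j j'))}"

definition map_scale :: "complex \<Rightarrow> ('n tensor \<Rightarrow> 'n tensor) \<Rightarrow> 'n tensor \<Rightarrow> 'n tensor" where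
  "map_scale c T = (\<lambda>v j. c * T v j)"

interpretation maps: vector_space map_scale
  by standard (auto simp: map_scale_def fun_eq_iff algebra_simps)

section \<open>Temperley-Lieb diagrams\<close>

text \<open>\<open>Inl a\<close> is the upper point and \<open>Inr b\<close> the lower point at position \<open>a\<close>, \<open>b\<close> (from 0).
  A diagram is the set of its strings, each string being the set of its two end points.\<close>

type_synonym point = "nat + nat"

text \<open>Planarity is tested by going around the boundary of the strip: first the \<open>L\<close> upper points
  from left to right, then the \<open>K\<close> lower points from right to left.\<close>

fun boundary_pos :: "nat \<Rightarrow> nat \<Rightarrow> point \<Rightarrow> nat" where
  "boundary_pos L K (Inl a) = a"
| "boundary_pos L K (Inr b) = L + (K - 1 - b)"

definition pairings :: "nat \<Rightarrow> nat \<Rightarrow> point set set set" where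
  "pairings L K = {P. partition_on (Inl ` {..<L} \<union> Inr ` {..<K}) P \<and> (\<forall>s\<in>P. card s = 2)}"

definition noncrossing :: "nat \<Rightarrow> nat \<Rightarrow> point set set \<Rightarrow> bool" where
  "noncrossing L K P \<longleftrightarrow> \<not> (\<exists>s\<in>P. \<exists>t\<in>P. \<exists>w\<in>s. \<exists>x\<in>t. \<exists>y\<in>s. \<exists>z\<in>t.
     boundary_pos L K w < boundary_pos L K x \<and> boundary_pos L K x < boundary_pos L K y \<and>
     boundary_pos L K y < boundary_pos L K z)"

definition nc_pairings :: "nat \<Rightarrow> nat \<Rightarrow> point set set set" where
  "nc_pairings L K = {P \<in> pairings L K. noncrossing L K P}"

datatype colour = Col_a | Col_b

text \<open>The colours of a row are \<open>abbaabba\<dots>\<close> from left to right.\<close>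

fun point_colour :: "point \<Rightarrow> colour" where
  "point_colour (Inl m) = (if m mod 4 \<in> {0, 3} then Col_a else Col_b)"
| "point_colour (Inr m) = (if m mod 4 \<in> {0, 3} then Col_a else Col_b)"

definition coloured :: "point set set \<Rightarrow> bool" where
  "coloured P \<longleftrightarrow> (\<forall>s\<in>P. \<forall>x\<in>s. \<forall>y\<in>s. point_colour x = point_colour y)"

text \<open>Doubling: the point at position \<open>m\<close> becomes the points at positions \<open>2 * m\<close> and
  \<open>2 * m + 1\<close> of the same row.  The two parallel copies of a string between the rows join left
  copy to left copy and right copy to right copy; those of a string within a row are nested, and
  join left copies to right copies.  In the last two sets \<open>a\<close> and \<open>b\<close> occur in both orders.\<close>

definition doubled :: "point set set \<Rightarrow> point set set" where
  "doubled P =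
     {{Inl (2 * a), Inr (2 * b)} | a b. {Inl a, Inr b} \<in> P} \<union>
     {{Inl (2 * a + 1), Inr (2 * b + 1)} | a b. {Inl a, Inr b} \<in> P} \<union>
     {{Inl (2 * a), Inl (2 * b + 1)} | a b. {Inl a, Inl b} \<in> P} \<union>
     {{Inr (2 * a), Inr (2 * b + 1)} | a b. {Inr a, Inr b} \<in> P}"

fun TL :: "species \<Rightarrow> nat \<Rightarrow> nat \<Rightarrow> point set set set" where
  "TL Magic l k = nc_pairings (2 * l) (2 * k)"
| "TL Cubic l k = {P \<in> nc_pairings (2 * l) (2 * k). coloured P}"
| "TL Ortho l k = {P \<in> nc_pairings (2 * l) (2 * k). \<exists>Q\<in>nc_pairings l k. P = doubled Q}"

text \<open>The doubled indices: both copies of the point at position \<open>m\<close> carry the \<open>m\<close>-th index.\<close>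

fun point_index :: "'n list \<Rightarrow> 'n list \<Rightarrow> point \<Rightarrow> 'n" where
  "point_index i j (Inl m) = i ! (m div 2)"
| "point_index i j (Inr m) = j ! (m div 2)"

definition diagram_symbol :: "'n list \<Rightarrow> point set set \<Rightarrow> 'n list \<Rightarrow> complex" where
  "diagram_symbol i P j =
     (if \<forall>s\<in>P. \<forall>x\<in>s. \<forall>y\<in>s. point_index i j x = point_index i j y then 1 else 0)"

definition diagram_map :: "nat \<Rightarrow> nat \<Rightarrow> point set set \<Rightarrow> 'n::finite tensor \<Rightarrow> 'n tensor" where
  "diagram_map l k P v =
     (if v \<in> tensor_power l
      then (\<lambda>j. if length j = k then (\<Sum>i | length i = l. v i * diagram_symbol i P j) else 0)
      else 0)"

lemma basis_tensor_in: "length i = l \<Longrightarrow> basis_tensor i \<in> tensor_power l"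
  by (auto simp: basis_tensor_def tensor_power_def)

lemma finite_words: "finite {w :: 'n::finite list. length w = l}"
  using finite_lists_length_eq[of "UNIV :: 'n set" l] by simp

lemma sum_tensor_apply: "(\<Sum>j\<in>S. f j :: 'n tensor) w = (\<Sum>j\<in>S. f j w)"
  by (induction S rule: infinite_finite_induct) auto

text \<open>The map of a diagram is the one given on basis tensors by the usual formula.\<close>

lemma diagram_map_basis:
  fixes i :: "'n::finite list"
  assumes "length i = l"
  shows "diagram_map l k P (basis_tensor i) =
    (\<Sum>j | length j = k. (\<lambda>w. diagram_symbol i P j * basis_tensor j w))"
proof
  fix w :: "'n list"
  have "(\<Sum>i' | length i' = l. basis_tensor i i' * diagram_symbol i' P w) = diagram_symbol i P w"
    using assms by (simp add: basis_tensor_def finite_words if_distrib[of "\<lambda>x. x * _"] sum.delta cong: if_cong)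
  then show "diagram_map l k P (basis_tensor i) w =
    (\<Sum>j | length j = k. (\<lambda>w. diagram_symbol i P j * basis_tensor j w)) w"
    using assms
    by (simp add: diagram_map_def basis_tensor_in sum_tensor_apply finite_words)
      (simp add: basis_tensor_def finite_words if_distrib[of "\<lambda>x. _ * x"] sum.delta' cong: if_cong)
qed

lemma diagram_map_linear: "(diagram_map l k P :: 'n::finite tensor \<Rightarrow> 'n tensor) \<in> linear_maps l k"
  by (auto simp: linear_maps_def diagram_map_def tensor_power_def fun_eq_iff sum.distrib
      sum_distrib_left algebra_simps)

section \<open>Inclusions of Hom spaces\<close>

definition diagram_span :: "species \<Rightarrow> nat \<Rightarrow> nat \<Rightarrow> ('n::finite tensor \<Rightarrow> 'n tensor) set" where
  "diagram_span x l k = maps.span (diagram_map l k ` TL x l k)"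

text \<open>The linear maps on the span of the \<open>T\<^sub>p\<close>, \<open>p\<close> of species \<open>x\<close>, which send each \<open>T\<^sub>p\<close> to the
  \<open>T\<^sub>p\<close> of the same diagram, regarded as being of species \<open>y\<close>.\<close>

definition diagram_inclusion :: "species \<Rightarrow> species \<Rightarrow> nat \<Rightarrow> nat \<Rightarrow>
    (('n::finite tensor \<Rightarrow> 'n tensor) \<Rightarrow> 'n tensor \<Rightarrow> 'n tensor) \<Rightarrow> bool" where
  "diagram_inclusion x y l k J \<longleftrightarrow> J \<in> diagram_span x l k \<rightarrow>\<^sub>E diagram_span y l k \<and>
     (\<forall>S\<in>diagram_span x l k. \<forall>T\<in>diagram_span x l k. J (S + T) = J S + J T) \<and>
     (\<forall>c. \<forall>T\<in>diagram_span x l k. J (map_scale c T) = map_scale c (J T)) \<and>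
     (\<forall>p\<in>TL x l k. p \<in> TL y l k \<and> J (diagram_map l k p) = diagram_map l k p)"

section \<open>The universal C*-algebras exist\<close>

text \<open>The completion for a C*-seminorm is a C*-algebra, the suprema defining
  \<^const>\<open>universal_seminorm\<close> are finite and give C*-seminorms for all three species, and
  \<^const>\<open>qalg\<close> with \<^const>\<open>fund\<close> has the universal property.\<close>

subsection \<open>The free *-algebra and its C*-seminorms\<close>

lemma free_star_induct [case_names single add]:
  fixes a :: "'g free_star"
  assumes single: "\<And>w c. P (Poly_Mapping.single w c)"
    and add: "\<And>a b. P a \<Longrightarrow> P b \<Longrightarrow> P (a + b)"
  shows "P a"
proof (induction a rule: update_induct)
  case const
  show ?case using single[of 0 0] by simp
next
  case (update f w c)
  have "Poly_Mapping.update w c f = f + Poly_Mapping.single w c"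
    using update by (intro poly_mapping_eqI)
      (auto simp: lookup_update lookup_add lookup_single when_def in_keys_iff)
  then show ?case using update single add by metis
qed

lemma word_star_simps [simp]:
  "word_star (word_star w) = w" "word_star (v + w) = word_star w + word_star v"
  "word_star 0 = 0"
  by (simp_all add: word_star_def plus_star_word_def zero_star_word_def rev_map o_def
      case_prod_unfold)

lemma fstar_superset:
  assumes "finite S" "Poly_Mapping.keys a \<subseteq> S"
  shows "fstar a =
    (\<Sum>w\<in>S. Poly_Mapping.single (word_star w) (cnj (Poly_Mapping.lookup a w)))"
  unfolding fstar_def using assms
  by (intro sum.mono_neutral_left) (auto simp: in_keys_iff)

lemma fstar_add: "fstar (a + b) = fstar a + fstar b"
proof -
  let ?S = "Poly_Mapping.keys a \<union> Poly_Mapping.keys b"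
  have "Poly_Mapping.keys (a + b) \<subseteq> ?S" by (rule Poly_Mapping.keys_add)
  then show ?thesis
    by (simp add: fstar_superset[of ?S] sum.distrib lookup_add single_add)
qed

lemma fstar_single: "fstar (Poly_Mapping.single w c) = Poly_Mapping.single (word_star w) (cnj c)"
  by (subst fstar_superset[of "{w}"]) auto

lemma fstar_fstar [simp]: "fstar (fstar a) = a"
  by (induction a rule: free_star_induct) (simp_all add: fstar_single fstar_add)

lemma fstar_mult: "fstar (a * b) = fstar b * fstar a"
proof (induction a rule: free_star_induct)
  case (single v c)
  show ?case
    by (induction b rule: free_star_induct)
      (simp_all add: fstar_single fstar_add mult_single algebra_simps)
qed (simp add: fstar_add algebra_simps)

lemma fstar_zero [simp]: "fstar 0 = 0"
  by (simp add: fstar_def)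

lemma fstar_one [simp]: "fstar 1 = 1"
  using fstar_single[of "0 :: 'a star_word" 1] by simp

lemma fstar_uminus: "fstar (- a) = - fstar a"
  using fstar_add[of a "- a"] by (simp add: eq_neg_iff_add_eq_0 add.commute)

lemma fstar_diff: "fstar (a - b) = fstar a - fstar b"
  using fstar_add[of a "- b"] by (simp add: fstar_uminus)

lemma single_0_commute: "Poly_Mapping.single 0 c * (a :: 'g free_star) = a * Poly_Mapping.single 0 c"
  by (induction a rule: free_star_induct) (simp_all add: mult_single algebra_simps)

lemma fscale_simps:
  "fscale c (a + b) = fscale c a + fscale c b" "fscale (c + d) a = fscale c a + fscale d a"
  "fscale c (fscale d a) = fscale (c * d) a" "fscale c a * b = fscale c (a * b)"
  "a * fscale c b = fscale c (a * b)" "fscale 1 a = a" "fscale (- 1) a = - a"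
  "fscale c (a - b) = fscale c a - fscale c b"
  by (auto simp: fscale_def algebra_simps single_add mult_single simp flip: mult.assoc)
    (simp_all add: single_0_commute single_uminus)

lemma fstar_fscale: "fstar (fscale c a) = fscale (cnj c) (fstar a)"
  by (simp add: fscale_def fstar_mult fstar_single single_0_commute)

locale seminorm_cstar =
  fixes p :: "'g free_star \<Rightarrow> real"
  assumes p: "cstar_seminorm p"
begin

lemma p_add: "p (a + b) \<le> p a + p b"
  and p_scale: "p (fscale c a) = cmod c * p a"
  and p_mult: "p (a * b) \<le> p a * p b"
  and p_cstar: "p (fstar a * a) = (p a)\<^sup>2"
  using p by (auto simp: cstar_seminorm_def)

lemma p_zero [simp]: "p 0 = 0"
  using p_scale[of 0 0] by (simp add: fscale_def)

lemma p_uminus [simp]: "p (- a) = p a"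
  using p_scale[of "-1" a] by (simp add: fscale_simps)

lemma p_nonneg [simp]: "0 \<le> p a"
  using p_add[of a "- a"] by simp

lemma p_diff_commute: "p (a - b) = p (b - a)"
  using p_uminus[of "a - b"] by simp

lemma p_diff_triangle: "p (a - c) \<le> p (a - b) + p (b - c)"
  using p_add[of "a - b" "b - c"] by simp

lemma p_diff_le: "p (a - b) \<le> p a + p b"
  using p_add[of a "- b"] by simp

lemma p_reverse: "\<bar>p a - p b\<bar> \<le> p (a - b)"
  using p_add[of "a - b" b] p_add[of "b - a" a] p_diff_commute[of a b] by simp

lemma p_star_le: "p a \<le> p (fstar a)"
proof (cases "p a = 0")
  case False
  then have "p a > 0" using p_nonneg[of a] by linarith
  moreover have "p a * p a \<le> p (fstar a) * p a"
    using p_mult[of "fstar a" a] by (simp add: p_cstar power2_eq_square)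
  ultimately show ?thesis by simp
qed simp

lemma p_star [simp]: "p (fstar a) = p a"
  using p_star_le[of a] p_star_le[of "fstar a"] by simp

lemma p_one_le: "p 1 \<le> 1"
proof -
  have "p 1 = (p 1)\<^sup>2" using p_cstar[of 1] by simp
  then show ?thesis by (metis linorder_not_less less_eq_real_def power2_eq_square mult_cancel_right2 p_nonneg order_refl zero_le_one)
qed

lemma p_sum: "p (\<Sum>i\<in>S. f i) \<le> (\<Sum>i\<in>S. p (f i))"
  by (induction S rule: infinite_finite_induct) (auto intro: order_trans[OF p_add])

text \<open>Square roots of \<open>1 - z\<close> for self-adjoint \<open>z\<close>, up to an arbitrarily small error.\<close>

lemma approx_sqrt:
  assumes z: "fstar z = z" "p z < 1" and e: "e > 0"
  shows "\<exists>s. fstar s = s \<and> (\<forall>x. x * z = z * x \<longrightarrow> x * s = s * x) \<and> p (s * s - (1 - z)) < e"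
proof -
  define f where "f y = fscale (1/2) (z + y * y)" for y
  define y where "y n = (f ^^ n) 0" for n
  have y0: "y 0 = 0" and ySuc: "y (Suc n) = f (y n)" for n by (simp_all add: y_def)
  define r where "r = 1 - sqrt (1 - p z)"
  have r: "0 \<le> r" "r < 1" using z p_nonneg[of z] by (auto simp: r_def)
  have rr: "(p z + r * r) / 2 = r"
  proof -
    have "(sqrt (1 - p z))\<^sup>2 = 1 - p z" using z by simp
    then show ?thesis by (simp add: r_def power2_eq_square field_simps)
  qed
  have star: "fstar (y n) = y n" for n
    by (induction n) (simp_all add: y0 ySuc f_def fstar_fscale fstar_add fstar_mult z)
  have comm: "x * y n = y n * x" if "x * z = z * x" for x n
  proof (induction n)
    case (Suc n)
    have "x * (y n * y n) = y n * y n * x" by (metis Suc mult.assoc)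
    then show ?case using that by (simp add: ySuc f_def fscale_simps algebra_simps)
  qed (simp add: y0)
  have bound: "p (y n) \<le> r" for n
  proof (induction n)
    case (Suc n)
    have "p (y n * y n) \<le> p (y n) * p (y n)" by (rule p_mult)
    also have "\<dots> \<le> r * r" using Suc r by (intro mult_mono) auto
    finally have "p (z + y n * y n) \<le> p z + r * r" using p_add[of z "y n * y n"] by linarith
    then have "p (y (Suc n)) \<le> (p z + r * r) / 2" by (simp add: ySuc f_def p_scale)
    then show ?case by (simp only: rr)
  qed (simp add: y0 r)
  have step: "p (y (Suc n) - y n) \<le> r ^ n * p z" for n
  proof (induction n)
    case 0
    show ?case using p_nonneg[of z] by (simp add: ySuc y0 f_def p_scale)
  next
    case (Suc n)
    let ?d = "y (Suc n) - y n"
    have "y (Suc (Suc n)) - y (Suc n) = fscale (1/2) (y (Suc n) * ?d + ?d * y n)"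
      by (simp add: ySuc[of "Suc n"] ySuc[of n] f_def flip: fscale_simps)
        (simp add: ySuc[of n] f_def algebra_simps)
    then have "p (y (Suc (Suc n)) - y (Suc n)) = p (y (Suc n) * ?d + ?d * y n) / 2"
      by (simp add: p_scale)
    also have "p (y (Suc n) * ?d + ?d * y n) \<le> p (y (Suc n)) * p ?d + p ?d * p (y n)"
      by (rule order_trans[OF p_add add_mono[OF p_mult p_mult]])
    also have "\<dots> \<le> r * p ?d + p ?d * r"
      by (intro add_mono mult_right_mono mult_left_mono bound) auto
    also have "(r * p ?d + p ?d * r) / 2 = r * p ?d" by simp
    also have "r * p ?d \<le> r * (r ^ n * p z)" using Suc r by (intro mult_left_mono) auto
    finally show ?case by simp
  qed
  have "(\<lambda>n. 2 * (r ^ n * p z)) \<longlonglongrightarrow> 2 * (0 * p z)"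
    using r by (intro tendsto_intros LIMSEQ_power_zero) auto
  then have "\<forall>\<^sub>F n in sequentially. 2 * (r ^ n * p z) < e"
    using e order_tendstoD(2) by fastforce
  then obtain n where n: "2 * (r ^ n * p z) < e" by (auto simp: eventually_sequentially)
  define s where "s = 1 - y n"
  have "s * s - (1 - z) = fscale 2 (y (Suc n) - y n)"
  proof -
    have "fscale 2 (y (Suc n)) = z + y n * y n" by (simp add: ySuc f_def fscale_simps)
    moreover have "fscale 2 (y n) = y n + y n"
      using fscale_simps(2)[of 1 1 "y n"] by (simp add: fscale_simps)
    ultimately show ?thesis by (simp add: fscale_simps s_def algebra_simps)
  qed
  then have "p (s * s - (1 - z)) = 2 * p (y (Suc n) - y n)" using p_scale[of 2] by simp
  then have "p (s * s - (1 - z)) < e" using step[of n] n by linarith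
  moreover have "x * s = s * x" if "x * z = z * x" for x
    using comm[OF that, of n] by (simp add: s_def algebra_simps)
  moreover have "fstar s = s" by (simp add: s_def fstar_diff star)
  ultimately show ?thesis by blast
qed

lemma commuting_squares:
  assumes "fstar x = x" "fstar y = y" "x * y = y * x"
  shows "(p x)\<^sup>2 \<le> p (x * x + y * y)"
proof -
  define v where "v = x + fscale \<i> y"
  have v': "fstar v = x - fscale \<i> y"
    using fscale_simps(3)[of "-1" \<i> y] by (simp add: v_def fstar_add fstar_fscale assms fscale_simps(7))
  have "fstar v * v = x * x + y * y"
    unfolding v' using fscale_simps(7)[of "y * y"]
    by (simp add: v_def algebra_simps fscale_simps assms)
  then have v2: "(p v)\<^sup>2 = p (x * x + y * y)" using p_cstar[of v] by simp
  have "x + x = v + fstar v" unfolding v' by (simp add: v_def)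
  then have "fscale 2 x = v + fstar v"
    using fscale_simps(2)[of 1 1 x] by (simp add: fscale_simps)
  then have "2 * p x \<le> p v + p (fstar v)"
    using p_add[of v "fstar v"] p_scale[of 2 x] by simp
  then have "p x \<le> p v" by simp
  then show ?thesis using v2 by (metis p_nonneg power_mono)
qed

lemma square_positive1:
  assumes a: "fstar a = a" "p a < 1"
  shows "p (1 - a * a) \<le> 1"
proof (rule field_le_epsilon)
  fix e :: real assume "e > 0"
  have "p (a * a) \<le> p a * p a" by (rule p_mult)
  also have "\<dots> < 1" using a p_nonneg[of a] mult_strict_mono'[of "p a" 1 "p a" 1] by simp
  finally obtain s where s: "fstar s = s" "a * s = s * a" "p (s * s - (1 - a * a)) < e / 2"
    using approx_sqrt[of "a * a" "e / 2"] \<open>e > 0\<close> a by (auto simp: fstar_mult mult.assoc)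
  have "(p s)\<^sup>2 \<le> p (s * s + a * a)" using commuting_squares s a by simp
  also have "s * s + a * a = (s * s - (1 - a * a)) + 1" by simp
  also have "p \<dots> \<le> e / 2 + 1" using p_add[of "s * s - (1 - a * a)" 1] s p_one_le by linarith
  finally have "p (s * s) \<le> e / 2 + 1" using p_cstar[of s] s by simp
  moreover have "1 - a * a = s * s - (s * s - (1 - a * a))" by simp
  ultimately show "p (1 - a * a) \<le> 1 + e"
    using p_diff_le[of "s * s" "s * s - (1 - a * a)"] s by simp
qed

lemma square_positive:
  assumes a: "fstar a = a" and t: "(p a)\<^sup>2 < t"
  shows "p (fscale t 1 - a * a) \<le> t"
proof -
  have t0: "t > 0" using t by (smt (verit) zero_le_power2)
  define b where "b = fscale (1 / sqrt t) a"
  have "p a < sqrt t" using t real_less_rsqrt by blast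
  then have "p b < 1" using t0 by (simp add: b_def p_scale norm_divide)
  moreover have "fstar b = b" by (simp add: b_def fstar_fscale a)
  ultimately have "p (1 - b * b) \<le> 1" using square_positive1 by blast
  moreover have "fscale t (1 - b * b) = fscale t 1 - a * a"
  proof -
    have "complex_of_real t * (1 / (sqrt t * sqrt t)) = 1"
      using t0 by (simp flip: of_real_mult)
    then show ?thesis by (simp add: b_def fscale_simps flip: of_real_mult)
  qed
  ultimately show ?thesis
    using t0 p_scale[of t "1 - b * b"] by (simp add: mult_left_le)
qed

text \<open>If self-adjoint elements have squares summing up to 1, then their norm is at most 1.\<close>

lemma sum_squares_bound:
  assumes S: "finite S" "k \<in> S" and sa: "\<And>i. i \<in> S \<Longrightarrow> fstar (a i) = a i"
    and sum: "p ((\<Sum>i\<in>S. a i * a i) - 1) = 0"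
  shows "p (a k) \<le> 1"
proof -
  let ?x = "a k"
  define b where "b = 1 - ?x * ?x"
  define t where "t = (\<Sum>i\<in>S - {k}. (p (a i))\<^sup>2 + 1)"
  have t0: "t \<ge> 0" unfolding t_def by (intro sum_nonneg) simp
  have x: "fstar ?x = ?x" using sa S by simp
  have "p (fscale t 1 - b) \<le> t"
  proof -
    have "fscale t 1 = (\<Sum>i\<in>S - {k}. fscale (complex_of_real ((p (a i))\<^sup>2 + 1)) 1)"
    proof -
      have "fscale (\<Sum>i\<in>F. complex_of_real (g i)) 1 = (\<Sum>i\<in>F. fscale (complex_of_real (g i)) 1)" if "finite F"
        for F and g :: "_ \<Rightarrow> real"
        using that by induction (simp_all add: fscale_simps, simp add: fscale_def)
      from this[of "S - {k}" "\<lambda>i. (p (a i))\<^sup>2 + 1"] show ?thesis using S by (simp add: t_def)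
    qed
    then have "fscale t 1 - b = (\<Sum>i\<in>S - {k}. fscale (complex_of_real ((p (a i))\<^sup>2 + 1)) 1 - a i * a i) +
        ((\<Sum>i\<in>S. a i * a i) - 1)"
      using S by (simp add: b_def sum_subtractf sum.remove[of S k])
    then have "p (fscale t 1 - b) \<le>
        p (\<Sum>i\<in>S - {k}. fscale (complex_of_real ((p (a i))\<^sup>2 + 1)) 1 - a i * a i) + 0"
      using sum p_add[of "\<Sum>i\<in>S - {k}. fscale (complex_of_real ((p (a i))\<^sup>2 + 1)) 1 - a i * a i"
        "(\<Sum>i\<in>S. a i * a i) - 1"] by presburger
    also have "\<dots> \<le> (\<Sum>i\<in>S - {k}. p (fscale (complex_of_real ((p (a i))\<^sup>2 + 1)) 1 - a i * a i)) + 0"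
      by (intro add_right_mono p_sum)
    also have "\<dots> \<le> t"
      unfolding t_def using sa square_positive[of "a i" "(p (a i))\<^sup>2 + 1" for i]
      by (auto intro!: sum_mono)
    finally show ?thesis .
  qed
  have main: "(p ?x)\<^sup>2 \<le> 1 + e" if e: "e > 0" for e
  proof -
    define c where "c = t + e / 2"
    have c: "c > 0" using t0 e by (simp add: c_def)
    define z where "z = fscale (1 / c) (fscale t 1 - b)"
    have z: "fstar z = z"
      by (simp add: z_def b_def fstar_fscale fstar_diff fstar_mult x)
    have "p z = p (fscale t 1 - b) / c" using c by (simp add: z_def p_scale norm_divide)
    also have "\<dots> \<le> t / c" using \<open>p (fscale t 1 - b) \<le> t\<close> c by (intro divide_right_mono) auto
    also have "\<dots> < 1" using c e by (simp add: c_def)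
    finally have "p z < 1" .
    moreover have "e / (2 * c) > 0" using c e by simp
    ultimately obtain s where s: "fstar s = s" "\<And>y. y * z = z * y \<Longrightarrow> y * s = s * y"
        "p (s * s - (1 - z)) < e / (2 * c)"
      using approx_sqrt[OF z] by blast
    have "?x * z = z * ?x" by (simp add: z_def b_def fscale_simps algebra_simps)
    then have comm: "?x * s = s * ?x" by (rule s)
    define y where "y = fscale (sqrt c) s"
    have y: "fstar y = y" "?x * y = y * ?x"
      by (simp_all add: y_def fstar_fscale s fscale_simps comm)
    have yy: "y * y = fscale c (s * s)"
      using c by (simp add: y_def fscale_simps flip: of_real_mult)
    have "fscale c z = fscale t 1 - b" using c by (simp add: z_def fscale_simps)
    moreover have "fscale c 1 = fscale t 1 + fscale (e / 2) (1 :: 'g free_star)"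
      using fscale_simps(2)[of t "e / 2" "1 :: 'g free_star"] by (simp add: c_def)
    ultimately have "?x * ?x + y * y = fscale c (s * s - (1 - z)) + (fscale (e / 2) 1 + 1)"
      by (simp add: yy fscale_simps(8) b_def)
    then have "p (?x * ?x + y * y) \<le> p (fscale c (s * s - (1 - z))) + (p (fscale (e / 2) 1) + p 1)"
      using p_add[of "fscale c (s * s - (1 - z))" "fscale (e / 2) 1 + 1"] p_add[of "fscale (e / 2) 1" 1]
      by simp
    also have "p (fscale c (s * s - (1 - z))) = c * p (s * s - (1 - z))"
      using c by (simp add: p_scale)
    also have "\<dots> \<le> c * (e / (2 * c))"
      using s(3) c by (intro mult_left_mono) auto
    also have "p (fscale (e / 2) 1) \<le> e / 2"
      using e p_one_le by (simp add: p_scale norm_divide mult_left_le)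
    finally have "p (?x * ?x + y * y) \<le> 1 + e" using c p_one_le by simp
    then show ?thesis using commuting_squares[OF x y] by linarith
  qed
  then have "(p ?x)\<^sup>2 \<le> 1" by (rule field_le_epsilon)
  then show ?thesis by (simp add: power_le_one_iff)
qed

end

subsection \<open>Completions\<close>

context seminorm_cstar
begin

lemma cauchy_bound:
  assumes "cauchy_seq p X" "cauchy_seq p Y" "B > 0"
    and le: "\<And>i j. p (Z i - Z j) \<le> B * (p (X i - X j) + p (Y i - Y j))"
  shows "cauchy_seq p Z"
  unfolding cauchy_seq_def
proof (intro allI impI)
  fix e :: real assume "e > 0"
  then have e: "e / (2 * B) > 0" using assms by simp
  obtain M N where M: "\<forall>i\<ge>M. \<forall>j\<ge>M. p (X i - X j) < e / (2 * B)"
    and N: "\<forall>i\<ge>N. \<forall>j\<ge>N. p (Y i - Y j) < e / (2 * B)"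
    using assms(1,2) e unfolding cauchy_seq_def by meson
  have "p (Z i - Z j) < e" if "i \<ge> max M N" "j \<ge> max M N" for i j
  proof -
    have "p (X i - X j) + p (Y i - Y j) < e / (2 * B) + e / (2 * B)"
      using M N that by (intro add_strict_mono) auto
    then have "B * (p (X i - X j) + p (Y i - Y j)) < B * (e / (2 * B) + e / (2 * B))"
      using assms by (intro mult_strict_left_mono) auto
    then have "B * (p (X i - X j) + p (Y i - Y j)) < e" using assms by simp
    then show ?thesis using le[of i j] by linarith
  qed
  then show "\<exists>N. \<forall>i\<ge>N. \<forall>j\<ge>N. p (Z i - Z j) < e" by blast
qed

lemma null_bound:
  assumes "(\<lambda>m. p (D m)) \<longlonglongrightarrow> 0" "(\<lambda>m. p (E m)) \<longlonglongrightarrow> 0"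
    and le: "\<And>m. p (Z m) \<le> B * (p (D m) + p (E m))"
  shows "(\<lambda>m. p (Z m)) \<longlonglongrightarrow> 0"
proof (rule tendsto_sandwich[OF _ _ tendsto_const])
  show "(\<lambda>m. B * (p (D m) + p (E m))) \<longlonglongrightarrow> 0"
    using tendsto_mult[OF tendsto_const tendsto_add[OF assms(1,2)], of B] by simp
qed (use le in auto)

lemma cauchy_const [simp]: "cauchy_seq p (\<lambda>m. a)"
  by (auto simp: cauchy_seq_def)

lemma cauchy_add:
  assumes "cauchy_seq p X" "cauchy_seq p Y"
  shows "cauchy_seq p (\<lambda>m. X m + Y m)"
proof (rule cauchy_bound[OF assms, of 1])
  fix i j
  have "X i + Y i - (X j + Y j) = (X i - X j) + (Y i - Y j)" by simp
  then show "p (X i + Y i - (X j + Y j)) \<le> 1 * (p (X i - X j) + p (Y i - Y j))"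
    using p_add by (metis mult_1)
qed simp

lemma cauchy_fscale:
  assumes "cauchy_seq p X"
  shows "cauchy_seq p (\<lambda>m. fscale c (X m))"
proof (rule cauchy_bound[OF assms assms, of "cmod c + 1"])
  fix i j
  have "p (fscale c (X i) - fscale c (X j)) = cmod c * p (X i - X j)"
    by (simp add: p_scale flip: fscale_simps)
  also have "\<dots> \<le> (cmod c + 1) * (p (X i - X j) + p (X i - X j))"
    by (intro mult_mono) auto
  finally show "p (fscale c (X i) - fscale c (X j)) \<le> (cmod c + 1) * (p (X i - X j) + p (X i - X j))" .
qed (simp add: add_nonneg_pos)

lemma cauchy_fstar:
  assumes "cauchy_seq p X"
  shows "cauchy_seq p (\<lambda>m. fstar (X m))"
  by (rule cauchy_bound[OF assms assms, of 1]) (simp_all flip: fstar_diff)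

lemma cauchy_bounded:
  assumes "cauchy_seq p X"
  obtains B where "B > 0" "\<And>m. p (X m) \<le> B"
proof -
  obtain N where N: "\<forall>i\<ge>N. \<forall>j\<ge>N. p (X i - X j) < 1"
    using assms unfolding cauchy_seq_def by (meson zero_less_one)
  define B where "B = 1 + (\<Sum>i\<le>N. p (X i))"
  have B: "p (X i) \<le> B - 1" if "i \<le> N" for i
    unfolding B_def using that member_le_sum[of i "{..N}" "\<lambda>i. p (X i)"] by simp
  have "p (X m) \<le> B" for m
  proof (cases "m \<le> N")
    case False
    then have "p (X m - X N) < 1" using N by simp
    then show ?thesis using p_add[of "X m - X N" "X N"] B[of N] by simp
  qed (use B[of m] in simp)
  moreover have "B > 0" by (simp add: B_def add_pos_nonneg sum_nonneg)
  ultimately show ?thesis using that by blast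
qed

lemma mult_diff_bound:
  assumes "p a \<le> B" "p d \<le> B" "B \<ge> 0"
  shows "p (a * b - c * d) \<le> B * (p (a - c) + p (b - d))"
proof -
  have "a * b - c * d = a * (b - d) + (a - c) * d" by (simp add: algebra_simps)
  then have "p (a * b - c * d) \<le> p (a * (b - d)) + p ((a - c) * d)" using p_add by metis
  also have "\<dots> \<le> p a * p (b - d) + p (a - c) * p d" by (intro add_mono p_mult)
  also have "\<dots> \<le> B * p (b - d) + p (a - c) * B"
    using assms by (intro add_mono mult_mono) auto
  finally show ?thesis by (simp add: algebra_simps)
qed

lemma cauchy_mult:
  assumes "cauchy_seq p X" "cauchy_seq p Y"
  shows "cauchy_seq p (\<lambda>m. X m * Y m)"
proof -
  obtain B C where B: "B > 0" "\<And>m. p (X m) \<le> B" and C: "C > 0" "\<And>m. p (Y m) \<le> C"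
    using cauchy_bounded assms by metis
  show ?thesis
  proof (rule cauchy_bound[OF assms, of "max B C"])
    show "p (X i * Y i - X j * Y j) \<le> max B C * (p (X i - X j) + p (Y i - Y j))" for i j
      using B(1) B(2)[of i] C(2)[of j] by (intro mult_diff_bound) auto
  qed (use B in auto)
qed

lemma cauchy_uminus: "cauchy_seq p X \<Longrightarrow> cauchy_seq p (\<lambda>m. - X m)"
  using cauchy_fscale[of X "-1"] by (simp add: fscale_simps)

lemma class_eq_iff:
  assumes "cauchy_seq p X" "cauchy_seq p Y"
  shows "seq_class p X = seq_class p Y \<longleftrightarrow> (\<lambda>m. p (X m - Y m)) \<longlonglongrightarrow> 0"
proof
  assume "seq_class p X = seq_class p Y"
  moreover have "Y \<in> seq_class p Y" using assms by (simp add: seq_class_def)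
  ultimately have "Y \<in> seq_class p X" by simp
  then show "(\<lambda>m. p (X m - Y m)) \<longlonglongrightarrow> 0" by (simp add: seq_class_def)
next
  assume xy: "(\<lambda>m. p (X m - Y m)) \<longlonglongrightarrow> 0"
  then have yx: "(\<lambda>m. p (Y m - X m)) \<longlonglongrightarrow> 0"
    by (subst p_diff_commute)
  have "(\<lambda>m. p (V m - Z m)) \<longlonglongrightarrow> 0"
    if "(\<lambda>m. p (W m - Z m)) \<longlonglongrightarrow> 0" "(\<lambda>m. p (V m - W m)) \<longlonglongrightarrow> 0" for V W Z
    by (rule null_bound[OF that, of _ 1]) (simp, subst add.commute, rule p_diff_triangle)
  then show "seq_class p X = seq_class p Y"
    using xy yx by (auto simp: seq_class_def)
qed

lemma rep_class:
  assumes "cauchy_seq p X"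
  shows "cauchy_seq p (seq_rep (seq_class p X))"
    and "(\<lambda>m. p (seq_rep (seq_class p X) m - X m)) \<longlonglongrightarrow> 0"
proof -
  have "X \<in> seq_class p X" using assms by (simp add: seq_class_def)
  then have "seq_rep (seq_class p X) \<in> seq_class p X"
    unfolding seq_rep_def by (rule someI[of "\<lambda>Y. Y \<in> seq_class p X" X])
  then show "cauchy_seq p (seq_rep (seq_class p X))"
    and "(\<lambda>m. p (seq_rep (seq_class p X) m - X m)) \<longlonglongrightarrow> 0"
    by (auto simp: seq_class_def p_diff_commute)
qed

abbreviation "C \<equiv> completion p"

lemma carrier_iff: "\<alpha> \<in> carrier C \<longleftrightarrow> (\<exists>X. cauchy_seq p X \<and> \<alpha> = seq_class p X)"
  by (auto simp: completion_def)

lemma carrierI: "cauchy_seq p X \<Longrightarrow> seq_class p X \<in> carrier C"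
  by (auto simp: carrier_iff)

lemma carrierE:
  assumes "\<alpha> \<in> carrier C"
  obtains X where "cauchy_seq p X" "\<alpha> = seq_class p X"
  using assms carrier_iff by blast

lemma add_class:
  assumes "cauchy_seq p X" "cauchy_seq p Y"
  shows "seq_class p X \<oplus>\<^bsub>C\<^esub> seq_class p Y = seq_class p (\<lambda>m. X m + Y m)"
proof -
  let ?X = "seq_rep (seq_class p X)" and ?Y = "seq_rep (seq_class p Y)"
  have "(\<lambda>m. p (?X m + ?Y m - (X m + Y m))) \<longlonglongrightarrow> 0"
  proof (rule null_bound[OF rep_class(2)[OF assms(1)] rep_class(2)[OF assms(2)], of _ 1])
    fix m
    have "?X m + ?Y m - (X m + Y m) = (?X m - X m) + (?Y m - Y m)" by simp
    then show "p (?X m + ?Y m - (X m + Y m)) \<le> 1 * (p (?X m - X m) + p (?Y m - Y m))"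
      using p_add by (metis mult_1)
  qed
  then show ?thesis
    by (simp add: completion_def class_eq_iff cauchy_add rep_class assms)
qed

lemma mult_class:
  assumes "cauchy_seq p X" "cauchy_seq p Y"
  shows "seq_class p X \<otimes>\<^bsub>C\<^esub> seq_class p Y = seq_class p (\<lambda>m. X m * Y m)"
proof -
  let ?X = "seq_rep (seq_class p X)" and ?Y = "seq_rep (seq_class p Y)"
  obtain B D where B: "B > 0" "\<And>m. p (?X m) \<le> B" and D: "D > 0" "\<And>m. p (Y m) \<le> D"
    using cauchy_bounded assms rep_class by metis
  have "(\<lambda>m. p (?X m * ?Y m - X m * Y m)) \<longlonglongrightarrow> 0"
  proof (rule null_bound[OF rep_class(2)[OF assms(1)] rep_class(2)[OF assms(2)]])
    fix m
    show "p (?X m * ?Y m - X m * Y m) \<le> max B D * (p (?X m - X m) + p (?Y m - Y m))"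
      using B(1) B(2)[of m] D(2)[of m] by (intro mult_diff_bound) auto
  qed
  then show ?thesis
    by (simp add: completion_def class_eq_iff cauchy_mult rep_class assms)
qed

lemma cscale_class:
  assumes "cauchy_seq p X"
  shows "cscale C c (seq_class p X) = seq_class p (\<lambda>m. fscale c (X m))"
proof -
  let ?X = "seq_rep (seq_class p X)"
  have "(\<lambda>m. cmod c * p (?X m - X m)) \<longlonglongrightarrow> cmod c * 0"
    by (intro tendsto_intros rep_class assms)
  then have "(\<lambda>m. p (fscale c (?X m) - fscale c (X m))) \<longlonglongrightarrow> 0"
    by (simp add: p_scale flip: fscale_simps)
  then show ?thesis
    by (simp add: completion_def class_eq_iff cauchy_fscale rep_class assms)
qed

lemma adj_class:
  assumes "cauchy_seq p X"
  shows "adj C (seq_class p X) = seq_class p (\<lambda>m. fstar (X m))"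
  using rep_class(2)[OF assms]
  by (simp add: completion_def class_eq_iff cauchy_fstar rep_class assms flip: fstar_diff)

lemma cnorm_class:
  assumes "cauchy_seq p X"
  shows "(\<lambda>m. p (X m)) \<longlonglongrightarrow> cnorm C (seq_class p X)"
proof -
  let ?X = "seq_rep (seq_class p X)"
  have "Cauchy (\<lambda>m. p (?X m))"
  proof (rule CauchyI)
    fix e :: real assume "e > 0"
    then obtain N where "\<forall>i\<ge>N. \<forall>j\<ge>N. p (?X i - ?X j) < e"
      using rep_class(1)[OF assms] unfolding cauchy_seq_def by meson
    then show "\<exists>N. \<forall>i\<ge>N. \<forall>j\<ge>N. norm (p (?X i) - p (?X j)) < e"
      using p_reverse by (metis order_le_less_trans real_norm_def)
  qed
  then have "(\<lambda>m. p (?X m)) \<longlonglongrightarrow> cnorm C (seq_class p X)"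
    by (simp add: completion_def convergent_LIMSEQ_iff[symmetric] real_Cauchy_convergent)
  moreover have "(\<lambda>m. p (?X m) - p (X m)) \<longlonglongrightarrow> 0"
    by (rule tendsto_rabs_zero_cancel, rule tendsto_sandwich[OF _ _ tendsto_const rep_class(2)[OF assms]])
      (use p_reverse in auto)
  ultimately show ?thesis using tendsto_diff by fastforce
qed

lemma zero_class: "\<zero>\<^bsub>C\<^esub> = seq_class p (\<lambda>m. 0)" and one_class: "\<one>\<^bsub>C\<^esub> = seq_class p (\<lambda>m. 1)"
  by (simp_all add: completion_def)

lemmas class_simps = add_class mult_class cscale_class adj_class zero_class one_class
  cauchy_add cauchy_mult cauchy_fscale cauchy_fstar cauchy_uminus carrierI

lemma ring_completion: "ring C"
proof (rule ringI)
  show "abelian_group C"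
  proof (rule abelian_groupI)
    fix x assume "x \<in> carrier C"
    then obtain X where X: "cauchy_seq p X" "x = seq_class p X" by (auto simp: carrier_iff)
    show "\<exists>y\<in>carrier C. y \<oplus>\<^bsub>C\<^esub> x = \<zero>\<^bsub>C\<^esub>"
      by (rule bexI[of _ "seq_class p (\<lambda>m. - X m)"]) (simp_all add: X class_simps)
  qed (auto elim!: carrierE simp: class_simps add_ac)
  show "Group.monoid C"
    by (rule monoidI) (auto elim!: carrierE simp: class_simps mult.assoc)
qed (auto elim!: carrierE simp: class_simps algebra_simps)

interpretation C: ring C by (rule ring_completion)

lemma uminus_class: "cauchy_seq p X \<Longrightarrow> \<ominus>\<^bsub>C\<^esub> seq_class p X = seq_class p (\<lambda>m. - X m)"
  by (rule C.minus_equality) (simp_all add: class_simps)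

lemma minus_class:
  "cauchy_seq p X \<Longrightarrow> cauchy_seq p Y \<Longrightarrow>
    seq_class p X \<ominus>\<^bsub>C\<^esub> seq_class p Y = seq_class p (\<lambda>m. X m - Y m)"
  by (simp add: a_minus_def uminus_class class_simps)

lemma cauchy_diff: "cauchy_seq p X \<Longrightarrow> cauchy_seq p Y \<Longrightarrow> cauchy_seq p (\<lambda>m. X m - Y m)"
  using cauchy_add[of X "\<lambda>m. - Y m"] by (simp add: cauchy_uminus)

lemma finsum_class:
  assumes "finite S" "\<And>k. k \<in> S \<Longrightarrow> cauchy_seq p (f k)"
  shows "cauchy_seq p (\<lambda>m. \<Sum>k\<in>S. f k m) \<and>
    (\<Oplus>\<^bsub>C\<^esub>k\<in>S. seq_class p (f k)) = seq_class p (\<lambda>m. \<Sum>k\<in>S. f k m)"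
  using assms
proof (induction S)
  case (insert k S)
  then show ?case by (subst C.finsum_insert) (auto simp: class_simps)
qed (simp add: class_simps)

lemma complete_completion:
  assumes \<alpha>: "\<And>k. \<alpha> k \<in> carrier C"
    and cau: "\<And>e. e > 0 \<Longrightarrow> \<exists>N. \<forall>i\<ge>N. \<forall>j\<ge>N. cnorm C (\<alpha> i \<ominus>\<^bsub>C\<^esub> \<alpha> j) < e"
  shows "\<exists>x\<in>carrier C. (\<lambda>k. cnorm C (\<alpha> k \<ominus>\<^bsub>C\<^esub> x)) \<longlonglongrightarrow> 0"
proof -
  have "\<forall>k. \<exists>X. cauchy_seq p X \<and> \<alpha> k = seq_class p X" using \<alpha> carrier_iff by blast
  then obtain X where X: "\<And>k. cauchy_seq p (X k)" "\<And>k. \<alpha> k = seq_class p (X k)" by metis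
  have "\<forall>k. \<exists>N. \<forall>i\<ge>N. \<forall>j\<ge>N. p (X k i - X k j) < inverse (real (Suc k))"
    using X(1) unfolding cauchy_seq_def by (metis inverse_positive_iff_positive of_nat_0_less_iff zero_less_Suc)
  then obtain N where N: "\<And>k i j. i \<ge> N k \<Longrightarrow> j \<ge> N k \<Longrightarrow> p (X k i - X k j) < inverse (real (Suc k))"
    by metis
  define Y where "Y k = X k (N k)" for k
  have small: "\<exists>M. \<forall>k\<ge>M. inverse (real (Suc k)) < e" if e: "e > 0" for e
    using order_tendstoD(2)[OF LIMSEQ_inverse_real_of_nat e] by (simp add: eventually_sequentially)
  have cauchy: "\<exists>M. \<forall>k\<ge>M. \<forall>l\<ge>M. p (Y k - Y l) < e" if "e > 0" for e
  proof -
    have e3: "e / 3 > 0" using that by simp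
    obtain M1 where M1: "\<forall>k\<ge>M1. inverse (real (Suc k)) < e / 3" using small[OF e3] by blast
    obtain M2 where M2: "\<forall>k\<ge>M2. \<forall>l\<ge>M2. cnorm C (\<alpha> k \<ominus>\<^bsub>C\<^esub> \<alpha> l) < e / 3" using cau[OF e3] by blast
    have "p (Y k - Y l) < e" if kl: "k \<ge> max M1 M2" "l \<ge> max M1 M2" for k l
    proof -
      have "(\<lambda>i. p (X k i - X l i)) \<longlonglongrightarrow> cnorm C (\<alpha> k \<ominus>\<^bsub>C\<^esub> \<alpha> l)"
        using cnorm_class[OF cauchy_diff[OF X(1) X(1)]] by (simp add: X minus_class)
      moreover have "cnorm C (\<alpha> k \<ominus>\<^bsub>C\<^esub> \<alpha> l) < e / 3" using M2 kl by simp
      ultimately have "\<forall>\<^sub>F i in sequentially. p (X k i - X l i) < e / 3"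
        by (rule order_tendstoD(2))
      then obtain I where I: "\<And>i. i \<ge> I \<Longrightarrow> p (X k i - X l i) < e / 3"
        by (auto simp: eventually_sequentially)
      define i where "i = max I (max (N k) (N l))"
      have "p (Y k - Y l) \<le> p (Y k - X k i) + p (X k i - Y l)" by (rule p_diff_triangle)
      also have "p (X k i - Y l) \<le> p (X k i - X l i) + p (X l i - Y l)" by (rule p_diff_triangle)
      finally have "p (Y k - Y l) \<le> p (Y k - X k i) + (p (X k i - X l i) + p (X l i - Y l))" by simp
      moreover have "p (Y k - X k i) < inverse (real (Suc k))"
        unfolding Y_def by (rule N) (auto simp: i_def)
      moreover have "p (X l i - Y l) < inverse (real (Suc l))"
        unfolding Y_def by (rule N) (auto simp: i_def)
      moreover have "p (X k i - X l i) < e / 3" by (rule I) (simp add: i_def)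
      moreover have "inverse (real (Suc k)) < e / 3" "inverse (real (Suc l)) < e / 3"
        using M1 kl by auto
      ultimately show ?thesis by linarith
    qed
    then show ?thesis by blast
  qed
  then have Y: "cauchy_seq p Y" by (simp add: cauchy_seq_def)
  have "(\<lambda>k. cnorm C (\<alpha> k \<ominus>\<^bsub>C\<^esub> seq_class p Y)) \<longlonglongrightarrow> 0"
  proof (rule LIMSEQ_I)
    fix e :: real assume "e > 0"
    then have e3: "e / 3 > 0" by simp
    obtain M1 where M1: "\<forall>k\<ge>M1. inverse (real (Suc k)) < e / 3" using small[OF e3] by blast
    obtain M2 where M2: "\<forall>k\<ge>M2. \<forall>l\<ge>M2. p (Y k - Y l) < e / 3" using cauchy[OF e3] by blast
    have "norm (cnorm C (\<alpha> k \<ominus>\<^bsub>C\<^esub> seq_class p Y) - 0) < e" if k: "k \<ge> max M1 M2" for k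
    proof -
      have lim: "(\<lambda>i. p (X k i - Y i)) \<longlonglongrightarrow> cnorm C (\<alpha> k \<ominus>\<^bsub>C\<^esub> seq_class p Y)"
        using cnorm_class[OF cauchy_diff[OF X(1) Y]] by (simp add: X Y minus_class)
      have "p (X k i - Y i) \<le> 2 * e / 3" if i: "i \<ge> max (N k) M2" for i
      proof -
        have "p (X k i - Y i) \<le> p (X k i - Y k) + p (Y k - Y i)" by (rule p_diff_triangle)
        moreover have "p (X k i - Y k) < inverse (real (Suc k))"
          unfolding Y_def by (rule N) (use i in auto)
        moreover have "inverse (real (Suc k)) < e / 3" using M1 k by simp
        moreover have "p (Y k - Y i) < e / 3" using M2 k i by simp
        ultimately show ?thesis by linarith
      qed
      then have "cnorm C (\<alpha> k \<ominus>\<^bsub>C\<^esub> seq_class p Y) \<le> 2 * e / 3"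
        by (intro LIMSEQ_le_const2[OF lim]) blast
      moreover have "0 \<le> cnorm C (\<alpha> k \<ominus>\<^bsub>C\<^esub> seq_class p Y)"
        by (rule LIMSEQ_le_const[OF lim]) auto
      ultimately show ?thesis using \<open>e > 0\<close> by simp
    qed
    then show "\<exists>M. \<forall>k\<ge>M. norm (cnorm C (\<alpha> k \<ominus>\<^bsub>C\<^esub> seq_class p Y) - 0) < e" by blast
  qed
  then show ?thesis using carrierI[OF Y] by blast
qed

theorem cstar_algebra_completion: "cstar_algebra C"
proof (rule cstar_algebra.intro[OF ring_completion], rule cstar_algebra_axioms.intro)
  fix x y and c :: complex
  assume "x \<in> carrier C" "y \<in> carrier C"
  then obtain X Y where X: "cauchy_seq p X" "x = seq_class p X" and Y: "cauchy_seq p Y" "y = seq_class p Y"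
    by (auto simp: carrier_iff)
  show "cnorm C (x \<oplus>\<^bsub>C\<^esub> y) \<le> cnorm C x + cnorm C y"
    by (rule LIMSEQ_le[of "\<lambda>m. p (X m + Y m)" _ "\<lambda>m. p (X m) + p (Y m)"])
      (auto simp: X Y class_simps p_add intro!: cnorm_class tendsto_add)
  show "cnorm C (x \<otimes>\<^bsub>C\<^esub> y) \<le> cnorm C x * cnorm C y"
    by (rule LIMSEQ_le[of "\<lambda>m. p (X m * Y m)" _ "\<lambda>m. p (X m) * p (Y m)"])
      (auto simp: X Y class_simps p_mult intro!: cnorm_class tendsto_mult)
next
  fix x and c :: complex
  assume "x \<in> carrier C"
  then obtain X where X: "cauchy_seq p X" "x = seq_class p X" by (auto simp: carrier_iff)
  note lim = cnorm_class[OF X(1)]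
  show "cnorm C (cscale C c x) = cmod c * cnorm C x"
    using cnorm_class[OF cauchy_fscale[OF X(1)], of c] tendsto_mult[OF tendsto_const lim, of "cmod c"]
    by (simp add: X class_simps p_scale LIMSEQ_unique)
  show "cnorm C (adj C x \<otimes>\<^bsub>C\<^esub> x) = (cnorm C x)\<^sup>2"
    using cnorm_class[OF cauchy_mult[OF cauchy_fstar[OF X(1)] X(1)]] tendsto_power[OF lim, of 2]
    by (simp add: X class_simps p_cstar LIMSEQ_unique)
  show "x = \<zero>\<^bsub>C\<^esub>" if "cnorm C x = 0"
    using lim that by (simp add: X class_simps class_eq_iff)
qed (auto elim!: carrierE simp: class_simps fscale_simps fstar_add fstar_mult fstar_fscale
      intro: complete_completion)

lemma gen_class: "completion_gen p g = seq_class p (\<lambda>m. fgen g)"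
  by (simp add: completion_gen_def)

lemma const_eq_iff: "seq_class p (\<lambda>m. a) = seq_class p (\<lambda>m. b) \<longleftrightarrow> p (a - b) = 0"
  by (subst class_eq_iff) (auto simp: LIMSEQ_const_iff)

end

subsection \<open>Limits and evaluation of words in a C*-algebra\<close>

context cstar_algebra
begin

lemma cscale_zero_left: "x \<in> carrier A \<Longrightarrow> cscale A 0 x = \<zero>"
  using cscale_add_left[of x 0 0] cscale_closed[of x 0] by (metis add.l_cancel_one add_0)

lemma uminus_eq: "x \<in> carrier A \<Longrightarrow> \<ominus> x = cscale A (- 1) x"
  using cscale_add_left[of x "-1" 1]
  by (intro minus_equality) (simp_all add: cscale_zero_left cscale_one cscale_closed)

lemma cnorm_zero: "cnorm A \<zero> = 0"
  using cnorm_cscale[of \<zero> 0] cscale_zero_left[of \<zero>] by simp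

lemma cnorm_uminus: "x \<in> carrier A \<Longrightarrow> cnorm A (\<ominus> x) = cnorm A x"
  by (simp add: uminus_eq cnorm_cscale)

lemma cnorm_nonneg: "x \<in> carrier A \<Longrightarrow> 0 \<le> cnorm A x"
  using cnorm_triangle[of x "\<ominus> x"] by (simp add: r_neg cnorm_zero cnorm_uminus)

lemma adj_zero: "adj A \<zero> = \<zero>"
  using adj_cscale[of \<zero> 0] by (simp add: cscale_zero_left adj_closed)

lemma adj_one: "adj A \<one> = \<one>"
  using adj_mult[of "adj A \<one>" \<one>] by (simp add: adj_adj adj_closed)

definition cdist :: "'a \<Rightarrow> 'a \<Rightarrow> real" where "cdist x y = cnorm A (x \<ominus> y)"

lemma cdist_nonneg: "x \<in> carrier A \<Longrightarrow> y \<in> carrier A \<Longrightarrow> 0 \<le> cdist x y"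
  by (simp add: cdist_def cnorm_nonneg)

lemma cdist_commute: "x \<in> carrier A \<Longrightarrow> y \<in> carrier A \<Longrightarrow> cdist x y = cdist y x"
  using cnorm_uminus[of "x \<ominus> y"] by (simp add: cdist_def a_minus_def minus_add a_ac)

lemma cdist_triangle:
  assumes "x \<in> carrier A" "y \<in> carrier A" "z \<in> carrier A"
  shows "cdist x z \<le> cdist x y + cdist y z"
proof -
  have "x \<ominus> z = (x \<ominus> y) \<oplus> (y \<ominus> z)"
    using assms by (simp add: a_minus_def a_assoc r_neg2 r_neg1)
  then show ?thesis using assms cnorm_triangle[of "x \<ominus> y" "y \<ominus> z"] by (simp add: cdist_def)
qed

lemma cdist_eq:
  assumes "x \<in> carrier A" "y \<in> carrier A" "cdist x y \<le> 0"
  shows "x = y"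
proof -
  have "x \<ominus> y = \<zero>"
    using assms cnorm_definite[of "x \<ominus> y"] cdist_nonneg[of x y] by (simp add: cdist_def)
  moreover have "(x \<ominus> y) \<oplus> y = x" using assms by (simp add: a_minus_def a_assoc l_neg)
  ultimately show ?thesis using assms by simp
qed

lemma cdist_add:
  assumes "x \<in> carrier A" "y \<in> carrier A" "x' \<in> carrier A" "y' \<in> carrier A"
  shows "cdist (x \<oplus> x') (y \<oplus> y') \<le> cdist x y + cdist x' y'"
proof -
  have "(x \<oplus> x') \<ominus> (y \<oplus> y') = (x \<ominus> y) \<oplus> (x' \<ominus> y')"
    using assms by (simp add: a_minus_def minus_add a_ac)
  then show ?thesis using assms cnorm_triangle[of "x \<ominus> y" "x' \<ominus> y'"] by (simp add: cdist_def)
qed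

lemma cdist_mult:
  assumes "x \<in> carrier A" "y \<in> carrier A" "x' \<in> carrier A" "y' \<in> carrier A"
  shows "cdist (x \<otimes> x') (y \<otimes> y') \<le> cnorm A x * cdist x' y' + cdist x y * cnorm A y'"
proof -
  have "(x \<otimes> x') \<ominus> (y \<otimes> y') = x \<otimes> (x' \<ominus> y') \<oplus> (x \<ominus> y) \<otimes> y'"
    using assms by (simp add: a_minus_def r_distr l_distr r_minus l_minus a_assoc r_neg1)
  also have "cnorm A \<dots> \<le> cnorm A (x \<otimes> (x' \<ominus> y')) + cnorm A ((x \<ominus> y) \<otimes> y')"
    using assms by (intro cnorm_triangle) auto
  also have "\<dots> \<le> cnorm A x * cdist x' y' + cdist x y * cnorm A y'"
    unfolding cdist_def using assms by (intro add_mono cnorm_mult) auto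
  finally show ?thesis by (simp add: cdist_def)
qed

lemma cdist_cscale:
  assumes "x \<in> carrier A" "y \<in> carrier A"
  shows "cdist (cscale A c x) (cscale A c y) = cmod c * cdist x y"
proof -
  have "cscale A c x \<ominus> cscale A c y = cscale A c (x \<ominus> y)"
    using assms by (simp add: a_minus_def uminus_eq cscale_closed cscale_add_right cscale_cscale)
  then show ?thesis using assms by (simp add: cdist_def cnorm_cscale)
qed

lemma cnorm_adj: "x \<in> carrier A \<Longrightarrow> cnorm A (adj A x) = cnorm A x"
proof -
  have le: "cnorm A x \<le> cnorm A (adj A x)" if x: "x \<in> carrier A" for x
  proof (cases "cnorm A x = 0")
    case False
    then have "cnorm A x > 0" using cnorm_nonneg[OF x] by linarith
    moreover have "cnorm A x * cnorm A x \<le> cnorm A (adj A x) * cnorm A x"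
      using x cnorm_mult[of "adj A x" x] by (simp add: cstar_identity adj_closed power2_eq_square)
    ultimately show ?thesis by simp
  qed (use x in \<open>simp add: cnorm_nonneg adj_closed\<close>)
  assume "x \<in> carrier A"
  then show ?thesis using le[of x] le[of "adj A x"] by (simp add: adj_adj adj_closed)
qed

lemma cdist_adj:
  assumes "x \<in> carrier A" "y \<in> carrier A"
  shows "cdist (adj A x) (adj A y) = cdist x y"
proof -
  have "adj A x \<ominus> adj A y = adj A (x \<ominus> y)"
    using assms by (simp add: a_minus_def uminus_eq cscale_closed adj_closed adj_add adj_cscale)
  then show ?thesis using assms by (simp add: cdist_def cnorm_adj)
qed

lemma cnorm_reverse:
  assumes "x \<in> carrier A" "y \<in> carrier A"
  shows "\<bar>cnorm A x - cnorm A y\<bar> \<le> cdist x y"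
proof -
  have "x \<ominus> \<zero> = x" if "x \<in> carrier A" for x using that by (simp add: a_minus_def)
  then have "cnorm A x = cdist x \<zero>" "cnorm A y = cdist y \<zero>" using assms by (simp_all add: cdist_def)
  then show ?thesis
    using cdist_triangle[of x y \<zero>] cdist_triangle[of y x \<zero>] cdist_commute[of x y] assms by simp
qed

definition clim :: "(nat \<Rightarrow> 'a) \<Rightarrow> 'a \<Rightarrow> bool" where
  "clim X x \<longleftrightarrow> (\<forall>m. X m \<in> carrier A) \<and> x \<in> carrier A \<and> (\<lambda>m. cdist (X m) x) \<longlonglongrightarrow> 0"

lemma climI:
  assumes "\<And>m. X m \<in> carrier A" "x \<in> carrier A" "f \<longlonglongrightarrow> 0" "\<And>m. cdist (X m) x \<le> f m"
  shows "clim X x"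
  unfolding clim_def using assms
  by (auto intro!: tendsto_sandwich[OF _ _ tendsto_const assms(3)] simp: cdist_nonneg)

lemma clim_const: "x \<in> carrier A \<Longrightarrow> clim (\<lambda>m. x) x"
  by (simp add: clim_def cdist_def r_neg a_minus_def cnorm_zero)

lemma clim_unique:
  assumes "clim X x" "clim X y"
  shows "x = y"
proof (rule cdist_eq)
  show "cdist x y \<le> 0"
  proof (rule LIMSEQ_le_const)
    show "(\<lambda>m. cdist (X m) x + cdist (X m) y) \<longlonglongrightarrow> 0"
      using assms tendsto_add[of "\<lambda>m. cdist (X m) x" 0 _ "\<lambda>m. cdist (X m) y" 0] by (simp add: clim_def)
    show "\<exists>N. \<forall>m\<ge>N. cdist x y \<le> cdist (X m) x + cdist (X m) y"
      using assms cdist_triangle[of x "X _" y] cdist_commute[of x] by (auto simp: clim_def)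
  qed
qed (use assms in \<open>auto simp: clim_def\<close>)

lemma clim_transform:
  assumes "clim X x" "\<And>m. Y m \<in> carrier A" "(\<lambda>m. cdist (Y m) (X m)) \<longlonglongrightarrow> 0"
  shows "clim Y x"
proof (rule climI)
  show "(\<lambda>m. cdist (Y m) (X m) + cdist (X m) x) \<longlonglongrightarrow> 0"
    using tendsto_add[OF assms(3), of "\<lambda>m. cdist (X m) x" 0] assms by (simp add: clim_def)
qed (use assms in \<open>auto simp: clim_def intro: cdist_triangle\<close>)

lemma clim_cnorm:
  assumes "clim X x"
  shows "(\<lambda>m. cnorm A (X m)) \<longlonglongrightarrow> cnorm A x"
proof -
  have "(\<lambda>m. cnorm A (X m) - cnorm A x) \<longlonglongrightarrow> 0"
  proof (rule tendsto_rabs_zero_cancel, rule tendsto_sandwich[OF _ _ tendsto_const])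
    show "(\<lambda>m. cdist (X m) x) \<longlonglongrightarrow> 0" using assms by (simp add: clim_def)
  qed (use assms in \<open>auto simp: clim_def intro!: always_eventually cnorm_reverse\<close>)
  then show ?thesis by (simp add: LIM_zero_iff)
qed

lemma clim_add:
  assumes "clim X x" "clim Y y"
  shows "clim (\<lambda>m. X m \<oplus> Y m) (x \<oplus> y)"
proof (rule climI)
  show "(\<lambda>m. cdist (X m) x + cdist (Y m) y) \<longlonglongrightarrow> 0"
    using assms tendsto_add[of "\<lambda>m. cdist (X m) x" 0 _ "\<lambda>m. cdist (Y m) y" 0] by (simp add: clim_def)
qed (use assms in \<open>auto simp: clim_def intro: cdist_add\<close>)

lemma clim_mult:
  assumes "clim X x" "clim Y y"
  shows "clim (\<lambda>m. X m \<otimes> Y m) (x \<otimes> y)"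
proof (rule climI)
  have "(\<lambda>m. cnorm A (X m) * cdist (Y m) y + cdist (X m) x * cnorm A y) \<longlonglongrightarrow>
      cnorm A x * 0 + 0 * cnorm A y"
    using assms by (intro tendsto_intros clim_cnorm) (auto simp: clim_def)
  then show "(\<lambda>m. cnorm A (X m) * cdist (Y m) y + cdist (X m) x * cnorm A y) \<longlonglongrightarrow> 0" by simp
qed (use assms in \<open>auto simp: clim_def intro: cdist_mult\<close>)

lemma clim_cscale:
  assumes "clim X x"
  shows "clim (\<lambda>m. cscale A c (X m)) (cscale A c x)"
proof (rule climI)
  show "(\<lambda>m. cmod c * cdist (X m) x) \<longlonglongrightarrow> 0"
    using assms tendsto_mult[OF tendsto_const, of "\<lambda>m. cdist (X m) x" 0 _ "cmod c"] by (simp add: clim_def)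
qed (use assms in \<open>auto simp: clim_def cscale_closed cdist_cscale\<close>)

lemma clim_adj: "clim X x \<Longrightarrow> clim (\<lambda>m. adj A (X m)) (adj A x)"
  by (simp add: clim_def adj_closed cdist_adj)

definition word_eval :: "('g \<Rightarrow> 'a) \<Rightarrow> 'g star_word \<Rightarrow> 'a" where
  "word_eval v w = foldr (\<lambda>(g, b) x. (if b then adj A (v g) else v g) \<otimes> x) (letters w) \<one>"

definition free_eval :: "('g \<Rightarrow> 'a) \<Rightarrow> 'g free_star \<Rightarrow> 'a" where
  "free_eval v a = (\<Oplus>w\<in>Poly_Mapping.keys a. cscale A (Poly_Mapping.lookup a w) (word_eval v w))"

context
  fixes v :: "'g \<Rightarrow> 'a"
  assumes v: "range v \<subseteq> carrier A"
begin

lemma v_closed: "v g \<in> carrier A"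
  using v by blast

lemma word_eval_closed: "word_eval v w \<in> carrier A"
proof -
  have "foldr (\<lambda>(g, b) x. (if b then adj A (v g) else v g) \<otimes> x) ws \<one> \<in> carrier A" for ws
    by (induction ws) (auto simp: v_closed adj_closed)
  then show ?thesis by (simp add: word_eval_def)
qed

lemma word_eval_Word:
  "word_eval v (Word []) = \<one>"
  "word_eval v (Word ((g, b) # ws)) = (if b then adj A (v g) else v g) \<otimes> word_eval v (Word ws)"
  by (simp_all add: word_eval_def)

lemma word_eval_append:
  "word_eval v (Word (ws @ ws')) = word_eval v (Word ws) \<otimes> word_eval v (Word ws')"
  by (induction ws) (auto simp: word_eval_Word word_eval_closed v_closed adj_closed m_assoc)

lemma word_eval_plus: "word_eval v (w + w') = word_eval v w \<otimes> word_eval v w'"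
  by (cases w; cases w') (simp add: plus_star_word_def word_eval_append)

lemma word_eval_zero: "word_eval v 0 = \<one>"
  by (simp add: zero_star_word_def word_eval_Word)

lemma word_eval_star: "word_eval v (word_star w) = adj A (word_eval v w)"
proof -
  have "word_eval v (Word (rev (map (\<lambda>(g, b). (g, \<not> b)) ws))) = adj A (word_eval v (Word ws))" for ws
    by (induction ws)
      (auto simp: word_eval_append word_eval_Word word_eval_closed v_closed adj_closed adj_one
        adj_mult adj_adj)
  then show ?thesis by (metis word_star_def star_word.collapse)
qed

lemma free_eval_closed: "free_eval v a \<in> carrier A"
  unfolding free_eval_def by (auto intro!: finsum_closed cscale_closed word_eval_closed)

lemma free_eval_superset:
  assumes "finite S" "Poly_Mapping.keys a \<subseteq> S"
  shows "free_eval v a = (\<Oplus>w\<in>S. cscale A (Poly_Mapping.lookup a w) (word_eval v w))"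
  unfolding free_eval_def using assms
  by (intro add.finprod_mono_neutral_cong_left)
    (auto simp: in_keys_iff cscale_zero_left cscale_closed word_eval_closed)

lemma free_eval_add: "free_eval v (a + b) = free_eval v a \<oplus> free_eval v b"
proof -
  let ?S = "Poly_Mapping.keys a \<union> Poly_Mapping.keys b"
  have "Poly_Mapping.keys (a + b) \<subseteq> ?S" by (rule Poly_Mapping.keys_add)
  moreover have "(\<Oplus>w\<in>?S. cscale A (Poly_Mapping.lookup a w) (word_eval v w) \<oplus>
      cscale A (Poly_Mapping.lookup b w) (word_eval v w)) =
    (\<Oplus>w\<in>?S. cscale A (Poly_Mapping.lookup a w) (word_eval v w)) \<oplus>
    (\<Oplus>w\<in>?S. cscale A (Poly_Mapping.lookup b w) (word_eval v w))"
    by (rule finsum_addf) (auto simp: cscale_closed word_eval_closed)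
  ultimately show ?thesis
    by (simp add: free_eval_superset[of ?S] lookup_add cscale_add_left word_eval_closed)
qed

lemma free_eval_single: "free_eval v (Poly_Mapping.single w c) = cscale A c (word_eval v w)"
  by (subst free_eval_superset[of "{w}"]) (auto simp: cscale_closed word_eval_closed)

lemma free_eval_mult: "free_eval v (a * b) = free_eval v a \<otimes> free_eval v b"
proof (induction a rule: free_star_induct)
  case (single w c)
  show ?case
  proof (induction b rule: free_star_induct)
    case (single w' c')
    show ?case
      by (simp add: mult_single free_eval_single word_eval_plus word_eval_closed cscale_closed
          cscale_mult_left cscale_mult_right cscale_cscale mult.commute)
  qed (simp add: distrib_left free_eval_add r_distr free_eval_closed)
qed (simp add: distrib_right free_eval_add l_distr free_eval_closed)

lemma free_eval_star: "free_eval v (fstar a) = adj A (free_eval v a)"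
  by (induction a rule: free_star_induct)
    (simp_all add: fstar_single fstar_add free_eval_single free_eval_add word_eval_star
      word_eval_closed adj_cscale adj_add free_eval_closed)

lemma free_eval_fscale: "free_eval v (fscale c a) = cscale A c (free_eval v a)"
  by (simp add: fscale_def free_eval_mult free_eval_single word_eval_zero cscale_mult_left
      free_eval_closed)

lemma free_eval_one: "free_eval v 1 = \<one>"
  using free_eval_single[of 0 1] by (simp add: word_eval_zero cscale_one)

lemma free_eval_diff: "free_eval v (a - b) = free_eval v a \<ominus> free_eval v b"
  using free_eval_add[of a "fscale (- 1) b"]
  by (simp add: free_eval_fscale a_minus_def uminus_eq free_eval_closed) (simp add: fscale_simps)

lemma free_eval_fgen: "free_eval v (fgen g) = v g"
  by (simp add: fgen_def free_eval_single word_eval_Word v_closed cscale_one)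

lemma cstar_seminorm_free_eval: "cstar_seminorm (\<lambda>a. cnorm A (free_eval v a))"
  by (simp add: cstar_seminorm_def free_eval_add free_eval_mult free_eval_fscale free_eval_star
      free_eval_closed cnorm_triangle cnorm_cscale cnorm_mult cstar_identity)

end
end

subsection \<open>Homomorphisms out of a completion\<close>

locale completion_hom = seminorm_cstar p + B: cstar_algebra B
  for p :: "'g free_star \<Rightarrow> real" and B :: "'b cstar" +
  fixes v :: "'g \<Rightarrow> 'b"
  assumes v: "range v \<subseteq> carrier B" and le: "\<And>a. cnorm B (B.free_eval v a) \<le> p a"
begin

abbreviation ev where "ev \<equiv> B.free_eval v"

definition ext :: "'g completed \<Rightarrow> 'b" where
  "ext \<alpha> = (SOME b. B.clim (\<lambda>m. ev (seq_rep \<alpha> m)) b)"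

lemma ev_dist: "B.cdist (ev a) (ev b) \<le> p (a - b)"
  using le[of "a - b"] by (simp add: B.cdist_def B.free_eval_diff[OF v])

lemma ext_class:
  assumes X: "cauchy_seq p X"
  shows "B.clim (\<lambda>m. ev (X m)) (ext (seq_class p X))"
proof -
  let ?Y = "seq_rep (seq_class p X)"
  have "\<exists>b\<in>carrier B. (\<lambda>m. cnorm B (ev (?Y m) \<ominus>\<^bsub>B\<^esub> b)) \<longlonglongrightarrow> 0"
  proof (rule B.complete)
    fix e :: real assume "e > 0"
    then obtain N where N: "\<forall>i\<ge>N. \<forall>j\<ge>N. p (?Y i - ?Y j) < e"
      using rep_class(1)[OF X] unfolding cauchy_seq_def by meson
    show "\<exists>N. \<forall>i\<ge>N. \<forall>j\<ge>N. cnorm B (ev (?Y i) \<ominus>\<^bsub>B\<^esub> ev (?Y j)) < e"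
      using N ev_dist[unfolded B.cdist_def] by (meson order_le_less_trans)
  qed (rule B.free_eval_closed[OF v])
  then have "\<exists>b. B.clim (\<lambda>m. ev (?Y m)) b"
    by (auto simp: B.clim_def B.cdist_def B.free_eval_closed[OF v])
  then have "B.clim (\<lambda>m. ev (?Y m)) (ext (seq_class p X))"
    unfolding ext_def by (rule someI_ex)
  then show ?thesis
  proof (rule B.clim_transform)
    show "(\<lambda>m. B.cdist (ev (X m)) (ev (?Y m))) \<longlonglongrightarrow> 0"
    proof (rule tendsto_sandwich[OF _ _ tendsto_const])
      show "(\<lambda>m. p (X m - ?Y m)) \<longlonglongrightarrow> 0"
        using rep_class(2)[OF X] by (subst p_diff_commute)
    qed (auto simp: ev_dist B.cdist_nonneg B.free_eval_closed[OF v])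
  qed (rule B.free_eval_closed[OF v])
qed

lemma ext_eqI: "cauchy_seq p X \<Longrightarrow> B.clim (\<lambda>m. ev (X m)) b \<Longrightarrow> ext (seq_class p X) = b"
  using ext_class B.clim_unique by blast

lemma ext_const: "ext (seq_class p (\<lambda>m. a)) = ev a"
  by (intro ext_eqI cauchy_const B.clim_const B.free_eval_closed[OF v])

lemma cstar_hom_ext: "cstar_hom C B ext"
  unfolding cstar_hom_def
proof (intro conjI ballI allI)
  show "ext \<in> ring_hom C B"
  proof (rule ring_hom_memI)
    fix x assume "x \<in> carrier C"
    then show "ext x \<in> carrier B" using ext_class by (auto elim!: carrierE simp: B.clim_def)
  next
    fix x y assume "x \<in> carrier C" "y \<in> carrier C"
    then obtain X Y where X: "cauchy_seq p X" "x = seq_class p X"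
      and Y: "cauchy_seq p Y" "y = seq_class p Y" by (auto elim!: carrierE)
    show "ext (x \<otimes>\<^bsub>C\<^esub> y) = ext x \<otimes>\<^bsub>B\<^esub> ext y"
      using B.clim_mult[OF ext_class[OF X(1)] ext_class[OF Y(1)]]
      by (simp add: X Y class_simps) (rule ext_eqI, simp_all add: X Y class_simps B.free_eval_mult[OF v])
    show "ext (x \<oplus>\<^bsub>C\<^esub> y) = ext x \<oplus>\<^bsub>B\<^esub> ext y"
      using B.clim_add[OF ext_class[OF X(1)] ext_class[OF Y(1)]]
      by (simp add: X Y class_simps) (rule ext_eqI, simp_all add: X Y class_simps B.free_eval_add[OF v])
  next
    show "ext \<one>\<^bsub>C\<^esub> = \<one>\<^bsub>B\<^esub>" by (simp add: one_class ext_const B.free_eval_one[OF v])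
  qed
next
  fix x c assume "x \<in> carrier C"
  then obtain X where X: "cauchy_seq p X" "x = seq_class p X" by (auto elim!: carrierE)
  show "ext (cscale C c x) = cscale B c (ext x)"
    using B.clim_cscale[OF ext_class[OF X(1)], of c]
    by (simp add: X class_simps) (rule ext_eqI, simp_all add: X class_simps B.free_eval_fscale[OF v])
next
  fix x assume "x \<in> carrier C"
  then obtain X where X: "cauchy_seq p X" "x = seq_class p X" by (auto elim!: carrierE)
  show "ext (adj C x) = adj B (ext x)"
    using B.clim_adj[OF ext_class[OF X(1)]]
    by (simp add: X class_simps) (rule ext_eqI, simp_all add: X class_simps B.free_eval_star[OF v])
qed

lemma ext_gen: "ext (completion_gen p g) = v g"
  by (simp add: gen_class ext_const B.free_eval_fgen[OF v])

lemma cnorm_ext: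
  assumes "x \<in> carrier C"
  shows "cnorm B (ext x) \<le> cnorm C x"
proof -
  obtain X where X: "cauchy_seq p X" "x = seq_class p X" using assms by (auto elim!: carrierE)
  show ?thesis unfolding X(2)
    by (rule LIMSEQ_le[OF B.clim_cnorm[OF ext_class[OF X(1)]] cnorm_class[OF X(1)]]) (auto simp: le)
qed

lemma ext_unique:
  assumes h: "cstar_hom C B h" and contr: "\<And>x. x \<in> carrier C \<Longrightarrow> cnorm B (h x) \<le> cnorm C x"
    and gen: "\<And>g. h (completion_gen p g) = v g" and x: "x \<in> carrier C"
  shows "h x = ext x"
proof -
  interpret C: cstar_algebra C by (rule cstar_algebra_completion)
  have rh: "h \<in> ring_hom C B" using h by (simp add: cstar_hom_def)
  have hw: "h (seq_class p (\<lambda>m. Poly_Mapping.single w 1)) = B.word_eval v w" for w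
  proof -
    have "h (seq_class p (\<lambda>m. Poly_Mapping.single (Word ws) 1)) = B.word_eval v (Word ws)" for ws
    proof (induction ws)
      case Nil
      have "seq_class p (\<lambda>m. Poly_Mapping.single (Word []) 1) = \<one>\<^bsub>C\<^esub>"
        by (simp add: one_class flip: zero_star_word_def)
      then show ?case using ring_hom_one[OF rh] by (simp add: B.word_eval_Word[OF v])
    next
      case (Cons l ws)
      obtain g b where l: "l = (g, b)" by (cases l)
      let ?l = "\<lambda>b. seq_class p (\<lambda>m. Poly_Mapping.single (Word [(g, b)]) 1)"
      have l0: "?l False = completion_gen p g" by (simp add: gen_class fgen_def)
      have l1: "?l True = adj C (?l False)" by (simp add: adj_class fstar_single word_star_def)
      have "h (?l False) = v g" by (simp add: l0 gen)
      moreover have "h (?l True) = adj B (h (?l False))"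
        unfolding l1 using h by (simp add: cstar_hom_def carrierI)
      ultimately have "h (?l b) = (if b then adj B (v g) else v g)" by (cases b) simp_all
      moreover have "Poly_Mapping.single (Word (l # ws)) (1::complex) =
          Poly_Mapping.single (Word [(g, b)]) 1 * Poly_Mapping.single (Word ws) 1"
        by (simp add: mult_single plus_star_word_def l)
      then have "seq_class p (\<lambda>m. Poly_Mapping.single (Word (l # ws)) 1) =
          ?l b \<otimes>\<^bsub>C\<^esub> seq_class p (\<lambda>m. Poly_Mapping.single (Word ws) 1)"
        by (simp add: mult_class)
      ultimately show ?case
        using Cons ring_hom_mult[OF rh] by (simp add: l B.word_eval_Word[OF v] carrierI)
    qed
    then show ?thesis by (metis star_word.collapse)
  qed
  have hc: "h (seq_class p (\<lambda>m. a)) = ev a" for a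
  proof (induction a rule: free_star_induct)
    case (single w c)
    have "fscale c (Poly_Mapping.single w 1) = Poly_Mapping.single w c"
      by (simp add: fscale_def mult_single)
    then have "seq_class p (\<lambda>m. Poly_Mapping.single w c) =
        cscale C c (seq_class p (\<lambda>m. Poly_Mapping.single w 1))"
      by (simp add: cscale_class)
    then show ?case using h by (simp add: cstar_hom_def carrierI hw B.free_eval_single[OF v])
  next
    case (add a b)
    then show ?case
      using ring_hom_add[OF rh, of "seq_class p (\<lambda>m. a)" "seq_class p (\<lambda>m. b)"]
      by (simp add: carrierI add_class B.free_eval_add[OF v])
  qed
  obtain X where X: "cauchy_seq p X" "x = seq_class p X" using x by (auto elim!: carrierE)
  have hx: "h x \<in> carrier B" using ring_hom_closed[OF rh x] .
  have "B.clim (\<lambda>m. ev (X m)) (h x)"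
    unfolding B.clim_def
  proof (intro conjI allI B.free_eval_closed[OF v] hx LIMSEQ_I)
    fix e :: real assume "e > 0"
    then have "e / 2 > 0" by simp
    then obtain N where N: "\<forall>i\<ge>N. \<forall>j\<ge>N. p (X i - X j) < e / 2"
      using X(1) unfolding cauchy_seq_def by meson
    have "norm (B.cdist (ev (X m)) (h x) - 0) < e" if m: "m \<ge> N" for m
    proof -
      let ?m = "seq_class p (\<lambda>i. X m)"
      have mc: "?m \<in> carrier C" by (simp add: carrierI)
      have "ev (X m) \<ominus>\<^bsub>B\<^esub> h x = h (?m \<ominus>\<^bsub>C\<^esub> x)"
      proof -
        have "h (cscale C (-1) x) = cscale B (-1) (h x)" using h x by (simp add: cstar_hom_def)
        then show ?thesis
          using ring_hom_add[OF rh mc C.cscale_closed[OF x, of "-1"]] x mc hx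
          by (simp add: a_minus_def B.uminus_eq C.uminus_eq hc)
      qed
      then have "B.cdist (ev (X m)) (h x) \<le> cnorm C (?m \<ominus>\<^bsub>C\<^esub> x)"
        using contr[of "?m \<ominus>\<^bsub>C\<^esub> x"] mc x by (simp add: B.cdist_def)
      also have "\<dots> \<le> e / 2"
      proof (rule LIMSEQ_le_const2)
        show "(\<lambda>i. p (X m - X i)) \<longlonglongrightarrow> cnorm C (?m \<ominus>\<^bsub>C\<^esub> x)"
          using cnorm_class[OF cauchy_diff[OF cauchy_const X(1)]] by (simp add: X minus_class)
        show "\<exists>N. \<forall>i\<ge>N. p (X m - X i) \<le> e / 2" using N m by (meson less_imp_le)
      qed
      finally show ?thesis
        using \<open>e > 0\<close> B.cdist_nonneg[OF B.free_eval_closed[OF v] hx] by simp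
    qed
    then show "\<exists>N. \<forall>m\<ge>N. norm (B.cdist (ev (X m)) (h x) - 0) < e" by blast
  qed
  then show ?thesis using ext_eqI[OF X(1)] X(2) by simp
qed

end

subsection \<open>The algebras of the three species\<close>

lemma cstar_hom_finsum:
  assumes "cstar_hom A B h" "cstar_algebra A" "cstar_algebra B" "finite S" "\<And>k. k \<in> S \<Longrightarrow> f k \<in> carrier A"
  shows "h (\<Oplus>\<^bsub>A\<^esub>k\<in>S. f k) = (\<Oplus>\<^bsub>B\<^esub>k\<in>S. h (f k))"
proof -
  interpret A: cstar_algebra A by fact
  interpret B: cstar_algebra B by fact
  have rh: "h \<in> ring_hom A B" using assms by (simp add: cstar_hom_def)
  note [simp] = ring_hom_zero[OF rh A.ring_axioms B.ring_axioms]
  show ?thesis using assms(4,5)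
  proof (induction S)
    case (insert k S)
    then show ?case
      by (subst A.finsum_insert) (auto simp: ring_hom_add[OF rh] ring_hom_closed[OF rh])
  qed simp
qed

text \<open>A matrix is of a given species if its images under a separating family of homomorphisms are.\<close>

lemma is_matrix_reflect:
  fixes A :: "'a cstar" and u :: "'n::finite \<times> 'n \<Rightarrow> 'a"
  assumes A: "cstar_algebra A" and u: "range u \<subseteq> carrier A"
    and B: "\<And>i. i \<in> I \<Longrightarrow> cstar_algebra (B i)" and h: "\<And>i. i \<in> I \<Longrightarrow> cstar_hom A (B i) (h i)"
    and sep: "\<And>x y. \<lbrakk>x \<in> carrier A; y \<in> carrier A; \<And>i. i \<in> I \<Longrightarrow> h i x = h i y\<rbrakk> \<Longrightarrow> x = y"
    and mat: "\<And>i. i \<in> I \<Longrightarrow> is_matrix s (B i) (h i \<circ> u)"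
  shows "is_matrix s A u"
proof -
  interpret A: cstar_algebra A by fact
  have rh: "h i \<in> ring_hom A (B i)" if "i \<in> I" for i using h[OF that] by (simp add: cstar_hom_def)
  have uc: "u ij \<in> carrier A" for ij using u by blast
  have [simp]: "h i \<zero>\<^bsub>A\<^esub> = \<zero>\<^bsub>B i\<^esub>" "h i \<one>\<^bsub>A\<^esub> = \<one>\<^bsub>B i\<^esub>"
    "x \<in> carrier A \<Longrightarrow> h i (adj A x) = adj (B i) (h i x)"
    "x \<in> carrier A \<Longrightarrow> y \<in> carrier A \<Longrightarrow> h i (x \<otimes>\<^bsub>A\<^esub> y) = h i x \<otimes>\<^bsub>B i\<^esub> h i y"
    if "i \<in> I" for i x y
    using ring_hom_zero[OF rh[OF that] A.ring_axioms cstar_algebra.axioms(1)[OF B[OF that]]]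
      ring_hom_one[OF rh[OF that]] ring_hom_mult[OF rh[OF that]] h[OF that]
    by (auto simp: cstar_hom_def)
  have [simp]: "h i (\<Oplus>\<^bsub>A\<^esub>k\<in>UNIV. f k) = (\<Oplus>\<^bsub>B i\<^esub>k\<in>UNIV. h i (f k))"
    if "i \<in> I" "\<And>k. f k \<in> carrier A" for i and f :: "'n \<Rightarrow> 'a"
    by (rule cstar_hom_finsum[OF h[OF that(1)] A B[OF that(1)]]) (auto intro: that)
  note [simp] = uc A.adj_closed A.finsum_closed if_distrib[of "h _"]
  have orth: "orthogonal_matrix A u" if o: "\<And>i. i \<in> I \<Longrightarrow> orthogonal_matrix (B i) (h i \<circ> u)"
  proof -
    have un: "unitary_matrix (B i) (h i \<circ> u)" and sa: "adj (B i) (h i (u (k, l))) = h i (u (k, l))"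
      if "i \<in> I" for i k l
      using o[OF that] by (auto simp: orthogonal_matrix_def)
    have "unitary_matrix A u"
      unfolding unitary_matrix_def
      by (intro conjI allI u; rule sep) (use un in \<open>auto simp: unitary_matrix_def\<close>)
    moreover have "adj A (u (k, l)) = u (k, l)" for k l
      by (rule sep) (use sa in auto)
    ultimately show ?thesis by (simp add: orthogonal_matrix_def)
  qed
  have prod: "\<forall>i j k. j \<noteq> k \<longrightarrow> u (i, j) \<otimes>\<^bsub>A\<^esub> u (i, k) = \<zero>\<^bsub>A\<^esub> \<and> u (j, i) \<otimes>\<^bsub>A\<^esub> u (k, i) = \<zero>\<^bsub>A\<^esub>"
    if "\<And>\<iota>. \<iota> \<in> I \<Longrightarrow> \<forall>i j k. j \<noteq> k \<longrightarrow>
      h \<iota> (u (i, j)) \<otimes>\<^bsub>B \<iota>\<^esub> h \<iota> (u (i, k)) = \<zero>\<^bsub>B \<iota>\<^esub> \<and> h \<iota> (u (j, i)) \<otimes>\<^bsub>B \<iota>\<^esub> h \<iota> (u (k, i)) = \<zero>\<^bsub>B \<iota>\<^esub>"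
    by (intro allI impI conjI; rule sep) (use that in auto)
  show ?thesis
  proof (cases s)
    case Ortho
    then show ?thesis using orth mat by simp
  next
    case Cubic
    then show ?thesis using orth prod mat by (simp add: cubic_matrix_def)
  next
    case Magic
    then have m: "magic_matrix (B i) (h i \<circ> u)" if "i \<in> I" for i using mat that by simp
    have "magic_matrix A u"
      unfolding magic_matrix_def projection_def
    proof (intro conjI[OF _ conjI[OF prod]])
      show "\<forall>i j. u (i, j) \<in> carrier A \<and> adj A (u (i, j)) = u (i, j) \<and>
          u (i, j) \<otimes>\<^bsub>A\<^esub> u (i, j) = u (i, j)"
        by (intro allI conjI uc; rule sep) (use m in \<open>auto simp: magic_matrix_def projection_def\<close>)
      show "\<forall>i. (\<Oplus>\<^bsub>A\<^esub>j\<in>UNIV. u (i, j)) = \<one>\<^bsub>A\<^esub> \<and> (\<Oplus>\<^bsub>A\<^esub>j\<in>UNIV. u (j, i)) = \<one>\<^bsub>A\<^esub>"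
        by (intro allI conjI; rule sep) (use m in \<open>auto simp: magic_matrix_def\<close>)
    qed (use m in \<open>auto simp: magic_matrix_def\<close>)
    then show ?thesis using Magic by simp
  qed
qed

definition admissible :: "species \<Rightarrow> (('n::finite \<times> 'n) free_star \<Rightarrow> real) \<Rightarrow> bool" where
  "admissible x p \<longleftrightarrow> cstar_seminorm p \<and> is_matrix x (completion p) (completion_gen p)"

lemma universal_seminorm_eq:
  "universal_seminorm (is_matrix x) a = (SUP p\<in>{p. admissible x p}. p a)"
  by (simp add: universal_seminorm_def admissible_def)

lemma admissible_gen_le:
  fixes p :: "('n::finite \<times> 'n) free_star \<Rightarrow> real"
  assumes "admissible x p"
  shows "p (fgen ij) \<le> 1"
proof -
  interpret seminorm_cstar p using assms by unfold_locales (simp add: admissible_def)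
  obtain i j where ij: "ij = (i, j)" by (cases ij)
  have m: "is_matrix x C (completion_gen p)" using assms by (simp add: admissible_def)
  then have sa: "p (fstar (fgen kl) - fgen kl) = 0" for kl
    by (cases kl; cases x) (auto simp: cubic_matrix_def orthogonal_matrix_def magic_matrix_def
        projection_def gen_class adj_class const_eq_iff)
  show ?thesis
  proof (cases "x = Magic")
    case True
    then have "p (fgen ij * fgen ij - fgen ij) = 0"
      using m by (auto simp: ij magic_matrix_def projection_def gen_class mult_class const_eq_iff)
    then have 1: "p (fgen ij * fgen ij) = p (fgen ij)"
      using p_reverse[of "fgen ij * fgen ij" "fgen ij"] by simp
    have "p (fstar (fgen ij) * fgen ij - fgen ij * fgen ij) \<le> p (fstar (fgen ij) - fgen ij) * p (fgen ij)"
      using p_mult[of "fstar (fgen ij) - fgen ij" "fgen ij"] by (simp add: algebra_simps)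
    then have "p (fstar (fgen ij) * fgen ij - fgen ij * fgen ij) \<le> 0" by (simp add: sa)
    then have "(p (fgen ij))\<^sup>2 = p (fgen ij)"
      using p_reverse[of "fstar (fgen ij) * fgen ij" "fgen ij * fgen ij"] 1 by (simp add: p_cstar)
    then show ?thesis by (cases "p (fgen ij) = 0") (auto simp: power2_eq_square)
  next
    case False
    then have "unitary_matrix C (completion_gen p)"
      using m by (cases x) (auto simp: cubic_matrix_def orthogonal_matrix_def)
    then have "(\<Oplus>\<^bsub>C\<^esub>k\<in>UNIV. completion_gen p (i, k) \<otimes>\<^bsub>C\<^esub> adj C (completion_gen p (i, k))) = \<one>\<^bsub>C\<^esub>"
      by (simp add: unitary_matrix_def)
    moreover have "(\<Oplus>\<^bsub>C\<^esub>k\<in>UNIV. completion_gen p (i, k) \<otimes>\<^bsub>C\<^esub> adj C (completion_gen p (i, k))) =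
        seq_class p (\<lambda>m. \<Sum>k\<in>UNIV. fgen (i, k) * fstar (fgen (i, k)))"
      using finsum_class[of UNIV "\<lambda>k m. fgen (i, k) * fstar (fgen (i, k))"]
      by (simp add: gen_class class_simps)
    ultimately have sum: "p ((\<Sum>k\<in>UNIV. fgen (i, k) * fstar (fgen (i, k))) - 1) = 0"
      by (simp add: one_class const_eq_iff)
    define a :: "'n \<Rightarrow> ('n \<times> 'n) free_star" where "a k = fscale (1/2) (fgen (i, k) + fstar (fgen (i, k)))" for k
    have a_gen: "p (a k - fgen (i, k)) = 0" "p (a k - fstar (fgen (i, k))) = 0" for k
    proof -
      have half: "fscale (1/2) y + fscale (1/2) y = y" for y :: "('n \<times> 'n) free_star"
        using fscale_simps(2)[of "1/2" "1/2" y] by (simp add: fscale_simps)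
      have "a k - fgen (i, k) = fscale (1/2) (fstar (fgen (i, k)) - fgen (i, k))"
        using half[of "fgen (i, k)"] by (simp add: a_def fscale_simps algebra_simps)
      then show "p (a k - fgen (i, k)) = 0" by (simp add: p_scale sa)
      have "a k - fstar (fgen (i, k)) = fscale (1/2) (fgen (i, k) - fstar (fgen (i, k)))"
        using half[of "fstar (fgen (i, k))"] by (simp add: a_def fscale_simps algebra_simps)
      then show "p (a k - fstar (fgen (i, k))) = 0"
        using sa[of "(i, k)"] by (simp add: p_scale p_diff_commute)
    qed
    have aa: "p (a k * a k - fgen (i, k) * fstar (fgen (i, k))) = 0" for k
    proof -
      have "a k * a k - fgen (i, k) * fstar (fgen (i, k)) =
          a k * (a k - fstar (fgen (i, k))) + (a k - fgen (i, k)) * fstar (fgen (i, k))"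
        by (simp add: algebra_simps)
      then have "p (a k * a k - fgen (i, k) * fstar (fgen (i, k))) \<le>
          p (a k) * p (a k - fstar (fgen (i, k))) + p (a k - fgen (i, k)) * p (fstar (fgen (i, k)))"
        using p_add p_mult by (smt (verit))
      then show ?thesis by (simp add: a_gen del: p_star) (simp add: order_antisym)
    qed
    have "p ((\<Sum>k\<in>UNIV. a k * a k) - 1) \<le>
        p (\<Sum>k\<in>UNIV. a k * a k - fgen (i, k) * fstar (fgen (i, k))) +
        p ((\<Sum>k\<in>UNIV. fgen (i, k) * fstar (fgen (i, k))) - 1)"
      using p_diff_triangle by (simp add: sum_subtractf)
    also have "p (\<Sum>k\<in>UNIV. a k * a k - fgen (i, k) * fstar (fgen (i, k))) \<le> 0"
      using p_sum[of "\<lambda>k. a k * a k - fgen (i, k) * fstar (fgen (i, k))" UNIV] by (simp add: aa)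
    finally have "p ((\<Sum>k\<in>UNIV. a k * a k) - 1) \<le> 0" by (simp add: sum)
    then have "p ((\<Sum>k\<in>UNIV. a k * a k) - 1) = 0" by (simp add: order_antisym)
    then have "p (a j) \<le> 1"
      by (intro sum_squares_bound[of UNIV j a])
        (auto simp: a_def fstar_fscale fstar_add add.commute)
    then show ?thesis using p_reverse[of "a j" "fgen (i, j)"] a_gen[of j] by (simp add: ij)
  qed
qed

lemma admissible_bdd: "\<exists>M. \<forall>p. admissible x p \<longrightarrow> p a \<le> M"
proof (induction a rule: free_star_induct)
  case (single w c)
  have "p (Poly_Mapping.single w 1) \<le> 1" if adm: "admissible x p" for p
  proof -
    interpret seminorm_cstar p using adm by unfold_locales (simp add: admissible_def)
    have "p (Poly_Mapping.single (Word ws) 1) \<le> 1" for ws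
    proof (induction ws)
      case Nil
      show ?case using p_one_le by (simp flip: zero_star_word_def)
    next
      case (Cons l ws)
      obtain g b where l: "l = (g, b)" by (cases l)
      have gen: "Poly_Mapping.single (Word [(g, b)]) 1 = (if b then fstar (fgen g) else fgen g)"
        by (simp add: fgen_def fstar_single word_star_def)
      have le: "p (if b then fstar (fgen g) else fgen g) \<le> 1"
        using admissible_gen_le[OF adm, of g] by simp
      have "Poly_Mapping.single (Word (l # ws)) (1::complex) =
          Poly_Mapping.single (Word [(g, b)]) 1 * Poly_Mapping.single (Word ws) 1"
        by (simp add: mult_single plus_star_word_def l)
      then have "p (Poly_Mapping.single (Word (l # ws)) 1) \<le>
          p (Poly_Mapping.single (Word [(g, b)]) 1) * p (Poly_Mapping.single (Word ws) 1)"
        by (simp add: p_mult)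
      also have "\<dots> \<le> 1 * 1" unfolding gen using Cons le by (intro mult_mono) auto
      finally show ?case by simp
    qed
    then show ?thesis by (metis star_word.collapse)
  qed
  moreover have "p (Poly_Mapping.single w c) = cmod c * p (Poly_Mapping.single w 1)"
    if "admissible x p" for p
  proof -
    have "Poly_Mapping.single w c = fscale c (Poly_Mapping.single w 1)"
      by (simp add: fscale_def mult_single)
    then show ?thesis using that by (simp add: admissible_def cstar_seminorm_def)
  qed
  ultimately have "p (Poly_Mapping.single w c) \<le> cmod c" if "admissible x p" for p
    using that by (metis mult_left_le norm_ge_zero)
  then show ?case by blast
next
  case (add a b)
  then obtain M N where "\<And>p. admissible x p \<Longrightarrow> p a \<le> M" "\<And>p. admissible x p \<Longrightarrow> p b \<le> N" by blast
  then have "p (a + b) \<le> M + N" if "admissible x p" for p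
    using that by (smt (verit) admissible_def cstar_seminorm_def)
  then show ?case by blast
qed

lemma admissible_zero: "admissible x (\<lambda>a :: ('n::finite \<times> 'n) free_star. 0)"
proof -
  let ?p = "\<lambda>a :: ('n \<times> 'n) free_star. 0 :: real"
  interpret seminorm_cstar ?p by unfold_locales (simp add: cstar_seminorm_def)
  interpret C: cstar_algebra C by (rule cstar_algebra_completion)
  have eq: "\<alpha> = \<beta>" if ab: "\<alpha> \<in> carrier C" "\<beta> \<in> carrier C" for \<alpha> \<beta>
  proof -
    obtain X where X: "cauchy_seq ?p X" "\<alpha> = seq_class ?p X" using ab(1) by (rule carrierE)
    obtain Y where Y: "cauchy_seq ?p Y" "\<beta> = seq_class ?p Y" using ab(2) by (rule carrierE)
    show ?thesis unfolding X(2) Y(2) by (rule iffD2[OF class_eq_iff[OF X(1) Y(1)] tendsto_const])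
  qed
  have "is_matrix x C (completion_gen ?p)"
  proof (rule is_matrix_reflect[of C "completion_gen ?p" "{} :: unit set" "\<lambda>_. C" "\<lambda>_. id"])
    show "cstar_algebra C" by (rule cstar_algebra_completion)
    show "range (completion_gen ?p) \<subseteq> carrier C"
      unfolding gen_class using carrierI[OF cauchy_const] by blast
    show "\<alpha> = \<beta>" if "\<alpha> \<in> carrier C" "\<beta> \<in> carrier C" for \<alpha> \<beta>
      using that by (rule eq)
  qed (erule emptyE)+
  then show ?thesis unfolding admissible_def using p by (rule conjI[rotated])
qed

context
  fixes x :: species and U :: "('n::finite \<times> 'n) free_star \<Rightarrow> real"
  defines "U \<equiv> universal_seminorm (is_matrix x)"
begin

lemma admissible_le: "admissible x p \<Longrightarrow> p a \<le> U a"
  unfolding U_def universal_seminorm_eq using admissible_bdd[of x a]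
  by (intro cSUP_upper) (auto simp: bdd_above_def)

lemma U_leI: "(\<And>p. admissible x p \<Longrightarrow> p a \<le> M) \<Longrightarrow> U a \<le> M"
  unfolding U_def universal_seminorm_eq using admissible_zero[of x]
  by (intro cSUP_least) auto

lemma U_nonneg: "0 \<le> U a"
  using admissible_le[OF admissible_zero] by simp

lemma cstar_seminorm_U: "cstar_seminorm U"
  unfolding cstar_seminorm_def
proof (intro conjI allI)
  have sn: "seminorm_cstar p" if "admissible x p" for p :: "('n \<times> 'n) free_star \<Rightarrow> real"
    using that by (simp add: admissible_def seminorm_cstar_def)
  fix a b :: "('n \<times> 'n) free_star" and c :: complex
  show "U (a + b) \<le> U a + U b"
  proof (rule U_leI)
    fix p :: "('n \<times> 'n) free_star \<Rightarrow> real" assume p: "admissible x p"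
    show "p (a + b) \<le> U a + U b"
      using seminorm_cstar.p_add[OF sn[OF p], of a b] admissible_le[OF p, of a] admissible_le[OF p, of b]
      by linarith
  qed
  show "U (a * b) \<le> U a * U b"
  proof (rule U_leI)
    fix p :: "('n \<times> 'n) free_star \<Rightarrow> real" assume p: "admissible x p"
    have "p (a * b) \<le> p a * p b" by (rule seminorm_cstar.p_mult[OF sn[OF p]])
    also have "\<dots> \<le> U a * U b"
      using admissible_le[OF p] seminorm_cstar.p_nonneg[OF sn[OF p]] U_nonneg by (intro mult_mono) auto
    finally show "p (a * b) \<le> U a * U b" .
  qed
  have le: "U (fscale c a) \<le> cmod c * U a" for c a
    by (rule U_leI) (auto simp: seminorm_cstar.p_scale[OF sn] intro!: mult_left_mono admissible_le)
  show "U (fscale c a) = cmod c * U a"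
  proof (cases "c = 0")
    case True
    then show ?thesis using le[of 0 a] U_nonneg[of "fscale 0 a"] by simp
  next
    case False
    have "U a \<le> cmod (1 / c) * U (fscale c a)"
      using le[of "1 / c" "fscale c a"] False by (simp add: fscale_simps)
    then have "cmod c * U a \<le> U (fscale c a)" using False by (simp add: norm_divide field_simps)
    then show ?thesis using le[of c a] by simp
  qed
  show "U (fstar a * a) = (U a)\<^sup>2"
  proof (rule antisym)
    show "U (fstar a * a) \<le> (U a)\<^sup>2"
    proof (rule U_leI)
      fix p :: "('n \<times> 'n) free_star \<Rightarrow> real" assume p: "admissible x p"
      show "p (fstar a * a) \<le> (U a)\<^sup>2"
        using admissible_le[OF p, of a] seminorm_cstar.p_nonneg[OF sn[OF p], of a]
        by (simp add: seminorm_cstar.p_cstar[OF sn[OF p]] power_mono)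
    qed
    have "U a \<le> sqrt (U (fstar a * a))"
    proof (rule U_leI)
      fix p :: "('n \<times> 'n) free_star \<Rightarrow> real" assume p: "admissible x p"
      show "p a \<le> sqrt (U (fstar a * a))"
        using admissible_le[OF p, of "fstar a * a"]
        by (intro real_le_rsqrt) (simp add: seminorm_cstar.p_cstar[OF sn[OF p]])
    qed
    then have "(U a)\<^sup>2 \<le> (sqrt (U (fstar a * a)))\<^sup>2" using U_nonneg by (intro power_mono) auto
    then show "(U a)\<^sup>2 \<le> U (fstar a * a)" using U_nonneg by simp
  qed
qed

interpretation U: seminorm_cstar U
  by unfold_locales (rule cstar_seminorm_U)

lemma is_matrix_U: "is_matrix x (completion U) (completion_gen U)"
proof -
  define h where "h p = completion_hom.ext (completion p) (completion_gen p)"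
    for p :: "('n \<times> 'n) free_star \<Rightarrow> real"
  have gen_eval: "cstar_algebra.free_eval (completion p) (completion_gen p) a = seq_class p (\<lambda>m. a)"
    if "admissible x p" for p :: "('n \<times> 'n) free_star \<Rightarrow> real" and a
  proof -
    interpret seminorm_cstar p using that by unfold_locales (simp add: admissible_def)
    interpret C: cstar_algebra C by (rule cstar_algebra_completion)
    have r: "range (completion_gen p) \<subseteq> carrier C" by (auto simp: gen_class carrierI)
    have w: "C.word_eval (completion_gen p) (Word ws) = seq_class p (\<lambda>m. Poly_Mapping.single (Word ws) 1)" for ws
    proof (induction ws)
      case Nil
      show ?case by (simp add: C.word_eval_zero[OF r] one_class flip: zero_star_word_def)
    next
      case (Cons l ws)
      obtain g b where l: "l = (g, b)" by (cases l)
      have "(if b then adj C (completion_gen p g) else completion_gen p g) =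
          seq_class p (\<lambda>m. Poly_Mapping.single (Word [(g, b)]) 1)"
        by (simp add: gen_class adj_class fgen_def fstar_single word_star_def)
      then show ?case
        by (simp add: l C.word_eval_Word[OF r] Cons mult_class mult_single plus_star_word_def)
    qed
    show ?thesis
    proof (induction a rule: free_star_induct)
      case (single w c)
      have "C.word_eval (completion_gen p) w = seq_class p (\<lambda>m. Poly_Mapping.single w 1)"
        using w by (metis star_word.collapse)
      then show ?case
        by (simp add: C.free_eval_single[OF r] cscale_class fscale_def mult_single)
    qed (simp add: C.free_eval_add[OF r] add_class)
  qed
  have hom: "completion_hom U (completion p) (completion_gen p)" if p: "admissible x p"
    for p :: "('n \<times> 'n) free_star \<Rightarrow> real"
  proof -
    interpret p: seminorm_cstar p using p by unfold_locales (simp add: admissible_def)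
    interpret C: cstar_algebra "completion p" by (rule p.cstar_algebra_completion)
    show ?thesis
    proof unfold_locales
      show "range (completion_gen p) \<subseteq> carrier (completion p)" by (auto simp: p.gen_class p.carrierI)
      fix a
      have "cnorm (completion p) (seq_class p (\<lambda>m. a)) = p a"
        using p.cnorm_class[of "\<lambda>m. a"] by (simp add: LIMSEQ_const_iff)
      then show "cnorm (completion p) (C.free_eval (completion_gen p) a) \<le> U a"
        using admissible_le[OF p, of a] by (simp add: gen_eval[OF p])
    qed
  qed
  show ?thesis
  proof (rule is_matrix_reflect[of "completion U" _ "{p. admissible x p}" completion h])
    show "cstar_algebra (completion U)" by (rule U.cstar_algebra_completion)
    show "range (completion_gen U) \<subseteq> carrier (completion U)" by (auto simp: U.gen_class U.carrierI)
    fix p :: "('n \<times> 'n) free_star \<Rightarrow> real" assume "p \<in> {p. admissible x p}"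
    then have p: "admissible x p" by simp
    interpret p: seminorm_cstar p using p by unfold_locales (simp add: admissible_def)
    interpret h: completion_hom U "completion p" "completion_gen p" by (rule hom[OF p])
    show "cstar_algebra (completion p)" by (rule p.cstar_algebra_completion)
    show "cstar_hom (completion U) (completion p) (h p)" unfolding h_def by (rule h.cstar_hom_ext)
    have "h p \<circ> completion_gen U = completion_gen p" by (auto simp: h_def h.ext_gen)
    then show "is_matrix x (completion p) (h p \<circ> completion_gen U)" using p by (simp add: admissible_def)
  next
    fix \<alpha> \<beta> assume ab: "\<alpha> \<in> carrier (completion U)" "\<beta> \<in> carrier (completion U)"
      and eq: "\<And>p. p \<in> {p. admissible x p} \<Longrightarrow> h p \<alpha> = h p \<beta>"
    obtain X Y where X: "cauchy_seq U X" "\<alpha> = seq_class U X" and Y: "cauchy_seq U Y" "\<beta> = seq_class U Y"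
      using ab by (auto elim!: U.carrierE)
    have XY: "cauchy_seq U (\<lambda>m. X m - Y m)" by (rule U.cauchy_diff[OF X(1) Y(1)])
    have lim: "(\<lambda>m. p (X m - Y m)) \<longlonglongrightarrow> 0" if p: "admissible x p"
      for p :: "('n \<times> 'n) free_star \<Rightarrow> real"
    proof -
      interpret p: seminorm_cstar p using p by unfold_locales (simp add: admissible_def)
      interpret h: completion_hom U "completion p" "completion_gen p" by (rule hom[OF p])
      have ha: "h p \<alpha> = h p \<beta>" using eq p by simp
      have "h.B.clim (\<lambda>m. seq_class p (\<lambda>i. X m)) (h p \<alpha>)" "h.B.clim (\<lambda>m. seq_class p (\<lambda>i. Y m)) (h p \<alpha>)"
        using h.ext_class[OF X(1)] h.ext_class[OF Y(1)] X Y ha by (simp_all add: gen_eval[OF p] h_def)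
      note clims = this
      have "(\<lambda>m. h.B.cdist (seq_class p (\<lambda>i. X m)) (seq_class p (\<lambda>i. Y m))) \<longlonglongrightarrow> 0"
      proof (rule tendsto_sandwich[OF _ _ tendsto_const])
        show "(\<lambda>m. h.B.cdist (seq_class p (\<lambda>i. X m)) (h p \<alpha>) + h.B.cdist (seq_class p (\<lambda>i. Y m)) (h p \<alpha>)) \<longlonglongrightarrow> 0"
          using clims tendsto_add[of "\<lambda>m. h.B.cdist (seq_class p (\<lambda>i. X m)) (h p \<alpha>)" 0 _
              "\<lambda>m. h.B.cdist (seq_class p (\<lambda>i. Y m)) (h p \<alpha>)" 0] by (simp add: h.B.clim_def)
        have "h.B.cdist (seq_class p (\<lambda>i. X m)) (seq_class p (\<lambda>i. Y m)) \<le>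
            h.B.cdist (seq_class p (\<lambda>i. X m)) (h p \<alpha>) + h.B.cdist (seq_class p (\<lambda>i. Y m)) (h p \<alpha>)" for m
          using clims h.B.cdist_triangle[of "seq_class p (\<lambda>i. X m)" "h p \<alpha>" "seq_class p (\<lambda>i. Y m)"]
            h.B.cdist_commute[of "h p \<alpha>" "seq_class p (\<lambda>i. Y m)"] by (simp add: h.B.clim_def)
        then show "\<forall>\<^sub>F m in sequentially. h.B.cdist (seq_class p (\<lambda>i. X m)) (seq_class p (\<lambda>i. Y m)) \<le>
            h.B.cdist (seq_class p (\<lambda>i. X m)) (h p \<alpha>) + h.B.cdist (seq_class p (\<lambda>i. Y m)) (h p \<alpha>)" by simp
      qed (use clims in \<open>auto simp: h.B.clim_def intro!: always_eventually h.B.cdist_nonneg\<close>)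
      moreover have "cnorm (completion p) (seq_class p (\<lambda>m. a)) = p a" for a
        using p.cnorm_class[of "\<lambda>m. a"] by (simp add: LIMSEQ_const_iff)
      ultimately show ?thesis by (simp add: h.B.cdist_def p.minus_class)
    qed
    have "(\<lambda>m. U (X m - Y m)) \<longlonglongrightarrow> 0"
    proof (rule LIMSEQ_I)
      fix e :: real assume "e > 0"
      then have "e / 2 > 0" by simp
      then obtain N where N: "\<forall>i\<ge>N. \<forall>j\<ge>N. U (X i - Y i - (X j - Y j)) < e / 2"
        using XY unfolding cauchy_seq_def by meson
      have "U (X m - Y m) \<le> e / 2" if m: "m \<ge> N" for m
      proof (rule U_leI)
        fix p :: "('n \<times> 'n) free_star \<Rightarrow> real" assume p: "admissible x p"
        interpret p: seminorm_cstar p using p by unfold_locales (simp add: admissible_def)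
        show "p (X m - Y m) \<le> e / 2"
        proof (rule LIMSEQ_le_const)
          show "(\<lambda>j. e / 2 + p (X j - Y j)) \<longlonglongrightarrow> e / 2"
            using tendsto_add[OF tendsto_const lim[OF p], of "e / 2"] by simp
          have "p (X m - Y m) \<le> e / 2 + p (X j - Y j)" if "j \<ge> N" for j
          proof -
            have "p (X m - Y m - (X j - Y j)) < e / 2"
              using N m that admissible_le[OF p] by (meson order_le_less_trans)
            then show ?thesis using p.p_reverse[of "X m - Y m" "X j - Y j"] by linarith
          qed
          then show "\<exists>N. \<forall>j\<ge>N. p (X m - Y m) \<le> e / 2 + p (X j - Y j)" by blast
        qed
      qed
      then have "norm (U (X m - Y m) - 0) < e" if "m \<ge> N" for m
        using that U_nonneg[of "X m - Y m"] \<open>e > 0\<close> by fastforce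
      then show "\<exists>N. \<forall>m\<ge>N. norm (U (X m - Y m) - 0) < e" by blast
    qed
    then show "\<alpha> = \<beta>" by (simp add: X Y U.class_eq_iff)
  qed
qed

lemma completion_hom_U:
  fixes B :: "'b cstar"
  assumes B: "cstar_algebra B" and v: "is_matrix x B v"
  shows "completion_hom U B v"
proof -
  interpret B: cstar_algebra B by fact
  have r: "range v \<subseteq> carrier B"
    using v by (cases x) (auto simp: cubic_matrix_def orthogonal_matrix_def unitary_matrix_def
        magic_matrix_def projection_def)
  define q where "q a = cnorm B (B.free_eval v a)" for a
  have q: "cstar_seminorm q" unfolding q_def by (rule B.cstar_seminorm_free_eval[OF r])
  interpret h: completion_hom q B v
    by unfold_locales (use q r in \<open>simp_all add: q_def\<close>)
  have iso: "cnorm B (h.ext \<alpha>) = cnorm (completion q) \<alpha>" if "\<alpha> \<in> carrier (completion q)" for \<alpha>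
  proof -
    obtain X where X: "cauchy_seq q X" "\<alpha> = seq_class q X" using \<open>\<alpha> \<in> _\<close> by (auto elim!: h.carrierE)
    show ?thesis
      using B.clim_cnorm[OF h.ext_class[OF X(1)]] h.cnorm_class[OF X(1)]
      by (simp add: X(2) LIMSEQ_unique flip: q_def)
  qed
  interpret C: cstar_algebra "completion q" by (rule h.cstar_algebra_completion)
  have rh: "h.ext \<in> ring_hom (completion q) B" using h.cstar_hom_ext by (simp add: cstar_hom_def)
  have "is_matrix x (completion q) (completion_gen q)"
  proof (rule is_matrix_reflect[of _ _ "{()}" "\<lambda>_. B" "\<lambda>_. h.ext"])
    fix \<alpha> \<beta> assume ab: "\<alpha> \<in> carrier (completion q)" "\<beta> \<in> carrier (completion q)"
      and "\<And>i. i \<in> {()} \<Longrightarrow> h.ext \<alpha> = h.ext \<beta>"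
    then have eq: "h.ext \<alpha> = h.ext \<beta>" by simp
    have "h.ext (\<alpha> \<ominus>\<^bsub>completion q\<^esub> \<beta>) = h.ext \<alpha> \<ominus>\<^bsub>B\<^esub> h.ext \<beta>"
      using ring_hom_add[OF rh ab(1) C.cscale_closed[OF ab(2), of "-1"]] h.cstar_hom_ext ab
        ring_hom_closed[OF rh]
      by (simp add: a_minus_def B.uminus_eq C.uminus_eq cstar_hom_def)
    also have "\<dots> = \<zero>\<^bsub>B\<^esub>" using eq ring_hom_closed[OF rh ab(2)] by (simp add: a_minus_def B.r_neg)
    finally have "C.cdist \<alpha> \<beta> = 0"
      using iso[of "\<alpha> \<ominus>\<^bsub>completion q\<^esub> \<beta>"] ab by (simp add: C.cdist_def B.cnorm_zero)
    then show "\<alpha> = \<beta>" using C.cdist_eq ab by simp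
  next
    have "h.ext \<circ> completion_gen q = v" by (auto simp: h.ext_gen)
    then show "is_matrix x B (h.ext \<circ> completion_gen q)" using v by simp
  qed (auto simp: h.gen_class h.carrierI h.cstar_hom_ext B h.cstar_algebra_completion)
  then have "admissible x q" using q by (simp add: admissible_def)
  then have "cnorm B (B.free_eval v a) \<le> U a" for a using admissible_le[of q a] by (simp add: q_def)
  then show ?thesis by unfold_locales (use r in auto)
qed

end

theorem cstar_algebra_qalg: "cstar_algebra (qalg x :: ('n::finite \<times> 'n) completed cstar)"
  unfolding qalg_def by (intro seminorm_cstar.cstar_algebra_completion seminorm_cstar.intro cstar_seminorm_U)

theorem is_matrix_fund: "is_matrix x (qalg x) (fund x :: 'n::finite \<times> 'n \<Rightarrow> _)"
  unfolding qalg_def fund_def by (rule is_matrix_U)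

text \<open>The universal property.  Every *-homomorphism of C*-algebras is norm decreasing; since this
  is not proved here, it is made part of the uniqueness statement.\<close>

theorem qalg_universal:
  fixes B :: "'b cstar" and v :: "'n::finite \<times> 'n \<Rightarrow> 'b"
  assumes "cstar_algebra B" "is_matrix x B v"
  shows "\<exists>!\<pi>. \<pi> \<in> extensional (carrier (qalg x)) \<and> cstar_hom (qalg x) B \<pi> \<and>
    (\<forall>\<alpha>\<in>carrier (qalg x). cnorm B (\<pi> \<alpha>) \<le> cnorm (qalg x) \<alpha>) \<and> (\<forall>ij. \<pi> (fund x ij) = v ij)"
proof -
  interpret completion_hom "universal_seminorm (is_matrix x)" B v
    by (rule completion_hom_U[OF assms])
  interpret A: cstar_algebra "qalg x :: ('n \<times> 'n) completed cstar" by (rule cstar_algebra_qalg)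
  note defs = qalg_def[symmetric] fund_def[symmetric]
  let ?e = "restrict ext (carrier (qalg x))"
  have fc: "fund x ij \<in> carrier (qalg x)" for ij :: "'n \<times> 'n"
    by (simp add: fund_def qalg_def gen_class carrierI)
  have "cstar_hom (qalg x) B ?e"
    using cstar_hom_ext[unfolded defs]
    by (auto simp: cstar_hom_def ring_hom_def A.cscale_closed A.adj_closed Pi_iff)
  then show ?thesis
  proof (intro ex1I[of _ ?e] conjI)
    show "\<forall>ij. ?e (fund x ij) = v ij" using ext_gen[unfolded defs] by (simp add: fc)
    fix \<pi> assume "\<pi> \<in> extensional (carrier (qalg x)) \<and> cstar_hom (qalg x) B \<pi> \<and>
      (\<forall>\<alpha>\<in>carrier (qalg x). cnorm B (\<pi> \<alpha>) \<le> cnorm (qalg x) \<alpha>) \<and> (\<forall>ij. \<pi> (fund x ij) = v ij)"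
    then show "\<pi> = ?e"
      by (intro extensionalityI[of _ "carrier (qalg x)"])
        (auto intro!: ext_unique[unfolded defs])
  qed (use cnorm_ext[unfolded defs] in auto)
qed

end

theory Submission
  imports Defs
begin

text \<open>By Frobenius duality an intertwiner is a vector fixed by a tensor power of \<open>u\<close>, and diagrams may be
  taken on a line; call \<open>V m\<close> the span of the vectors of the diagrams on \<open>m\<close> letters.  That these
  vectors are fixed follows by removing strings that join neighbours one by one.  Conversely, the
  spaces \<open>V m\<close> are closed under tensor products, reversal, and insertion and contraction of pairs, so
  that they are the Hom spaces of a *-category.  Hence the functional with
  \<open>h (u\<^sup>\<otimes>\<^sup>m) =\<close> the orthogonal projection to \<open>V m\<close> is positive and vanishes on the ideal of relations:
  it is the Haar functional.  Its GNS representation defines an admissible C*-seminorm, so \<open>h\<close>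
  descends to the universal C*-algebra, and applying it to the equation of a fixed vector \<open>\<xi>\<close>
  shows that \<open>\<xi>\<close> is equal to its projection to \<open>V m\<close>.\<close>

section \<open>Reproducing kernels\<close>

text \<open>The relations hold under \<open>h\<close> by naturality: a linear map between tensor
  powers that preserves the spaces \<open>V\<close>, together with its adjoint, commutes with the
  orthogonal projections to them. Each relation of a species, inside an arbitrary product of
  generators, is such a commutation: with inserting a pair of letters for orthogonality, with
  restricting to equal neighbours for the cubic relations, with inserting or duplicating one letter
  for the magic ones. The obstacle is positivity. The value of \<open>h\<close> at
  \<open>fstar a * a\<close> is a quadratic form in the coefficients of \<open>a\<close>, indexed by
  pairs of a row word and a column word; its matrix is that of a projection with two of the four
  indices exchanged, so the positivity of projections does not settle it. What rescues it is that
  \<open>V\<close> is closed under composition: the exchanged projection is the Casimir operator of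
  a matrix algebra. A positive functional on a free *-algebra need not act by bounded operators;
  here the orthonormality of the columns of \<open>u\<close> makes every generator a
  contraction.\<close>

definition vscale :: "complex \<Rightarrow> ('a \<Rightarrow> complex) \<Rightarrow> 'a \<Rightarrow> complex" where
  "vscale c f = (\<lambda>x. c * f x)"

interpretation vec: vector_space vscale
  by standard (auto simp: vscale_def fun_eq_iff algebra_simps)

lemma sum_fun_apply: "(\<Sum>i\<in>S. f i) x = (\<Sum>i\<in>S. f i x :: complex)"
  by (induction S rule: infinite_finite_induct) auto

lemma vec_subspace_lincomb:
  assumes "vec.subspace V" "\<And>b. b \<in> B \<Longrightarrow> f b \<in> V"
  shows "(\<lambda>x. \<Sum>b\<in>B. c b * f b x) \<in> V"
proof -
  have "(\<Sum>b\<in>B. vscale (c b) (f b)) \<in> V"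
    using assms by (intro vec.subspace_sum vec.subspace_scale)
  moreover have "(\<Sum>b\<in>B. vscale (c b) (f b)) = (\<lambda>x. \<Sum>b\<in>B. c b * f b x)"
    by (simp add: fun_eq_iff sum_fun_apply vscale_def)
  ultimately show ?thesis by simp
qed

text \<open>The matrix of the orthogonal projection of \<open>C^I\<close> to \<open>V\<close>,
  characterised by its properties so that uniqueness yields its symmetries. The columns lie in
  \<open>V\<close> as functions on the whole type, while sums run over \<open>I\<close>
  only.\<close>

definition rkernel :: "'a set \<Rightarrow> ('a \<Rightarrow> complex) set \<Rightarrow> ('a \<Rightarrow> 'a \<Rightarrow> complex) \<Rightarrow> bool" where
  "rkernel I V K \<longleftrightarrow> (\<forall>j\<in>I. (\<lambda>i. K i j) \<in> V) \<and> (\<forall>f\<in>V. \<forall>i\<in>I. (\<Sum>j\<in>I. K i j * f j) = f i) \<and>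
     (\<forall>i\<in>I. \<forall>j\<in>I. K i j = cnj (K j i))"

lemma rkernel_col: "rkernel I V K \<Longrightarrow> j \<in> I \<Longrightarrow> (\<lambda>i. K i j) \<in> V"
  and rkernel_rep: "rkernel I V K \<Longrightarrow> f \<in> V \<Longrightarrow> i \<in> I \<Longrightarrow> (\<Sum>j\<in>I. K i j * f j) = f i"
  and rkernel_herm: "rkernel I V K \<Longrightarrow> i \<in> I \<Longrightarrow> j \<in> I \<Longrightarrow> cnj (K i j) = K j i"
  unfolding rkernel_def by (blast, blast, metis)

lemma sum_cnj_self: "(\<Sum>i\<in>I. f i * cnj (f i)) = complex_of_real (\<Sum>i\<in>I. (cmod (f i))\<^sup>2)"
  by (simp only: complex_norm_square[symmetric] of_real_sum)

definition orthonormal :: "'a set \<Rightarrow> ('a \<Rightarrow> complex) set \<Rightarrow> bool" where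
  "orthonormal I B \<longleftrightarrow> finite B \<and>
     (\<forall>b\<in>B. \<forall>c\<in>B. (\<Sum>i\<in>I. b i * cnj (c i)) = (if b = c then 1 else 0))"

lemma orthonormal_rep:
  assumes "orthonormal I B" "c \<in> B"
  shows "(\<Sum>j\<in>I. (\<Sum>b\<in>B. b i * cnj (b j)) * c j) = c i"
proof -
  have "(\<Sum>j\<in>I. (\<Sum>b\<in>B. b i * cnj (b j)) * c j) = (\<Sum>j\<in>I. \<Sum>b\<in>B. b i * (c j * cnj (b j)))"
    by (simp add: sum_distrib_left sum_distrib_right algebra_simps)
  also have "\<dots> = (\<Sum>b\<in>B. \<Sum>j\<in>I. b i * (c j * cnj (b j)))" by (rule sum.swap)
  also have "\<dots> = (\<Sum>b\<in>B. b i * (\<Sum>j\<in>I. c j * cnj (b j)))" by (simp add: sum_distrib_left)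
  also have "\<dots> = (\<Sum>b\<in>B. if b = c then b i else 0)"
    using assms by (intro sum.cong) (auto simp: orthonormal_def)
  also have "\<dots> = c i" using assms by (simp add: orthonormal_def)
  finally show ?thesis .
qed

text \<open>The diagonal entry \<open>t i\<close> of the projection spanned by \<open>B\<close> is
  the squared norm of its column, so it dominates its own square and is at most 1. The trace of this
  projection is \<open>card B\<close>.\<close>

lemma orthonormal_card_le:
  assumes I: "finite I" and B: "orthonormal I B"
  shows "card B \<le> card I"
proof -
  have fB: "finite B" using B by (simp add: orthonormal_def)
  define t where "t i = (\<Sum>b\<in>B. (cmod (b i))\<^sup>2)" for i
  have t: "t i \<le> 1" if "i \<in> I" for i
  proof -
    define v where "v j = (\<Sum>b\<in>B. b j * cnj (b i))" for j
    have vi: "v i = t i" by (simp add: v_def t_def sum_cnj_self)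
    have "cnj (v j) * v j = (\<Sum>c\<in>B. cnj (c i) * (cnj (v j) * c j))" for j
      by (subst (2) v_def) (simp add: sum_distrib_left mult_ac)
    then have "(\<Sum>j\<in>I. cnj (v j) * v j) = (\<Sum>j\<in>I. \<Sum>c\<in>B. cnj (c i) * (cnj (v j) * c j))" by simp
    also have "\<dots> = (\<Sum>c\<in>B. \<Sum>j\<in>I. cnj (c i) * (cnj (v j) * c j))" by (rule sum.swap)
    also have "\<dots> = (\<Sum>c\<in>B. cnj (c i) * c i)"
    proof (intro sum.cong refl)
      fix c assume c: "c \<in> B"
      have "(\<Sum>j\<in>I. cnj (v j) * c j) = (\<Sum>j\<in>I. (\<Sum>b\<in>B. b i * cnj (b j)) * c j)"
        by (simp add: v_def mult.commute)
      then have "(\<Sum>j\<in>I. cnj (v j) * c j) = c i" using orthonormal_rep[OF B c] by simp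
      then show "(\<Sum>j\<in>I. cnj (c i) * (cnj (v j) * c j)) = cnj (c i) * c i"
        by (simp flip: sum_distrib_left)
    qed
    also have "\<dots> = complex_of_real (t i)" by (simp add: t_def sum_cnj_self mult.commute)
    finally have "(\<Sum>j\<in>I. (cmod (v j))\<^sup>2) = t i"
      using sum_cnj_self[of v I] by (metis (mono_tags, lifting) mult.commute of_real_eq_iff sum.cong)
    moreover have "(cmod (v i))\<^sup>2 \<le> (\<Sum>j\<in>I. (cmod (v j))\<^sup>2)"
      using I that by (intro member_le_sum) auto
    moreover have "t i \<ge> 0" unfolding t_def by (intro sum_nonneg) auto
    ultimately have "(t i)\<^sup>2 \<le> t i" by (simp add: vi)
    then show ?thesis using mult_strict_left_mono[of 1 "t i" "t i"] by (cases "t i \<le> 1") (auto simp: power2_eq_square)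
  qed
  have "real (card B) = (\<Sum>b\<in>B. \<Sum>i\<in>I. (cmod (b i))\<^sup>2)"
  proof -
    have "(\<Sum>i\<in>I. (cmod (b i))\<^sup>2) = 1" if "b \<in> B" for b
      using B that sum_cnj_self[of b I] by (simp add: orthonormal_def del: of_real_sum)
    then show ?thesis by simp
  qed
  also have "\<dots> = (\<Sum>i\<in>I. t i)" unfolding t_def by (rule sum.swap)
  also have "\<dots> \<le> (\<Sum>i\<in>I. 1)" using t by (intro sum_mono)
  finally show ?thesis by simp
qed

text \<open>Orthonormal families in \<open>V\<close> have bounded size, so a largest one exists.
  Were its projection to miss some \<open>f\<close>, the normalised defect of \<open>f\<close> would
  enlarge it.\<close>

lemma ex_rkernel:
  assumes I: "finite I" and V: "vec.subspace V" and supp: "\<And>f i. f \<in> V \<Longrightarrow> i \<notin> I \<Longrightarrow> f i = 0"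
  shows "\<exists>K. rkernel I V K"
proof -
  let ?P = "\<lambda>B. B \<subseteq> V \<and> orthonormal I B"
  have "?P {}" by (simp add: orthonormal_def)
  moreover have "\<forall>B. ?P B \<longrightarrow> card B < Suc (card I)" using orthonormal_card_le[OF I] by (simp add: le_imp_less_Suc)
  ultimately have "\<exists>B. ?P B \<and> (\<forall>B'. ?P B' \<longrightarrow> card B' \<le> card B)" by (rule ex_has_greatest_nat)
  then obtain B where B: "B \<subseteq> V" "orthonormal I B" and max: "\<And>B'. B' \<subseteq> V \<Longrightarrow> orthonormal I B' \<Longrightarrow> card B' \<le> card B"
    by blast
  have fB: "finite B" using B by (simp add: orthonormal_def)
  define K where "K i j = (\<Sum>b\<in>B. b i * cnj (b j))" for i j
  have col: "(\<lambda>i. K i j) \<in> V" for j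
    using vec_subspace_lincomb[OF V, of B "\<lambda>b. b" "\<lambda>b. cnj (b j)"] B(1)
    by (auto simp: K_def mult.commute)
  have herm: "K i j = cnj (K j i)" for i j by (simp add: K_def mult.commute)
  have h: "cnj (K j i) = K i j" for i j by (simp add: K_def mult.commute)
  have rep: "(\<Sum>j\<in>I. K i j * f j) = f i" if f: "f \<in> V" and "i \<in> I" for f i
  proof (rule ccontr)
    assume ne: "(\<Sum>j\<in>I. K i j * f j) \<noteq> f i"
    define w where "w i = f i - (\<Sum>j\<in>I. K i j * f j)" for i
    have wV: "w \<in> V"
    proof -
      have "(\<lambda>i. \<Sum>j\<in>I. f j * K i j) \<in> V"
        using vec_subspace_lincomb[OF V, of I "\<lambda>j i. K i j" f] col by auto
      from vec.subspace_diff[OF V f this] show ?thesis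
        unfolding w_def fun_diff_def by (simp only: mult.commute)
    qed
    have orth: "(\<Sum>i\<in>I. w i * cnj (b i)) = 0" if b: "b \<in> B" for b
    proof -
      have "(\<Sum>i\<in>I. (\<Sum>j\<in>I. K i j * f j) * cnj (b i)) = (\<Sum>i\<in>I. \<Sum>j\<in>I. f j * (K i j * cnj (b i)))"
        by (simp add: sum_distrib_left mult_ac)
      also have "\<dots> = (\<Sum>j\<in>I. \<Sum>i\<in>I. f j * (K i j * cnj (b i)))" by (rule sum.swap)
      also have "\<dots> = (\<Sum>j\<in>I. f j * cnj (\<Sum>i\<in>I. K j i * b i))"
        by (simp add: sum_distrib_left h)
      also have "\<dots> = (\<Sum>j\<in>I. f j * cnj (b j))"
        using orthonormal_rep[OF B(2) b] by (simp add: K_def)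
      finally show ?thesis by (simp add: w_def algebra_simps sum_subtractf)
    qed
    define t where "t = (\<Sum>i\<in>I. (cmod (w i))\<^sup>2)"
    have "0 < (cmod (w i))\<^sup>2" using ne by (simp add: w_def)
    also have "\<dots> \<le> t" unfolding t_def using I \<open>i \<in> I\<close> by (intro member_le_sum) auto
    finally have t: "t > 0" .
    define c where "c = vscale (1 / sqrt t) w"
    have cV: "c \<in> V" unfolding c_def using V wV by (rule vec.subspace_scale)
    have cc: "(\<Sum>i\<in>I. c i * cnj (c i)) = 1"
    proof -
      have "(\<Sum>i\<in>I. c i * cnj (c i)) = complex_of_real (\<Sum>i\<in>I. (cmod (c i))\<^sup>2)" by (rule sum_cnj_self)
      also have "(\<Sum>i\<in>I. (cmod (c i))\<^sup>2) = (\<Sum>i\<in>I. (1/t) * (cmod (w i))\<^sup>2)"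
        using t by (simp add: c_def vscale_def norm_mult norm_divide power_mult_distrib power_divide)
      also have "\<dots> = (1/t) * t" by (simp only: t_def sum_distrib_left)
      also have "\<dots> = 1" using t by simp
      finally show ?thesis by simp
    qed
    have cb: "(\<Sum>i\<in>I. c i * cnj (b i)) = 0" if "b \<in> B" for b
      using orth[OF that] by (simp add: c_def vscale_def mult.assoc flip: sum_distrib_left sum_divide_distrib)
    have bc: "(\<Sum>i\<in>I. b i * cnj (c i)) = 0" if "b \<in> B" for b
    proof -
      have "(\<Sum>i\<in>I. b i * cnj (c i)) = cnj (\<Sum>i\<in>I. c i * cnj (b i))" by (simp add: mult.commute)
      then show ?thesis using cb[OF that] by simp
    qed
    have "c \<notin> B" using cc cb by force
    then have "orthonormal I (insert c B)" "card (insert c B) = Suc (card B)"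
      using B cc cb bc fB by (auto simp: orthonormal_def)
    then show False using max[of "insert c B"] B cV by simp
  qed
  show ?thesis unfolding rkernel_def using col herm rep by blast
qed

text \<open>\<open>K' A = K' A K\<close> because the adjoint of \<open>A\<close> maps
  \<open>V'\<close> to \<open>V\<close>, and \<open>K' A K = A K\<close> because \<open>A\<close>
  maps \<open>V\<close> to \<open>V'\<close>.\<close>

lemma rkernel_natural:
  assumes K: "rkernel I V K" and K': "rkernel I' V' K'"
    and A: "\<And>f. f \<in> V \<Longrightarrow> (\<lambda>a. \<Sum>i\<in>I. A a i * f i) \<in> V'"
    and A': "\<And>g. g \<in> V' \<Longrightarrow> (\<lambda>i. \<Sum>a\<in>I'. cnj (A a i) * g a) \<in> V"
    and a: "a \<in> I'" and i: "i \<in> I"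
  shows "(\<Sum>b\<in>I'. K' a b * A b i) = (\<Sum>j\<in>I. A a j * K j i)"
proof -
  let ?g = "\<lambda>j. \<Sum>b\<in>I'. cnj (A b j) * K' b a"
  have "(\<Sum>b\<in>I'. K' a b * A b i) = cnj (?g i)"
    using a by (simp add: rkernel_herm[OF K'] mult.commute)
  also have "?g i = (\<Sum>j\<in>I. K i j * ?g j)"
    using rkernel_rep[OF K A'[OF rkernel_col[OF K' a]] i] by simp
  also have "cnj \<dots> = (\<Sum>j\<in>I. \<Sum>b\<in>I'. K' a b * (A b j * K j i))"
    using a i by (simp add: rkernel_herm[OF K] rkernel_herm[OF K'] sum_distrib_left algebra_simps)
  also have "\<dots> = (\<Sum>b\<in>I'. \<Sum>j\<in>I. K' a b * (A b j * K j i))" by (rule sum.swap)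
  also have "\<dots> = (\<Sum>b\<in>I'. K' a b * (\<Sum>j\<in>I. A b j * K j i))" by (simp add: sum_distrib_left)
  also have "\<dots> = (\<Sum>j\<in>I. A a j * K j i)"
    using rkernel_rep[OF K' A[OF rkernel_col[OF K i]] a] .
  finally show ?thesis .
qed

text \<open>\<open>K K' = K'\<close> because the columns of \<open>K'\<close> lie in
  \<open>V\<close>, and \<open>K K' = K\<close> by the adjoint of the same argument. A symmetry of
  \<open>V\<close> carries its kernel to a kernel, hence leaves it fixed.\<close>

lemma rkernel_unique:
  assumes K: "rkernel I V K" and K': "rkernel I V K'" and a: "a \<in> I" and i: "i \<in> I"
  shows "K a i = K' a i"
proof -
  have "K' a i = (\<Sum>j\<in>I. K a j * K' j i)"
    using rkernel_rep[OF K rkernel_col[OF K' i] a] by simp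
  also have "\<dots> = cnj (\<Sum>j\<in>I. K' i j * K j a)"
    using a i by (simp add: rkernel_herm[OF K] rkernel_herm[OF K'] mult.commute)
  also have "\<dots> = K a i"
    using rkernel_rep[OF K' rkernel_col[OF K a] i] rkernel_herm[OF K i a] by simp
  finally show ?thesis by simp
qed

text \<open>\<open>K\<close> is hermitian and idempotent, so the form is the squared norm of
  \<open>K z\<close>.\<close>

lemma rkernel_psd:
  assumes K: "rkernel I V K" and I: "finite I"
  shows "0 \<le> Re (\<Sum>a\<in>I. \<Sum>b\<in>I. cnj (z a) * K a b * z b)"
proof -
  have "(\<Sum>a\<in>I. \<Sum>b\<in>I. cnj (z a) * K a b * z b) =
      (\<Sum>a\<in>I. \<Sum>b\<in>I. \<Sum>c\<in>I. (cnj (z a) * cnj (K c a)) * (K c b * z b))"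
  proof (intro sum.cong refl)
    fix a b assume a: "a \<in> I" and b: "b \<in> I"
    have "cnj (z a) * K a b * z b = cnj (z a) * (\<Sum>c\<in>I. K a c * K c b) * z b"
      using rkernel_rep[OF K rkernel_col[OF K b] a] by simp
    also have "\<dots> = (\<Sum>c\<in>I. (cnj (z a) * cnj (K c a)) * (K c b * z b))"
      using a by (simp add: rkernel_herm[OF K] sum_distrib_left sum_distrib_right mult.assoc)
    finally show "cnj (z a) * K a b * z b = \<dots>" .
  qed
  also have "\<dots> = (\<Sum>a\<in>I. \<Sum>c\<in>I. \<Sum>b\<in>I. (cnj (z a) * cnj (K c a)) * (K c b * z b))"
    by (intro sum.cong refl sum.swap)
  also have "\<dots> = (\<Sum>c\<in>I. \<Sum>a\<in>I. \<Sum>b\<in>I. (cnj (z a) * cnj (K c a)) * (K c b * z b))"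
    by (rule sum.swap)
  also have "\<dots> = (\<Sum>c\<in>I. cnj (\<Sum>a\<in>I. K c a * z a) * (\<Sum>b\<in>I. K c b * z b))"
    by (simp only: cnj_sum complex_cnj_mult sum_product) (simp only: mult_ac)
  also have "\<dots> = complex_of_real (\<Sum>c\<in>I. (cmod (\<Sum>a\<in>I. K c a * z a))\<^sup>2)"
    using sum_cnj_self[of "\<lambda>c. \<Sum>a\<in>I. K c a * z a" I] by (simp add: mult.commute)
  finally show ?thesis by (simp add: sum_nonneg)
qed

lemma ex_projection:
  assumes K: "rkernel I V K" and V: "vec.subspace V"
  shows "\<exists>y\<in>V. \<forall>z\<in>V. (\<Sum>a\<in>I. cnj (z a) * x a) = (\<Sum>a\<in>I. cnj (z a) * y a)"
proof
  let ?y = "\<lambda>a. \<Sum>b\<in>I. x b * K a b"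
  show "?y \<in> V" using vec_subspace_lincomb[OF V, of I "\<lambda>b a. K a b" x] rkernel_col[OF K] by auto
  show "\<forall>z\<in>V. (\<Sum>a\<in>I. cnj (z a) * x a) = (\<Sum>a\<in>I. cnj (z a) * ?y a)"
  proof
    fix z assume z: "z \<in> V"
    have "(\<Sum>b\<in>I. cnj (z b) * x b) = (\<Sum>b\<in>I. cnj (\<Sum>a\<in>I. K b a * z a) * x b)"
      by (intro sum.cong refl) (simp only: rkernel_rep[OF K z])
    also have "\<dots> = (\<Sum>b\<in>I. \<Sum>a\<in>I. cnj (z a) * (x b * K a b))"
      by (simp add: sum_distrib_left sum_distrib_right rkernel_herm[OF K] mult_ac)
    also have "\<dots> = (\<Sum>a\<in>I. \<Sum>b\<in>I. cnj (z a) * (x b * K a b))" by (rule sum.swap)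
    finally show "(\<Sum>a\<in>I. cnj (z a) * x a) = (\<Sum>a\<in>I. cnj (z a) * ?y a)"
      by (simp add: sum_distrib_left)
  qed
qed

section \<open>Positivity of the Casimir form of a matrix *-algebra\<close>

text \<open>With \<open>S\<close> ranging over an orthonormal basis of \<open>M\<close>, the form is the inner product of
  \<open>E X = \<Sum> S\<^sup>t X (cnj S)\<close> with \<open>X\<close>.  The map \<open>E\<close> is self-adjoint with range in the commutant of \<open>M\<close>, so
  that \<open>X\<close> may be replaced by its projection \<open>Y\<close> to the commutant; there \<open>E\<close> multiplies by the
  positive matrix \<open>\<Sum> S\<^sup>t (cnj S)\<close>.\<close>

lemma sum_fst_delta:
  assumes "finite I" "r \<in> I"
  shows "(\<Sum>x\<in>I \<times> I. if fst x = r then g (snd x) else 0) = (\<Sum>q\<in>I. g q :: complex)"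
proof -
  have "(\<Sum>x\<in>I \<times> I. if fst x = r then g (snd x) else 0) = (\<Sum>p\<in>I. \<Sum>q\<in>I. if p = r then g q else 0)"
    by (simp add: sum.cartesian_product' cong: if_cong)
  also have "\<dots> = (\<Sum>q\<in>I. \<Sum>p\<in>I. if p = r then g q else 0)" by (rule sum.swap)
  finally show ?thesis using assms by simp
qed

lemma casimir_nonneg:
  fixes M :: "('a \<times> 'a \<Rightarrow> complex) set"
  assumes I: "finite I" and K: "rkernel (I \<times> I) M K"
    and supp: "\<And>S a. S \<in> M \<Longrightarrow> a \<notin> I \<times> I \<Longrightarrow> S a = 0"
    and mult: "\<And>S T. S \<in> M \<Longrightarrow> T \<in> M \<Longrightarrow> (\<lambda>(i, j). \<Sum>k\<in>I. S (i, k) * T (k, j)) \<in> M"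
    and transp: "\<And>S. S \<in> M \<Longrightarrow> (\<lambda>(i, j). S (j, i)) \<in> M"
    and conj: "\<And>S. S \<in> M \<Longrightarrow> (\<lambda>ij. cnj (S ij)) \<in> M"
  shows "0 \<le> Re (\<Sum>a\<in>I \<times> I. \<Sum>b\<in>I \<times> I. cnj (X a) * X b * K (fst b, fst a) (snd b, snd a))"
proof -
  define J where "J = I \<times> I"
  have finJ: "finite J" using I by (simp add: J_def)
  note KJ = K[folded J_def]
  \<comment> \<open>The two middle indices are exchanged: if \<open>K a b\<close> is the sum of
    \<open>S a * cnj (S b)\<close> over an orthonormal basis of \<open>M\<close>, then summing
    \<open>\<kappa> a b * X b\<close> over \<open>b\<close> gives the sum of the matrices
    \<open>S^t X (cnj S)\<close>.\<close>
  define \<kappa> where "\<kappa> a b = K (fst b, fst a) (snd b, snd a)" for a b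
  define E where "E X a = (if a \<in> J then \<Sum>b\<in>J. \<kappa> a b * X b else 0)"
    for X :: "'a \<times> 'a \<Rightarrow> complex" and a
  define M' where "M' = {Y :: 'a \<times> 'a \<Rightarrow> complex. (\<forall>ij. ij \<notin> J \<longrightarrow> Y ij = 0) \<and> (\<forall>T\<in>M. \<forall>i\<in>I. \<forall>j\<in>I.
      (\<Sum>k\<in>I. Y (i, k) * T (k, j)) = (\<Sum>k\<in>I. T (i, k) * Y (k, j)))}"
  have sub: "vec.subspace M'"
  proof -
    have "(\<Sum>k\<in>I. c * Y (i, k) * T (k, j)) = (\<Sum>k\<in>I. T (i, k) * (c * Y (k, j)))"
      if "(\<Sum>k\<in>I. Y (i, k) * T (k, j)) = (\<Sum>k\<in>I. T (i, k) * Y (k, j))" for c i j and Y T :: "'a \<times> 'a \<Rightarrow> complex"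
      using arg_cong[OF that, of "(*) c"] by (simp add: sum_distrib_left mult_ac)
    then show ?thesis
      by (auto simp: vec.subspace_def M'_def vscale_def distrib_left distrib_right sum.distrib)
  qed
  obtain K' where K': "rkernel J M' K'"
    using ex_rkernel[OF finJ sub] by (auto simp: M'_def)
  \<comment> \<open>Right multiplication by the transpose of \<open>T\<close> preserves
    \<open>M\<close>, and so does its adjoint, right multiplication by \<open>cnj T\<close>; hence
    it commutes with the projection \<open>K\<close>.\<close>
  have comm: "(\<Sum>q\<in>I. K (i', i) (j', q) * T (q, j)) = (\<Sum>q\<in>I. T (i, q) * K (i', q) (j', j))"
    if T: "T \<in> M" and ij: "i \<in> I" "j \<in> I" "i' \<in> I" "j' \<in> I" for T i j i' j'
  proof -
    define A :: "'a \<times> 'a \<Rightarrow> 'a \<times> 'a \<Rightarrow> complex"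
      where "A a b = (if fst a = fst b then T (snd a, snd b) else 0)" for a b
    have "(\<Sum>b\<in>J. K (i', i) b * A b (j', j)) = (\<Sum>b\<in>J. A (i', i) b * K b (j', j))"
    proof (rule rkernel_natural[OF KJ KJ])
      fix f assume f: "f \<in> M"
      have "(\<Sum>b\<in>J. A a b * f b) = (\<Sum>q\<in>I. f (fst a, q) * T (snd a, q))" for a
      proof (cases "fst a \<in> I")
        case True
        have "(\<Sum>b\<in>J. A a b * f b) =
            (\<Sum>b\<in>I \<times> I. if fst b = fst a then f (fst a, snd b) * T (snd a, snd b) else 0)"
          unfolding J_def by (intro sum.cong refl) (auto simp: A_def)
        then show ?thesis using sum_fst_delta[OF I True] by simp
      next
        case False
        then have "A a b = 0" if "b \<in> J" for b using that by (auto simp: A_def J_def)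
        then show ?thesis using False supp[OF f] by simp
      qed
      then show "(\<lambda>a. \<Sum>b\<in>J. A a b * f b) \<in> M"
        using mult[OF f transp[OF T]] by (simp add: case_prod_unfold)
    next
      fix f assume f: "f \<in> M"
      have "(\<Sum>a\<in>J. cnj (A a b) * f a) = (\<Sum>q\<in>I. f (fst b, q) * cnj (T (q, snd b)))" for b
      proof (cases "fst b \<in> I")
        case True
        have "(\<Sum>a\<in>J. cnj (A a b) * f a) =
            (\<Sum>a\<in>I \<times> I. if fst a = fst b then f (fst b, snd a) * cnj (T (snd a, snd b)) else 0)"
          unfolding J_def by (intro sum.cong refl) (auto simp: A_def)
        then show ?thesis using sum_fst_delta[OF I True] by simp
      next
        case False
        then have "A a b = 0" if "a \<in> J" for a using that by (auto simp: A_def J_def)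
        then show ?thesis using False supp[OF f] by simp
      qed
      then show "(\<lambda>b. \<Sum>a\<in>J. cnj (A a b) * f a) \<in> M"
        using mult[OF f conj[OF T]] by (simp add: case_prod_unfold)
    qed (use ij in \<open>auto simp: J_def\<close>)
    moreover have "(\<Sum>b\<in>J. K (i', i) b * A b (j', j)) = (\<Sum>q\<in>I. K (i', i) (j', q) * T (q, j))"
    proof -
      have "(\<Sum>b\<in>J. K (i', i) b * A b (j', j)) =
          (\<Sum>b\<in>I \<times> I. if fst b = j' then K (i', i) (j', snd b) * T (snd b, j) else 0)"
        unfolding J_def by (intro sum.cong refl) (auto simp: A_def)
      then show ?thesis using sum_fst_delta[OF I ij(4)] by simp
    qed
    moreover have "(\<Sum>b\<in>J. A (i', i) b * K b (j', j)) = (\<Sum>q\<in>I. T (i, q) * K (i', q) (j', j))"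
    proof -
      have "(\<Sum>b\<in>J. A (i', i) b * K b (j', j)) =
          (\<Sum>b\<in>I \<times> I. if fst b = i' then T (i, snd b) * K (i', snd b) (j', j) else 0)"
        unfolding J_def by (intro sum.cong refl) (auto simp: A_def)
      then show ?thesis using sum_fst_delta[OF I ij(3)] by simp
    qed
    ultimately show ?thesis by simp
  qed
  \<comment> \<open>The conjugate transpose preserves \<open>M\<close>, so exchanging the members of
    both index pairs and conjugating leaves \<open>K\<close> unchanged.\<close>
  have \<kappa>herm: "\<kappa> a b = cnj (\<kappa> b a)" if ab: "a \<in> J" "b \<in> J" for a b
  proof -
    have swapJ: "prod.swap c \<in> J \<longleftrightarrow> c \<in> J" for c by (cases c) (auto simp: J_def)
    have dag: "(\<lambda>a. cnj (f (prod.swap a))) \<in> M" if "f \<in> M" for f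
      using conj[OF transp[OF that]] by (simp add: case_prod_unfold prod.swap_def)
    have "rkernel J M (\<lambda>a b. cnj (K (prod.swap a) (prod.swap b)))"
      unfolding rkernel_def
    proof (intro conjI ballI)
      fix b assume "b \<in> J"
      then show "(\<lambda>a. cnj (K (prod.swap a) (prod.swap b))) \<in> M"
        using dag[OF rkernel_col[OF KJ]] by (simp add: swapJ)
    next
      fix f a assume f: "f \<in> M" and a: "a \<in> J"
      have "(\<Sum>b\<in>J. cnj (K (prod.swap a) (prod.swap b)) * f b) =
          (\<Sum>c\<in>J. cnj (K (prod.swap a) c * cnj (f (prod.swap c))))"
        by (rule sum.reindex_bij_witness[of _ prod.swap prod.swap]) (auto simp: swapJ)
      also have "\<dots> = cnj (\<Sum>c\<in>J. K (prod.swap a) c * cnj (f (prod.swap c)))" by simp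
      also have "\<dots> = f a" using rkernel_rep[OF KJ dag[OF f], of "prod.swap a"] a by (simp add: swapJ)
      finally show "(\<Sum>b\<in>J. cnj (K (prod.swap a) (prod.swap b)) * f b) = f a" .
    next
      fix a b assume "a \<in> J" "b \<in> J"
      then show "cnj (K (prod.swap a) (prod.swap b)) = cnj (cnj (K (prod.swap b) (prod.swap a)))"
        by (simp add: rkernel_herm[OF KJ] swapJ)
    qed
    from rkernel_unique[OF KJ this, of "(fst b, fst a)" "(snd b, snd a)"] ab
    show ?thesis by (auto simp: \<kappa>_def J_def)
  qed
  have EM': "E Z \<in> M'" for Z
    unfolding M'_def
  proof (intro CollectI conjI ballI allI impI)
    fix T i j assume T: "T \<in> M" and i: "i \<in> I" and j: "j \<in> I"
    have "(\<Sum>k\<in>I. E Z (i, k) * T (k, j)) = (\<Sum>k\<in>I. \<Sum>b\<in>J. Z b * (K (fst b, i) (snd b, k) * T (k, j)))"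
      using i by (intro sum.cong refl) (simp add: E_def \<kappa>_def J_def sum_distrib_left mult_ac)
    also have "\<dots> = (\<Sum>b\<in>J. Z b * (\<Sum>k\<in>I. K (fst b, i) (snd b, k) * T (k, j)))"
      by (subst sum.swap) (simp add: sum_distrib_left)
    also have "\<dots> = (\<Sum>b\<in>J. Z b * (\<Sum>k\<in>I. T (i, k) * K (fst b, k) (snd b, j)))"
      by (intro sum.cong refl arg_cong2[where f = "(*)"] comm) (use T i j in \<open>auto simp: J_def\<close>)
    also have "\<dots> = (\<Sum>k\<in>I. \<Sum>b\<in>J. Z b * (T (i, k) * K (fst b, k) (snd b, j)))"
      by (subst sum.swap) (simp add: sum_distrib_left)
    also have "\<dots> = (\<Sum>k\<in>I. T (i, k) * E Z (k, j))"
      using j by (intro sum.cong refl) (simp add: E_def \<kappa>_def J_def sum_distrib_left mult_ac)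
    finally show "(\<Sum>k\<in>I. E Z (i, k) * T (k, j)) = (\<Sum>k\<in>I. T (i, k) * E Z (k, j))" .
  qed (simp add: E_def)
  have sa: "(\<Sum>a\<in>J. cnj (W a) * E Z a) = cnj (\<Sum>a\<in>J. cnj (Z a) * E W a)" for W Z
  proof -
    have "(\<Sum>a\<in>J. cnj (W a) * E Z a) = (\<Sum>a\<in>J. \<Sum>b\<in>J. cnj (W a) * (\<kappa> a b * Z b))"
      by (simp add: E_def sum_distrib_left)
    also have "\<dots> = (\<Sum>b\<in>J. \<Sum>a\<in>J. cnj (W a) * (\<kappa> a b * Z b))" by (rule sum.swap)
    also have "\<dots> = (\<Sum>b\<in>J. \<Sum>a\<in>J. cnj (cnj (Z b) * (\<kappa> b a * W a)))"
    proof (intro sum.cong refl)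
      fix a b assume "b \<in> J" "a \<in> J"
      then show "cnj (W a) * (\<kappa> a b * Z b) = cnj (cnj (Z b) * (\<kappa> b a * W a))"
        using \<kappa>herm[of a b] by simp
    qed
    also have "\<dots> = cnj (\<Sum>a\<in>J. cnj (Z a) * E W a)"
      by (simp add: E_def sum_distrib_left)
    finally show ?thesis .
  qed
  obtain Y where Y: "Y \<in> M'" and proj: "\<And>Z. Z \<in> M' \<Longrightarrow> (\<Sum>a\<in>J. cnj (Z a) * X a) = (\<Sum>a\<in>J. cnj (Z a) * Y a)"
    using ex_projection[OF K' sub, of X] by blast
  have cnjsum: "cnj (\<Sum>a\<in>J. cnj (V a) * W a) = (\<Sum>a\<in>J. cnj (W a) * V a)" for V W
    by (simp add: mult.commute)
  have "(\<Sum>a\<in>J. \<Sum>b\<in>J. cnj (X a) * X b * K (fst b, fst a) (snd b, snd a)) = (\<Sum>a\<in>J. cnj (X a) * E X a)"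
    by (simp add: E_def \<kappa>_def sum_distrib_left mult_ac)
  also have "\<dots> = cnj (\<Sum>a\<in>J. cnj (E X a) * X a)" by (simp only: cnjsum)
  also have "\<dots> = (\<Sum>a\<in>J. cnj (Y a) * E X a)" by (simp only: proj[OF EM'] cnjsum)
  also have "\<dots> = cnj (\<Sum>a\<in>J. cnj (X a) * E Y a)" by (rule sa)
  also have "\<dots> = (\<Sum>a\<in>J. cnj (E Y a) * Y a)" by (simp only: cnjsum proj[OF EM'])
  also have "\<dots> = cnj (\<Sum>a\<in>J. cnj (Y a) * E Y a)" by (simp only: cnjsum)
  also have "(\<Sum>a\<in>J. cnj (Y a) * E Y a) = (\<Sum>i\<in>I. \<Sum>j\<in>I. cnj (Y (i, j)) * E Y (i, j))"
    by (simp add: J_def sum.cartesian_product')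
  also have "\<dots> = (\<Sum>i\<in>I. \<Sum>j\<in>I. \<Sum>j'\<in>I. \<Sum>i'\<in>I. cnj (Y (i, j)) * (Y (i, i') * K (j', i') (j', j)))"
  proof (intro sum.cong refl)
    fix i j assume ij: "i \<in> I" "j \<in> I"
    have "E Y (i, j) = (\<Sum>j'\<in>I. \<Sum>i'\<in>I. K (i', i) (j', j) * Y (i', j'))"
      using ij by (simp add: E_def \<kappa>_def J_def sum.cartesian_product') (rule sum.swap)
    also have "\<dots> = (\<Sum>j'\<in>I. \<Sum>i'\<in>I. Y (i, i') * K (j', i') (j', j))"
    proof (rule sum.cong[OF refl])
      fix j' assume j': "j' \<in> I"
      \<comment> \<open>Each column of \<open>K\<close>, transposed, is in \<open>M\<close> and
        hence commutes with \<open>Y\<close>, which moves \<open>Y\<close> to the left.\<close>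
      have "(\<lambda>(a, b). K (b, a) (j', j)) \<in> M"
        using transp[OF rkernel_col[OF K, of "(j', j)"]] ij j' by simp
      then have "(\<Sum>k\<in>I. Y (i, k) * (\<lambda>(a, b). K (b, a) (j', j)) (k, j')) =
          (\<Sum>k\<in>I. (\<lambda>(a, b). K (b, a) (j', j)) (i, k) * Y (k, j'))"
        using Y ij j' unfolding M'_def by blast
      then show "(\<Sum>i'\<in>I. K (i', i) (j', j) * Y (i', j')) = (\<Sum>i'\<in>I. Y (i, i') * K (j', i') (j', j))" by simp
    qed
    finally show "cnj (Y (i, j)) * E Y (i, j) =
        (\<Sum>j'\<in>I. \<Sum>i'\<in>I. cnj (Y (i, j)) * (Y (i, i') * K (j', i') (j', j)))"
      by (simp add: sum_distrib_left)
  qed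
  also have "\<dots> = (\<Sum>i\<in>I. \<Sum>j'\<in>I. \<Sum>j\<in>I. \<Sum>i'\<in>I. cnj (Y (i, j)) * (Y (i, i') * K (j', i') (j', j)))"
    by (intro sum.cong refl sum.swap)
  finally have eq: "(\<Sum>a\<in>J. \<Sum>b\<in>J. cnj (X a) * X b * K (fst b, fst a) (snd b, snd a)) = cnj \<dots>" .
  have pos: "0 \<le> Re (\<Sum>j\<in>I. \<Sum>i'\<in>I. cnj (Y (i, j)) * (Y (i, i') * K (j', i') (j', j)))"
    if ij: "i \<in> I" "j' \<in> I" for i j'
  proof -
    \<comment> \<open>A vector supported on the pairs with first member \<open>j'\<close>:
      positivity of \<open>K\<close> at it is positivity of one diagonal block.\<close>
    define z where "z a = (if fst a = j' then cnj (Y (i, snd a)) else 0)" for a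
    have "(\<Sum>a\<in>J. \<Sum>b\<in>J. cnj (z a) * K a b * z b) =
        (\<Sum>a\<in>I \<times> I. if fst a = j' then \<Sum>b\<in>I \<times> I. if fst b = j' then
          cnj (Y (i, snd b)) * (Y (i, snd a) * K (j', snd a) (j', snd b)) else 0 else 0)"
      unfolding J_def by (intro sum.cong refl) (auto simp: z_def intro!: sum.cong)
    also have "\<dots> = (\<Sum>i'\<in>I. \<Sum>j\<in>I. cnj (Y (i, j)) * (Y (i, i') * K (j', i') (j', j)))"
      using sum_fst_delta[OF I ij(2), of "\<lambda>p. \<Sum>b\<in>I \<times> I. if fst b = j' then
          cnj (Y (i, snd b)) * (Y (i, p) * K (j', p) (j', snd b)) else 0"]
        sum_fst_delta[OF I ij(2), of "\<lambda>q. cnj (Y (i, q)) * (Y (i, p) * K (j', p) (j', q))" for p]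
      by simp
    also have "\<dots> = (\<Sum>j\<in>I. \<Sum>i'\<in>I. cnj (Y (i, j)) * (Y (i, i') * K (j', i') (j', j)))"
      by (rule sum.swap)
    finally show ?thesis using rkernel_psd[OF KJ finJ, of z] by simp
  qed
  define G where "G i j' = (\<Sum>j\<in>I. \<Sum>i'\<in>I. cnj (Y (i, j)) * (Y (i, i') * K (j', i') (j', j)))" for i j'
  have "0 \<le> Re (\<Sum>a\<in>J. \<Sum>b\<in>J. cnj (X a) * X b * K (fst b, fst a) (snd b, snd a))"
    using pos unfolding eq G_def[symmetric] by (auto intro!: sum_nonneg)
  then show ?thesis by (simp add: J_def)
qed

section \<open>The Haar functional of a family of spaces of fixed vectors\<close>

abbreviation words :: "nat \<Rightarrow> 'n list set" where "words m \<equiv> {w. length w = m}"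

lemma sum_words_append:
  "(\<Sum>w\<in>words (l + m). F w) = (\<Sum>v\<in>words l. \<Sum>w\<in>words m. F (v @ w) :: 'a::comm_monoid_add)"
proof -
  have "(\<Sum>v\<in>words l. \<Sum>w\<in>words m. F (v @ w)) = (\<Sum>(v, w)\<in>words l \<times> words m. F (v @ w))"
    by (rule sum.cartesian_product)
  also have "\<dots> = (\<Sum>w\<in>words (l + m). F w)"
    by (rule sum.reindex_bij_witness[of _ "\<lambda>w. (take l w, drop l w)" "\<lambda>(v, w). v @ w"]) auto
  finally show ?thesis by simp
qed

lemma sum_words_1: "(\<Sum>w\<in>words (Suc 0). F w) = (\<Sum>k\<in>UNIV. F [k])"
  by (rule sum.reindex_bij_witness[of _ "\<lambda>k. [k]" hd]) (auto simp: length_Suc_conv)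

lemma sum_words_2: "(\<Sum>w\<in>words 2. F w) = (\<Sum>k\<in>UNIV. \<Sum>k'\<in>UNIV. F [k, k'])"
  using sum_words_append[of F 1 1] by (simp add: sum_words_1 numeral_2_eq_2)

lemma sum_words_rev: "(\<Sum>w\<in>words m. F (rev w)) = (\<Sum>w\<in>words m. F w)"
  by (rule sum.reindex_bij_witness[of _ rev rev]) auto

text \<open>Inserts the vector \<open>\<Sum> e_k \<otimes> e_k\<close> at position \<open>l\<close>.
  The guard makes the result vanish on words too short to hold the pair, so that supports on words
  of a fixed length are respected.\<close>

definition cup_at :: "nat \<Rightarrow> ('n list \<Rightarrow> complex) \<Rightarrow> 'n list \<Rightarrow> complex" where
  "cup_at l f w = (if Suc l < length w \<and> w ! l = w ! Suc l then f (take l w @ drop (l + 2) w) else 0)"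

definition cap_at :: "nat \<Rightarrow> ('n::finite list \<Rightarrow> complex) \<Rightarrow> 'n list \<Rightarrow> complex" where
  "cap_at l f w = (\<Sum>k\<in>UNIV. f (take l w @ [k, k] @ drop l w))"

lemma cup_at_append: "length v = l \<Longrightarrow> cup_at l f (v @ [x, y] @ w) = (if x = y then f (v @ w) else 0)"
  by (auto simp: cup_at_def nth_append)

lemma cap_at_append: "length v = l \<Longrightarrow> cap_at l f (v @ w) = (\<Sum>k\<in>UNIV. f (v @ [k, k] @ w))"
  by (simp add: cap_at_def)

lemma split_list_at:
  assumes "l \<le> length w" obtains v v' where "w = v @ v'" "length v = l"
  using assms by (metis append_take_drop_id length_take min.absorb2)

text \<open>\<open>V m\<close> plays the role of \<open>Hom(1, u^m)\<close> in a tensor category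
  with a self-dual generator. Composition of morphisms is contained in \<open>V_tensor\<close> and
  \<open>V_cap\<close>: juxtapose, then contract the letters of the intermediate object.\<close>

locale fixed_spaces =
  fixes V :: "nat \<Rightarrow> ('n::finite list \<Rightarrow> complex) set"
  assumes V_subspace: "vec.subspace (V m)"
    and V_supp: "f \<in> V m \<Longrightarrow> length w \<noteq> m \<Longrightarrow> f w = 0"
    and V_cnj: "f \<in> V m \<Longrightarrow> (\<lambda>w. cnj (f w)) \<in> V m"
    and V_rev: "f \<in> V m \<Longrightarrow> (\<lambda>w. f (rev w)) \<in> V m"
    and V_tensor: "f \<in> V l \<Longrightarrow> g \<in> V m \<Longrightarrow> (\<lambda>w. f (take l w) * g (drop l w)) \<in> V (l + m)"
    and V_cup: "f \<in> V (l + m) \<Longrightarrow> cup_at l f \<in> V (l + 2 + m)"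
    and V_cap: "f \<in> V (l + 2 + m) \<Longrightarrow> cap_at l f \<in> V (l + m)"
    and V_unit: "(\<lambda>w. if w = [] then 1 else 0) \<in> V 0"
begin

lemma V_0: "(\<lambda>w. 0) \<in> V m"
  using vec.subspace_0[OF V_subspace] by (simp add: zero_fun_def)

lemma V_lincomb: "(\<And>b. b \<in> B \<Longrightarrow> f b \<in> V m) \<Longrightarrow> (\<lambda>x. \<Sum>b\<in>B. c b * f b x) \<in> V m"
  by (rule vec_subspace_lincomb[OF V_subspace])

lemma V_sum: "(\<And>b. b \<in> B \<Longrightarrow> f b \<in> V m) \<Longrightarrow> (\<lambda>x. \<Sum>b\<in>B. f b x) \<in> V m"
  using V_lincomb[of B f m "\<lambda>_. 1"] by simp

text \<open>Contracting a nested block \<open>v @ rev v\<close> composes two morphisms. The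
  innermost pair, at position \<open>a + l\<close>, is contracted first, which leaves the same
  situation with one pair fewer.\<close>

lemma V_multicap:
  "f \<in> V (a + 2 * l + b) \<Longrightarrow> (\<lambda>w. \<Sum>v\<in>words l. f (take a w @ v @ rev v @ drop a w)) \<in> V (a + b)"
proof (induction l arbitrary: f)
  case 0
  then show ?case by simp
next
  case (Suc l)
  have "a + 2 * Suc l + b = a + l + 2 + (l + b)" "a + l + (l + b) = a + 2 * l + b" by simp_all
  note eq = this
  have f: "f \<in> V (a + l + 2 + (l + b))" using Suc.prems unfolding eq .
  from V_cap[OF f] have "cap_at (a + l) f \<in> V (a + 2 * l + b)" unfolding eq .
  from Suc.IH[OF this]
  have "(\<lambda>w. \<Sum>v\<in>words l. cap_at (a + l) f (take a w @ v @ rev v @ drop a w)) \<in> V (a + b)" .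
  moreover have "(\<Sum>v\<in>words l. cap_at (a + l) f (take a w @ v @ rev v @ drop a w)) =
      (\<Sum>v\<in>words (Suc l). f (take a w @ v @ rev v @ drop a w))" for w
  proof (cases "a \<le> length w")
    case True
    have "(\<Sum>v\<in>words (l + Suc 0). f (take a w @ v @ rev v @ drop a w)) =
        (\<Sum>v\<in>words l. \<Sum>k\<in>UNIV. f (take a w @ v @ [k, k] @ rev v @ drop a w))"
      by (simp add: sum_words_append sum_words_1 del: add_Suc_right)
    moreover have "cap_at (a + l) f (take a w @ v @ rev v @ drop a w) =
        (\<Sum>k\<in>UNIV. f (take a w @ v @ [k, k] @ rev v @ drop a w))" if "length v = l" for v
      using cap_at_append[of "take a w @ v" "a + l" f "rev v @ drop a w"] True that by simp
    ultimately show ?thesis by simp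
  next
    case False
    then have "f (take a w @ v @ rev v @ drop a w) = 0" if "length v = Suc l" for v
      using V_supp[OF f] that by simp
    moreover have "cap_at (a + l) f (take a w @ v @ rev v @ drop a w) = 0" if "length v = l" for v
      using V_supp[OF V_cap[OF f], of "take a w @ v @ rev v @ drop a w"] that False by simp
    ultimately show ?thesis by simp
  qed
  ultimately show ?case by simp
qed

definition kern :: "nat \<Rightarrow> 'n list \<Rightarrow> 'n list \<Rightarrow> complex" where
  "kern m = (SOME K. rkernel (words m) (V m) K)"

lemma rkernel_kern: "rkernel (words m) (V m) (kern m)"
  unfolding kern_def
  by (rule someI_ex[of "rkernel (words m) (V m)"], rule ex_rkernel) (auto simp: finite_words V_subspace V_supp)

text \<open>By Frobenius duality the vectors of \<open>V (k + l)\<close> are the matrices with entries \<open>S (i', i)\<close> at the words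
  \<open>rev i @ i'\<close>; they form the \<open>(l, k)\<close> block of a matrix *-algebra.\<close>

definition block :: "nat \<Rightarrow> nat \<Rightarrow> ('n list \<times> 'n list \<Rightarrow> complex) \<Rightarrow> 'n list \<Rightarrow> complex" where
  "block k l S w = (if length w = k + l then S (drop k w, rev (take k w)) else 0)"

lemma block_append: "length i = k \<Longrightarrow> length i' = l \<Longrightarrow> block k l S (rev i @ i') = S (i', i)"
  by (simp add: block_def)

text \<open>For words of length at most \<open>N\<close> the blocks form a finite-dimensional matrix
  algebra closed under the operations of \<open>casimir_nonneg\<close>, and \<open>K\<close> is its
  projection, assembled from one \<open>kern\<close> per pair of lengths. Row, column and summation
  indices range over the same bounded words, so products stay inside.\<close>

lemma block_kernel_nonneg:
  fixes X :: "'n list \<times> 'n list \<Rightarrow> complex" and N :: nat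
  defines "I \<equiv> {w. length w \<le> N}"
  defines "K \<equiv> \<lambda>a b. if a \<in> I \<times> I \<and> b \<in> I \<times> I \<and> length (fst a) = length (fst b) \<and> length (snd a) = length (snd b)
    then kern (length (snd a) + length (fst a)) (rev (snd a) @ fst a) (rev (snd b) @ fst b) else 0"
  shows "0 \<le> Re (\<Sum>a\<in>I \<times> I. \<Sum>b\<in>I \<times> I. cnj (X a) * X b * K (fst b, fst a) (snd b, snd a))"
proof (rule casimir_nonneg)
  define M where "M = {S. (\<forall>a. a \<notin> I \<times> I \<longrightarrow> S a = 0) \<and> (\<forall>k\<le>N. \<forall>l\<le>N. block k l S \<in> V (k + l))}"
  have I_Un: "I = (\<Union>l\<in>{..N}. words l)" by (auto simp: I_def)
  show finI: "finite I" unfolding I_Un by (intro finite_UN_I finite_words) auto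
  have sumI: "(\<Sum>w\<in>I. F w) = (\<Sum>l\<le>N. \<Sum>w\<in>words l. F w)" for F :: "'n list \<Rightarrow> complex"
    unfolding I_Un by (rule sum.UNION_disjoint) (auto simp: finite_words)
  have blk: "block k l S \<in> V (k + l)" if "S \<in> M" "k \<le> N" "l \<le> N" for k l S
    using that by (auto simp: M_def)
  show "rkernel (I \<times> I) M K"
    unfolding rkernel_def
  proof (intro conjI ballI)
    fix b assume b: "b \<in> I \<times> I"
    have "block k l (\<lambda>a. K a b) \<in> V (k + l)" if kl: "k \<le> N" "l \<le> N" for k l
    proof (cases "length (snd b) = k \<and> length (fst b) = l")
      case True
      have "block k l (\<lambda>a. K a b) w = kern (k + l) w (rev (snd b) @ fst b)" for w
      proof (cases "length w = k + l")
        case True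
        then show ?thesis using b kl \<open>length (snd b) = k \<and> length (fst b) = l\<close> by (auto simp: block_def K_def I_def)
      next
        case False
        then show ?thesis
          using V_supp[OF rkernel_col[OF rkernel_kern, of "rev (snd b) @ fst b" "k + l"]] True
          by (simp add: block_def)
      qed
      then have "block k l (\<lambda>a. K a b) = (\<lambda>w. kern (k + l) w (rev (snd b) @ fst b))" by (rule ext)
      then show ?thesis using rkernel_col[OF rkernel_kern, of "rev (snd b) @ fst b" "k + l"] True by simp
    next
      case False
      then have "K (drop k w, rev (take k w)) b = 0" if "length w = k + l" for w
        using that by (simp add: K_def) metis
      then have "block k l (\<lambda>a. K a b) = (\<lambda>w. 0)" by (intro ext) (simp add: block_def)
      then show ?thesis using V_0 by simp
    qed
    then show "(\<lambda>a. K a b) \<in> M" by (auto simp: M_def K_def)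
  next
    fix f a assume f: "f \<in> M" and a: "a \<in> I \<times> I"
    obtain i' i where ai: "a = (i', i)" by (cases a)
    let ?k = "length i" and ?l = "length i'"
    have kl: "?k \<le> N" "?l \<le> N" using a by (auto simp: ai I_def)
    have "(\<Sum>b\<in>I \<times> I. K a b * f b) =
        (\<Sum>b\<in>words ?l \<times> words ?k. kern (?k + ?l) (rev i @ i') (rev (snd b) @ fst b) * f b)"
      using finI kl a by (intro sum.mono_neutral_cong_right) (auto simp: K_def ai I_def)
    also have "\<dots> = (\<Sum>w\<in>words (?k + ?l). kern (?k + ?l) (rev i @ i') w * block ?k ?l f w)"
      by (rule sum.reindex_bij_witness[of _ "\<lambda>w. (drop ?k w, rev (take ?k w))" "\<lambda>b. rev (snd b) @ fst b"])
        (auto simp: block_def)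
    also have "\<dots> = f a"
      using rkernel_rep[OF rkernel_kern blk[OF f kl], of "rev i @ i'"] by (simp add: ai block_append)
    finally show "(\<Sum>b\<in>I \<times> I. K a b * f b) = f a" .
  next
    fix a b assume "a \<in> I \<times> I" "b \<in> I \<times> I"
    then show "K a b = cnj (K b a)"
      by (auto simp: K_def rkernel_herm[OF rkernel_kern])
  qed
  show "S a = 0" if "S \<in> M" "a \<notin> I \<times> I" for S a using that unfolding M_def by blast
  show "(\<lambda>ij. cnj (S ij)) \<in> M" if S: "S \<in> M" for S
  proof -
    have "block k l (\<lambda>ij. cnj (S ij)) = (\<lambda>w. cnj (block k l S w))" for k l
      by (intro ext) (simp add: block_def)
    then show ?thesis using S V_cnj[OF blk[OF S]] unfolding M_def by simp
  qed
  show "(\<lambda>(i, j). S (j, i)) \<in> M" if S: "S \<in> M" for S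
  proof -
    \<comment> \<open>Transposing a matrix reverses the word \<open>rev i @ i'\<close> at which its
      entry is stored.\<close>
    have "block k l (\<lambda>(i, j). S (j, i)) = (\<lambda>w. block l k S (rev w))" for k l
      by (auto simp: block_def fun_eq_iff rev_take rev_drop)
    then have "block k l (\<lambda>(i, j). S (j, i)) \<in> V (k + l)" if "k \<le> N" "l \<le> N" for k l
      using V_rev[OF blk[OF S that(2,1)]] by (simp add: add.commute)
    then show ?thesis using S by (auto simp: M_def)
  qed
  show "(\<lambda>(i, j). \<Sum>k\<in>I. S (i, k) * T (k, j)) \<in> M" if S: "S \<in> M" and T: "T \<in> M" for S T
  proof -
    have "block k m (\<lambda>(i, j). \<Sum>k\<in>I. S (i, k) * T (k, j)) \<in> V (k + m)" if km: "k \<le> N" "m \<le> N" for k m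
    proof -
      \<comment> \<open>Between the column word and the row word the intermediate word
        \<open>v\<close> is inserted as \<open>v @ rev v\<close>; the left half is then an argument
        of \<open>T\<close>, the right half one of \<open>S\<close>.\<close>
      let ?F = "\<lambda>l v w. block k l T (take (k + l) (take k w @ v @ rev v @ drop k w)) *
        block l m S (drop (k + l) (take k w @ v @ rev v @ drop k w))"
      have h: "(\<lambda>w. \<Sum>v\<in>words l. ?F l v w) \<in> V (k + m)" if l: "l \<le> N" for l
      proof (rule V_multicap[of "\<lambda>w. block k l T (take (k + l) w) * block l m S (drop (k + l) w)"])
        have eq: "k + 2 * l + m = (k + l) + (l + m)" by simp
        show "(\<lambda>w. block k l T (take (k + l) w) * block l m S (drop (k + l) w)) \<in> V (k + 2 * l + m)"
          unfolding eq by (rule V_tensor[OF blk[OF T km(1) l] blk[OF S l km(2)]])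
      qed
      have "(\<lambda>w. \<Sum>l\<le>N. \<Sum>v\<in>words l. ?F l v w) \<in> V (k + m)"
        by (rule V_sum, rule h) simp
      moreover have "(\<Sum>l\<le>N. \<Sum>v\<in>words l. ?F l v w) =
        block k m (\<lambda>(i, j). \<Sum>k\<in>I. S (i, k) * T (k, j)) w" for w
      proof (cases "length w = k + m")
        case True
        have "?F l v w =
          S (drop k w, v) * T (v, rev (take k w))" if "length v = l" for v l
          using True that by (simp add: block_def)
        then have "(\<Sum>l\<le>N. \<Sum>v\<in>words l. ?F l v w) =
          (\<Sum>v\<in>I. S (drop k w, v) * T (v, rev (take k w)))"
          unfolding sumI by (intro sum.cong refl) (simp only: mem_Collect_eq)
        then show ?thesis using True by (simp add: block_def)
      next
        case False
        have "?F l v w = 0" if "length v = l" for v l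
          using False that by (auto simp: block_def)
        then have "(\<Sum>l\<le>N. \<Sum>v\<in>words l. ?F l v w) = 0"
          by (intro sum.neutral ballI) (simp only: mem_Collect_eq)
        then show ?thesis using False by (simp add: block_def)
      qed
      ultimately show ?thesis by simp
    qed
    moreover have "(\<lambda>(i, j). \<Sum>k\<in>I. S (i, k) * T (k, j)) a = 0" if "a \<notin> I \<times> I" for a
      using that S T by (cases a) (auto simp: M_def)
    ultimately show ?thesis by (auto simp: M_def)
  qed
qed

section \<open>The functional and its positivity\<close>

definition hword :: "('n \<times> 'n) list \<Rightarrow> complex" where
  "hword ps = kern (length ps) (map fst ps) (map snd ps)"

text \<open>The functional ignores stars, as the generators are self-adjoint in the quotients considered.\<close>

definition haar :: "('n \<times> 'n) free_star \<Rightarrow> complex" where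
  "haar a = (\<Sum>w\<in>Poly_Mapping.keys a. Poly_Mapping.lookup a w * hword (map fst (letters w)))"

lemma haar_superset:
  assumes "finite S" "Poly_Mapping.keys a \<subseteq> S"
  shows "haar a = (\<Sum>w\<in>S. Poly_Mapping.lookup a w * hword (map fst (letters w)))"
  unfolding haar_def using assms by (intro sum.mono_neutral_left) (auto simp: in_keys_iff)

lemma haar_add: "haar (a + b) = haar a + haar b"
  using haar_superset[of "Poly_Mapping.keys a \<union> Poly_Mapping.keys b"] Poly_Mapping.keys_add[of a b]
  by (simp add: lookup_add distrib_right sum.distrib)

lemma haar_single: "haar (Poly_Mapping.single w c) = c * hword (map fst (letters w))"
  by (subst haar_superset[of "{w}"]) auto

lemma haar_diff: "haar (a - b) = haar a - haar b"
  using haar_add[of "a - b" b] by simp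

lemma haar_zero [simp]: "haar 0 = 0"
  by (simp add: haar_def)

lemma haar_sum: "haar (\<Sum>i\<in>S. f i) = (\<Sum>i\<in>S. haar (f i))"
  by (induction S rule: infinite_finite_induct) (auto simp: haar_add)

lemma haar_fscale: "haar (fscale c a) = c * haar a"
  by (induction a rule: free_star_induct)
    (simp_all add: fscale_simps haar_add haar_single distrib_left, simp add: fscale_def mult_single haar_single)

text \<open>\<open>V m\<close> is closed under conjugation, so the conjugate of its kernel is a
  kernel as well, and uniqueness makes the entries real. With \<open>kern_rev\<close>, proved in the
  same way, this gives \<open>haar_fstar\<close>.\<close>

lemma kern_cnj:
  fixes i j :: "'n list"
  assumes ij: "length i = m" "length j = m"
  shows "cnj (kern m i j) = kern m i j"
proof -
  have "rkernel (words m) (V m) (\<lambda>i j. cnj (kern m i j))"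
    unfolding rkernel_def
  proof (intro conjI ballI)
    fix f and i :: "'n list" assume f: "f \<in> V m" and i: "i \<in> words m"
    show "(\<Sum>j\<in>words m. cnj (kern m i j) * f j) = f i"
      using arg_cong[OF rkernel_rep[OF rkernel_kern V_cnj[OF f] i], of cnj] by simp
  qed (auto simp: rkernel_herm[OF rkernel_kern] intro!: V_cnj rkernel_col[OF rkernel_kern])
  from rkernel_unique[OF this rkernel_kern] show ?thesis using ij by simp
qed

lemma kern_rev:
  fixes i j :: "'n list"
  assumes ij: "length i = m" "length j = m"
  shows "kern m (rev i) (rev j) = kern m i j"
proof -
  have "rkernel (words m) (V m) (\<lambda>i j. kern m (rev i) (rev j))"
    unfolding rkernel_def
  proof (intro conjI ballI)
    fix f and i :: "'n list" assume f: "f \<in> V m" and i: "i \<in> words m"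
    have "(\<Sum>j\<in>words m. kern m (rev i) (rev j) * f j) = (\<Sum>j\<in>words m. kern m (rev i) j * f (rev j))"
      by (rule sum.reindex_bij_witness[of _ rev rev]) auto
    also have "\<dots> = f i" using rkernel_rep[OF rkernel_kern V_rev[OF f], of "rev i"] i by simp
    finally show "(\<Sum>j\<in>words m. kern m (rev i) (rev j) * f j) = f i" .
  next
    fix j :: "'n list" assume "j \<in> words m"
    then show "(\<lambda>i. kern m (rev i) (rev j)) \<in> V m"
      using V_rev[OF rkernel_col[OF rkernel_kern, of "rev j" m]] by simp
  qed (auto simp: rkernel_herm[OF rkernel_kern])
  from rkernel_unique[OF this rkernel_kern] show ?thesis using ij by simp
qed

lemma haar_fstar: "haar (fstar a) = cnj (haar a)"
proof (induction a rule: free_star_induct)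
  case (single w c)
  have "hword (map fst (letters (word_star w))) = cnj (hword (map fst (letters w)))"
    by (simp add: hword_def word_star_def rev_map o_def case_prod_unfold kern_cnj kern_rev flip: rev_map)
  then show ?case by (simp add: fstar_single haar_single)
qed (simp add: fstar_add haar_add)

lemma haar_one: "haar 1 = 1"
proof -
  have "kern 0 [] [] = (\<Sum>j\<in>words 0. kern 0 [] j * (if j = [] then 1 else 0))" by simp
  also have "\<dots> = 1" using rkernel_rep[OF rkernel_kern V_unit, of "[]"] by simp
  finally have "hword (map fst (letters 0)) = 1" by (simp add: zero_star_word_def hword_def)
  then show ?thesis using haar_single[of 0 1] by simp
qed

lemma poly_mapping_sum_single: "a = (\<Sum>w\<in>Poly_Mapping.keys a. Poly_Mapping.single w (Poly_Mapping.lookup a w))"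
  by (rule poly_mapping_eqI) (simp add: lookup_sum lookup_single when_def in_keys_iff)

text \<open>If \<open>v\<close> has row and column words \<open>i\<close>, \<open>j\<close> and
  \<open>w\<close> has \<open>i'\<close>, \<open>j'\<close>, then \<open>word_star v + w\<close> has
  \<open>rev i @ i'\<close> and \<open>rev j @ j'\<close>, the words at which \<open>block\<close>
  stores the entries \<open>(i', i)\<close> and \<open>(j', j)\<close>. So the value is the form of
  \<open>block_kernel_nonneg\<close>.\<close>

lemma haar_nonneg: "0 \<le> Re (haar (fstar a * a))"
proof -
  define S where "S = Poly_Mapping.keys a"
  define c where "c = Poly_Mapping.lookup a"
  define \<pi> where "\<pi> w = (map (fst \<circ> fst) (letters w), map (snd \<circ> fst) (letters w))"
    for w :: "('n \<times> 'n) star_word"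
  define N where "N = Max (insert 0 ((\<lambda>w. length (letters w)) ` S))"
  define I :: "'n list set" where "I = {w. length w \<le> N}"
  have finS: "finite S" by (simp add: S_def)
  have len: "length (letters w) \<le> N" if "w \<in> S" for w
    unfolding N_def using that finS by (intro Max_ge) auto
  have finI: "finite I"
    unfolding I_def using finite_lists_length_le[of "UNIV :: 'n set" N] by simp
  define K where "K a b = (if a \<in> I \<times> I \<and> b \<in> I \<times> I \<and> length (fst a) = length (fst b) \<and> length (snd a) = length (snd b)
    then kern (length (snd a) + length (fst a)) (rev (snd a) @ fst a) (rev (snd b) @ fst b) else 0)" for a b
  \<comment> \<open>Words that differ only in their stars have equal row and column words, so their
    coefficients are added up.\<close>
  define X where "X a = (\<Sum>v\<in>{v\<in>S. \<pi> v = a}. c v)" for a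
  have \<pi>: "\<pi> ` S \<subseteq> I \<times> I" using len by (auto simp: \<pi>_def I_def)
  have "haar (fstar a * a) = (\<Sum>v\<in>S. \<Sum>w\<in>S. cnj (c v) * c w * K (fst (\<pi> w), fst (\<pi> v)) (snd (\<pi> w), snd (\<pi> v)))"
  proof -
    have "haar (fstar a * a) = haar ((\<Sum>v\<in>S. Poly_Mapping.single (word_star v) (cnj (c v))) * (\<Sum>w\<in>S. Poly_Mapping.single w (c w)))"
      using poly_mapping_sum_single[of a] by (simp add: fstar_def S_def c_def)
    also have "\<dots> = (\<Sum>v\<in>S. \<Sum>w\<in>S. cnj (c v) * c w * hword (map fst (letters (word_star v + w))))"
      by (simp add: sum_product haar_sum mult_single haar_single)
    also have "\<dots> = (\<Sum>v\<in>S. \<Sum>w\<in>S. cnj (c v) * c w * K (fst (\<pi> w), fst (\<pi> v)) (snd (\<pi> w), snd (\<pi> v)))"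
    proof (intro sum.cong refl arg_cong2[where f = "(*)"])
      fix v w assume "v \<in> S" "w \<in> S"
      then show "hword (map fst (letters (word_star v + w))) = K (fst (\<pi> w), fst (\<pi> v)) (snd (\<pi> w), snd (\<pi> v))"
        using len by (simp add: hword_def K_def \<pi>_def I_def word_star_def plus_star_word_def rev_map o_def case_prod_unfold)
    qed
    finally show ?thesis .
  qed
  also have "\<dots> = (\<Sum>a\<in>I \<times> I. \<Sum>b\<in>I \<times> I. cnj (X a) * X b * K (fst b, fst a) (snd b, snd a))"
  proof -
    have fin2: "finite (I \<times> I)" using finI by simp
    have g: "(\<Sum>v\<in>S. F v) = (\<Sum>a\<in>I \<times> I. \<Sum>v\<in>{v\<in>S. \<pi> v = a}. F v)" for F :: "_ \<Rightarrow> complex"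
      using sum.group[OF finS fin2 \<pi>, of F] by simp
    have "(\<Sum>v\<in>S. \<Sum>w\<in>S. cnj (c v) * c w * K (fst (\<pi> w), fst (\<pi> v)) (snd (\<pi> w), snd (\<pi> v))) =
      (\<Sum>a\<in>I \<times> I. \<Sum>v\<in>{v\<in>S. \<pi> v = a}. \<Sum>b\<in>I \<times> I. \<Sum>w\<in>{w\<in>S. \<pi> w = b}.
        cnj (c v) * c w * K (fst b, fst a) (snd b, snd a))"
      by (subst g, subst g) simp
    also have "\<dots> = (\<Sum>a\<in>I \<times> I. \<Sum>b\<in>I \<times> I. \<Sum>v\<in>{v\<in>S. \<pi> v = a}. \<Sum>w\<in>{w\<in>S. \<pi> w = b}.
        cnj (c v) * c w * K (fst b, fst a) (snd b, snd a))"
      by (intro sum.cong refl sum.swap)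
    also have "\<dots> = (\<Sum>a\<in>I \<times> I. \<Sum>b\<in>I \<times> I. cnj (X a) * X b * K (fst b, fst a) (snd b, snd a))"
    proof -
      have "cnj (X a) * X b = (\<Sum>v\<in>{v\<in>S. \<pi> v = a}. \<Sum>w\<in>{w\<in>S. \<pi> w = b}. cnj (c v) * c w)" for a b
        by (simp only: X_def cnj_sum sum_product)
      then show ?thesis by (simp only: sum_distrib_right)
    qed
    finally show ?thesis .
  qed
  finally show ?thesis using block_kernel_nonneg[of X N] unfolding K_def I_def by simp
qed

end

section \<open>The C*-seminorm of a positive functional\<close>

locale positive_functional =
  fixes h :: "'g free_star \<Rightarrow> complex"
  assumes h_add: "h (a + b) = h a + h b"
    and h_fscale: "h (fscale c a) = c * h a"
    and h_fstar: "h (fstar a) = cnj (h a)"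
    and h_nonneg: "0 \<le> Re (h (fstar a * a))"
    and h_one: "h 1 = 1"
begin

definition nrm :: "'g free_star \<Rightarrow> real" where "nrm a = sqrt (Re (h (fstar a * a)))"

lemma nrm_nonneg: "0 \<le> nrm a"
  by (simp add: nrm_def h_nonneg)

lemma nrm_sq: "(nrm a)\<^sup>2 = Re (h (fstar a * a))"
  by (simp add: nrm_def h_nonneg)

lemma nrm_zero [simp]: "nrm 0 = 0"
  using h_fscale[of 0 0] by (simp add: nrm_def fscale_def)

lemma nrm_one: "nrm 1 = 1"
  by (simp add: nrm_def h_one)

lemma nrm_sq_add: "(nrm (a + b))\<^sup>2 = (nrm a)\<^sup>2 + 2 * Re (h (fstar a * b)) + (nrm b)\<^sup>2"
proof -
  have "h (fstar b * a) = cnj (h (fstar a * b))"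
    using h_fstar[of "fstar a * b"] by (simp add: fstar_mult)
  then show ?thesis by (simp add: nrm_sq fstar_add algebra_simps h_add)
qed

lemma nrm_fscale: "nrm (fscale c a) = cmod c * nrm a"
proof -
  have cc: "complex_of_real ((cmod c)\<^sup>2) = cnj c * c" by (simp only: complex_norm_square mult.commute)
  have "h (fstar (fscale c a) * fscale c a) = complex_of_real ((cmod c)\<^sup>2) * h (fstar a * a)"
    unfolding cc by (simp add: fstar_fscale fscale_simps h_fscale)
  then show ?thesis by (simp add: nrm_def real_sqrt_mult)
qed

lemma cauchy_schwarz: "cmod (h (fstar a * b)) \<le> nrm a * nrm b"
proof -
  define z where "z = h (fstar a * b)"
  \<comment> \<open>Expands the squared norm of \<open>a\<close> minus \<open>s * cnj z\<close>
    times \<open>b\<close>. If \<open>b\<close> has norm 0, a suitable \<open>s\<close> gives the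
    value -1 unless \<open>z = 0\<close>; otherwise \<open>s\<close> is taken at the
    minimum.\<close>
  have key: "0 \<le> (nrm a)\<^sup>2 - 2 * s * (cmod z)\<^sup>2 + s\<^sup>2 * (cmod z)\<^sup>2 * (nrm b)\<^sup>2" for s :: real
  proof -
    define t where "t = - (of_real s * cnj z)"
    have "0 \<le> (nrm (a + fscale t b))\<^sup>2" by simp
    also have "\<dots> = (nrm a)\<^sup>2 + 2 * Re (t * z) + (cmod t * nrm b)\<^sup>2"
      by (simp only: nrm_sq_add nrm_fscale fscale_simps h_fscale z_def)
    also have "t * z = - of_real (s * (cmod z)\<^sup>2)"
      unfolding t_def of_real_mult complex_norm_square by (simp add: mult_ac)
    finally show ?thesis by (simp add: t_def norm_mult power_mult_distrib del: of_real_mult)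
  qed
  show ?thesis
  proof (cases "nrm b = 0")
    case True
    have "z = 0"
    proof (rule ccontr)
      assume "z \<noteq> 0"
      then have z: "(cmod z)\<^sup>2 > 0" by simp
      show False using key[of "((nrm a)\<^sup>2 + 1) / (2 * (cmod z)\<^sup>2)"] z True by simp
    qed
    then show ?thesis using True by (simp add: z_def)
  next
    case False
    then have b: "(nrm b)\<^sup>2 > 0" by simp
    have eq: "A - 2 * (1 / B) * Z + (1 / B)\<^sup>2 * Z * B = A - Z / B" if "B > 0" for A B Z :: real
      using that by (simp add: power2_eq_square field_simps)
    have "0 \<le> (nrm a)\<^sup>2 - (cmod z)\<^sup>2 / (nrm b)\<^sup>2"
      using key[of "1 / (nrm b)\<^sup>2"] unfolding eq[OF b] .
    then have "(cmod z)\<^sup>2 \<le> (nrm a * nrm b)\<^sup>2" using b by (simp add: power_mult_distrib field_simps)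
    then show ?thesis using nrm_nonneg by (simp add: z_def abs_le_square_iff[symmetric])
  qed
qed

lemma nrm_triangle: "nrm (a + b) \<le> nrm a + nrm b"
proof -
  have "(nrm (a + b))\<^sup>2 \<le> (nrm a + nrm b)\<^sup>2"
    using cauchy_schwarz[of a b] complex_Re_le_cmod[of "h (fstar a * b)"]
    by (simp add: nrm_sq_add power2_sum)
  then show ?thesis using nrm_nonneg by (simp add: abs_le_square_iff[symmetric])
qed

lemma nrm_bounded_induct:
  assumes gen: "\<And>g b c. nrm (Poly_Mapping.single (Word [(g, c)]) 1 * b) \<le> nrm b"
  shows "\<exists>C\<ge>0. \<forall>b. nrm (a * b) \<le> C * nrm b"
proof (induction a rule: free_star_induct)
  case (single w c)
  have word: "nrm (Poly_Mapping.single (Word ws) 1 * b) \<le> nrm b" for ws b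
  proof (induction ws)
    case Nil
    show ?case by (simp flip: zero_star_word_def)
  next
    case (Cons l ws)
    have "Poly_Mapping.single (Word (l # ws)) (1::complex) =
        Poly_Mapping.single (Word [l]) 1 * Poly_Mapping.single (Word ws) 1"
      by (simp add: mult_single plus_star_word_def)
    then have "nrm (Poly_Mapping.single (Word (l # ws)) 1 * b) \<le> nrm (Poly_Mapping.single (Word ws) 1 * b)"
      using gen[of "fst l" "snd l"] by (simp add: mult.assoc)
    then show ?case using Cons by simp
  qed
  have "Poly_Mapping.single w c * b = fscale c (Poly_Mapping.single w 1 * b)" for b
    by (simp add: fscale_def mult_single flip: mult.assoc)
  then have "nrm (Poly_Mapping.single w c * b) \<le> cmod c * nrm b" for b
    using word[of "letters w" b] by (simp add: nrm_fscale mult_left_mono)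
  then show ?case by (intro exI[of _ "cmod c"]) auto
next
  case (add a b)
  then obtain C D where "C \<ge> 0" "D \<ge> 0" and C: "\<And>x. nrm (a * x) \<le> C * nrm x" and D: "\<And>x. nrm (b * x) \<le> D * nrm x"
    by blast
  have "nrm ((a + b) * x) \<le> (C + D) * nrm x" for x
    using nrm_triangle[of "a * x" "b * x"] C[of x] D[of x] by (simp add: distrib_right)
  then show ?case using \<open>C \<ge> 0\<close> \<open>D \<ge> 0\<close> by (intro exI[of _ "C + D"]) auto
qed

definition gns :: "'g free_star \<Rightarrow> real" where
  "gns a = (SUP b\<in>{b. nrm b \<le> 1}. nrm (a * b))"

text \<open>The squared norm of \<open>a * b\<close> is the real part of \<open>h\<close> at
  \<open>fstar b * fstar a * a * b\<close>, an element of the two-sided ideal generated by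
  \<open>a\<close>; so relations killed by \<open>h\<close> hold in the representation.\<close>

lemma gns_null:
  assumes "\<And>x y. h (x * a * y) = 0"
  shows "gns a = 0"
proof -
  have "nrm (a * b) = 0" for b
    using assms[of "fstar b * fstar a" b] by (simp add: nrm_def fstar_mult mult.assoc)
  moreover have "{b. nrm b \<le> 1} \<noteq> {}" using nrm_zero by (metis empty_iff mem_Collect_eq zero_le_one)
  ultimately show ?thesis by (simp add: gns_def)
qed

end

locale bounded_functional = positive_functional +
  assumes bounded: "\<exists>C\<ge>0. \<forall>b. nrm (a * b) \<le> C * nrm b"
begin

lemma gns_upper:
  assumes "nrm b \<le> 1"
  shows "nrm (a * b) \<le> gns a"
proof -
  obtain C where C: "C \<ge> 0" "\<And>b. nrm (a * b) \<le> C * nrm b" using bounded by blast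
  have "nrm (a * b) \<le> C" if "nrm b \<le> 1" for b
    using C(2)[of b] mult_left_mono[OF that C(1)] by simp
  then show ?thesis unfolding gns_def using assms by (intro cSUP_upper bdd_aboveI[of _ C]) auto
qed

lemma gns_nonneg: "0 \<le> gns a"
  using gns_upper[of 0 a] by simp

lemma nrm_mult_le: "nrm (a * b) \<le> gns a * nrm b"
proof (cases "nrm b = 0")
  case True
  then show ?thesis using bounded[of a] nrm_nonneg[of "a * b"] by (metis mult_zero_right)
next
  case False
  then have b: "nrm b > 0" using nrm_nonneg[of b] by linarith
  have "nrm (a * fscale (1 / nrm b) b) \<le> gns a"
    using b by (intro gns_upper) (simp add: nrm_fscale norm_divide)
  then show ?thesis using b by (simp add: fscale_simps nrm_fscale norm_divide field_simps)
qed

lemma gns_least: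
  assumes "C \<ge> 0" "\<And>b. nrm (a * b) \<le> C * nrm b"
  shows "gns a \<le> C"
  unfolding gns_def
proof (rule cSUP_least)
  show "{b. nrm b \<le> 1} \<noteq> {}" using nrm_zero by (metis empty_iff mem_Collect_eq zero_le_one)
  show "nrm (a * b) \<le> C" if "b \<in> {b. nrm b \<le> 1}" for b
    using assms(2)[of b] mult_left_mono[of "nrm b" 1 C] that assms(1) by simp
qed

text \<open>With \<open>c = fstar a * b\<close>, the Cauchy-Schwarz inequality bounds the squared
  norm of \<open>c\<close> by \<open>nrm b * nrm (a * c)\<close>; one factor \<open>nrm c\<close>
  cancels.\<close>

lemma gns_fstar_le: "gns (fstar a) \<le> gns a"
proof (rule gns_least[OF gns_nonneg])
  fix b
  let ?c = "fstar a * b"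
  have "(nrm ?c)\<^sup>2 = Re (h (fstar b * (a * ?c)))" by (simp add: nrm_sq fstar_mult mult.assoc)
  also have "\<dots> \<le> nrm b * nrm (a * ?c)"
    using cauchy_schwarz[of b "a * ?c"] complex_Re_le_cmod[of "h (fstar b * (a * ?c))"] by linarith
  also have "\<dots> \<le> nrm b * (gns a * nrm ?c)" by (intro mult_left_mono nrm_mult_le nrm_nonneg)
  finally have "nrm ?c * nrm ?c \<le> (gns a * nrm b) * nrm ?c" by (simp add: power2_eq_square mult_ac)
  then show "nrm ?c \<le> gns a * nrm b"
    using nrm_nonneg[of ?c] nrm_nonneg[of b] gns_nonneg[of a] by (cases "nrm ?c = 0") auto
qed

lemma gns_mult: "gns (a * b) \<le> gns a * gns b"
proof (rule gns_least)
  fix x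
  have "nrm (a * (b * x)) \<le> gns a * nrm (b * x)" by (rule nrm_mult_le)
  also have "\<dots> \<le> gns a * (gns b * nrm x)" by (intro mult_left_mono nrm_mult_le gns_nonneg)
  finally show "nrm (a * b * x) \<le> gns a * gns b * nrm x" by (simp add: mult.assoc)
qed (simp add: gns_nonneg)

lemma gns_fscale_le: "gns (fscale c a) \<le> cmod c * gns a"
  using nrm_mult_le[of a]
  by (intro gns_least) (auto simp: gns_nonneg fscale_simps nrm_fscale mult.assoc intro!: mult_left_mono)

lemma cstar_seminorm_gns: "cstar_seminorm gns"
  unfolding cstar_seminorm_def
proof (intro conjI allI)
  fix a b c
  show "gns (a + b) \<le> gns a + gns b"
  proof (rule gns_least)
    fix x
    show "nrm ((a + b) * x) \<le> (gns a + gns b) * nrm x"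
      using nrm_triangle[of "a * x" "b * x"] nrm_mult_le[of a x] nrm_mult_le[of b x]
      by (simp add: distrib_right)
  qed (simp add: gns_nonneg)
  show "gns (fscale c a) = cmod c * gns a"
  proof (cases "c = 0")
    case True
    then show ?thesis using gns_fscale_le[of 0 a] gns_nonneg[of "fscale 0 a"] by simp
  next
    case False
    have "gns a \<le> cmod (1 / c) * gns (fscale c a)"
      using gns_fscale_le[of "1 / c" "fscale c a"] False by (simp add: fscale_simps)
    then have "cmod c * gns a \<le> gns (fscale c a)" using False by (simp add: norm_divide field_simps)
    then show ?thesis using gns_fscale_le[of c a] by simp
  qed
  show "gns (a * b) \<le> gns a * gns b" by (rule gns_mult)
  show "gns (fstar a * a) = (gns a)\<^sup>2"
  proof (rule antisym)
    have "gns (fstar a * a) \<le> gns (fstar a) * gns a" by (rule gns_mult)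
    also have "\<dots> \<le> gns a * gns a" by (intro mult_right_mono gns_fstar_le gns_nonneg)
    finally show "gns (fstar a * a) \<le> (gns a)\<^sup>2" by (simp add: power2_eq_square)
    \<comment> \<open>The half of the C*-identity that is special to operator norms: the squared
      norm of \<open>a * b\<close> is the inner product of \<open>b\<close> with
      \<open>fstar a * a * b\<close>.\<close>
    have "gns a \<le> sqrt (gns (fstar a * a))"
    proof (rule gns_least)
      fix b
      have "(nrm (a * b))\<^sup>2 = Re (h (fstar b * (fstar a * a * b)))"
        by (simp add: nrm_sq fstar_mult mult.assoc)
      also have "\<dots> \<le> nrm b * nrm (fstar a * a * b)"
        using cauchy_schwarz[of b "fstar a * a * b"] complex_Re_le_cmod[of "h (fstar b * (fstar a * a * b))"]
        by linarith
      also have "\<dots> \<le> nrm b * (gns (fstar a * a) * nrm b)" by (intro mult_left_mono nrm_mult_le nrm_nonneg)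
      also have "\<dots> = (sqrt (gns (fstar a * a)) * nrm b)\<^sup>2"
        using gns_nonneg by (simp add: power_mult_distrib power2_eq_square)
      finally show "nrm (a * b) \<le> sqrt (gns (fstar a * a)) * nrm b"
        using power2_le_imp_le gns_nonneg nrm_nonneg by (meson mult_nonneg_nonneg real_sqrt_ge_zero)
    qed (simp add: gns_nonneg)
    then have "(gns a)\<^sup>2 \<le> (sqrt (gns (fstar a * a)))\<^sup>2" using gns_nonneg by (intro power_mono) auto
    then show "(gns a)\<^sup>2 \<le> gns (fstar a * a)" using gns_nonneg by simp
  qed
qed

text \<open>\<open>h\<close> is the vector state of the unit: \<open>h a\<close> is the inner
  product of \<open>1\<close> with \<open>a * 1\<close>, and \<open>nrm 1 = 1\<close>.\<close>

lemma cmod_le_gns: "cmod (h a) \<le> gns a"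
  using cauchy_schwarz[of 1 a] nrm_mult_le[of a 1] by (simp add: nrm_one)

end

section \<open>The relations of the three species modulo a C*-seminorm\<close>

definition ortho_rel :: "(('n::finite \<times> 'n) free_star \<Rightarrow> ('n \<times> 'n) free_star \<Rightarrow> bool) \<Rightarrow> bool" where
  "ortho_rel E \<longleftrightarrow>
     (\<forall>i j. E (\<Sum>k\<in>UNIV. fgen (i, k) * fstar (fgen (j, k))) (if i = j then 1 else 0)) \<and>
     (\<forall>i j. E (\<Sum>k\<in>UNIV. fstar (fgen (k, i)) * fgen (k, j)) (if i = j then 1 else 0)) \<and>
     (\<forall>i j. E (fstar (fgen (i, j))) (fgen (i, j)))"

fun gen_rel :: "species \<Rightarrow> (('n::finite \<times> 'n) free_star \<Rightarrow> ('n \<times> 'n) free_star \<Rightarrow> bool) \<Rightarrow> bool" where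
  "gen_rel Ortho E \<longleftrightarrow> ortho_rel E"
| "gen_rel Cubic E \<longleftrightarrow> ortho_rel E \<and>
     (\<forall>i j k. j \<noteq> k \<longrightarrow> E (fgen (i, j) * fgen (i, k)) 0 \<and> E (fgen (j, i) * fgen (k, i)) 0)"
| "gen_rel Magic E \<longleftrightarrow>
     (\<forall>i j. E (fstar (fgen (i, j))) (fgen (i, j)) \<and> E (fgen (i, j) * fgen (i, j)) (fgen (i, j))) \<and>
     (\<forall>i j k. j \<noteq> k \<longrightarrow> E (fgen (i, j) * fgen (i, k)) 0 \<and> E (fgen (j, i) * fgen (k, i)) 0) \<and>
     (\<forall>i. E (\<Sum>j\<in>UNIV. fgen (i, j)) 1 \<and> E (\<Sum>j\<in>UNIV. fgen (j, i)) 1)"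

text \<open>All elements in the relations are classes of constant sequences, and two such classes
  agree exactly when the seminorm of the difference vanishes. So the relations can be checked in the
  free *-algebra.\<close>

lemma is_matrix_completion_iff:
  fixes p :: "('n::finite \<times> 'n) free_star \<Rightarrow> real"
  assumes "cstar_seminorm p"
  shows "is_matrix x (completion p) (completion_gen p) \<longleftrightarrow> gen_rel x (\<lambda>a b. p (a - b) = 0)"
proof -
  interpret seminorm_cstar p using assms by unfold_locales
  have fs: "(\<Oplus>\<^bsub>C\<^esub>k\<in>UNIV. seq_class p (\<lambda>m. f k)) = seq_class p (\<lambda>m. \<Sum>k\<in>UNIV. f k)" for f :: "'n \<Rightarrow> ('n \<times> 'n) free_star"
    using finsum_class[of UNIV "\<lambda>k m. f k"] by simp
  have r: "range (completion_gen p) \<subseteq> carrier C" by (auto simp: gen_class carrierI)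
  have ifs: "(if P then seq_class p (\<lambda>m. a) else seq_class p (\<lambda>m. b)) = seq_class p (\<lambda>m. if P then a else b)" for P a b
    by simp
  note simps = gen_class adj_class mult_class zero_class one_class fs ifs const_eq_iff carrierI
  have o: "orthogonal_matrix C (completion_gen p) \<longleftrightarrow> ortho_rel (\<lambda>a b. p (a - b) = 0)"
    using r by (simp add: ortho_rel_def orthogonal_matrix_def unitary_matrix_def simps)
  show ?thesis
  proof (cases x)
    case Ortho
    then show ?thesis using o by simp
  next
    case Cubic
    then show ?thesis unfolding Cubic is_matrix.simps cubic_matrix_def o gen_rel.simps(2)
      by (simp add: simps)
  next
    case Magic
    then show ?thesis by (auto simp: magic_matrix_def projection_def simps)
  qed
qed

text \<open>The stars stay parameters because \<open>haar\<close> ignores them: one computation then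
  covers all ways of placing stars on two generators.\<close>

definition gen2 :: "'n \<times> 'n \<Rightarrow> bool \<Rightarrow> 'n \<times> 'n \<Rightarrow> bool \<Rightarrow> ('n \<times> 'n) free_star" where
  "gen2 g b g' b' = Poly_Mapping.single (Word [(g, b), (g', b')]) 1"

definition fword :: "'n list \<Rightarrow> 'n list \<Rightarrow> ('n \<times> 'n) free_star" where
  "fword i j = Poly_Mapping.single (Word (map (\<lambda>g. (g, False)) (zip i j))) 1"

section \<open>The orthogonal relations under the Haar functional\<close>

context fixed_spaces begin

lemma kern_sym: "length i = m \<Longrightarrow> length j = m \<Longrightarrow> kern m i j = kern m j i"
  using kern_cnj[of j m i] rkernel_herm[OF rkernel_kern, of j m i] by simp

text \<open>Both sides are the inner product of column \<open>a\<close> of \<open>kern m'\<close>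
  with the image of column \<open>i\<close> of \<open>kern m\<close>, evaluated by the reproducing
  property in one factor or the other. It is \<open>rkernel_natural\<close> for maps not given by
  matrices.\<close>

lemma kern_adjoint:
  assumes B: "\<And>f. f \<in> V m \<Longrightarrow> B f \<in> V m'" and B': "\<And>g. g \<in> V m' \<Longrightarrow> B' g \<in> V m"
    and adj: "\<And>f g. (\<Sum>a\<in>words m'. cnj (g a) * B f a) = (\<Sum>i\<in>words m. cnj (B' g i) * f i)"
    and i: "length i = m" and a: "length a = m'"
  shows "cnj (B' (\<lambda>w. kern m' w a) i) = B (\<lambda>w. kern m w i) a"
proof -
  let ?f = "\<lambda>w. kern m w i" and ?g = "\<lambda>w. kern m' w a"
  have f: "?f \<in> V m" and g: "?g \<in> V m'"
    using rkernel_col[OF rkernel_kern] i a by auto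
  have "B ?f a = (\<Sum>b\<in>words m'. kern m' a b * B ?f b)"
    using rkernel_rep[OF rkernel_kern B[OF f]] a by simp
  also have "\<dots> = (\<Sum>b\<in>words m'. cnj (?g b) * B ?f b)"
    using a by (intro sum.cong refl) (simp add: rkernel_herm[OF rkernel_kern])
  also have "\<dots> = (\<Sum>j\<in>words m. cnj (B' ?g j) * ?f j)" by (rule adj)
  also have "\<dots> = cnj (\<Sum>j\<in>words m. kern m i j * B' ?g j)"
    unfolding cnj_sum using i by (intro sum.cong refl) (simp add: rkernel_herm[OF rkernel_kern])
  also have "\<dots> = cnj (B' ?g i)"
    using rkernel_rep[OF rkernel_kern B'[OF g]] i by simp
  finally show ?thesis by simp
qed

text \<open>Adjointness of \<open>cup_at\<close> and \<open>cap_at\<close> in matrix form: inside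
  any product, \<open>h\<close> respects the relation that the columns of \<open>u\<close> are
  orthonormal.\<close>

lemma kern_cap:
  assumes "length v = l" "length w = m" "length v' = l" "length w' = m"
  shows "(\<Sum>k\<in>UNIV. kern (l + 2 + m) (v @ [k, k] @ w) (v' @ [i, j] @ w')) =
    (if i = j then kern (l + m) (v @ w) (v' @ w') else 0)"
proof -
  have "cnj (cap_at l (\<lambda>u. kern (l + 2 + m) u (v' @ [i, j] @ w')) (v @ w)) =
      cup_at l (\<lambda>u. kern (l + m) u (v @ w)) (v' @ [i, j] @ w')"
  proof (rule kern_adjoint[OF V_cup V_cap])
    fix f g :: "'n list \<Rightarrow> complex"
    have "(\<Sum>a\<in>words (l + 2 + m). cnj (g a) * cup_at l f a) =
        (\<Sum>v\<in>words l. \<Sum>w\<in>words m. \<Sum>k\<in>UNIV. cnj (g (v @ [k, k] @ w)) * f (v @ w))"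
    proof -
      have "(\<Sum>a\<in>words (l + 2 + m). cnj (g a) * cup_at l f a) =
          (\<Sum>v\<in>words l. \<Sum>x\<in>UNIV. \<Sum>y\<in>UNIV. \<Sum>w\<in>words m. cnj (g (v @ [x, y] @ w)) * cup_at l f (v @ [x, y] @ w))"
        by (simp only: sum_words_append sum_words_2 append_assoc)
      also have "\<dots> = (\<Sum>v\<in>words l. \<Sum>x\<in>UNIV. \<Sum>y\<in>UNIV. if x = y then \<Sum>w\<in>words m. cnj (g (v @ [x, x] @ w)) * f (v @ w) else 0)"
        by (intro sum.cong refl) (simp only: mem_Collect_eq cup_at_append, simp)
      also have "\<dots> = (\<Sum>v\<in>words l. \<Sum>x\<in>UNIV. \<Sum>w\<in>words m. cnj (g (v @ [x, x] @ w)) * f (v @ w))"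
        by (simp add: sum.delta')
      also have "\<dots> = (\<Sum>v\<in>words l. \<Sum>w\<in>words m. \<Sum>k\<in>UNIV. cnj (g (v @ [k, k] @ w)) * f (v @ w))"
        by (intro sum.cong refl sum.swap)
      finally show ?thesis .
    qed
    moreover have "(\<Sum>i\<in>words (l + m). cnj (cap_at l g i) * f i) =
        (\<Sum>v\<in>words l. \<Sum>w\<in>words m. \<Sum>k\<in>UNIV. cnj (g (v @ [k, k] @ w)) * f (v @ w))"
      by (simp add: sum_words_append cap_at_append sum_distrib_right)
    ultimately show "(\<Sum>a\<in>words (l + 2 + m). cnj (g a) * cup_at l f a) =
        (\<Sum>i\<in>words (l + m). cnj (cap_at l g i) * f i)" by simp
  qed (use assms in auto)
  then show ?thesis
    using assms kern_cnj[of "v @ [k, k] @ w" "l + 2 + m" "v' @ [i, j] @ w'" for k] kern_sym[of "v @ w" "l + m" "v' @ w'"]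
    by (simp only: cap_at_append cup_at_append) simp
qed

text \<open>The second identity is the first one for rows in place of columns; they are exchanged by
  the symmetry of \<open>kern\<close>.\<close>

lemma hword_cap:
  "(\<Sum>k\<in>UNIV. hword (p @ [(k, i), (k, j)] @ q)) = (if i = j then hword (p @ q) else 0)"
  "(\<Sum>k\<in>UNIV. hword (p @ [(i, k), (j, k)] @ q)) = (if i = j then hword (p @ q) else 0)"
proof -
  define l where "l = length p"
  define m where "m = length q"
  have L: "length (p @ [x, y] @ q) = l + 2 + m" "length (p @ q) = l + m" for x y by (simp_all add: l_def m_def)
  have len: "length (map fst p) = l" "length (map snd p) = l" "length (map fst q) = m" "length (map snd q) = m"
    by (simp_all add: l_def m_def)
  show "(\<Sum>k\<in>UNIV. hword (p @ [(k, i), (k, j)] @ q)) = (if i = j then hword (p @ q) else 0)"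
    unfolding hword_def L using kern_cap[OF len(1,3) len(2,4), of i j] by simp
  have "kern (l + 2 + m) (map fst p @ [i, j] @ map fst q) (map snd p @ [k, k] @ map snd q) =
      kern (l + 2 + m) (map snd p @ [k, k] @ map snd q) (map fst p @ [i, j] @ map fst q)" for k
    by (rule kern_sym) (simp_all add: l_def m_def)
  moreover have "kern (l + m) (map fst p @ map fst q) (map snd p @ map snd q) =
      kern (l + m) (map snd p @ map snd q) (map fst p @ map fst q)"
    by (rule kern_sym) (simp_all add: l_def m_def)
  ultimately show "(\<Sum>k\<in>UNIV. hword (p @ [(i, k), (j, k)] @ q)) = (if i = j then hword (p @ q) else 0)"
    unfolding hword_def L using kern_cap[OF len(2,4) len(1,3), of i j] by simp
qed

sublocale positive_functional haar
  by unfold_locales (simp_all add: haar_add haar_fscale haar_fstar haar_nonneg haar_one)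

lemma haar_idealI:
  assumes "\<And>v w. haar (Poly_Mapping.single v 1 * a * Poly_Mapping.single w 1) = 0"
  shows "haar (x * a * y) = 0"
proof (induction x rule: free_star_induct)
  case (single v c)
  show ?case
  proof (induction y rule: free_star_induct)
    case (single w d)
    have "Poly_Mapping.single v c * a * Poly_Mapping.single w d =
        fscale c (fscale d (Poly_Mapping.single v 1 * a * Poly_Mapping.single w 1))"
    proof -
      have "Poly_Mapping.single u e = fscale e (Poly_Mapping.single u 1)" for u :: "('n \<times> 'n) star_word" and e
        by (simp add: fscale_def mult_single)
      then have "Poly_Mapping.single v c * a * Poly_Mapping.single w d =
        fscale c (Poly_Mapping.single v 1) * a * fscale d (Poly_Mapping.single w 1)" by metis
      then show ?thesis by (simp add: fscale_simps mult.commute[of d c])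
    qed
    then show ?case using assms by (simp add: haar_fscale)
  qed (simp add: haar_add distrib_left)
qed (simp add: haar_add distrib_right)

lemma haar_words:
  "haar (Poly_Mapping.single v 1 * Poly_Mapping.single (Word ws) 1 * Poly_Mapping.single w 1) =
    hword (map fst (letters v) @ map fst ws @ map fst (letters w))"
  by (simp add: mult_single haar_single plus_star_word_def)

lemma haar_words_one:
  "haar (Poly_Mapping.single v 1 * 1 * Poly_Mapping.single w 1) =
    hword (map fst (letters v) @ map fst (letters w))"
  by (simp add: mult_single haar_single plus_star_word_def)

lemma haar_unitary:
  "haar (x * ((\<Sum>k\<in>UNIV. gen2 (k, i) b (k, j) b') - (if i = j then 1 else 0)) * y) = 0"
  "haar (x * ((\<Sum>k\<in>UNIV. gen2 (i, k) b (j, k) b') - (if i = j then 1 else 0)) * y) = 0"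
proof -
  show "haar (x * ((\<Sum>k\<in>UNIV. gen2 (k, i) b (k, j) b') - (if i = j then 1 else 0)) * y) = 0"
    by (rule haar_idealI) (simp add: gen2_def left_diff_distrib right_diff_distrib sum_distrib_left
        sum_distrib_right haar_diff haar_sum haar_words haar_words_one[simplified] hword_cap[simplified])
  show "haar (x * ((\<Sum>k\<in>UNIV. gen2 (i, k) b (j, k) b') - (if i = j then 1 else 0)) * y) = 0"
    by (rule haar_idealI) (simp add: gen2_def left_diff_distrib right_diff_distrib sum_distrib_left
        sum_distrib_right haar_diff haar_sum haar_words haar_words_one[simplified] hword_cap[simplified])
qed

text \<open>By \<open>haar_unitary\<close> the squared norms of the products
  \<open>u_kj * b\<close>, over all \<open>k\<close>, add up to that of \<open>b\<close>, so every
  generator, starred or not, acts as a contraction.\<close>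

sublocale bounded_functional haar
proof unfold_locales
  fix a
  show "\<exists>C\<ge>0. \<forall>b. nrm (a * b) \<le> C * nrm b"
  proof (rule nrm_bounded_induct)
    fix g :: "'n \<times> 'n" and b c
    obtain i j where g: "g = (i, j)" by (cases g)
    let ?l = "\<lambda>k. Poly_Mapping.single (Word [((k, j), c)]) (1 :: complex)"
    have star: "fstar (?l k) * ?l k = gen2 (k, j) (\<not> c) (k, j) c" for k
      by (simp add: fstar_single word_star_def mult_single plus_star_word_def gen2_def)
    have "(\<Sum>k\<in>UNIV. haar (fstar (?l k * b) * (?l k * b))) = (\<Sum>k\<in>UNIV. haar (fstar b * gen2 (k, j) (\<not> c) (k, j) c * b))"
      by (simp add: fstar_mult mult.assoc star[symmetric])
    also have "\<dots> = haar (fstar b * (\<Sum>k\<in>UNIV. gen2 (k, j) (\<not> c) (k, j) c) * b)"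
      by (simp add: haar_sum sum_distrib_left sum_distrib_right)
    also have "\<dots> = haar (fstar b * b)"
      using haar_unitary(1)[of "fstar b" j "\<not> c" j c b]
      by (simp add: left_diff_distrib right_diff_distrib haar_diff)
    finally have "(\<Sum>k\<in>UNIV. (nrm (?l k * b))\<^sup>2) = (nrm b)\<^sup>2"
      by (simp only: nrm_sq Re_sum[symmetric])
    moreover have "(nrm (?l i * b))\<^sup>2 \<le> (\<Sum>k\<in>UNIV. (nrm (?l k * b))\<^sup>2)"
      by (intro member_le_sum) auto
    ultimately show "nrm (Poly_Mapping.single (Word [(g, c)]) 1 * b) \<le> nrm b"
      using nrm_nonneg by (simp add: g abs_le_square_iff[symmetric])
  qed
qed

lemma gen2_simps:
  "fgen g * fgen g' = gen2 g False g' False" "fgen g * fstar (fgen g') = gen2 g False g' True"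
  "fstar (fgen g) * fgen g' = gen2 g True g' False"
  by (simp_all add: gen2_def fgen_def fstar_single word_star_def mult_single plus_star_word_def)

lemma gns_star: "gns (fstar (fgen g) - fgen g) = 0"
proof (rule gns_null, rule haar_idealI)
  show "haar (Poly_Mapping.single v 1 * (fstar (fgen g) - fgen g) * Poly_Mapping.single w 1) = 0" for v w
    by (simp add: fgen_def fstar_single word_star_def left_diff_distrib right_diff_distrib haar_diff haar_words)
qed

lemma gns_Ortho: "gen_rel Ortho (\<lambda>a b. gns (a - b) = 0)"
  by (auto simp only: gen_rel.simps ortho_rel_def gen2_simps intro!: gns_star gns_null haar_unitary)

lemma admissible_Ortho: "admissible Ortho gns"
  unfolding admissible_def using is_matrix_completion_iff[OF cstar_seminorm_gns] gns_Ortho cstar_seminorm_gns by blast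

lemma fixed_vector_in_V:
  fixes \<xi> :: "'n list \<Rightarrow> complex"
  assumes adm: "admissible x gns" and supp: "\<And>w. length w \<noteq> m \<Longrightarrow> \<xi> w = 0"
    and fixed: "\<And>w. length w = m \<Longrightarrow>
      universal_seminorm (is_matrix x) ((\<Sum>w'\<in>words m. fscale (\<xi> w') (fword w w')) - fscale (\<xi> w) 1) = 0"
  shows "\<xi> \<in> V m"
proof -
  have "\<xi> w = (\<Sum>w'\<in>words m. \<xi> w' * kern m w w')" for w
  proof (cases "length w = m")
    case True
    let ?a = "(\<Sum>w'\<in>words m. fscale (\<xi> w') (fword w w')) - fscale (\<xi> w) 1"
    \<comment> \<open>As \<open>gns\<close> is admissible, it lies below the universal seminorm, and
      \<open>h\<close> is dominated by \<open>gns\<close>; hence \<open>h\<close> vanishes on the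
      defect of the fixed-vector equation.\<close>
    have "cmod (haar ?a) \<le> 0"
      using cmod_le_gns[of ?a] admissible_le[OF adm, of ?a] fixed[OF True] by linarith
    then have "(\<Sum>w'\<in>words m. \<xi> w' * haar (fword w w')) - \<xi> w = 0"
      by (simp add: haar_diff haar_sum haar_fscale haar_one)
    moreover have "haar (fword w w') = kern m w w'" if "length w' = m" for w'
      using that True by (simp add: fword_def haar_single hword_def o_def)
    ultimately show ?thesis by simp
  next
    case False
    then show ?thesis
      using supp V_supp[OF rkernel_col[OF rkernel_kern]] by (simp add: sum.neutral)
  qed
  moreover have "(\<lambda>w. \<Sum>w'\<in>words m. \<xi> w' * kern m w w') \<in> V m"
    by (rule V_lincomb[of "words m" "\<lambda>w' w. kern m w w'" m \<xi>]) (use rkernel_col[OF rkernel_kern] in auto)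
  ultimately show ?thesis by (metis (no_types, lifting) ext)
qed

end

section \<open>The cubic and the magic relations under the Haar functional\<close>

definition join_at :: "nat \<Rightarrow> ('n list \<Rightarrow> complex) \<Rightarrow> 'n list \<Rightarrow> complex" where
  "join_at l f w = (if w ! l = w ! Suc l then f w else 0)"

definition ins_at :: "nat \<Rightarrow> ('n list \<Rightarrow> complex) \<Rightarrow> 'n list \<Rightarrow> complex" where
  "ins_at l f w = (if l < length w then f (take l w @ drop (Suc l) w) else 0)"

definition del_at :: "nat \<Rightarrow> ('n::finite list \<Rightarrow> complex) \<Rightarrow> 'n list \<Rightarrow> complex" where
  "del_at l f w = (\<Sum>k\<in>UNIV. f (take l w @ [k] @ drop l w))"

definition dup_at :: "nat \<Rightarrow> ('n list \<Rightarrow> complex) \<Rightarrow> 'n list \<Rightarrow> complex" where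
  "dup_at l f w = (if Suc l < length w \<and> w ! l = w ! Suc l then f (take l w @ drop (Suc l) w) else 0)"

definition merge_at :: "nat \<Rightarrow> ('n list \<Rightarrow> complex) \<Rightarrow> 'n list \<Rightarrow> complex" where
  "merge_at l f w = (if l < length w then f (take (Suc l) w @ drop l w) else 0)"

lemma ins_at_append: "length v = l \<Longrightarrow> ins_at l f (v @ [x] @ w) = f (v @ w)"
  by (simp add: ins_at_def)

lemma del_at_append: "length v = l \<Longrightarrow> del_at l f (v @ w) = (\<Sum>k\<in>UNIV. f (v @ [k] @ w))"
  by (simp add: del_at_def)

lemma dup_at_append: "length v = l \<Longrightarrow> dup_at l f (v @ [x, y] @ w) = (if x = y then f (v @ [x] @ w) else 0)"
  by (auto simp: dup_at_def nth_append)

lemma merge_at_append: "length v = l \<Longrightarrow> merge_at l f (v @ [x] @ w) = f (v @ [x, x] @ w)"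
  by (simp add: merge_at_def)

lemma join_at_append: "length v = l \<Longrightarrow> join_at l f (v @ [x, y] @ w) = (if x = y then f (v @ [x, y] @ w) else 0)"
  by (auto simp: join_at_def nth_append)

text \<open>On words of a fixed length \<open>join_at\<close> is a self-adjoint projection. Its
  commutation with the kernels is the relation that \<open>u_ij u_ik\<close> and
  \<open>u_ji u_ki\<close> vanish for distinct \<open>j\<close>, \<open>k\<close>.\<close>

locale cubic_spaces = fixed_spaces V for V :: "nat \<Rightarrow> ('n::finite list \<Rightarrow> complex) set" +
  assumes V_join: "f \<in> V (l + 2 + m) \<Longrightarrow> join_at l f \<in> V (l + 2 + m)"
begin

lemma kern_join:
  assumes "length v = l" "length w = m" "length v' = l" "length w' = m"
  shows "(if x = y then kern (l + 2 + m) (v @ [x, y] @ w) (v' @ [i, j] @ w') else 0) =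
    (if i = j then kern (l + 2 + m) (v @ [x, y] @ w) (v' @ [i, j] @ w') else 0)"
proof -
  let ?a = "v @ [x, y] @ w" and ?b = "v' @ [i, j] @ w'"
  have "cnj (join_at l (\<lambda>u. kern (l + 2 + m) u ?b) ?a) = join_at l (\<lambda>u. kern (l + 2 + m) u ?a) ?b"
    by (rule kern_adjoint[OF V_join V_join])
      (use assms in \<open>auto simp: join_at_def intro!: sum.cong\<close>)
  then show ?thesis
    using assms kern_cnj[of ?a "l + 2 + m" ?b] kern_sym[of ?a "l + 2 + m" ?b]
    by (simp only: join_at_append) (simp split: if_splits)
qed

lemma hword_join:
  assumes "j \<noteq> k"
  shows "hword (p @ [(i, j), (i, k)] @ q) = 0" "hword (p @ [(j, i), (k, i)] @ q) = 0"
proof -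
  define l where "l = length p"
  define m where "m = length q"
  have L: "length (p @ [x, y] @ q) = l + 2 + m" for x y by (simp_all add: l_def m_def)
  have len: "length (map fst p) = l" "length (map snd p) = l" "length (map fst q) = m" "length (map snd q) = m"
    by (simp_all add: l_def m_def)
  show "hword (p @ [(i, j), (i, k)] @ q) = 0" "hword (p @ [(j, i), (k, i)] @ q) = 0"
    unfolding hword_def L using assms kern_join[OF len(1,3) len(2,4), of i i j k]
      kern_join[OF len(1,3) len(2,4), of j k i i] by simp_all
qed

lemma gns_join:
  assumes "j \<noteq> k"
  shows "gns (fgen (i, j) * fgen (i, k) - 0) = 0" "gns (fgen (j, i) * fgen (k, i) - 0) = 0"
  by (rule gns_null, rule haar_idealI,
      simp add: gen2_simps gen2_def haar_words hword_join[OF assms, simplified])+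

lemma admissible_Cubic: "admissible Cubic gns"
  unfolding admissible_def is_matrix_completion_iff[OF cstar_seminorm_gns]
  using gns_Ortho gns_join cstar_seminorm_gns by (simp only: gen_rel.simps simp_thms) blast

end

text \<open>The four maps are the unit, the counit, the comultiplication and the multiplication of
  the algebra \<open>C^n\<close>, applied in one place. \<open>ins_at\<close> and
  \<open>del_at\<close> are adjoint to each other, as are \<open>dup_at\<close> and
  \<open>merge_at\<close>; the first two encode the row and column sums, the last two
  \<open>u_ij u_ij = u_ij\<close>.\<close>

locale magic_spaces = cubic_spaces V for V :: "nat \<Rightarrow> ('n::finite list \<Rightarrow> complex) set" +
  assumes V_ins: "f \<in> V (l + m) \<Longrightarrow> ins_at l f \<in> V (l + 1 + m)"
    and V_del: "f \<in> V (l + 1 + m) \<Longrightarrow> del_at l f \<in> V (l + m)"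
    and V_dup: "f \<in> V (l + 1 + m) \<Longrightarrow> dup_at l f \<in> V (l + 2 + m)"
    and V_merge: "f \<in> V (l + 2 + m) \<Longrightarrow> merge_at l f \<in> V (l + 1 + m)"
begin

lemma kern_del:
  assumes "length v = l" "length w = m" "length v' = l" "length w' = m"
  shows "(\<Sum>k\<in>UNIV. kern (l + 1 + m) (v @ [k] @ w) (v' @ [i] @ w')) = kern (l + m) (v @ w) (v' @ w')"
proof -
  have "cnj (del_at l (\<lambda>u. kern (l + 1 + m) u (v' @ [i] @ w')) (v @ w)) =
      ins_at l (\<lambda>u. kern (l + m) u (v @ w)) (v' @ [i] @ w')"
  proof (rule kern_adjoint[OF V_ins V_del])
    fix f g :: "'n list \<Rightarrow> complex"
    have "(\<Sum>a\<in>words (l + 1 + m). cnj (g a) * ins_at l f a) =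
        (\<Sum>v\<in>words l. \<Sum>k\<in>UNIV. \<Sum>w\<in>words m. cnj (g (v @ [k] @ w)) * ins_at l f (v @ [k] @ w))"
      by (simp only: sum_words_append sum_words_1 One_nat_def append_assoc)
    also have "\<dots> = (\<Sum>v\<in>words l. \<Sum>k\<in>UNIV. \<Sum>w\<in>words m. cnj (g (v @ [k] @ w)) * f (v @ w))"
      by (intro sum.cong refl) (simp only: mem_Collect_eq ins_at_append)
    also have "\<dots> = (\<Sum>v\<in>words l. \<Sum>w\<in>words m. \<Sum>k\<in>UNIV. cnj (g (v @ [k] @ w)) * f (v @ w))"
      by (intro sum.cong refl sum.swap)
    also have "\<dots> = (\<Sum>i\<in>words (l + m). cnj (del_at l g i) * f i)"
      by (simp add: sum_words_append del_at_append sum_distrib_right)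
    finally show "(\<Sum>a\<in>words (l + 1 + m). cnj (g a) * ins_at l f a) =
        (\<Sum>i\<in>words (l + m). cnj (del_at l g i) * f i)" .
  qed (use assms in auto)
  then show ?thesis
    using assms kern_cnj[of "v @ [k] @ w" "l + 1 + m" "v' @ [i] @ w'" for k] kern_sym[of "v @ w" "l + m" "v' @ w'"]
    by (simp only: del_at_append ins_at_append) simp
qed

lemma kern_merge:
  assumes "length v = l" "length w = m" "length v' = l" "length w' = m"
  shows "kern (l + 2 + m) (v @ [x, x] @ w) (v' @ [i, i] @ w') = kern (l + 1 + m) (v @ [x] @ w) (v' @ [i] @ w')"
proof -
  let ?a = "v @ [x] @ w" and ?b = "v' @ [i, i] @ w'"
  have "cnj (merge_at l (\<lambda>u. kern (l + 2 + m) u ?b) ?a) = dup_at l (\<lambda>u. kern (l + 1 + m) u ?a) ?b"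
  proof (rule kern_adjoint[OF V_dup V_merge])
    fix f g :: "'n list \<Rightarrow> complex"
    have "(\<Sum>a\<in>words (l + 2 + m). cnj (g a) * dup_at l f a) =
        (\<Sum>v\<in>words l. \<Sum>x\<in>UNIV. \<Sum>y\<in>UNIV. \<Sum>w\<in>words m. cnj (g (v @ [x, y] @ w)) * dup_at l f (v @ [x, y] @ w))"
      by (simp only: sum_words_append sum_words_2 append_assoc)
    also have "\<dots> = (\<Sum>v\<in>words l. \<Sum>x\<in>UNIV. \<Sum>y\<in>UNIV. if x = y then \<Sum>w\<in>words m. cnj (g (v @ [x, x] @ w)) * f (v @ [x] @ w) else 0)"
      by (intro sum.cong refl) (simp only: mem_Collect_eq dup_at_append, simp)
    also have "\<dots> = (\<Sum>v\<in>words l. \<Sum>x\<in>UNIV. \<Sum>w\<in>words m. cnj (g (v @ [x, x] @ w)) * f (v @ [x] @ w))"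
      by (simp add: sum.delta')
    also have "\<dots> = (\<Sum>v\<in>words l. \<Sum>x\<in>UNIV. \<Sum>w\<in>words m. cnj (merge_at l g (v @ [x] @ w)) * f (v @ [x] @ w))"
      by (intro sum.cong refl) (simp only: mem_Collect_eq merge_at_append)
    also have "\<dots> = (\<Sum>i\<in>words (l + 1 + m). cnj (merge_at l g i) * f i)"
      by (simp only: sum_words_append sum_words_1 One_nat_def append_assoc)
    finally show "(\<Sum>a\<in>words (l + 2 + m). cnj (g a) * dup_at l f a) =
        (\<Sum>i\<in>words (l + 1 + m). cnj (merge_at l g i) * f i)" .
  qed (use assms in auto)
  then show ?thesis
    using assms kern_cnj[of "v @ [x, x] @ w" "l + 2 + m" ?b] kern_sym[of ?a "l + 1 + m" "v' @ [i] @ w'"]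
    by (simp only: merge_at_append dup_at_append) simp
qed

lemma hword_magic:
  "hword (p @ [(i, j), (i, j)] @ q) = hword (p @ [(i, j)] @ q)"
  "(\<Sum>k\<in>UNIV. hword (p @ [(i, k)] @ q)) = hword (p @ q)"
  "(\<Sum>k\<in>UNIV. hword (p @ [(k, i)] @ q)) = hword (p @ q)"
proof -
  define l where "l = length p"
  define m where "m = length q"
  have L: "length (p @ [x, y] @ q) = l + 2 + m" "length (p @ [x] @ q) = l + 1 + m" "length (p @ q) = l + m" for x y
    by (simp_all add: l_def m_def)
  have len: "length (map fst p) = l" "length (map snd p) = l" "length (map fst q) = m" "length (map snd q) = m"
    by (simp_all add: l_def m_def)
  show "hword (p @ [(i, j), (i, j)] @ q) = hword (p @ [(i, j)] @ q)"
    unfolding hword_def L using kern_merge[OF len(1,3) len(2,4), of i j] by simp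
  show "(\<Sum>k\<in>UNIV. hword (p @ [(k, i)] @ q)) = hword (p @ q)"
    unfolding hword_def L using kern_del[OF len(1,3) len(2,4), of i] by simp
  have "kern (l + 1 + m) (map fst p @ [i] @ map fst q) (map snd p @ [k] @ map snd q) =
      kern (l + 1 + m) (map snd p @ [k] @ map snd q) (map fst p @ [i] @ map fst q)" for k
    by (rule kern_sym) (simp_all add: l_def m_def)
  moreover have "kern (l + m) (map fst p @ map fst q) (map snd p @ map snd q) =
      kern (l + m) (map snd p @ map snd q) (map fst p @ map fst q)"
    by (rule kern_sym) (simp_all add: l_def m_def)
  ultimately show "(\<Sum>k\<in>UNIV. hword (p @ [(i, k)] @ q)) = hword (p @ q)"
    unfolding hword_def L using kern_del[OF len(2,4) len(1,3), of i] by simp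
qed

lemma admissible_Magic: "admissible Magic gns"
proof -
  have sq: "gns (fgen (i, j) * fgen (i, j) - fgen (i, j)) = 0" for i j
    by (rule gns_null, rule haar_idealI)
      (simp only: gen2_simps, simp add: gen2_def fgen_def left_diff_distrib right_diff_distrib haar_diff haar_words
        hword_magic(1)[simplified])
  have row: "gns ((\<Sum>k\<in>UNIV. fgen (i, k)) - 1) = 0" and col: "gns ((\<Sum>k\<in>UNIV. fgen (k, i)) - 1) = 0" for i
    by (rule gns_null, rule haar_idealI, simp add: fgen_def left_diff_distrib right_diff_distrib haar_diff haar_sum
        haar_words haar_words_one[simplified] sum_distrib_left sum_distrib_right hword_magic(2,3)[simplified])+
  show ?thesis
    unfolding admissible_def is_matrix_completion_iff[OF cstar_seminorm_gns]
    using gns_star sq row col gns_join cstar_seminorm_gns by (simp only: gen_rel.simps) blast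
qed

end

section \<open>Noncrossing pairings on a line\<close>

text \<open>A noncrossing pairing of the points of a line is obtained from the empty one by inserting
  strings that join neighbours.  The points carry colours, listed in the first argument of
  \<open>lnc\<close>, and strings join points of equal colour.\<close>

definition shift2 :: "nat \<Rightarrow> nat \<Rightarrow> nat" where
  "shift2 q p = (if p < q then p else p + 2)"

definition cupins :: "nat \<Rightarrow> nat set set \<Rightarrow> nat set set" where
  "cupins q P = insert {q, Suc q} ((`) (shift2 q) ` P)"

inductive lnc :: "'c list \<Rightarrow> nat set set \<Rightarrow> bool" where
  lnc_Nil: "lnc [] {}"
| lnc_cup: "lnc (c1 @ c2) P \<Longrightarrow> lnc (c1 @ [x, x] @ c2) (cupins (length c1) P)"

definition match :: "nat set set \<Rightarrow> 'n list \<Rightarrow> complex" where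
  "match P w = (if \<forall>s\<in>P. \<forall>x\<in>s. \<forall>y\<in>s. w ! x = w ! y then 1 else 0)"

lemma match_empty [simp]: "match {} w = 1"
  by (simp add: match_def)

lemma match_cupins:
  assumes "length v = q"
  shows "match (cupins q P) (v @ [x, y] @ w) = (if x = y then match P (v @ w) else 0)"
proof -
  have "(v @ [x, y] @ w) ! shift2 q p = (v @ w) ! p" for p
    using assms by (auto simp: shift2_def nth_append)
  moreover have "(v @ [x, y] @ w) ! q = x" "(v @ [x, y] @ w) ! Suc q = y"
    using assms by (auto simp: nth_append)
  ultimately show ?thesis by (auto simp: match_def cupins_def)
qed

definition dbl :: "'n list \<Rightarrow> 'n list" where
  "dbl w = concat (map (\<lambda>x. [x, x]) w)"

lemma dbl_simps [simp]: "dbl [] = []" "dbl (x # w) = x # x # dbl w" "dbl (v @ w) = dbl v @ dbl w"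
  by (simp_all add: dbl_def)

lemma length_dbl [simp]: "length (dbl w) = 2 * length w"
  by (induction w) auto

lemma rev_dbl: "rev (dbl w) = dbl (rev w)"
  by (induction w) auto

text \<open>On doubled words the parity of the position decides what a new string does. At an even
  position it joins the two copies of one letter and puts no condition on it; at an odd position
  (\<open>match_cupins_odd\<close>) it joins copies of two neighbouring letters, forces them to be
  equal, and leaves them to the other strings as one letter.\<close>

lemma match_cupins_even:
  assumes "length v = s"
  shows "match (cupins (2 * s) P) (dbl (v @ [b] @ w)) = match P (dbl (v @ w))"
  using match_cupins[of "dbl v" "2 * s" P b b "dbl w"] assms by simp

lemma match_cupins_odd:
  assumes "length v = s"
  shows "match (cupins (Suc (2 * s)) P) (dbl (v @ [a, b] @ w)) = (if a = b then match P (dbl (v @ [a] @ w)) else 0)"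
  using match_cupins[of "dbl v @ [a]" "Suc (2 * s)" P a b "b # dbl w"] assms by simp

text \<open>Case split for a cap that meets the string inserted last: same place, overlap in one
  point on either side, or disjoint.\<close>

lemma two_neighbours_cases:
  assumes "d1 @ [y, y] @ d2 = c1 @ [x, x] @ c2"
  obtains "d1 = c1" "y = x" "d2 = c2"
    | "d1 = c1 @ [x]" "y = x" "c2 = x # d2"
    | "c1 = d1 @ [x]" "y = x" "d2 = x # c2"
    | e where "d1 = c1 @ [x, x] @ e" "c2 = e @ [y, y] @ d2"
    | e where "c1 = d1 @ [y, y] @ e" "d2 = e @ [x, x] @ c2"
proof -
  obtain us where "d1 = c1 @ us \<and> us @ [y, y] @ d2 = [x, x] @ c2 \<or> d1 @ us = c1 \<and> [y, y] @ d2 = us @ [x, x] @ c2"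
    using assms by (auto simp: append_eq_append_conv2)
  then show thesis
  proof (elim disjE conjE)
    assume u: "d1 = c1 @ us" "us @ [y, y] @ d2 = [x, x] @ c2"
    show thesis
    proof (cases us)
      case Nil
      then show ?thesis using u that(1) by simp
    next
      case (Cons a us')
      then show ?thesis using u that(2,4) by (cases us') auto
    qed
  next
    assume u: "d1 @ us = c1" "[y, y] @ d2 = us @ [x, x] @ c2"
    show thesis
    proof (cases us)
      case Nil
      then show ?thesis using u that(1) by simp
    next
      case (Cons a us')
      then show ?thesis using u that(3,5) by (cases us') auto
    qed
  qed
qed

lemma split_word2:
  assumes "length w = a + 2 + b"
  obtains v x y u where "w = v @ [x, y] @ u" "length v = a" "length u = b"
proof -
  have "length (take a w) = a" "length (drop a w) = Suc (Suc b)" using assms by auto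
  moreover obtain x y u where "drop a w = x # y # u" "length u = b"
    using \<open>length (drop a w) = _\<close> by (metis length_Suc_conv)
  ultimately show thesis using that[of "take a w" x y u] append_take_drop_id[of a w] by simp
qed

lemma split_word1:
  assumes "length w = a + 1 + b"
  obtains v x u where "w = v @ [x] @ u" "length v = a" "length u = b"
proof -
  have "length (take a w) = a" "length (drop a w) = Suc b" using assms by auto
  moreover obtain x u where "drop a w = x # u" "length u = b"
    using \<open>length (drop a w) = _\<close> by (metis length_Suc_conv)
  ultimately show thesis using that[of "take a w" x u] append_take_drop_id[of a w] by simp
qed

text \<open>A cap on the two ends of the string inserted last closes a loop, worth
  \<open>CARD('n)\<close>; one that overlaps it in a single point straightens a zigzag; one that is
  disjoint from it commutes with the insertion. Hence capping a diagram gives a multiple of a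
  diagram.\<close>

lemma lnc_cap:
  assumes "lnc c P" "c = c1 @ [x, x] @ c2"
  shows "\<exists>r P'. lnc (c1 @ c2) P' \<and> (\<forall>v w. length v = length c1 \<longrightarrow> length w = length c2 \<longrightarrow>
    (\<Sum>k\<in>UNIV. match P (v @ [k, k] @ w)) = r * match P' (v @ w :: 'n::finite list))"
  using assms
proof (induction arbitrary: c1 x c2 rule: lnc.induct)
  case lnc_Nil
  then show ?case by simp
next
  case (lnc_cup d1 d2 P y)
  from lnc_cup.prems show ?case
  proof (cases rule: two_neighbours_cases)
    case 1
    then show ?thesis using lnc_cup.hyps
      by (intro exI[of _ "of_nat CARD('n)"] exI[of _ P]) (auto simp: match_cupins[simplified])
  next
    case 2
    have "(\<Sum>k\<in>UNIV. match (cupins (length d1) P) (v @ [k, k] @ w)) = match P (v @ w)"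
      if vw: "length v = length c1" "length w = length c2" for v w :: "'n list"
    proof -
      obtain b w' where w: "w = b # w'" using vw 2 by (cases w) auto
      have "match (cupins (length d1) P) (v @ [k, k] @ w) = (if k = b then match P (v @ w) else 0)" for k
        using match_cupins[of "v @ [k]" "length d1" P k b w'] 2 vw by (simp add: w)
      then show ?thesis by simp
    qed
    then show ?thesis using 2 lnc_cup.hyps by (intro exI[of _ 1] exI[of _ P]) auto
  next
    case 3
    have "(\<Sum>k\<in>UNIV. match (cupins (length d1) P) (v @ [k, k] @ w)) = match P (v @ w)"
      if vw: "length v = length c1" "length w = length c2" for v w :: "'n list"
    proof -
      obtain v' b where v: "v = v' @ [b]" using vw 3 by (cases v rule: rev_cases) auto
      have "match (cupins (length d1) P) (v @ [k, k] @ w) = (if b = k then match P (v @ w) else 0)" for k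
        using match_cupins[of v' "length d1" P b k "k # w"] 3 vw by (simp add: v)
      then show ?thesis by simp
    qed
    then show ?thesis using 3 lnc_cup.hyps by (intro exI[of _ 1] exI[of _ P]) auto
  next
    case (4 e)
    then have "d1 @ d2 = c1 @ [x, x] @ (e @ d2)" by simp
    from lnc_cup.IH[OF this] obtain r P' where P': "lnc (c1 @ e @ d2) P'"
      and eq: "\<And>v w :: 'n list. length v = length c1 \<Longrightarrow> length w = length (e @ d2) \<Longrightarrow>
        (\<Sum>k\<in>UNIV. match P (v @ [k, k] @ w)) = r * match P' (v @ w)" by auto
    have "lnc (c1 @ c2) (cupins (length (c1 @ e)) P')"
      using lnc.lnc_cup[of "c1 @ e" d2 P' y] P' 4 by simp
    moreover have "(\<Sum>k\<in>UNIV. match (cupins (length d1) P) (v @ [k, k] @ w)) = r * match (cupins (length (c1 @ e)) P') (v @ w)"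
      if vw: "length v = length c1" "length w = length c2" for v w :: "'n list"
    proof -
      have "length w = length e + 2 + length d2" using vw 4 by simp
      then obtain w1 a b w2 where w: "w = w1 @ [a, b] @ w2" "length w1 = length e" "length w2 = length d2"
        by (rule split_word2)
      have "match (cupins (length d1) P) (v @ [k, k] @ w) = (if a = b then match P (v @ [k, k] @ w1 @ w2) else 0)" for k
        using match_cupins[of "v @ [k, k] @ w1" "length d1" P a b w2] 4 vw w by simp
      then show ?thesis
        using match_cupins[of "v @ w1" "length (c1 @ e)" P' a b w2] eq[of v "w1 @ w2"] vw w by simp
    qed
    ultimately show ?thesis by blast
  next
    case (5 e)
    then have "d1 @ d2 = (d1 @ e) @ [x, x] @ c2" by simp
    from lnc_cup.IH[OF this] obtain r P' where P': "lnc (d1 @ e @ c2) P'"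
      and eq: "\<And>v w :: 'n list. length v = length (d1 @ e) \<Longrightarrow> length w = length c2 \<Longrightarrow>
        (\<Sum>k\<in>UNIV. match P (v @ [k, k] @ w)) = r * match P' (v @ w)" by auto
    have "lnc (c1 @ c2) (cupins (length d1) P')"
      using lnc.lnc_cup[of d1 "e @ c2" P' y] P' 5 by simp
    moreover have "(\<Sum>k\<in>UNIV. match (cupins (length d1) P) (v @ [k, k] @ w)) = r * match (cupins (length d1) P') (v @ w)"
      if vw: "length v = length c1" "length w = length c2" for v w :: "'n list"
    proof -
      have "length v = length d1 + 2 + length e" using vw 5 by simp
      then obtain v1 a b v2 where v: "v = v1 @ [a, b] @ v2" "length v1 = length d1" "length v2 = length e"
        by (rule split_word2)
      have "match (cupins (length d1) P) (v @ [k, k] @ w) = (if a = b then match P ((v1 @ v2) @ [k, k] @ w) else 0)" for k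
        using match_cupins[of v1 "length d1" P a b "v2 @ [k, k] @ w"] 5 vw v by simp
      then show ?thesis
        using match_cupins[of v1 "length d1" P' a b "v2 @ w"] eq[of "v1 @ v2" w] vw v by simp
    qed
    ultimately show ?thesis by blast
  qed
qed

text \<open>On doubled words, joining the two middle points of \<open>k k k k\<close> by a cap merges two letters.\<close>

lemma lnc_merge:
  assumes "lnc c P" "c = c1 @ [x, x] @ c2" "length c1 = Suc (2 * l)" "length c2 = Suc (2 * m)"
  shows "\<exists>P'. lnc (c1 @ c2) P' \<and> (\<forall>v k w. length v = l \<longrightarrow> length w = m \<longrightarrow>
    match P (dbl (v @ [k, k] @ w)) = match P' (dbl (v @ [k] @ w :: 'n list)))"
  using assms
proof (induction arbitrary: c1 x c2 l m rule: lnc.induct)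
  case lnc_Nil
  then show ?case by simp
next
  case (lnc_cup d1 d2 P y)
  note c1 = lnc_cup.prems(2) and c2 = lnc_cup.prems(3)
  from lnc_cup.prems(1) show ?case
  proof (cases rule: two_neighbours_cases)
    case 1
    have "match (cupins (length d1) P) (dbl (v @ [k, k] @ w)) = match P (dbl (v @ [k] @ w))"
      if "length v = l" for v w :: "'n list" and k
      using match_cupins_odd[of v l P k k w] 1 c1 that by simp
    then show ?thesis using 1 lnc_cup.hyps by (intro exI[of _ P]) auto
  next
    case 2
    have "match (cupins (length d1) P) (dbl (v @ [k, k] @ w)) = match P (dbl (v @ [k] @ w))"
      if "length v = l" for v w :: "'n list" and k
      using match_cupins_even[of "v @ [k]" "Suc l" P k w] 2 c1 that by simp
    then show ?thesis using 2 lnc_cup.hyps by (intro exI[of _ P]) auto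
  next
    case 3
    have "match (cupins (length d1) P) (dbl (v @ [k, k] @ w)) = match P (dbl (v @ [k] @ w))"
      if "length v = l" for v w :: "'n list" and k
      using match_cupins_even[of v l P k "[k] @ w"] 3 c1 that by simp
    then show ?thesis using 3 lnc_cup.hyps by (intro exI[of _ P]) auto
  next
    case (4 e)
    then have d: "d1 @ d2 = c1 @ [x, x] @ (e @ d2)" by simp
    have len: "length e + 2 + length d2 = Suc (2 * m)" using 4 c2 by simp
    then obtain m' where m: "m = Suc m'" by (cases m) auto
    have ed: "length (e @ d2) = Suc (2 * m')" using len m by simp
    from lnc_cup.IH[OF d c1 ed] obtain P' where P': "lnc (c1 @ e @ d2) P'"
      and eq: "\<And>v w k. length v = l \<Longrightarrow> length w = m' \<Longrightarrow>
        match P (dbl (v @ [k, k] @ w)) = match P' (dbl (v @ [k] @ w :: 'n list))" by blast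
    have "lnc (c1 @ c2) (cupins (length (c1 @ e)) P')"
      using lnc.lnc_cup[of "c1 @ e" d2 P' y] P' 4 by simp
    moreover have "match (cupins (length d1) P) (dbl (v @ [k, k] @ w)) = match (cupins (length (c1 @ e)) P') (dbl (v @ [k] @ w))"
      if vw: "length v = l" "length w = m" for v w :: "'n list" and k
    proof (cases "even (length e)")
      \<comment> \<open>Here the last string joins two neighbouring letters, the first of which may
        be the second \<open>k\<close>; therefore \<open>k\<close> is kept in front of
        \<open>w\<close> when splitting. For odd \<open>length e\<close> it joins the copies of one
        letter of \<open>w\<close>.\<close>
      case True
      then obtain r where r: "length e = 2 * r" by blast
      have "length (k # w) = r + 2 + (m' - r)" using len r m vw by simp
      then obtain w1 a b w2 where w: "k # w = w1 @ [a, b] @ w2" "length w1 = r" "length w2 = m' - r"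
        by (rule split_word2)
      obtain w' where w': "w1 @ [a] @ w2 = k # w'" using w(1) by (cases w1) auto
      have "length w' = m'" using arg_cong[OF w', of length] w len r m by simp
      have "match (cupins (length d1) P) (dbl ((v @ [k] @ w1) @ [a, b] @ w2)) =
          (if a = b then match P (dbl ((v @ [k] @ w1) @ [a] @ w2)) else 0)"
        using match_cupins_odd[of "v @ [k] @ w1" "l + 1 + r" P a b w2] 4 vw w r c1 by simp
      moreover have "match (cupins (length (c1 @ e)) P') (dbl ((v @ w1) @ [a, b] @ w2)) =
          (if a = b then match P' (dbl ((v @ w1) @ [a] @ w2)) else 0)"
        using match_cupins_odd[of "v @ w1" "l + r" P' a b w2] vw w r c1 by simp
      moreover have "match P (dbl ((v @ [k] @ w1) @ [a] @ w2)) = match P' (dbl ((v @ w1) @ [a] @ w2))"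
        using eq[of v w' k] vw \<open>length w' = m'\<close> w' by (simp del: dbl_simps)
      moreover have "v @ [k, k] @ w = (v @ [k] @ w1) @ [a, b] @ w2" "v @ [k] @ w = (v @ w1) @ [a, b] @ w2"
        using w(1) by simp_all
      ultimately show ?thesis by (simp only:)
    next
      case False
      then obtain r where r: "length e = Suc (2 * r)" by (metis oddE Suc_eq_plus1)
      have "length w = r + 1 + (m' - r)" using len r m vw by simp
      then obtain w1 b w2 where w: "w = w1 @ [b] @ w2" "length w1 = r" "length w2 = m' - r"
        by (rule split_word1)
      have "match (cupins (length d1) P) (dbl ((v @ [k, k] @ w1) @ [b] @ w2)) = match P (dbl ((v @ [k, k] @ w1) @ w2))"
        using match_cupins_even[of "v @ [k, k] @ w1" "l + 2 + r" P b w2] 4 vw w r c1 by simp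
      moreover have "match (cupins (length (c1 @ e)) P') (dbl ((v @ [k] @ w1) @ [b] @ w2)) = match P' (dbl ((v @ [k] @ w1) @ w2))"
        using match_cupins_even[of "v @ [k] @ w1" "l + 1 + r" P' b w2] vw w r c1 by simp
      moreover have "match P (dbl (v @ [k, k] @ w1 @ w2)) = match P' (dbl (v @ [k] @ w1 @ w2))"
        by (rule eq) (use vw w len r m in auto)
      ultimately show ?thesis unfolding w(1) by (simp only: append_assoc)
    qed
    ultimately show ?thesis by blast
  next
    case (5 e)
    then have d: "d1 @ d2 = (d1 @ e) @ [x, x] @ c2" by simp
    have len: "length d1 + 2 + length e = Suc (2 * l)" using 5 c1 by simp
    then obtain l' where l: "l = Suc l'" by (cases l) auto
    have de: "length (d1 @ e) = Suc (2 * l')" using len l by simp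
    from lnc_cup.IH[OF d de c2] obtain P' where P': "lnc (d1 @ e @ c2) P'"
      and eq: "\<And>v w k. length v = l' \<Longrightarrow> length w = m \<Longrightarrow>
        match P (dbl (v @ [k, k] @ w)) = match P' (dbl (v @ [k] @ w :: 'n list))" by auto
    have "lnc (c1 @ c2) (cupins (length d1) P')"
      using lnc.lnc_cup[of d1 "e @ c2" P' y] P' 5 by simp
    moreover have "match (cupins (length d1) P) (dbl (v @ [k, k] @ w)) = match (cupins (length d1) P') (dbl (v @ [k] @ w))"
      if vw: "length v = l" "length w = m" for v w :: "'n list" and k
    proof (cases "even (length d1)")
      case True
      then obtain r where r: "length d1 = 2 * r" by blast
      have "length v = r + 1 + (l' - r)" using len r l vw by simp
      then obtain v1 b v2 where v: "v = v1 @ [b] @ v2" "length v1 = r" "length v2 = l' - r"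
        by (rule split_word1)
      have "match (cupins (length d1) P) (dbl (v1 @ [b] @ (v2 @ [k, k] @ w))) = match P (dbl (v1 @ v2 @ [k, k] @ w))"
        using match_cupins_even[of v1 r P b "v2 @ [k, k] @ w"] v r by simp
      moreover have "match (cupins (length d1) P') (dbl (v1 @ [b] @ (v2 @ [k] @ w))) = match P' (dbl (v1 @ v2 @ [k] @ w))"
        using match_cupins_even[of v1 r P' b "v2 @ [k] @ w"] v r by simp
      moreover have "match P (dbl ((v1 @ v2) @ [k, k] @ w)) = match P' (dbl ((v1 @ v2) @ [k] @ w))"
        by (rule eq) (use vw v len r l in auto)
      ultimately show ?thesis unfolding v(1) by (simp only: append_assoc)
    next
      case False
      \<comment> \<open>The mirror image: the last string joins two neighbouring letters, the second
        of which may be the first \<open>k\<close>, so \<open>v @ [k]\<close> is split.\<close>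
      then obtain r where r: "length d1 = Suc (2 * r)" by (metis oddE Suc_eq_plus1)
      have "length (v @ [k]) = r + 2 + (l' - r)" using len r l vw by simp
      then obtain v1 a b v2 where v: "v @ [k] = v1 @ [a, b] @ v2" "length v1 = r" "length v2 = l' - r"
        by (rule split_word2)
      obtain v' where v': "v1 @ [b] @ v2 = v' @ [k]"
        using v(1) by (cases v2 rule: rev_cases) auto
      have "length v' = l'" using arg_cong[OF v', of length] v len r l by simp
      have 1: "match (cupins (length d1) P) (dbl (v1 @ [a, b] @ (v2 @ [k] @ w))) =
          (if a = b then match P (dbl (v1 @ [a] @ v2 @ [k] @ w)) else 0)"
        using match_cupins_odd[of v1 r P a b "v2 @ [k] @ w"] v r by simp
      have 2: "match (cupins (length d1) P') (dbl (v1 @ [a, b] @ (v2 @ w))) =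
          (if a = b then match P' (dbl (v1 @ [a] @ v2 @ w)) else 0)"
        using match_cupins_odd[of v1 r P' a b "v2 @ w"] v r by simp
      have "v1 @ [b] @ v2 @ [k] @ w = v' @ [k, k] @ w" "v1 @ [b] @ v2 @ w = v' @ [k] @ w"
        using v' by (metis append_assoc append_Cons append_Nil)+
      then have 3: "match P (dbl (v1 @ [b] @ v2 @ [k] @ w)) = match P' (dbl (v1 @ [b] @ v2 @ w))"
        using eq[of v' w k] vw \<open>length v' = l'\<close> by (simp only:)
      have "v @ [k, k] @ w = v1 @ [a, b] @ v2 @ [k] @ w" "v @ [k] @ w = v1 @ [a, b] @ v2 @ w"
        using v(1) by (metis append_assoc append_Cons append_Nil)+
      then show ?thesis using 1 2 3 by (cases "a = b") (simp_all only: if_True if_False simp_thms)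
    qed
    ultimately show ?thesis by blast
  qed
qed

text \<open>The strings of the right factor are inserted one by one behind the points of the left
  one, which shifts their positions by \<open>length c\<close>.\<close>

lemma lnc_tensor:
  assumes "lnc d Q" "lnc c P"
  shows "\<exists>R. lnc (c @ d) R \<and> (\<forall>v w :: 'n list. length v = length c \<longrightarrow> length w = length d \<longrightarrow>
    match R (v @ w) = match P v * match Q w)"
  using assms(1)
proof induction
  case lnc_Nil
  then show ?case using assms(2) by auto
next
  case (lnc_cup d1 d2 Q x)
  then obtain R where R: "lnc (c @ d1 @ d2) R" and eq: "\<And>v w :: 'n list. length v = length c \<Longrightarrow>
      length w = length (d1 @ d2) \<Longrightarrow> match R (v @ w) = match P v * match Q w" by auto
  have "lnc (c @ d1 @ [x, x] @ d2) (cupins (length (c @ d1)) R)"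
    using lnc.lnc_cup[of "c @ d1" d2 R x] R by simp
  moreover have "match (cupins (length (c @ d1)) R) (v @ w) = match P v * match (cupins (length d1) Q) w"
    if vw: "length v = length c" "length w = length (d1 @ [x, x] @ d2)" for v w :: "'n list"
  proof -
    have "length w = length d1 + 2 + length d2" using vw by simp
    then obtain w1 a b w2 where w: "w = w1 @ [a, b] @ w2" "length w1 = length d1" "length w2 = length d2"
      by (rule split_word2)
    show ?thesis
      using match_cupins[of "v @ w1" "length (c @ d1)" R a b w2] match_cupins[of w1 "length d1" Q a b w2]
        eq[of v "w1 @ w2"] vw w by simp
  qed
  ultimately show ?case by blast
qed

lemma lnc_rev:
  assumes "lnc c P"
  shows "\<exists>R. lnc (rev c) R \<and> (\<forall>w :: 'n list. length w = length c \<longrightarrow> match R (rev w) = match P w)"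
  using assms
proof induction
  case lnc_Nil
  then show ?case using lnc.lnc_Nil by auto
next
  case (lnc_cup d1 d2 P x)
  then obtain R where R: "lnc (rev d2 @ rev d1) R"
    and eq: "\<And>w :: 'n list. length w = length (d1 @ d2) \<Longrightarrow> match R (rev w) = match P w" by auto
  have "lnc (rev (d1 @ [x, x] @ d2)) (cupins (length d2) R)"
    using lnc.lnc_cup[OF R, of x] by simp
  moreover have "match (cupins (length d2) R) (rev w) = match (cupins (length d1) P) w"
    if "length w = length (d1 @ [x, x] @ d2)" for w :: "'n list"
  proof -
    have "length w = length d1 + 2 + length d2" using that by simp
    then obtain w1 a b w2 where w: "w = w1 @ [a, b] @ w2" "length w1 = length d1" "length w2 = length d2"
      by (rule split_word2)
    show ?thesis
      using match_cupins[of "rev w2" "length d2" R b a "rev w1"] match_cupins[of w1 "length d1" P a b w2]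
        eq[of "w1 @ w2"] w by auto
  qed
  ultimately show ?case by blast
qed

text \<open>A string accounts for two points of its colour. As each letter of a cubic row
  contributes one point of colour \<open>Col_a\<close>, and each letter of an orthogonal row is one,
  diagrams of these species exist only on an even number of letters.\<close>

lemma lnc_count_even: "lnc c P \<Longrightarrow> even (count_list c x)"
  by (induction rule: lnc.induct) auto

section \<open>The spaces spanned by the diagrams without upper points\<close>

definition colour_at :: "nat \<Rightarrow> colour" where
  "colour_at p = (if p mod 4 \<in> {0, 3} then Col_a else Col_b)"

text \<open>Colours of the \<open>m\<close> letters from letter \<open>s\<close> on, two points per
  letter; the pattern repeats after two letters.\<close>

definition seg :: "nat \<Rightarrow> nat \<Rightarrow> colour list" where
  "seg s m = map colour_at [2 * s..<2 * (s + m)]"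

lemma length_seg [simp]: "length (seg s m) = 2 * m"
  by (simp add: seg_def)

lemma nth_seg: "i < 2 * m \<Longrightarrow> seg s m ! i = colour_at (2 * s + i)"
  by (simp add: seg_def)

lemma seg_append: "seg s (l + m) = seg s l @ seg (s + l) m"
  by (rule nth_equalityI) (auto simp: nth_append nth_seg algebra_simps)

lemma colour_at_shift: "even t \<Longrightarrow> colour_at (2 * t + p) = colour_at p"
proof -
  assume "even t"
  then have "(2 * t + p) mod 4 = p mod 4" by presburger
  then show ?thesis by (simp only: colour_at_def)
qed

lemma seg_shift: "even t \<Longrightarrow> seg (s + t) m = seg s m"
  using colour_at_shift[of t "2 * s + i" for i]
  by (intro nth_equalityI) (auto simp: nth_seg algebra_simps)

text \<open>Two consecutive letters read \<open>p q q p\<close>, whatever the parity of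
  \<open>s\<close>: the two nested strings of a doubled cup always join equal colours.\<close>

lemma seg_2: "seg s 2 = [colour_at (2 * s), colour_at (2 * s + 1), colour_at (2 * s + 1), colour_at (2 * s)]"
proof -
  have upt: "[2 * s..<2 * (s + 2)] = [2 * s, 2 * s + 1, 2 * s + 2, 2 * s + 3]"
    by (simp add: upt_rec)
  have eq: "colour_at (2 * s + 2) = colour_at (2 * s + 1)" "colour_at (2 * s + 3) = colour_at (2 * s)"
    unfolding colour_at_def by (cases "even s"; auto elim!: evenE oddE; presburger)+
  show ?thesis unfolding seg_def upt by (simp only: list.map eq)
qed

lemma count_seg: "count_list (seg s m) Col_a = m"
proof (induction m)
  case (Suc m)
  have "seg s (m + 1) = seg s m @ seg (s + m) 1" by (rule seg_append)
  moreover have "count_list (seg t 1) Col_a = 1" for t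
  proof -
    have "seg t 1 = [colour_at (2 * t), colour_at (2 * t + 1)]" by (simp add: seg_def upt_rec)
    moreover have "(2 * t) mod 4 \<in> {0, 3} \<longleftrightarrow> (2 * t + 1) mod 4 \<notin> {0, 3}" by (simp; presburger)
    ultimately show ?thesis by (simp add: colour_at_def)
  qed
  ultimately show ?case using Suc by simp
qed (simp add: seg_def)

text \<open>Modulo 4 the hypothesis pairs 0 with 3 and 1 with 2, positions of equal colour.\<close>

lemma colour_at_reflect:
  assumes "(d + e) mod 4 = 3"
  shows "colour_at d = colour_at e"
proof -
  have "d mod 4 = 3 - e mod 4" using assms by presburger
  moreover have "e mod 4 < 4" by simp
  ultimately show ?thesis by (auto simp: colour_at_def)
qed

text \<open>A row with an odd number of letters ends with \<open>ab\<close>, so backwards it starts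
  with \<open>ba\<close>, the second letter of the pattern; one with an even number is a
  palindrome.\<close>

lemma rev_seg: "rev (seg 0 m) = seg (m mod 2) m"
proof (rule nth_equalityI)
  fix i assume i: "i < length (rev (seg 0 m))"
  define e where "e = m mod 2"
  have "m = e + 2 * (m div 2)" by (simp add: e_def)
  then obtain j where j: "m = e + 2 * j" by blast
  have "(2 * m - Suc i) + Suc i = 2 * m" using i by simp
  with j have "(2 * m - Suc i) + (2 * e + i) = 3 + (e + j - 1) * 4" by linarith
  then have "((2 * m - Suc i) + (2 * e + i)) mod 4 = 3" by simp
  then show "rev (seg 0 m) ! i = seg (m mod 2) m ! i"
    using i colour_at_reflect[of "2 * m - Suc i" "2 * e + i"] by (simp add: rev_nth nth_seg flip: e_def)
qed simp

text \<open>An orthogonal diagram is determined by the pairing that it doubles, so that species uses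
  one point per letter, the others two. In \<open>col\<close> a single colour stands for the absence
  of colour conditions.\<close>

fun enc :: "species \<Rightarrow> 'n list \<Rightarrow> 'n list" where
  "enc Ortho w = w" | "enc Cubic w = dbl w" | "enc Magic w = dbl w"

fun col :: "species \<Rightarrow> nat \<Rightarrow> colour list" where
  "col Ortho m = replicate m Col_a"
| "col Cubic m = seg 0 m"
| "col Magic m = replicate (2 * m) Col_a"

lemma length_col: "length (col x (length w)) = length (enc x w)"
  by (cases x) auto

lemma enc_append: "enc x (v @ w) = enc x v @ enc x w"
  by (cases x) auto

lemma enc_rev: "enc x (rev w) = rev (enc x w)"
  by (cases x) (auto simp: rev_dbl)

text \<open>The cubic pattern continues in this way for even \<open>l\<close>, which the existence
  of a diagram on \<open>l\<close> letters provides.\<close>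

lemma col_append: "lnc (col x l) P \<Longrightarrow> col x (l + m) = col x l @ col x m"
  using lnc_count_even[of "col x l" P Col_a] seg_append[of 0 l m] seg_shift[of l 0 m]
  by (cases x) (auto simp: replicate_add count_seg distrib_left)

lemma rev_col: "lnc (col x m) P \<Longrightarrow> rev (col x m) = col x m"
  using lnc_count_even[of "col x m" P Col_a] by (cases x) (auto simp: count_seg rev_seg mod_2_eq_odd)

lemma col_insert2:
  assumes "x \<noteq> Ortho"
  obtains A p q B where "col x (l + m) = A @ B" "col x (l + 2 + m) = A @ [p, q, q, p] @ B" "length A = 2 * l" "length B = 2 * m"
proof (cases "x = Cubic")
  case True
  have "seg 0 (l + 2 + m) = seg 0 l @ seg l 2 @ seg l m"
    using seg_append[of 0 "l + 2" m] seg_append[of 0 l 2] seg_shift[of 2 l m] by simp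
  then show thesis using that[of "seg 0 l" "seg l m"] seg_append[of 0 l m] True by (simp add: seg_2)
next
  case False
  have "replicate (2 * (l + 2 + m)) Col_a = replicate (2 * l) Col_a @ [Col_a, Col_a, Col_a, Col_a] @ replicate (2 * m) Col_a"
  proof -
    have "2 * (l + 2 + m) = 2 * l + (4 + 2 * m)" by simp
    then show ?thesis by (simp only: replicate_add) (simp add: numeral_eq_Suc)
  qed
  then show thesis
    using that[of "replicate (2 * l) Col_a" "replicate (2 * m) Col_a" Col_a Col_a] assms False
    by (cases x) (auto simp: replicate_add distrib_left)
qed

section \<open>Spans of diagram vectors and their closure properties\<close>

definition pvec :: "species \<Rightarrow> nat \<Rightarrow> nat set set \<Rightarrow> 'n list \<Rightarrow> complex" where
  "pvec x m P w = (if length w = m then match P (enc x w) else 0)"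

definition line_span :: "species \<Rightarrow> nat \<Rightarrow> ('n list \<Rightarrow> complex) set" where
  "line_span x m = vec.span (pvec x m ` {P. lnc (col x m) P})"

lemma line_span_subspace: "vec.subspace (line_span x m)"
  by (simp add: line_span_def)

lemma line_span_memI:
  assumes "lnc (col x m) P" "\<And>w. length w = m \<Longrightarrow> f w = r * match P (enc x w)"
    and "\<And>w. length w \<noteq> m \<Longrightarrow> f w = 0"
  shows "f \<in> line_span x m"
proof -
  have feq: "f = vscale r (pvec x m P)" using assms(2,3) by (auto simp: fun_eq_iff vscale_def pvec_def)
  show ?thesis unfolding line_span_def feq
    by (rule vec.span_scale, rule vec.span_base) (use assms(1) in blast)
qed

text \<open>The factor \<open>c'\<close> allows \<open>T\<close> to be semilinear: it is the
  identity except for complex conjugation.\<close>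

lemma line_span_induct:
  assumes f: "f \<in> line_span x m" and W: "vec.subspace W"
    and add: "\<And>f g. T (f + g) = T f + T g" and scale: "\<And>c f. T (vscale c f) = vscale (c' c) (T f)"
    and gen: "\<And>P. lnc (col x m) P \<Longrightarrow> T (pvec x m P) \<in> W"
  shows "T f \<in> W"
  using f unfolding line_span_def
proof (induction rule: vec.span_induct_alt)
  case base
  have "T 0 = 0" using add[of 0 0] by simp
  then show ?case using vec.subspace_0[OF W] by (simp add: zero_fun_def)
next
  case (step c g h)
  then have "T g \<in> W" using gen by auto
  then have "vscale (c' c) (T g) + T h \<in> W"
    using step by (intro vec.subspace_add[OF W] vec.subspace_scale[OF W])
  then show ?case by (simp only: add scale)
qed

lemma line_span_supp:
  assumes "f \<in> line_span x m" "length w \<noteq> m" shows "f w = 0"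
proof -
  \<comment> \<open>Evaluation at \<open>w\<close>, with values in functions on a one-point type, so
    that the zero subspace can serve as \<open>W\<close>.\<close>
  have "(\<lambda>_ :: unit. f w) \<in> {\<lambda>_. 0}"
    by (rule line_span_induct[OF assms(1), where T = "\<lambda>f _. f w" and c' = "\<lambda>c. c"])
      (use assms(2) in \<open>auto simp: vec.subspace_def vscale_def fun_eq_iff pvec_def\<close>)
  then show ?thesis by (auto simp: fun_eq_iff)
qed

lemma replicate_insert2: "replicate (l + 2 + m) a = replicate l a @ [a, a] @ replicate m a"
proof -
  have "l + 2 + m = l + (2 + m)" by simp
  then show ?thesis by (simp only: replicate_add) (simp add: numeral_eq_Suc)
qed

lemma line_span_cup:
  assumes "f \<in> line_span x (l + m)" shows "cup_at l f \<in> line_span x (l + 2 + m)"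
proof (rule line_span_induct[OF assms line_span_subspace, where c' = "\<lambda>c. c" and T = "cup_at l"])
  fix P assume P: "lnc (col x (l + m)) P"
  have supp: "cup_at l (pvec x (l + m) P) w = 0" if "length w \<noteq> l + 2 + m" for w :: "'a list"
    using that by (auto simp: cup_at_def pvec_def)
  show "cup_at l (pvec x (l + m) P :: 'a list \<Rightarrow> complex) \<in> line_span x (l + 2 + m)"
  proof (cases "x = Ortho")
    case True
    note eq = replicate_insert2[of l m Col_a]
    have "lnc (col x (l + 2 + m)) (cupins l P)"
      using lnc_cup[of "replicate l Col_a" "replicate m Col_a" P Col_a] P unfolding True col.simps eq
      by (simp add: replicate_add)
    then show ?thesis
    proof (rule line_span_memI[where r = 1])
      fix w :: "'a list" assume "length w = l + 2 + m"
      then obtain v a b u where "w = v @ [a, b] @ u" "length v = l" "length u = m" by (rule split_word2)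
      then show "cup_at l (pvec x (l + m) P) w = 1 * match (cupins l P) (enc x w)"
        using cup_at_append[of v l _ a b u] match_cupins[of v l P a b u] by (simp add: pvec_def True)
    qed (rule supp)
  next
    case False
    then obtain A p q B where AB: "col x (l + m) = A @ B" "col x (l + 2 + m) = A @ [p, q, q, p] @ B" "length A = 2 * l"
      using col_insert2[of x l m] by metis
    \<comment> \<open>The two strings of a doubled cup are nested: the outer one goes in first, at
      \<open>2 * l\<close>, then the inner one between its ends.\<close>
    have "lnc (A @ [p, p] @ B) (cupins (2 * l) P)" using lnc_cup[of A B P p] P AB by simp
    then have "lnc (col x (l + 2 + m)) (cupins (Suc (2 * l)) (cupins (2 * l) P))"
      using lnc_cup[of "A @ [p]" "p # B" _ q] AB by simp
    then show ?thesis
    proof (rule line_span_memI[where r = 1])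
      fix w :: "'a list" assume "length w = l + 2 + m"
      then obtain v a b u where w: "w = v @ [a, b] @ u" "length v = l" "length u = m" by (rule split_word2)
      have e: "enc x u = dbl u" for u :: "'a list" using False by (cases x) auto
      show "cup_at l (pvec x (l + m) P) w = 1 * match (cupins (Suc (2 * l)) (cupins (2 * l) P)) (enc x w)"
        unfolding e w(1) cup_at_append[OF w(2)] match_cupins_odd[OF w(2)] match_cupins_even[OF w(2)]
        by (simp add: pvec_def w e)
    qed (rule supp)
  qed
qed (auto simp: cup_at_def vscale_def fun_eq_iff)

lemma lnc_merge_dbl:
  assumes "lnc (A @ [p, q, q, p'] @ B) P" "length A = 2 * l" "length B = 2 * m"
  shows "\<exists>P'. lnc (A @ [p, p'] @ B) P' \<and> (\<forall>v k w. length v = l \<longrightarrow> length w = m \<longrightarrow>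
    match P (dbl (v @ [k, k] @ w)) = match P' (dbl (v @ [k] @ w :: 'n list)))"
  using lnc_merge[OF assms(1), of "A @ [p]" q "p' # B" l m] assms(2,3) by simp

lemma lnc_cap_dbl:
  assumes "lnc (A @ [p, p] @ B) P" "length A = 2 * l" "length B = 2 * m"
  shows "\<exists>r P'. lnc (A @ B) P' \<and> (\<forall>v w. length v = l \<longrightarrow> length w = m \<longrightarrow>
    (\<Sum>k\<in>UNIV. match P (dbl (v @ [k] @ w))) = r * match P' (dbl (v @ w :: 'n::finite list)))"
proof -
  from lnc_cap[OF assms(1) refl] obtain r P' where "lnc (A @ B) P'"
    "\<And>v w :: 'n list. length v = length A \<Longrightarrow> length w = length B \<Longrightarrow>
      (\<Sum>k\<in>UNIV. match P (v @ [k, k] @ w)) = r * match P' (v @ w)" by blast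
  then show ?thesis using assms(2,3) by (intro exI[of _ r] exI[of _ P']) auto
qed

text \<open>On doubled letters a cap decomposes into a cap on the two inner points, which merges the
  letters (\<open>lnc_merge_dbl\<close>), and a cap on the two outer ones, which sums over the
  merged letter (\<open>lnc_cap_dbl\<close>).\<close>

lemma line_span_cap:
  assumes "f \<in> line_span x (l + 2 + m)" shows "cap_at l f \<in> line_span x (l + m)"
proof (rule line_span_induct[OF assms line_span_subspace, where c' = "\<lambda>c. c" and T = "cap_at l"])
  fix P assume P: "lnc (col x (l + 2 + m)) P"
  have supp: "cap_at l (pvec x (l + 2 + m) P) w = 0" if "length w \<noteq> l + m" for w :: "'a list"
    using that by (auto simp: cap_at_def pvec_def min_def split: if_splits)
  show "cap_at l (pvec x (l + 2 + m) P :: 'a list \<Rightarrow> complex) \<in> line_span x (l + m)"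
  proof (cases "x = Ortho")
    case True
    note eq = replicate_insert2[of l m Col_a]
    obtain r P' where P': "lnc (replicate l Col_a @ replicate m Col_a) P'"
      and cap: "\<And>v w :: 'a list. length v = l \<Longrightarrow> length w = m \<Longrightarrow>
        (\<Sum>k\<in>UNIV. match P (v @ [k, k] @ w)) = r * match P' (v @ w)"
      using lnc_cap[where 'n = 'a, OF P[unfolded True col.simps eq] refl] by auto
    have "lnc (col x (l + m)) P'" using P' by (simp add: True replicate_add)
    then show ?thesis
    proof (rule line_span_memI[where r = r])
      fix w :: "'a list" assume w: "length w = l + m"
      obtain v u where w': "w = v @ u" "length v = l" using w by (metis split_list_at le_add1)
      have "cap_at l (pvec x (l + 2 + m) P) w = (\<Sum>k\<in>UNIV. match P (v @ [k, k] @ u))"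
        unfolding w'(1) cap_at_append[OF w'(2)] using w w' by (simp add: pvec_def True)
      then show "cap_at l (pvec x (l + 2 + m) P) w = r * match P' (enc x w)"
        using cap[of v u] w w' by (simp add: True)
    qed (rule supp)
  next
    case False
    have e: "enc x u = dbl u" for u :: "'a list" using False by (cases x) auto
    obtain A p q B where AB: "col x (l + m) = A @ B" "col x (l + 2 + m) = A @ [p, q, q, p] @ B" "length A = 2 * l" "length B = 2 * m"
      using col_insert2[OF False, of l m] by metis
    obtain P1 where P1: "lnc (A @ [p, p] @ B) P1" and merge: "\<And>v k w. length v = l \<Longrightarrow> length w = m \<Longrightarrow>
        match P (dbl (v @ [k, k] @ w)) = match P1 (dbl (v @ [k] @ w :: 'a list))"
      using lnc_merge_dbl[where 'n = 'a, OF P[unfolded AB(2)] AB(3,4)] by blast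
    obtain r P' where P': "lnc (A @ B) P'" and cap: "\<And>v w. length v = l \<Longrightarrow> length w = m \<Longrightarrow>
        (\<Sum>k\<in>UNIV. match P1 (dbl (v @ [k] @ w))) = r * match P' (dbl (v @ w :: 'a list))"
      using lnc_cap_dbl[where 'n = 'a, OF P1 AB(3,4)] by blast
    show ?thesis
    proof (rule line_span_memI[OF P'[folded AB(1)], where r = r])
      fix w :: "'a list" assume w: "length w = l + m"
      obtain v u where w': "w = v @ u" "length v = l" "length u = m" using w by (metis split_list_at le_add1 length_append add_left_cancel)
      have "cap_at l (pvec x (l + 2 + m) P) w = (\<Sum>k\<in>UNIV. match P (dbl (v @ [k, k] @ u)))"
        unfolding w'(1) cap_at_append[OF w'(2)] using w w' by (simp add: pvec_def e)
      also have "\<dots> = r * match P' (dbl (v @ u))" using merge cap w' by simp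
      finally show "cap_at l (pvec x (l + 2 + m) P) w = r * match P' (enc x w)" by (simp only: e w'(1))
    qed (rule supp)
  qed
qed (auto simp: cap_at_def vscale_def fun_eq_iff sum.distrib sum_distrib_left)

lemma line_span_tensor:
  assumes f: "f \<in> line_span x l" and g: "g \<in> line_span x m"
  shows "(\<lambda>w. f (take l w) * g (drop l w)) \<in> line_span x (l + m)"
proof (rule line_span_induct[OF f line_span_subspace, where c' = "\<lambda>c. c" and T = "\<lambda>f w. f (take l w) * g (drop l w)"])
  fix P assume P: "lnc (col x l) P"
  show "(\<lambda>w :: 'a list. pvec x l P (take l w) * g (drop l w)) \<in> line_span x (l + m)"
  proof (rule line_span_induct[OF g line_span_subspace, where c' = "\<lambda>c. c" and T = "\<lambda>g w. pvec x l P (take l w) * g (drop l w)"])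
    fix Q assume Q: "lnc (col x m) Q"
    obtain R where R: "lnc (col x l @ col x m) R" "\<And>v w :: 'a list. length v = length (col x l) \<Longrightarrow>
        length w = length (col x m) \<Longrightarrow> match R (v @ w) = match P v * match Q w"
      using lnc_tensor[where 'n = 'a, OF Q P] by blast
    show "(\<lambda>w :: 'a list. pvec x l P (take l w) * pvec x m Q (drop l w)) \<in> line_span x (l + m)"
    proof (rule line_span_memI[OF R(1)[folded col_append[OF P]], where r = 1])
      fix w :: "'a list" assume w: "length w = l + m"
      obtain v u where w': "w = v @ u" "length v = l" "length u = m" using w by (metis split_list_at le_add1 length_append add_left_cancel)
      show "pvec x l P (take l w) * pvec x m Q (drop l w) = 1 * match R (enc x w)"
        using w' R(2)[of "enc x v" "enc x u"] length_col[of x v] length_col[of x u] by (simp add: pvec_def enc_append)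
    qed (auto simp: pvec_def)
  qed (auto simp: vscale_def fun_eq_iff algebra_simps)
qed (auto simp: vscale_def fun_eq_iff algebra_simps)

lemma line_span_rev:
  assumes f: "f \<in> line_span x m" shows "(\<lambda>w. f (rev w)) \<in> line_span x m"
proof (rule line_span_induct[OF f line_span_subspace, where c' = "\<lambda>c. c" and T = "\<lambda>f w. f (rev w)"])
  fix P assume P: "lnc (col x m) P"
  obtain R where R: "lnc (rev (col x m)) R" "\<And>w :: 'a list. length w = length (col x m) \<Longrightarrow> match R (rev w) = match P w"
    using lnc_rev[where 'n = 'a, OF P] by blast
  show "(\<lambda>w :: 'a list. pvec x m P (rev w)) \<in> line_span x m"
  proof (rule line_span_memI[OF R(1)[unfolded rev_col[OF P]], where r = 1])
    fix w :: "'a list" assume "length w = m"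
    then show "pvec x m P (rev w) = 1 * match R (enc x w)"
      using R(2)[of "rev (enc x w)"] length_col[of x w] by (simp add: pvec_def enc_rev)
  qed (auto simp: pvec_def)
qed (auto simp: vscale_def fun_eq_iff)

lemma line_span_cnj:
  assumes f: "f \<in> line_span x m" shows "(\<lambda>w. cnj (f w)) \<in> line_span x m"
proof (rule line_span_induct[OF f line_span_subspace, where c' = cnj and T = "\<lambda>f w. cnj (f w)"])
  fix P assume P: "lnc (col x m) P"
  show "(\<lambda>w :: 'a list. cnj (pvec x m P w)) \<in> line_span x m"
    by (rule line_span_memI[OF P, where r = 1]) (auto simp: pvec_def match_def)
qed (auto simp: vscale_def fun_eq_iff)

lemma fixed_spaces_line_span: "fixed_spaces (line_span x :: nat \<Rightarrow> ('n::finite list \<Rightarrow> complex) set)"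
proof
  show "(\<lambda>w. if w = [] then 1 else 0) \<in> (line_span x 0 :: ('n list \<Rightarrow> complex) set)"
  proof (rule line_span_memI[where r = 1])
    show "lnc (col x 0) {}" using lnc_Nil by (cases x) (auto simp: seg_def)
  qed auto
qed (fact line_span_subspace line_span_supp line_span_cnj line_span_rev line_span_tensor
    line_span_cup line_span_cap)+

text \<open>Capping the two inner points merges the letters, and a string inserted at the same place
  separates them again with the condition that they agree. Cap and string have the same colour
  \<open>q\<close>, so the cubic colouring is respected.\<close>

lemma line_span_join:
  assumes f: "f \<in> line_span x (l + 2 + m)" and x: "x \<noteq> Ortho"
  shows "join_at l f \<in> line_span x (l + 2 + m)"
proof (rule line_span_induct[OF f line_span_subspace, where c' = "\<lambda>c. c" and T = "join_at l"])
  fix P assume P: "lnc (col x (l + 2 + m)) P"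
  have e: "enc x u = dbl u" for u :: "'a list" using x by (cases x) auto
  obtain A p q B where AB: "col x (l + 2 + m) = A @ [p, q, q, p] @ B" "length A = 2 * l" "length B = 2 * m"
    using col_insert2[OF x, of l m] by metis
  obtain P1 where P1: "lnc (A @ [p, p] @ B) P1" and merge: "\<And>v k w. length v = l \<Longrightarrow> length w = m \<Longrightarrow>
      match P (dbl (v @ [k, k] @ w)) = match P1 (dbl (v @ [k] @ w :: 'a list))"
    using lnc_merge_dbl[where 'n = 'a, OF P[unfolded AB(1)] AB(2,3)] by blast
  have "lnc (col x (l + 2 + m)) (cupins (Suc (2 * l)) P1)"
    using lnc_cup[of "A @ [p]" "p # B" P1 q] P1 AB by simp
  then show "join_at l (pvec x (l + 2 + m) P :: 'a list \<Rightarrow> complex) \<in> line_span x (l + 2 + m)"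
  proof (rule line_span_memI[where r = 1])
    fix w :: "'a list" assume "length w = l + 2 + m"
    then obtain v a b u where w: "w = v @ [a, b] @ u" "length v = l" "length u = m" by (rule split_word2)
    show "join_at l (pvec x (l + 2 + m) P) w = 1 * match (cupins (Suc (2 * l)) P1) (enc x w)"
      unfolding e w(1) join_at_append[OF w(2)] match_cupins_odd[OF w(2)]
      using merge[OF w(2,3), of b] w by (simp add: pvec_def e del: dbl_simps)
  qed (auto simp: join_at_def pvec_def)
qed (auto simp: join_at_def vscale_def fun_eq_iff)

lemma cubic_spaces_line_span:
  "x \<noteq> Ortho \<Longrightarrow> cubic_spaces (line_span x :: nat \<Rightarrow> ('n::finite list \<Rightarrow> complex) set)"
  unfolding cubic_spaces_def cubic_spaces_axioms_def
  using fixed_spaces_line_span line_span_join by blast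

text \<open>With a single colour, strings may be inserted or capped at any position, so that single
  letters can be created, removed, duplicated and merged.\<close>

lemma magic_spaces_line_span: "magic_spaces (line_span Magic :: nat \<Rightarrow> ('n::finite list \<Rightarrow> complex) set)"
proof -
  interpret cubic_spaces "line_span Magic :: nat \<Rightarrow> ('n list \<Rightarrow> complex) set"
    by (rule cubic_spaces_line_span) simp
  let ?r = "\<lambda>m. replicate (2 * m) Col_a"
  have c0: "col Magic (l + m) = ?r l @ ?r m" and c1: "col Magic (l + 1 + m) = ?r l @ [Col_a, Col_a] @ ?r m"
    and c2: "col Magic (l + 2 + m) = ?r l @ [Col_a, Col_a, Col_a, Col_a] @ ?r m" for l m
  proof -
    show "col Magic (l + m) = ?r l @ ?r m" by (simp add: replicate_add distrib_left)
    have "2 * (l + 1 + m) = 2 * l + (2 + 2 * m)" "2 * (l + 2 + m) = 2 * l + (4 + 2 * m)" by simp_all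
    then show "col Magic (l + 1 + m) = ?r l @ [Col_a, Col_a] @ ?r m" "col Magic (l + 2 + m) = ?r l @ [Col_a, Col_a, Col_a, Col_a] @ ?r m"
      by (simp_all only: col.simps replicate_add) (simp_all add: numeral_eq_Suc)
  qed
  show ?thesis
  proof
    fix f :: "'n list \<Rightarrow> complex" and l m
    show "ins_at l f \<in> line_span Magic (l + 1 + m)" if f: "f \<in> line_span Magic (l + m)"
    proof (rule line_span_induct[OF f line_span_subspace, where c' = "\<lambda>c. c" and T = "ins_at l"])
      fix P assume P: "lnc (col Magic (l + m)) P"
      have "lnc (col Magic (l + 1 + m)) (cupins (2 * l) P)"
        using lnc_cup[OF P[unfolded c0], of Col_a] unfolding c1 by simp
      then show "ins_at l (pvec Magic (l + m) P :: 'n list \<Rightarrow> complex) \<in> line_span Magic (l + 1 + m)"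
      proof (rule line_span_memI[where r = 1])
        fix w :: "'n list" assume "length w = l + 1 + m"
        then obtain v a u where w: "w = v @ [a] @ u" "length v = l" "length u = m" by (rule split_word1)
        show "ins_at l (pvec Magic (l + m) P) w = 1 * match (cupins (2 * l) P) (enc Magic w)"
          unfolding enc.simps w(1) ins_at_append[OF w(2)] match_cupins_even[OF w(2)]
          using w by (simp add: pvec_def)
      qed (auto simp: ins_at_def pvec_def)
    qed (auto simp: ins_at_def vscale_def fun_eq_iff)
    show "del_at l f \<in> line_span Magic (l + m)" if f: "f \<in> line_span Magic (l + 1 + m)"
    proof (rule line_span_induct[OF f line_span_subspace, where c' = "\<lambda>c. c" and T = "del_at l"])
      fix P assume P: "lnc (col Magic (l + 1 + m)) P"
      obtain r P' where P': "lnc (?r l @ ?r m) P'" and cap: "\<And>v w. length v = l \<Longrightarrow> length w = m \<Longrightarrow>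
          (\<Sum>k\<in>UNIV. match P (dbl (v @ [k] @ w))) = r * match P' (dbl (v @ w :: 'n list))"
        using lnc_cap_dbl[where 'n = 'n, OF P[unfolded c1], of l m] by auto
      show "del_at l (pvec Magic (l + 1 + m) P :: 'n list \<Rightarrow> complex) \<in> line_span Magic (l + m)"
      proof (rule line_span_memI[OF P'[folded c0], where r = r])
        fix w :: "'n list" assume w: "length w = l + m"
        obtain v u where w': "w = v @ u" "length v = l" "length u = m"
          using w by (metis split_list_at le_add1 length_append add_left_cancel)
        have "del_at l (pvec Magic (l + 1 + m) P) w = (\<Sum>k\<in>UNIV. match P (dbl (v @ [k] @ u)))"
          unfolding w'(1) del_at_append[OF w'(2)] using w w' by (simp add: pvec_def)
        then show "del_at l (pvec Magic (l + 1 + m) P) w = r * match P' (enc Magic w)"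
          using cap[OF w'(2,3)] by (simp only: enc.simps w'(1))
      qed (auto simp: del_at_def pvec_def min_def split: if_splits)
    qed (auto simp: del_at_def vscale_def fun_eq_iff sum.distrib sum_distrib_left)
    show "dup_at l f \<in> line_span Magic (l + 2 + m)" if f: "f \<in> line_span Magic (l + 1 + m)"
    proof (rule line_span_induct[OF f line_span_subspace, where c' = "\<lambda>c. c" and T = "dup_at l"])
      fix P assume P: "lnc (col Magic (l + 1 + m)) P"
      have "lnc (col Magic (l + 2 + m)) (cupins (Suc (2 * l)) P)"
        using lnc_cup[of "?r l @ [Col_a]" "Col_a # ?r m" P Col_a] P unfolding c1 c2 by simp
      then show "dup_at l (pvec Magic (l + 1 + m) P :: 'n list \<Rightarrow> complex) \<in> line_span Magic (l + 2 + m)"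
      proof (rule line_span_memI[where r = 1])
        fix w :: "'n list" assume "length w = l + 2 + m"
        then obtain v a b u where w: "w = v @ [a, b] @ u" "length v = l" "length u = m" by (rule split_word2)
        show "dup_at l (pvec Magic (l + 1 + m) P) w = 1 * match (cupins (Suc (2 * l)) P) (enc Magic w)"
          unfolding enc.simps w(1) dup_at_append[OF w(2)] match_cupins_odd[OF w(2)]
          using w by (simp add: pvec_def)
      qed (auto simp: dup_at_def pvec_def)
    qed (auto simp: dup_at_def vscale_def fun_eq_iff)
    show "merge_at l f \<in> line_span Magic (l + 1 + m)" if f: "f \<in> line_span Magic (l + 2 + m)"
    proof (rule line_span_induct[OF f line_span_subspace, where c' = "\<lambda>c. c" and T = "merge_at l"])
      fix P assume P: "lnc (col Magic (l + 2 + m)) P"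
      obtain P1 where P1: "lnc (?r l @ [Col_a, Col_a] @ ?r m) P1" and merge: "\<And>v k w. length v = l \<Longrightarrow> length w = m \<Longrightarrow>
          match P (dbl (v @ [k, k] @ w)) = match P1 (dbl (v @ [k] @ w :: 'n list))"
        using lnc_merge_dbl[where 'n = 'n, OF P[unfolded c2], of l m] by auto
      show "merge_at l (pvec Magic (l + 2 + m) P :: 'n list \<Rightarrow> complex) \<in> line_span Magic (l + 1 + m)"
      proof (rule line_span_memI[OF P1[folded c1], where r = 1])
        fix w :: "'n list" assume "length w = l + 1 + m"
        then obtain v a u where w: "w = v @ [a] @ u" "length v = l" "length u = m" by (rule split_word1)
        show "merge_at l (pvec Magic (l + 2 + m) P) w = 1 * match P1 (enc Magic w)"
          unfolding w(1) merge_at_append[OF w(2)]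
          using merge[OF w(2,3), of a] w by (simp add: pvec_def del: dbl_simps)
      qed (auto simp: merge_at_def pvec_def min_def split: if_splits)
    qed (auto simp: merge_at_def vscale_def fun_eq_iff)
  qed
qed

lemma admissible_line_span:
  "admissible x (positive_functional.gns (fixed_spaces.haar (line_span x :: nat \<Rightarrow> ('n::finite list \<Rightarrow> complex) set)))"
  using fixed_spaces.admissible_Ortho[OF fixed_spaces_line_span]
    cubic_spaces.admissible_Cubic[OF cubic_spaces_line_span[of Cubic]]
    magic_spaces.admissible_Magic[OF magic_spaces_line_span] by (cases x) simp_all

lemma fixed_vector_in_line_span:
  fixes \<xi> :: "'n::finite list \<Rightarrow> complex"
  assumes "\<And>w. length w \<noteq> m \<Longrightarrow> \<xi> w = 0"
    and "\<And>w. length w = m \<Longrightarrow>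
      universal_seminorm (is_matrix x) ((\<Sum>w'\<in>words m. fscale (\<xi> w') (fword w w')) - fscale (\<xi> w) 1) = 0"
  shows "\<xi> \<in> line_span x m"
proof -
  interpret fixed_spaces "line_span x :: nat \<Rightarrow> ('n list \<Rightarrow> complex) set" by (rule fixed_spaces_line_span)
  show ?thesis by (rule fixed_vector_in_V[OF admissible_line_span assms])
qed

section \<open>Calculation modulo the null space of a C*-seminorm\<close>

lemma sum_fscale: "fscale c (\<Sum>i\<in>S. f i) = (\<Sum>i\<in>S. fscale c (f i))"
  by (simp add: fscale_def sum_distrib_left)

lemma fscale_0 [simp]: "fscale 0 a = 0" "fscale c 0 = 0"
  by (simp_all add: fscale_def)

text \<open>If \<open>u\<close> is cubic, then the entries \<open>u\<^sub>i\<^sub>j\<^sup>2\<close> form a magic unitary.  A letter of a doubled word stands for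
  \<open>u\<close> if its two copies have different colours and for this magic unitary otherwise, so that
  strings may be removed one at a time.\<close>

definition lett :: "bool \<Rightarrow> 'g \<Rightarrow> 'g free_star" where
  "lett t g = (if t then fgen g else fgen g * fgen g)"

definition tword :: "bool list \<Rightarrow> 'n list \<Rightarrow> 'n list \<Rightarrow> ('n \<times> 'n) free_star" where
  "tword ts w w' = prod_list (map (\<lambda>(t, g). lett t g) (zip ts (zip w w')))"

lemma tword_append:
  "length ts = length v \<Longrightarrow> length v = length v' \<Longrightarrow> tword (ts @ ts') (v @ w) (v' @ w') = tword ts v v' * tword ts' w w'"
  by (simp add: tword_def)

lemma tword_Cons: "tword (t # ts) (i # v) (j # w) = lett t (i, j) * tword ts v w"
  by (simp add: tword_def)

lemma fword_Cons: "fword (i # v) (j # w) = fgen (i, j) * fword v w"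
  by (simp add: fword_def fgen_def mult_single plus_star_word_def)

lemma fword_Nil [simp]: "fword [] w = 1"
  by (simp add: fword_def flip: zero_star_word_def)

lemma fword_append: "length v = length v' \<Longrightarrow> fword (v @ w) (v' @ w') = fword v v' * fword w w'"
  by (induction v v' rule: list_induct2) (simp_all add: fword_Cons mult.assoc)

lemma tword_True: "length v = length w \<Longrightarrow> tword (replicate (length v) True) v w = fword v w"
  by (induction v w rule: list_induct2) (simp_all add: fword_Cons tword_Cons lett_def, simp add: tword_def)

fun types :: "'c list \<Rightarrow> bool list" where
  "types (x # y # c) = (x \<noteq> y) # types c"
| "types _ = []"

lemma types_append: "even (length c) \<Longrightarrow> types (c @ d) = types c @ types d"
  by (induction c rule: types.induct) auto

lemma length_types: "length (types c) = length c div 2"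
  by (induction c rule: types.induct) auto

context seminorm_cstar begin

definition eqv :: "'g free_star \<Rightarrow> 'g free_star \<Rightarrow> bool" where "eqv a b \<longleftrightarrow> p (a - b) = 0"

lemma eqv_refl [simp]: "eqv a a"
  by (simp add: eqv_def)

lemma eqv_sym: "eqv a b \<Longrightarrow> eqv b a"
  by (simp add: eqv_def p_diff_commute)

lemma eqv_trans [trans]: "eqv a b \<Longrightarrow> eqv b c \<Longrightarrow> eqv a c"
  using p_diff_triangle[of a c b] p_nonneg[of "a - c"] by (simp add: eqv_def)

lemma eqv_add: "eqv a b \<Longrightarrow> eqv c d \<Longrightarrow> eqv (a + c) (b + d)"
  using p_add[of "a - b" "c - d"] p_nonneg[of "a + c - (b + d)"] by (simp add: eqv_def algebra_simps)

lemma eqv_mult_left: "eqv a b \<Longrightarrow> eqv (c * a) (c * b)"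
  using p_mult[of c "a - b"] p_nonneg[of "c * a - c * b"] by (simp add: eqv_def algebra_simps)

lemma eqv_mult_right: "eqv a b \<Longrightarrow> eqv (a * c) (b * c)"
  using p_mult[of "a - b" c] p_nonneg[of "a * c - b * c"] by (simp add: eqv_def algebra_simps)

lemma eqv_mult: "eqv a b \<Longrightarrow> eqv c d \<Longrightarrow> eqv (a * c) (b * d)"
  using eqv_trans[OF eqv_mult_right eqv_mult_left] .

lemma eqv_fscale: "eqv a b \<Longrightarrow> eqv (fscale c a) (fscale c b)"
  by (simp add: eqv_def p_scale flip: fscale_simps)

lemma eqv_sum: "(\<And>i. i \<in> S \<Longrightarrow> eqv (f i) (g i)) \<Longrightarrow> eqv (\<Sum>i\<in>S. f i) (\<Sum>i\<in>S. g i)"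
  by (induction S rule: infinite_finite_induct) (auto intro: eqv_add)

lemma eqv_eq_trans [trans]: "eqv a b \<Longrightarrow> b = c \<Longrightarrow> eqv a c" "a = b \<Longrightarrow> eqv b c \<Longrightarrow> eqv a c"
  by simp_all

end

locale ortho_seminorm = seminorm_cstar p for p :: "('n::finite \<times> 'n) free_star \<Rightarrow> real" +
  assumes ortho: "ortho_rel eqv"
begin

lemma eqv_gen_star: "eqv (fstar (fgen g)) (fgen g)"
  using ortho by (cases g) (simp add: ortho_rel_def)

lemma eqv_row: "eqv (\<Sum>k\<in>UNIV. fgen (i, k) * fgen (j, k)) (if i = j then 1 else 0)"
proof -
  have "eqv (\<Sum>k\<in>UNIV. fgen (i, k) * fgen (j, k)) (\<Sum>k\<in>UNIV. fgen (i, k) * fstar (fgen (j, k)))"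
    by (intro eqv_sum eqv_mult_left eqv_sym[OF eqv_gen_star])
  also have "eqv \<dots> (if i = j then 1 else 0)" using ortho by (simp add: ortho_rel_def)
  finally show ?thesis .
qed

lemma eqv_column: "eqv (\<Sum>k\<in>UNIV. fgen (k, i) * fgen (k, j)) (if i = j then 1 else 0)"
proof -
  have "eqv (\<Sum>k\<in>UNIV. fgen (k, i) * fgen (k, j)) (\<Sum>k\<in>UNIV. fstar (fgen (k, i)) * fgen (k, j))"
    by (intro eqv_sum eqv_mult_right eqv_sym[OF eqv_gen_star])
  also have "eqv \<dots> (if i = j then 1 else 0)" using ortho by (simp add: ortho_rel_def)
  finally show ?thesis .
qed

lemma fixed_line_Ortho:
  assumes "lnc c P" "length w = length c"
  shows "eqv (\<Sum>w'\<in>words (length c). fscale (match P w') (fword w w')) (fscale (match P w) 1)"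
  using assms
proof (induction arbitrary: w)
  case lnc_Nil
  then show ?case by simp
next
  case (lnc_cup c1 c2 P x)
  let ?l = "length c1" and ?m = "length c2"
  have "length w = ?l + 2 + ?m" using lnc_cup.prems by simp
  then obtain v a b u where w: "w = v @ [a, b] @ u" "length v = ?l" "length u = ?m" by (rule split_word2)
  let ?M = "cupins ?l P"
  have "(\<Sum>w'\<in>words (length (c1 @ [x, x] @ c2)). fscale (match ?M w') (fword w w')) =
      (\<Sum>w'\<in>words (?l + 2 + ?m). fscale (match ?M w') (fword w w'))" by simp
  also have "\<dots> = (\<Sum>v'\<in>words ?l. \<Sum>k\<in>UNIV. \<Sum>k'\<in>UNIV. \<Sum>u'\<in>words ?m.
      fscale (match ?M (v' @ [k, k'] @ u')) (fword w (v' @ [k, k'] @ u')))"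
    by (simp only: sum_words_append sum_words_2 append_assoc)
  also have "\<dots> = (\<Sum>v'\<in>words ?l. \<Sum>k\<in>UNIV. \<Sum>k'\<in>UNIV. if k = k' then \<Sum>u'\<in>words ?m.
      fscale (match P (v' @ u')) (fword v v' * (fgen (a, k) * fgen (b, k)) * fword u u') else 0)"
    by (intro sum.cong refl) (simp add: match_cupins[simplified] w fword_append fword_Cons mult.assoc)
  also have "\<dots> = (\<Sum>v'\<in>words ?l. \<Sum>k\<in>UNIV. \<Sum>u'\<in>words ?m.
      fscale (match P (v' @ u')) (fword v v' * (fgen (a, k) * fgen (b, k)) * fword u u'))"
    by simp
  also have "\<dots> = (\<Sum>v'\<in>words ?l. \<Sum>u'\<in>words ?m. \<Sum>k\<in>UNIV.
      fscale (match P (v' @ u')) (fword v v' * (fgen (a, k) * fgen (b, k)) * fword u u'))"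
    by (intro sum.cong refl sum.swap)
  also have "\<dots> = (\<Sum>v'\<in>words ?l. \<Sum>u'\<in>words ?m.
      fscale (match P (v' @ u')) (fword v v' * (\<Sum>k\<in>UNIV. fgen (a, k) * fgen (b, k)) * fword u u'))"
    by (simp add: sum_fscale sum_distrib_left sum_distrib_right)
  also have "eqv \<dots> (\<Sum>v'\<in>words ?l. \<Sum>u'\<in>words ?m.
      fscale (match P (v' @ u')) (fword v v' * (if a = b then 1 else 0) * fword u u'))"
    by (intro eqv_sum eqv_fscale eqv_mult_left eqv_mult_right eqv_row)
  also have "\<dots> = (if a = b then \<Sum>w'\<in>words (length (c1 @ c2)). fscale (match P w') (fword (v @ u) w') else 0)"
    by (simp add: sum_words_append fword_append w)
  also have "eqv \<dots> (if a = b then fscale (match P (v @ u)) 1 else 0)"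
    using lnc_cup.IH[of "v @ u"] w by simp
  also have "\<dots> = fscale (match ?M w) 1"
    unfolding w(1) match_cupins[OF w(2)] by simp
  finally show ?case .
qed

text \<open>Modulo the null space the generators are self-adjoint, so
  \<open>fword (rev b) (rev i)\<close> is the adjoint of \<open>fword b i\<close>. The inner letters
  of the product are contracted first: here the last letters of \<open>a\<close> and
  \<open>b\<close>, in \<open>fword_unitary_2\<close> the first ones.\<close>

lemma fword_unitary_1:
  "length a = l \<Longrightarrow> length b = l \<Longrightarrow> eqv (\<Sum>i\<in>words l. fword a i * fword (rev b) (rev i)) (if a = b then 1 else 0)"
proof (induction l arbitrary: a b)
  case (Suc l)
  obtain a0 x b0 y where ab: "a = a0 @ [x]" "b = b0 @ [y]" "length a0 = l" "length b0 = l"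
    using Suc.prems by (cases a rule: rev_cases; cases b rule: rev_cases) auto
  have "(\<Sum>i\<in>words (Suc l). fword a i * fword (rev b) (rev i)) =
      (\<Sum>i\<in>words (l + Suc 0). fword a i * fword (rev b) (rev i))" by simp
  also have "\<dots> = (\<Sum>i\<in>words l. \<Sum>k\<in>UNIV. fword a0 i * (fgen (x, k) * fgen (y, k)) * fword (rev b0) (rev i))"
    unfolding sum_words_append sum_words_1
    by (intro sum.cong refl) (simp add: ab fword_append fword_Cons mult.assoc)
  also have "\<dots> = (\<Sum>i\<in>words l. fword a0 i * (\<Sum>k\<in>UNIV. fgen (x, k) * fgen (y, k)) * fword (rev b0) (rev i))"
    by (simp add: sum_distrib_left sum_distrib_right)
  also have "eqv \<dots> (\<Sum>i\<in>words l. fword a0 i * (if x = y then 1 else 0) * fword (rev b0) (rev i))"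
    by (intro eqv_sum eqv_mult_left eqv_mult_right eqv_row)
  also have "\<dots> = (if x = y then \<Sum>i\<in>words l. fword a0 i * fword (rev b0) (rev i) else 0)" by simp
  also have "eqv \<dots> (if a = b then 1 else 0)"
    using Suc.IH[OF ab(3,4)] ab by auto
  finally show ?case .
qed simp

lemma fword_unitary_2:
  "length a = l \<Longrightarrow> length b = l \<Longrightarrow> eqv (\<Sum>i\<in>words l. fword (rev i) (rev a) * fword i b) (if a = b then 1 else 0)"
proof (induction l arbitrary: a b)
  case (Suc l)
  obtain a0 x b0 y where ab: "a = x # a0" "b = y # b0" "length a0 = l" "length b0 = l"
    using Suc.prems by (cases a; cases b) auto
  have "(\<Sum>i\<in>words (Suc l). fword (rev i) (rev a) * fword i b) =
      (\<Sum>i\<in>words (Suc 0 + l). fword (rev i) (rev a) * fword i b)" by simp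
  also have "\<dots> = (\<Sum>k\<in>UNIV. \<Sum>i\<in>words l. fword (rev i) (rev a0) * (fgen (k, x) * fgen (k, y)) * fword i b0)"
    unfolding sum_words_append sum_words_1
    by (intro sum.cong refl) (simp add: ab fword_append fword_Cons mult.assoc)
  also have "\<dots> = (\<Sum>i\<in>words l. \<Sum>k\<in>UNIV. fword (rev i) (rev a0) * (fgen (k, x) * fgen (k, y)) * fword i b0)"
    by (rule sum.swap)
  also have "\<dots> = (\<Sum>i\<in>words l. fword (rev i) (rev a0) * (\<Sum>k\<in>UNIV. fgen (k, x) * fgen (k, y)) * fword i b0)"
    by (simp add: sum_distrib_left sum_distrib_right)
  also have "eqv \<dots> (\<Sum>i\<in>words l. fword (rev i) (rev a0) * (if x = y then 1 else 0) * fword i b0)"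
    by (intro eqv_sum eqv_mult_left eqv_mult_right eqv_column)
  also have "\<dots> = (if x = y then \<Sum>i\<in>words l. fword (rev i) (rev a0) * fword i b0 else 0)" by simp
  also have "eqv \<dots> (if a = b then 1 else 0)"
    using Suc.IH[OF ab(3,4)] ab by auto
  finally show ?case .
qed simp

text \<open>Frobenius duality: the matrix \<open>(u\<^sub>i\<^sub>j)\<close> indexed by words is invertible, the inverse having the entries
  at the reversed words and transposed.\<close>

lemma frobenius:
  "(\<forall>i\<in>words l. \<forall>j\<in>words k. eqv (\<Sum>i'\<in>words l. fscale (t j i') (fword i' i))
      (\<Sum>j'\<in>words k. fscale (t j' i) (fword j j'))) \<longleftrightarrow>
   (\<forall>i\<in>words l. \<forall>j\<in>words k. eqv (\<Sum>j'\<in>words k. \<Sum>i'\<in>words l.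
      fscale (t j' i') (fword j j' * fword (rev i) (rev i'))) (fscale (t j i) 1))"
  (is "?hom \<longleftrightarrow> ?fix")
proof (intro iffI ballI)
  fix i j :: "'n list" assume hom: ?hom and i: "i \<in> words l" and j: "j \<in> words k"
  have "(\<Sum>j'\<in>words k. \<Sum>i'\<in>words l. fscale (t j' i') (fword j j' * fword (rev i) (rev i'))) =
      (\<Sum>i'\<in>words l. \<Sum>j'\<in>words k. fscale (t j' i') (fword j j' * fword (rev i) (rev i')))"
    by (rule sum.swap)
  also have "\<dots> = (\<Sum>i'\<in>words l. (\<Sum>j'\<in>words k. fscale (t j' i') (fword j j')) * fword (rev i) (rev i'))"
    by (simp add: sum_distrib_right fscale_simps)
  also have "eqv \<dots> (\<Sum>i'\<in>words l. (\<Sum>i''\<in>words l. fscale (t j i'') (fword i'' i')) * fword (rev i) (rev i'))"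
    using hom j by (intro eqv_sum eqv_mult_right) (auto intro: eqv_sym)
  also have "\<dots> = (\<Sum>i'\<in>words l. \<Sum>i''\<in>words l. fscale (t j i'') (fword i'' i' * fword (rev i) (rev i')))"
    by (simp add: sum_distrib_right fscale_simps)
  also have "\<dots> = (\<Sum>i''\<in>words l. fscale (t j i'') (\<Sum>i'\<in>words l. fword i'' i' * fword (rev i) (rev i')))"
    by (subst sum.swap) (simp add: sum_fscale)
  also have "eqv \<dots> (\<Sum>i''\<in>words l. fscale (t j i'') (if i'' = i then 1 else 0))"
    using i by (intro eqv_sum eqv_fscale fword_unitary_1) auto
  also have "\<dots> = fscale (t j i) 1"
    using i by (simp add: if_distrib[of "fscale _"] finite_words cong: if_cong)
  finally show "eqv (\<Sum>j'\<in>words k. \<Sum>i'\<in>words l. fscale (t j' i') (fword j j' * fword (rev i) (rev i'))) (fscale (t j i) 1)" .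
next
  fix i j :: "'n list" assume fixed: ?fix and i: "i \<in> words l" and j: "j \<in> words k"
  have "(\<Sum>i'\<in>words l. fscale (t j i') (fword i' i)) = (\<Sum>i'\<in>words l. fscale (t j i') 1 * fword i' i)"
    by (simp add: fscale_simps)
  also have "eqv \<dots> (\<Sum>i'\<in>words l. (\<Sum>j'\<in>words k. \<Sum>i''\<in>words l.
      fscale (t j' i'') (fword j j' * fword (rev i') (rev i''))) * fword i' i)"
    using fixed j by (intro eqv_sum eqv_mult_right) (auto intro: eqv_sym)
  also have "\<dots> = (\<Sum>i'\<in>words l. \<Sum>j'\<in>words k. \<Sum>i''\<in>words l.
      fscale (t j' i'') (fword j j' * (fword (rev i') (rev i'') * fword i' i)))"
    by (simp add: sum_distrib_right fscale_simps mult.assoc)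
  also have "\<dots> = (\<Sum>j'\<in>words k. \<Sum>i'\<in>words l. \<Sum>i''\<in>words l.
      fscale (t j' i'') (fword j j' * (fword (rev i') (rev i'') * fword i' i)))"
    by (rule sum.swap)
  also have "\<dots> = (\<Sum>j'\<in>words k. \<Sum>i''\<in>words l. \<Sum>i'\<in>words l.
      fscale (t j' i'') (fword j j' * (fword (rev i') (rev i'') * fword i' i)))"
    by (intro sum.cong refl sum.swap)
  also have "\<dots> = (\<Sum>j'\<in>words k. \<Sum>i''\<in>words l.
      fscale (t j' i'') (fword j j' * (\<Sum>i'\<in>words l. fword (rev i') (rev i'') * fword i' i)))"
    by (simp add: sum_fscale sum_distrib_left)
  also have "eqv \<dots> (\<Sum>j'\<in>words k. \<Sum>i''\<in>words l. fscale (t j' i'') (fword j j' * (if i'' = i then 1 else 0)))"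
    using i by (intro eqv_sum eqv_fscale eqv_mult_left fword_unitary_2) auto
  also have "\<dots> = (\<Sum>j'\<in>words k. fscale (t j' i) (fword j j'))"
    using i by (simp add: if_distrib[of "fscale _"] if_distrib[of "(*) _"] finite_words cong: if_cong)
  finally show "eqv (\<Sum>i'\<in>words l. fscale (t j i') (fword i' i)) (\<Sum>j'\<in>words k. fscale (t j' i) (fword j j'))" .
qed

end

section \<open>Fixed vectors under the cubic relations\<close>

locale cubic_seminorm = ortho_seminorm p for p :: "('n::finite \<times> 'n) free_star \<Rightarrow> real" +
  assumes prod_zero: "j \<noteq> k \<Longrightarrow> eqv (fgen (i, j) * fgen (i, k)) 0" "j \<noteq> k \<Longrightarrow> eqv (fgen (j, i) * fgen (k, i)) 0"
begin

text \<open>Multiply the row relation by \<open>u_ik\<close>: of the squares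
  \<open>u_ik' u_ik'\<close> only the one with \<open>k' = k\<close> survives.\<close>

lemma eqv_cube: "eqv (fgen (i, k) * fgen (i, k) * fgen (i, k)) (fgen (i, k))"
proof -
  have "fgen (i, k) * fgen (i, k) * fgen (i, k) =
      (\<Sum>k'\<in>UNIV. if k' = k then fgen (i, k) * fgen (i, k') * fgen (i, k') else 0)" by simp
  also have "eqv \<dots> (\<Sum>k'\<in>UNIV. fgen (i, k) * fgen (i, k') * fgen (i, k'))"
  proof (intro eqv_sum)
    fix k'
    show "eqv (if k' = k then fgen (i, k) * fgen (i, k') * fgen (i, k') else 0) (fgen (i, k) * fgen (i, k') * fgen (i, k'))"
      using eqv_sym[OF eqv_mult_right[OF prod_zero(1)[of k k' i], of "fgen (i, k')"]] by auto
  qed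
  also have "\<dots> = fgen (i, k) * (\<Sum>k'\<in>UNIV. fgen (i, k') * fgen (i, k'))"
    by (simp add: sum_distrib_left mult.assoc)
  also have "eqv \<dots> (fgen (i, k) * 1)" using eqv_mult_left[OF eqv_row[of i i]] by simp
  finally show ?thesis by simp
qed

lemma eqv_lett_sum: "eqv (\<Sum>k\<in>UNIV. lett False (i, k)) 1"
  using eqv_row[of i i] by (simp add: lett_def)

text \<open>A letter carries the parity of an exponent: by \<open>eqv_cube\<close> a positive power
  of \<open>u_ik\<close> depends only on it, and multiplication adds parities.\<close>

lemma eqv_lett_mult: "eqv (lett s (i, k) * lett t (j, k)) (if i = j then lett (s \<noteq> t) (i, k) else 0)"
proof (cases "i = j")
  case True
  have 1: "eqv (fgen (i, k) * (fgen (i, k) * fgen (i, k))) (fgen (i, k))"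
    using eqv_cube by (simp add: mult.assoc)
  have 2: "eqv (fgen (i, k) * fgen (i, k) * (fgen (i, k) * fgen (i, k))) (fgen (i, k) * fgen (i, k))"
    using eqv_mult_left[OF 1, of "fgen (i, k)"] by (simp add: mult.assoc)
  show ?thesis using True 1 2 eqv_cube by (cases s; cases t) (auto simp: lett_def)
next
  case False
  have z: "eqv (x * (fgen (i, k) * fgen (j, k)) * y) 0" for x y
    using eqv_mult_right[OF eqv_mult_left[OF prod_zero(2)[OF False]]] by simp
  show ?thesis
    using z[of 1 1] z[of "fgen (i, k)" 1] z[of 1 "fgen (j, k)"] z[of "fgen (i, k)" "fgen (j, k)"] False
    by (cases s; cases t) (auto simp: lett_def mult.assoc)
qed

text \<open>A string at an even position sits on a letter of type \<open>False\<close>, an entry of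
  the magic unitary of squares, and is removed by the row sums. A string at an odd position merges
  two letters by \<open>eqv_lett_mult\<close>.\<close>

lemma fixed_line_typed:
  assumes "lnc (c :: colour list) P" "length c = 2 * length w"
  shows "eqv (\<Sum>w'\<in>words (length w). fscale (match P (dbl w')) (tword (types c) w w')) (fscale (match P (dbl w)) 1)"
  using assms
proof (induction arbitrary: w)
  case lnc_Nil
  then show ?case by (simp add: tword_def)
next
  case (lnc_cup c1 c2 P x)
  show ?case
  proof (cases "even (length c1)")
    case True
    then obtain l where l: "length c1 = 2 * l" by blast
    define m where "m = length w - (l + 1)"
    have m: "length c2 = 2 * m" "length w = l + 1 + m" using lnc_cup.prems l by (auto simp: m_def)
    obtain v a u where w: "w = v @ [a] @ u" "length v = l" "length u = m" using m(2) by (rule split_word1)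
    have ty: "types (c1 @ [x, x] @ c2) = types c1 @ [False] @ types c2" "types (c1 @ c2) = types c1 @ types c2"
      using True by (simp_all add: types_append)
    have lt: "length (types c1) = l" "length (types c2) = m" using l m by (simp_all add: length_types)
    let ?M = "cupins (2 * l) P"
    have "(\<Sum>w'\<in>words (l + 1 + m). fscale (match ?M (dbl w')) (tword (types (c1 @ [x, x] @ c2)) w w')) =
        (\<Sum>v'\<in>words l. \<Sum>k\<in>UNIV. \<Sum>u'\<in>words m.
          fscale (match ?M (dbl (v' @ [k] @ u'))) (tword (types (c1 @ [x, x] @ c2)) w (v' @ [k] @ u')))"
      by (simp only: sum_words_append sum_words_1 One_nat_def append_assoc)
    also have "\<dots> = (\<Sum>v'\<in>words l. \<Sum>k\<in>UNIV. \<Sum>u'\<in>words m. fscale (match P (dbl (v' @ u')))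
        (tword (types c1) v v' * lett False (a, k) * tword (types c2) u u'))"
    proof (intro sum.cong refl)
      fix v' u' :: "'n list" and k assume "v' \<in> words l" "u' \<in> words m"
      then have v': "length v' = l" "length u' = m" by auto
      show "fscale (match ?M (dbl (v' @ [k] @ u'))) (tword (types (c1 @ [x, x] @ c2)) w (v' @ [k] @ u')) =
          fscale (match P (dbl (v' @ u'))) (tword (types c1) v v' * lett False (a, k) * tword (types c2) u u')"
        unfolding match_cupins_even[OF v'(1)] ty w(1) using w v' lt
        by (simp add: tword_append tword_Cons mult.assoc)
    qed
    also have "\<dots> = (\<Sum>v'\<in>words l. \<Sum>u'\<in>words m. \<Sum>k\<in>UNIV. fscale (match P (dbl (v' @ u')))
        (tword (types c1) v v' * lett False (a, k) * tword (types c2) u u'))"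
      by (intro sum.cong refl sum.swap)
    also have "\<dots> = (\<Sum>v'\<in>words l. \<Sum>u'\<in>words m. fscale (match P (dbl (v' @ u')))
        (tword (types c1) v v' * (\<Sum>k\<in>UNIV. lett False (a, k)) * tword (types c2) u u'))"
      by (simp add: sum_fscale sum_distrib_left sum_distrib_right)
    also have "eqv \<dots> (\<Sum>v'\<in>words l. \<Sum>u'\<in>words m. fscale (match P (dbl (v' @ u')))
        (tword (types c1) v v' * 1 * tword (types c2) u u'))"
      by (intro eqv_sum eqv_fscale eqv_mult_left eqv_mult_right eqv_lett_sum)
    also have "\<dots> = (\<Sum>w'\<in>words (length (v @ u)). fscale (match P (dbl w')) (tword (types (c1 @ c2)) (v @ u) w'))"
      using w lt by (simp add: sum_words_append ty tword_append)
    also have "eqv \<dots> (fscale (match P (dbl (v @ u))) 1)"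
      by (rule lnc_cup.IH) (use w l m in auto)
    also have "\<dots> = fscale (match ?M (dbl w)) 1"
      unfolding w(1) match_cupins_even[OF w(2)] ..
    finally show ?thesis by (simp only: l m(2))
  next
    case False
    then obtain l where l: "length c1 = Suc (2 * l)" by (metis oddE Suc_eq_plus1)
    obtain A q where c1: "c1 = A @ [q]" "length A = 2 * l" using l by (cases c1 rule: rev_cases) auto
    define m where "m = length w - (l + 2)"
    have e: "Suc (2 * l) + 2 + length c2 = 2 * length w" using lnc_cup.prems l by simp
    have lw: "length w = l + 2 + m" using e unfolding m_def by presburger
    then have m: "length c2 = Suc (2 * m)" "length w = l + 2 + m" using e by simp_all
    obtain r B where c2: "c2 = r # B" "length B = 2 * m" using m by (cases c2) auto
    obtain v a b u where w: "w = v @ [a, b] @ u" "length v = l" "length u = m" using m(2) by (rule split_word2)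
    \<comment> \<open>With two colours only, the difference of \<open>q\<close> and \<open>r\<close>
      is the sum modulo 2 of the differences along \<open>q\<close>, \<open>x\<close>,
      \<open>r\<close>; so the merged letter has the type given by its outer colours.\<close>
    have "(q \<noteq> r) = ((q \<noteq> x) \<noteq> (x \<noteq> r))" by (cases q; cases r; cases x) auto
    then have ty: "types (c1 @ [x, x] @ c2) = types A @ [q \<noteq> x, x \<noteq> r] @ types B"
        "types (c1 @ c2) = types A @ [(q \<noteq> x) \<noteq> (x \<noteq> r)] @ types B"
      using c1 c2 by (simp_all add: types_append)
    have lt: "length (types A) = l" "length (types B) = m" using c1 c2 by (simp_all add: length_types)
    let ?M = "cupins (Suc (2 * l)) P"
    have "(\<Sum>w'\<in>words (l + 2 + m). fscale (match ?M (dbl w')) (tword (types (c1 @ [x, x] @ c2)) w w')) =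
        (\<Sum>v'\<in>words l. \<Sum>k\<in>UNIV. \<Sum>k'\<in>UNIV. \<Sum>u'\<in>words m.
          fscale (match ?M (dbl (v' @ [k, k'] @ u'))) (tword (types (c1 @ [x, x] @ c2)) w (v' @ [k, k'] @ u')))"
      by (simp only: sum_words_append sum_words_2 append_assoc)
    also have "\<dots> = (\<Sum>v'\<in>words l. \<Sum>k\<in>UNIV. \<Sum>k'\<in>UNIV. if k = k' then \<Sum>u'\<in>words m. fscale (match P (dbl (v' @ [k] @ u')))
        (tword (types A) v v' * (lett (q \<noteq> x) (a, k) * lett (x \<noteq> r) (b, k)) * tword (types B) u u') else 0)"
    proof (intro sum.cong refl)
      fix v' :: "'n list" and k k' assume "v' \<in> words l"
      then have v': "length v' = l" by auto
      show "(\<Sum>u'\<in>words m. fscale (match ?M (dbl (v' @ [k, k'] @ u'))) (tword (types (c1 @ [x, x] @ c2)) w (v' @ [k, k'] @ u'))) =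
        (if k = k' then \<Sum>u'\<in>words m. fscale (match P (dbl (v' @ [k] @ u')))
        (tword (types A) v v' * (lett (q \<noteq> x) (a, k) * lett (x \<noteq> r) (b, k)) * tword (types B) u u') else 0)"
        unfolding match_cupins_odd[OF v'] ty w(1) using w v' lt
        by (simp add: tword_append tword_Cons mult.assoc)
    qed
    also have "\<dots> = (\<Sum>v'\<in>words l. \<Sum>k\<in>UNIV. \<Sum>u'\<in>words m. fscale (match P (dbl (v' @ [k] @ u')))
        (tword (types A) v v' * (lett (q \<noteq> x) (a, k) * lett (x \<noteq> r) (b, k)) * tword (types B) u u'))"
      by simp
    also have "eqv \<dots> (\<Sum>v'\<in>words l. \<Sum>k\<in>UNIV. \<Sum>u'\<in>words m. fscale (match P (dbl (v' @ [k] @ u')))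
        (tword (types A) v v' * (if a = b then lett ((q \<noteq> x) \<noteq> (x \<noteq> r)) (a, k) else 0) * tword (types B) u u'))"
      by (intro eqv_sum eqv_fscale eqv_mult_left eqv_mult_right eqv_lett_mult)
    also have "\<dots> = (if a = b then \<Sum>w'\<in>words (length (v @ [a] @ u)). fscale (match P (dbl w')) (tword (types (c1 @ c2)) (v @ [a] @ u) w') else 0)"
    proof -
      have "length (v @ [a] @ u) = l + Suc 0 + m" using w by simp
      then show ?thesis
        using w lt by (simp only: sum_words_append sum_words_1) (simp add: ty tword_append tword_Cons mult.assoc)
    qed
    also have "eqv \<dots> (if a = b then fscale (match P (dbl (v @ [a] @ u))) 1 else 0)"
      using lnc_cup.IH[of "v @ [a] @ u"] w l m by (auto simp del: dbl_simps)
    also have "\<dots> = fscale (match ?M (dbl w)) 1"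
      unfolding w(1) match_cupins_odd[OF w(2)] by (simp del: dbl_simps)
    finally show ?thesis by (simp only: l m(2))
  qed
qed

end

text \<open>For \<open>i = j\<close> the orthogonality relation is a row or column sum of
  projections; for distinct \<open>i\<close>, \<open>j\<close> all its terms vanish.\<close>

lemma gen_rel_Magic_imp_Cubic:
  fixes p :: "('n::finite \<times> 'n) free_star \<Rightarrow> real"
  assumes "cstar_seminorm p" "gen_rel Magic (seminorm_cstar.eqv p)"
  shows "gen_rel Cubic (seminorm_cstar.eqv p)"
proof -
  interpret seminorm_cstar p using assms by unfold_locales
  have star: "eqv (fstar (fgen g)) (fgen g)" and sq: "eqv (fgen g * fgen g) (fgen g)"
    and prod: "j \<noteq> k \<Longrightarrow> eqv (fgen (i, j) * fgen (i, k)) 0" "j \<noteq> k \<Longrightarrow> eqv (fgen (j, i) * fgen (k, i)) 0"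
    and sum: "eqv (\<Sum>j\<in>UNIV. fgen (i, j)) 1" "eqv (\<Sum>j\<in>UNIV. fgen (j, i)) 1" for g i j k
    using assms(2) by (cases g; simp)+
  have 1: "eqv (\<Sum>k\<in>UNIV. fgen (i, k) * fstar (fgen (j, k))) (if i = j then 1 else 0)" for i j
  proof -
    have "eqv (\<Sum>k\<in>UNIV. fgen (i, k) * fstar (fgen (j, k))) (\<Sum>k\<in>UNIV. fgen (i, k) * fgen (j, k))"
      by (intro eqv_sum eqv_mult_left star)
    also have "eqv \<dots> (\<Sum>k\<in>UNIV. if i = j then fgen (i, k) else 0)"
      using sq prod by (intro eqv_sum) auto
    also have "\<dots> = (if i = j then \<Sum>k\<in>UNIV. fgen (i, k) else 0)" by simp
    also have "eqv \<dots> (if i = j then 1 else 0)" using sum by simp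
    finally show ?thesis .
  qed
  have 2: "eqv (\<Sum>k\<in>UNIV. fstar (fgen (k, i)) * fgen (k, j)) (if i = j then 1 else 0)" for i j
  proof -
    have "eqv (\<Sum>k\<in>UNIV. fstar (fgen (k, i)) * fgen (k, j)) (\<Sum>k\<in>UNIV. fgen (k, i) * fgen (k, j))"
      by (intro eqv_sum eqv_mult_right star)
    also have "eqv \<dots> (\<Sum>k\<in>UNIV. if i = j then fgen (k, i) else 0)"
      using sq prod by (intro eqv_sum) auto
    also have "\<dots> = (if i = j then \<Sum>k\<in>UNIV. fgen (k, i) else 0)" by simp
    also have "eqv \<dots> (if i = j then 1 else 0)" using sum by simp
    finally show ?thesis .
  qed
  show ?thesis using 1 2 star prod by (simp add: ortho_rel_def)
qed

section \<open>Intertwiners as fixed vectors\<close>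

abbreviation univ :: "species \<Rightarrow> ('n::finite \<times> 'n) free_star \<Rightarrow> real" where
  "univ x \<equiv> universal_seminorm (is_matrix x)"

lemma gen_rel_univ: "gen_rel x (seminorm_cstar.eqv (univ x :: ('n::finite \<times> 'n) free_star \<Rightarrow> real))"
proof -
  interpret seminorm_cstar "univ x :: ('n \<times> 'n) free_star \<Rightarrow> real"
    by unfold_locales (rule cstar_seminorm_U)
  have "gen_rel x (\<lambda>a b. univ x (a - b :: ('n \<times> 'n) free_star) = 0)"
    using is_matrix_completion_iff[OF cstar_seminorm_U] is_matrix_U by blast
  then show ?thesis by (simp add: eqv_def[abs_def])
qed

lemma cubic_seminorm_univ:
  assumes "x \<noteq> Ortho" shows "cubic_seminorm (univ x :: ('n::finite \<times> 'n) free_star \<Rightarrow> real)"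
proof -
  interpret seminorm_cstar "univ x :: ('n \<times> 'n) free_star \<Rightarrow> real"
    by unfold_locales (rule cstar_seminorm_U)
  have "gen_rel Cubic eqv"
    using gen_rel_univ[of x] gen_rel_Magic_imp_Cubic[OF p] assms by (cases x) auto
  then show ?thesis by unfold_locales auto
qed

lemma ortho_seminorm_univ: "ortho_seminorm (univ x :: ('n::finite \<times> 'n) free_star \<Rightarrow> real)"
proof (cases "x = Ortho")
  case True
  interpret seminorm_cstar "univ x :: ('n \<times> 'n) free_star \<Rightarrow> real"
    by unfold_locales (rule cstar_seminorm_U)
  show ?thesis using gen_rel_univ[of x] True by unfold_locales simp
qed (use cubic_seminorm_univ cubic_seminorm.axioms in blast)

lemma types_replicate: "types (replicate (2 * m) a) = replicate m False"
  by (induction m) auto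

lemma types_seg: "types (seg s m) = replicate m True"
proof (induction m arbitrary: s)
  case (Suc m)
  have "seg s (1 + m) = seg s 1 @ seg (s + 1) m" by (rule seg_append)
  moreover have "seg s 1 = [colour_at (2 * s), colour_at (2 * s + 1)]" by (simp add: seg_def upt_rec)
  moreover have "colour_at (2 * s) \<noteq> colour_at (2 * s + 1)"
  proof -
    have "(2 * s) mod 4 = 0 \<or> (2 * s) mod 4 = 3 \<longleftrightarrow> \<not> ((2 * s + 1) mod 4 = 0 \<or> (2 * s + 1) mod 4 = 3)" by presburger
    then show ?thesis by (simp add: colour_at_def)
  qed
  ultimately show ?case using Suc by simp
qed (simp add: seg_def)

text \<open>In the cubic pattern the two copies of a letter have different colours, so every letter
  stands for an entry of \<open>u\<close>; in the magic pattern it stands for the square of an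
  entry, which is the entry.\<close>

lemma line_vector_fixed:
  fixes w :: "'n::finite list"
  assumes P: "lnc (col x m) P" and w: "length w = m"
  shows "seminorm_cstar.eqv (univ x) (\<Sum>w'\<in>words m. fscale (match P (enc x w')) (fword w w'))
    (fscale (match P (enc x w)) 1)"
proof (cases "x = Ortho")
  case True
  interpret ortho_seminorm "univ x :: ('n \<times> 'n) free_star \<Rightarrow> real" by (rule ortho_seminorm_univ)
  show ?thesis using fixed_line_Ortho[OF P, of w] w True by simp
next
  case False
  interpret cubic_seminorm "univ x :: ('n \<times> 'n) free_star \<Rightarrow> real" by (rule cubic_seminorm_univ[OF False])
  have e: "enc x u = dbl u" for u :: "'n list" using False by (cases x) auto
  have len: "length (col x m) = 2 * length w" using w False by (cases x) auto
  have tw: "eqv (fword w w') (tword (types (col x m)) w w')" if w': "length w' = m" for w'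
  proof (cases "x = Cubic")
    case True
    then have "tword (types (col x m)) w w' = fword w w'"
      using tword_True[of w w'] w w' by (simp add: types_seg)
    then show ?thesis by (simp only: eqv_refl)
  next
    case False
    then have x: "x = Magic" using \<open>x \<noteq> Ortho\<close> by (cases x) auto
    have tf: "eqv (fword v v') (tword (replicate (length v) False) v v')" if "length v = length v'" for v v' :: "'n list"
      using that
    proof (induction v v' rule: list_induct2)
      case (Cons a v b v')
      have "eqv (fgen (a, b)) (fgen (a, b) * fgen (a, b))"
        using gen_rel_univ[where 'n = 'n and x = x] eqv_sym by (simp add: x)
      then show ?case using Cons.IH by (simp add: fword_Cons tword_Cons lett_def eqv_mult)
    qed (simp add: tword_def)
    then show ?thesis using tf[of w w'] w w' by (simp add: x types_replicate del: replicate.simps)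
  qed
  have "eqv (\<Sum>w'\<in>words m. fscale (match P (dbl w')) (fword w w'))
      (\<Sum>w'\<in>words m. fscale (match P (dbl w')) (tword (types (col x m)) w w'))"
    by (intro eqv_sum eqv_fscale tw) simp
  also have "eqv \<dots> (fscale (match P (dbl w)) 1)"
    using fixed_line_typed[OF P len] by (simp only: w)
  finally show ?thesis by (simp only: e)
qed

text \<open>From left to right this is the Haar functional at work; from right to left, fixed
  vectors form a subspace that contains the diagrams.\<close>

lemma fixed_iff_line_span:
  fixes \<xi> :: "'n::finite list \<Rightarrow> complex"
  assumes supp: "\<And>w. length w \<noteq> m \<Longrightarrow> \<xi> w = 0"
  shows "(\<forall>w\<in>words m. seminorm_cstar.eqv (univ x) (\<Sum>w'\<in>words m. fscale (\<xi> w') (fword w w')) (fscale (\<xi> w) 1))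
    \<longleftrightarrow> \<xi> \<in> line_span x m"
proof -
  interpret seminorm_cstar "univ x :: ('n \<times> 'n) free_star \<Rightarrow> real"
    by unfold_locales (rule cstar_seminorm_U)
  show ?thesis
  proof
    assume "\<forall>w\<in>words m. eqv (\<Sum>w'\<in>words m. fscale (\<xi> w') (fword w w')) (fscale (\<xi> w) 1)"
    then show "\<xi> \<in> line_span x m"
      by (intro fixed_vector_in_line_span supp) (auto simp: eqv_def)
  next
    assume \<xi>: "\<xi> \<in> line_span x m"
    define W where "W = {\<xi> :: 'n list \<Rightarrow> complex. \<forall>w\<in>words m.
      eqv (\<Sum>w'\<in>words m. fscale (\<xi> w') (fword w w')) (fscale (\<xi> w) 1)}"
    have "vec.subspace W"
      unfolding vec.subspace_def
    proof (intro conjI ballI allI)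
      show "0 \<in> W" by (simp add: W_def)
    next
      fix f g assume "f \<in> W" "g \<in> W"
      then show "f + g \<in> W" by (auto simp: W_def fscale_simps sum.distrib intro!: eqv_add)
    next
      fix c f assume "f \<in> W"
      then have "eqv (fscale c (\<Sum>w'\<in>words m. fscale (f w') (fword w w'))) (fscale c (fscale (f w) 1))"
        if "w \<in> words m" for w using that by (intro eqv_fscale) (auto simp: W_def)
      then show "vscale c f \<in> W" by (simp add: W_def vscale_def fscale_simps sum_fscale)
    qed
    then have "\<xi> \<in> W"
    proof (rule line_span_induct[OF \<xi>, where T = "\<lambda>f. f" and c' = "\<lambda>c. c"])
      fix P assume "lnc (col x m) P"
      then show "pvec x m P \<in> W" using line_vector_fixed[of x m P] by (auto simp: W_def pvec_def)
    qed auto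
    then show "\<forall>w\<in>words m. eqv (\<Sum>w'\<in>words m. fscale (\<xi> w') (fword w w')) (fscale (\<xi> w) 1)"
      by (simp add: W_def)
  qed
qed

section \<open>Hom spaces in coordinates\<close>

lemma upow_completion:
  assumes "cstar_seminorm p"
  shows "upow (completion p) (completion_gen p) i j = seq_class p (\<lambda>m. fword i j)"
proof -
  interpret seminorm_cstar p using assms by unfold_locales
  have "foldr (\<lambda>ij x. completion_gen p ij \<otimes>\<^bsub>C\<^esub> x) ps \<one>\<^bsub>C\<^esub> =
      seq_class p (\<lambda>m. Poly_Mapping.single (Word (map (\<lambda>g. (g, False)) ps)) 1)" for ps
  proof (induction ps)
    case Nil
    show ?case by (simp add: one_class flip: zero_star_word_def)
  next
    case (Cons g ps)
    then show ?case by (simp add: gen_class mult_class fgen_def mult_single plus_star_word_def)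
  qed
  then show ?thesis by (simp add: upow_def fword_def)
qed

lemma Hom_completion_iff:
  assumes "cstar_seminorm p"
  shows "T \<in> Hom (completion p) (completion_gen p) l k \<longleftrightarrow> T \<in> linear_maps l k \<and>
    (\<forall>i\<in>words l. \<forall>j\<in>words k. seminorm_cstar.eqv p (\<Sum>i'\<in>words l. fscale (T (basis_tensor i') j) (fword i' i))
      (\<Sum>j'\<in>words k. fscale (T (basis_tensor i) j') (fword j j')))"
proof -
  interpret seminorm_cstar p using assms by unfold_locales
  have "(\<Oplus>\<^bsub>C\<^esub>w\<in>words l. seq_class p (\<lambda>m. f w)) = seq_class p (\<lambda>m. \<Sum>w\<in>words l. f w)"
    for f :: "'a list \<Rightarrow> ('a \<times> 'a) free_star" and l
    using finsum_class[of "words l" "\<lambda>w m. f w"] by (simp add: finite_words)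
  then show ?thesis
    unfolding Hom_def by (auto simp: upow_completion[OF assms] cscale_class const_eq_iff eqv_def)
qed

text \<open>Frobenius duality in coordinates: the entry of the map in row \<open>j\<close> and
  column \<open>i\<close> is the coefficient at \<open>j @ rev i\<close>, the order of the letters
  around the boundary of the strip.\<close>

definition line_map :: "nat \<Rightarrow> nat \<Rightarrow> ('n::finite list \<Rightarrow> complex) \<Rightarrow> 'n tensor \<Rightarrow> 'n tensor" where
  "line_map l k \<xi> v = (if v \<in> tensor_power l
     then (\<lambda>j. if length j = k then (\<Sum>i\<in>words l. v i * \<xi> (j @ rev i)) else 0) else 0)"

definition line_vector :: "nat \<Rightarrow> nat \<Rightarrow> ('n tensor \<Rightarrow> 'n tensor) \<Rightarrow> 'n list \<Rightarrow> complex" where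
  "line_vector l k T w = (if length w = k + l then T (basis_tensor (rev (drop k w))) (take k w) else 0)"

lemma line_map_linear: "line_map l k \<xi> \<in> linear_maps l k"
  by (auto simp: linear_maps_def line_map_def tensor_power_def fun_eq_iff sum.distrib
      sum_distrib_left algebra_simps)

lemma line_map_basis:
  assumes "length i = l" "length j = k"
  shows "line_map l k \<xi> (basis_tensor i) j = \<xi> (j @ rev i)"
proof -
  have "(\<Sum>i'\<in>words l. basis_tensor i i' * \<xi> (j @ rev i')) = (\<Sum>i'\<in>words l. if i' = i then \<xi> (j @ rev i') else 0)"
    by (intro sum.cong) (auto simp: basis_tensor_def)
  then show ?thesis using assms by (simp add: line_map_def basis_tensor_in finite_words)
qed

lemma line_map_line_vector:
  assumes T: "T \<in> linear_maps l k"
  shows "line_map l k (line_vector l k T) = T"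
proof
  fix v :: "'a tensor"
  show "line_map l k (line_vector l k T) v = T v"
  proof (cases "v \<in> tensor_power l")
    case True
    \<comment> \<open>Additivity of \<open>T\<close> is available on \<open>tensor_power l\<close>
      only, so membership of the partial sums is carried along the induction.\<close>
    have sub: "(\<Sum>i\<in>S. (\<lambda>w. v i * basis_tensor i w)) \<in> tensor_power l \<and>
        T (\<Sum>i\<in>S. (\<lambda>w. v i * basis_tensor i w)) = (\<Sum>i\<in>S. (\<lambda>j. v i * T (basis_tensor i) j))"
      if "finite S" "S \<subseteq> words l" for S
      using that
    proof (induction S)
      case empty
      have z: "(0 :: 'a tensor) \<in> tensor_power l" by (simp add: tensor_power_def)
      then have "T (0 + 0) = T 0 + T 0" using T unfolding linear_maps_def by blast
      then have "T 0 = 0" by simp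
      then show ?case using z by (simp add: zero_fun_def)
    next
      case (insert i S)
      have b: "(\<lambda>w. v i * basis_tensor i w) \<in> tensor_power l" "basis_tensor i \<in> tensor_power l"
        using insert.prems by (auto simp: tensor_power_def basis_tensor_def)
      have IH: "(\<Sum>i\<in>S. (\<lambda>w. v i * basis_tensor i w)) \<in> tensor_power l"
        "T (\<Sum>i\<in>S. (\<lambda>w. v i * basis_tensor i w)) = (\<Sum>i\<in>S. (\<lambda>j. v i * T (basis_tensor i) j))"
        using insert by auto
      have "(\<lambda>w. v i * basis_tensor i w) + (\<Sum>i\<in>S. (\<lambda>w. v i * basis_tensor i w)) \<in> tensor_power l"
        using b(1) IH(1) by (simp add: tensor_power_def)
      moreover have "T ((\<lambda>w. v i * basis_tensor i w) + (\<Sum>i\<in>S. (\<lambda>w. v i * basis_tensor i w))) =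
          (\<lambda>j. v i * T (basis_tensor i) j) + (\<Sum>i\<in>S. (\<lambda>j. v i * T (basis_tensor i) j))"
        using T b IH unfolding linear_maps_def by simp
      ultimately show ?case unfolding sum.insert[OF insert.hyps] by (rule conjI)
    qed
    have v: "(\<Sum>i\<in>words l. (\<lambda>w. v i * basis_tensor i w)) = v"
    proof
      fix w
      have "(\<Sum>i\<in>words l. v i * basis_tensor i w) = (\<Sum>i\<in>words l. if i = w then v i else 0)"
        by (intro sum.cong) (auto simp: basis_tensor_def)
      then show "(\<Sum>i\<in>words l. (\<lambda>w. v i * basis_tensor i w)) w = v w"
        using True by (simp add: sum_tensor_apply finite_words tensor_power_def)
    qed
    have Tv: "T v = (\<Sum>i\<in>words l. (\<lambda>j. v i * T (basis_tensor i) j))"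
      using sub[of "words l"] by (simp add: v finite_words)
    have "T v \<in> tensor_power k" using T True by (auto simp: linear_maps_def)
    then have "T v j = line_map l k (line_vector l k T) v j" for j
    proof (cases "length j = k")
      case True
      have "T v j = (\<Sum>i\<in>words l. v i * T (basis_tensor i) j)" by (simp add: Tv sum_tensor_apply)
      also have "\<dots> = (\<Sum>i\<in>words l. v i * line_vector l k T (j @ rev i))"
        using True by (intro sum.cong) (auto simp: line_vector_def)
      finally show ?thesis using True \<open>v \<in> tensor_power l\<close> by (simp add: line_map_def)
    qed (simp add: tensor_power_def line_map_def)
    then show ?thesis by auto
  next
    case False
    then show ?thesis using T by (simp add: line_map_def linear_maps_def)
  qed
qed

lemma line_vector_line_map:
  assumes "\<And>w. length w \<noteq> k + l \<Longrightarrow> \<xi> w = 0"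
  shows "line_vector l k (line_map l k \<xi>) = \<xi>"
  using assms line_map_basis[of "rev (drop k w)" l "take k w" k \<xi> for w]
  by (auto simp: line_vector_def fun_eq_iff)

lemma line_map_hom: "module_hom vscale map_scale (line_map l k)"
  by unfold_locales
    (auto simp: line_map_def vscale_def map_scale_def fun_eq_iff algebra_simps sum.distrib sum_distrib_left)

text \<open>By \<open>frobenius\<close> the intertwining equations for \<open>T\<close> are the
  equations of a fixed vector for \<open>line_vector l k T\<close>, to which
  \<open>fixed_iff_line_span\<close> applies.\<close>

lemma Hom_eq_line_map:
  "Hom (qalg x) (fund x :: 'n::finite \<times> 'n \<Rightarrow> _) l k = line_map l k ` line_span x (k + l)"
proof -
  interpret ortho_seminorm "univ x :: ('n \<times> 'n) free_star \<Rightarrow> real" by (rule ortho_seminorm_univ)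
  have iff: "T \<in> Hom (qalg x) (fund x :: 'n \<times> 'n \<Rightarrow> _) l k \<longleftrightarrow> line_vector l k T \<in> line_span x (k + l)"
    if T: "T \<in> linear_maps l k" for T
  proof -
    let ?\<xi> = "line_vector l k T"
    have \<xi>: "?\<xi> (j @ rev i) = T (basis_tensor i) j" if "i \<in> words l" "j \<in> words k" for i j
      using that by (simp add: line_vector_def)
    have "T \<in> Hom (qalg x) (fund x :: 'n \<times> 'n \<Rightarrow> _) l k \<longleftrightarrow>
        (\<forall>i\<in>words l. \<forall>j\<in>words k. eqv (\<Sum>j'\<in>words k. \<Sum>i'\<in>words l.
          fscale (T (basis_tensor i') j') (fword j j' * fword (rev i) (rev i'))) (fscale (T (basis_tensor i) j) 1))"
      using Hom_completion_iff[OF p, of T l k] frobenius[of l k "\<lambda>j i. T (basis_tensor i) j"] T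
      by (simp only: qalg_def fund_def simp_thms)
    also have "\<dots> \<longleftrightarrow> (\<forall>i\<in>words l. \<forall>j\<in>words k.
        eqv (\<Sum>w'\<in>words (k + l). fscale (?\<xi> w') (fword (j @ rev i) w')) (fscale (?\<xi> (j @ rev i)) 1))"
    proof (intro ball_cong refl)
      fix i j :: "'n list" assume i: "i \<in> words l" and j: "j \<in> words k"
      have "(\<Sum>w'\<in>words (k + l). fscale (?\<xi> w') (fword (j @ rev i) w')) =
          (\<Sum>j'\<in>words k. \<Sum>i'\<in>words l. fscale (?\<xi> (j' @ rev i')) (fword (j @ rev i) (j' @ rev i')))"
        unfolding sum_words_append by (intro sum.cong refl sum_words_rev[symmetric])
      also have "\<dots> = (\<Sum>j'\<in>words k. \<Sum>i'\<in>words l.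
          fscale (T (basis_tensor i') j') (fword j j' * fword (rev i) (rev i')))"
        using i j by (intro sum.cong refl) (simp add: \<xi> fword_append)
      finally show "eqv (\<Sum>j'\<in>words k. \<Sum>i'\<in>words l. fscale (T (basis_tensor i') j') (fword j j' * fword (rev i) (rev i')))
          (fscale (T (basis_tensor i) j) 1) \<longleftrightarrow>
        eqv (\<Sum>w'\<in>words (k + l). fscale (?\<xi> w') (fword (j @ rev i) w')) (fscale (?\<xi> (j @ rev i)) 1)"
        using i j by (simp add: \<xi>)
    qed
    also have "\<dots> \<longleftrightarrow> (\<forall>w\<in>words (k + l). eqv (\<Sum>w'\<in>words (k + l). fscale (?\<xi> w') (fword w w')) (fscale (?\<xi> w) 1))"
      (is "(\<forall>i\<in>_. \<forall>j\<in>_. ?Q (j @ rev i)) \<longleftrightarrow> _")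
    proof
      assume a: "\<forall>i\<in>words l. \<forall>j\<in>words k. ?Q (j @ rev i)"
      show "\<forall>w\<in>words (k + l). ?Q w"
      proof
        fix w :: "'n list" assume "w \<in> words (k + l)"
        then have "rev (drop k w) \<in> words l" "take k w \<in> words k" by auto
        with a have "?Q (take k w @ rev (rev (drop k w)))" by blast
        then show "?Q w" by simp
      qed
    qed simp
    also have "\<dots> \<longleftrightarrow> ?\<xi> \<in> line_span x (k + l)"
      by (rule fixed_iff_line_span) (simp add: line_vector_def)
    finally show ?thesis .
  qed
  show ?thesis
  proof (intro equalityI subsetI)
    fix T assume T: "T \<in> Hom (qalg x) (fund x :: 'n \<times> 'n \<Rightarrow> _) l k"
    then have lin: "T \<in> linear_maps l k" by (simp add: Hom_def)
    then show "T \<in> line_map l k ` line_span x (k + l)"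
      using iff[OF lin] T line_map_line_vector[OF lin] by (metis imageI)
  next
    fix T assume "T \<in> line_map l k ` (line_span x (k + l) :: ('n list \<Rightarrow> complex) set)"
    then obtain \<xi> where \<xi>: "\<xi> \<in> line_span x (k + l)" "T = line_map l k \<xi>" by blast
    then have "line_vector l k T = \<xi>"
      using line_vector_line_map[of k l \<xi>] line_span_supp[OF \<xi>(1)] by blast
    then show "T \<in> Hom (qalg x) (fund x :: 'n \<times> 'n \<Rightarrow> _) l k"
      using iff[of T] \<xi> line_map_linear[of l k \<xi>] by simp
  qed
qed

lemma line_map_line_span:
  "line_map l k ` line_span x (k + l) = maps.span (line_map l k ` pvec x (k + l) ` {P. lnc (col x (k + l)) P})"
  unfolding line_span_def by (rule module_hom.span_image[OF line_map_hom, symmetric])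

lemma diagram_map_eq_line_map:
  assumes "\<And>i j :: 'n::finite list. length i = l \<Longrightarrow> length j = k \<Longrightarrow> diagram_symbol i p j = match P (enc x (j @ rev i))"
  shows "diagram_map l k p = (line_map l k (pvec x (k + l) P) :: 'n tensor \<Rightarrow> 'n tensor)"
  using assms by (auto simp: diagram_map_def line_map_def pvec_def fun_eq_iff intro!: sum.cong)

section \<open>Temperley-Lieb diagrams as pairings on a line\<close>

definition pairing :: "'a set \<Rightarrow> 'a set set \<Rightarrow> bool" where
  "pairing A P \<longleftrightarrow> \<Union>P = A \<and> (\<forall>s\<in>P. \<forall>t\<in>P. s \<noteq> t \<longrightarrow> s \<inter> t = {}) \<and> (\<forall>s\<in>P. card s = 2)"

lemma pairing_disjoint: "pairing A P \<Longrightarrow> s \<in> P \<Longrightarrow> t \<in> P \<Longrightarrow> s \<noteq> t \<Longrightarrow> s \<inter> t = {}"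
  by (simp add: pairing_def)

lemma pairing_iff_partition: "pairing A P \<longleftrightarrow> partition_on A P \<and> (\<forall>s\<in>P. card s = 2)"
  by (auto simp: pairing_def partition_on_def pairwise_def disjnt_def)

text \<open>The position \<open>f\<close> is a parameter, so that the same notion serves the points
  of the strip and those of the line.\<close>

definition crossing :: "('a \<Rightarrow> nat) \<Rightarrow> 'a set set \<Rightarrow> bool" where
  "crossing f P \<longleftrightarrow> (\<exists>s\<in>P. \<exists>t\<in>P. \<exists>w\<in>s. \<exists>x\<in>t. \<exists>y\<in>s. \<exists>z\<in>t. f w < f x \<and> f x < f y \<and> f y < f z)"

definition monochromatic :: "('a \<Rightarrow> 'c) \<Rightarrow> 'a set set \<Rightarrow> bool" where
  "monochromatic f P \<longleftrightarrow> (\<forall>s\<in>P. \<forall>x\<in>s. \<forall>y\<in>s. f x = f y)"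

lemma monochromatic_image: "monochromatic f ((`) h ` P) \<longleftrightarrow> monochromatic (\<lambda>x. f (h x)) P"
  by (auto simp: monochromatic_def)

lemma crossing_image: "crossing f ((`) h ` P) \<longleftrightarrow> crossing (\<lambda>x. f (h x)) P"
  by (auto simp: crossing_def)

lemma crossing_mono: "crossing f P \<Longrightarrow> P \<subseteq> Q \<Longrightarrow> crossing f Q"
  unfolding crossing_def by (meson subsetD)

lemma pairing_image:
  assumes "inj_on h A" "P \<subseteq> Pow A"
  shows "pairing (h ` A) ((`) h ` P) \<longleftrightarrow> pairing A P"
proof -
  have inj: "h ` s = h ` t \<longleftrightarrow> s = t" "h ` s \<inter> h ` t = {} \<longleftrightarrow> s \<inter> t = {}" "card (h ` s) = card s"
    if "s \<subseteq> A" "t \<subseteq> A" for s t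
  proof -
    show "h ` s = h ` t \<longleftrightarrow> s = t" by (rule inj_on_image_eq_iff[OF assms(1) that])
    show "h ` s \<inter> h ` t = {} \<longleftrightarrow> s \<inter> t = {}"
      using inj_on_image_Int[OF assms(1) that] by (metis image_is_empty)
    show "card (h ` s) = card s" using card_image inj_on_subset[OF assms(1) that(1)] by blast
  qed
  have P: "s \<subseteq> A" if "s \<in> P" for s using assms(2) that by blast
  have "\<Union>((`) h ` P) = h ` \<Union>P" by blast
  moreover have "h ` \<Union>P = h ` A \<longleftrightarrow> \<Union>P = A"
    by (rule inj_on_image_eq_iff[OF assms(1)]) (use assms(2) in auto)
  moreover have "(\<forall>s\<in>P. \<forall>t\<in>P. h ` s \<noteq> h ` t \<longrightarrow> h ` s \<inter> h ` t = {}) \<longleftrightarrow>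
      (\<forall>s\<in>P. \<forall>t\<in>P. s \<noteq> t \<longrightarrow> s \<inter> t = {})"
    by (intro ball_cong refl) (simp add: inj(1,2)[OF P P])
  moreover have "(\<forall>s\<in>P. card (h ` s) = 2) \<longleftrightarrow> (\<forall>s\<in>P. card s = 2)"
    by (intro ball_cong refl) (simp add: inj(3)[OF P P])
  ultimately show ?thesis by (simp add: pairing_def)
qed

definition line_pairing :: "'c list \<Rightarrow> nat set set \<Rightarrow> bool" where
  "line_pairing c P \<longleftrightarrow> pairing {..<length c} P \<and> \<not> crossing (\<lambda>p. p) P \<and> monochromatic ((!) c) P"

lemma shift2_less_iff: "shift2 q a < shift2 q b \<longleftrightarrow> a < b"
  by (auto simp: shift2_def)

lemma shift2_eq_iff: "shift2 q a = shift2 q b \<longleftrightarrow> a = b"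
  by (auto simp: shift2_def)

lemma shift2_image: "q \<le> M \<Longrightarrow> insert q (insert (Suc q) (shift2 q ` {..<M})) = {..<M + 2}"
proof (intro equalityI subsetI)
  fix p assume "q \<le> M" "p \<in> {..<M + 2}"
  then consider "p < q" | "p = q" | "p = Suc q" | "p \<ge> q + 2" "p - 2 < M" by fastforce
  then show "p \<in> insert q (insert (Suc q) (shift2 q ` {..<M}))"
  proof cases
    case 1
    then show ?thesis using \<open>q \<le> M\<close> by (auto simp: shift2_def intro!: image_eqI[of _ _ p])
  next
    case 4
    then show ?thesis by (auto simp: shift2_def intro!: image_eqI[of _ _ "p - 2"])
  qed auto
qed (auto simp: shift2_def)

text \<open>\<open>shift2 q\<close> is injective and misses exactly \<open>q\<close> and
  \<open>Suc q\<close>, the ends of the new string.\<close>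

lemma pairing_cupins:
  assumes "q \<le> M"
  shows "pairing {..<M + 2} (cupins q P) \<longleftrightarrow> pairing {..<M} P"
proof -
  let ?h = "shift2 q"
  have inj: "inj ?h" by (auto simp: inj_def shift2_eq_iff)
  have ne: "q \<notin> ?h ` s" "Suc q \<notin> ?h ` s" for s
    by (auto simp: shift2_def split: if_splits)
  have h: "?h ` s = ?h ` t \<longleftrightarrow> s = t" "?h ` s \<inter> ?h ` t = {} \<longleftrightarrow> s \<inter> t = {}" "card (?h ` s) = card s" for s t
    using inj by (simp_all add: inj_image_eq_iff image_Int[symmetric] card_image inj_on_subset[OF inj])
  have "\<Union>(cupins q P) = insert q (insert (Suc q) (?h ` \<Union>P))" by (auto simp: cupins_def)
  then have "\<Union>(cupins q P) = {..<M + 2} \<longleftrightarrow> insert q (insert (Suc q) (?h ` \<Union>P)) = insert q (insert (Suc q) (?h ` {..<M}))"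
    using shift2_image[OF assms] by simp
  also have "\<dots> \<longleftrightarrow> ?h ` \<Union>P = ?h ` {..<M}" 
  proof -
    have "X = insert q (insert (Suc q) X) - {q, Suc q}" if "q \<notin> X" "Suc q \<notin> X" for X
      using that by auto
    then show ?thesis using ne by metis
  qed
  also have "\<dots> \<longleftrightarrow> \<Union>P = {..<M}" by (rule h)
  finally have U: "\<Union>(cupins q P) = {..<M + 2} \<longleftrightarrow> \<Union>P = {..<M}" .
  have "(\<forall>s\<in>cupins q P. \<forall>t\<in>cupins q P. s \<noteq> t \<longrightarrow> s \<inter> t = {}) \<longleftrightarrow>
      (\<forall>s\<in>P. \<forall>t\<in>P. ?h ` s \<noteq> ?h ` t \<longrightarrow> ?h ` s \<inter> ?h ` t = {})"
    using ne by (simp add: cupins_def)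
  also have "\<dots> \<longleftrightarrow> (\<forall>s\<in>P. \<forall>t\<in>P. s \<noteq> t \<longrightarrow> s \<inter> t = {})" by (simp only: h)
  finally show ?thesis unfolding pairing_def U by (simp add: cupins_def h)
qed

text \<open>No point lies strictly between the ends of a string that joins neighbours, so it takes
  part in no crossing; \<open>shift2\<close> preserves the order.\<close>

lemma crossing_cupins: "crossing (\<lambda>p. p) (cupins q P) \<longleftrightarrow> crossing (\<lambda>p. p) P"
proof
  assume "crossing (\<lambda>p. p) (cupins q P)"
  then obtain s t w x y z where st: "s \<in> cupins q P" "t \<in> cupins q P" "w \<in> s" "x \<in> t" "y \<in> s" "z \<in> t"
    and lt: "w < x" "x < y" "y < z" unfolding crossing_def by blast
  have "s \<noteq> {q, Suc q}" using st lt by auto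
  moreover have "t \<noteq> {q, Suc q}" using st lt by auto
  ultimately obtain s' t' where "s' \<in> P" "s = shift2 q ` s'" "t' \<in> P" "t = shift2 q ` t'"
    using st by (auto simp: cupins_def)
  then show "crossing (\<lambda>p. p) P"
    using st lt unfolding crossing_def by (auto simp: shift2_less_iff) blast
next
  assume "crossing (\<lambda>p. p) P"
  then have "crossing (\<lambda>p. p) ((`) (shift2 q) ` P)"
    unfolding crossing_image by (simp add: crossing_def shift2_less_iff)
  then show "crossing (\<lambda>p. p) (cupins q P)" by (rule crossing_mono) (auto simp: cupins_def)
qed

lemma line_pairing_cupins:
  "line_pairing (c1 @ [x, y] @ c2) (cupins (length c1) P) \<longleftrightarrow> x = y \<and> line_pairing (c1 @ c2) P"
proof -
  have "(c1 @ [x, y] @ c2) ! shift2 (length c1) p = (c1 @ c2) ! p" for p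
    by (auto simp: shift2_def nth_append)
  moreover have "(c1 @ [x, y] @ c2) ! length c1 = x" "(c1 @ [x, y] @ c2) ! Suc (length c1) = y"
    by (auto simp: nth_append)
  ultimately have "monochromatic ((!) (c1 @ [x, y] @ c2)) (cupins (length c1) P) \<longleftrightarrow> x = y \<and> monochromatic ((!) (c1 @ c2)) P"
    by (auto simp: monochromatic_def cupins_def)
  then show ?thesis
    using pairing_cupins[of "length c1" "length (c1 @ c2)" P]
    by (auto simp: line_pairing_def crossing_cupins)
qed

text \<open>A string of minimal length joins neighbours.\<close>

lemma ex_neighbours:
  assumes "pairing {..<M} P" "\<not> crossing (\<lambda>p. p) P" "M > 0"
  shows "\<exists>q. {q, Suc q} \<in> P"
proof -
  have partner: "\<exists>b. {a, b} \<in> P \<and> b \<noteq> a" if "a < M" for a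
  proof -
    obtain s where s: "s \<in> P" "a \<in> s" using assms(1) \<open>a < M\<close> unfolding pairing_def by blast
    then have "card s = 2" using assms(1) by (simp add: pairing_def)
    then obtain u v where "s = {u, v}" "u \<noteq> v" by (auto simp: card_2_iff)
    then show ?thesis using s by (auto simp: insert_commute)
  qed
  define gap where "gap d \<longleftrightarrow> (\<exists>a b. {a, b} \<in> P \<and> a < b \<and> b - a = d)" for d
  obtain b where "{0, b} \<in> P" "b \<noteq> 0" using partner[of 0] assms(3) by auto
  then have "gap b" unfolding gap_def by (intro exI[of _ 0] exI[of _ b]) auto
  define d where "d = (LEAST d. gap d)"
  have "gap d" unfolding d_def by (rule LeastI[of gap, OF \<open>gap b\<close>])
  then obtain a b where ab: "{a, b} \<in> P" "a < b" "b - a = d" by (auto simp: gap_def)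
  have bM: "b < M" using ab(1) assms(1) unfolding pairing_def by blast
  have "b = Suc a"
  proof (rule ccontr)
    \<comment> \<open>The point \<open>Suc a\<close> lies between \<open>a\<close> and
      \<open>b\<close>, so without crossings the other end of its string lies there too, and that
      string is shorter.\<close>
    assume ne: "b \<noteq> Suc a"
    then obtain e where e: "{Suc a, e} \<in> P" "e \<noteq> Suc a" using partner[of "Suc a"] ab bM by auto
    have "{Suc a, e} \<noteq> {a, b}" using ne ab by (auto simp: doubleton_eq_iff)
    then have disj: "{Suc a, e} \<inter> {a, b} = {}" by (rule pairing_disjoint[OF assms(1) e(1) ab(1)])

    have "a < e"
    proof (rule ccontr)
      assume "\<not> a < e"
      then have "e < a" using disj by auto
      then have "crossing (\<lambda>p. p) P"
        unfolding crossing_def using e ab ne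
        by (intro bexI[of _ "{Suc a, e}"] bexI[of _ "{a, b}"] bexI[of _ e] bexI[of _ a] bexI[of _ "Suc a"] bexI[of _ b]) auto
      then show False using assms(2) by simp
    qed
    then have ae: "Suc a < e" using e by auto
    have "e < b"
    proof (rule ccontr)
      assume "\<not> e < b"
      then have "b < e" using disj by auto
      then have "crossing (\<lambda>p. p) P"
        unfolding crossing_def using e ab ne
        by (intro bexI[of _ "{a, b}"] bexI[of _ "{Suc a, e}"] bexI[of _ a] bexI[of _ "Suc a"] bexI[of _ b] bexI[of _ e]) auto
      then show False using assms(2) by simp
    qed
    have "gap (e - Suc a)" using e ae by (auto simp: gap_def)
    then have "d \<le> e - Suc a" unfolding d_def by (rule Least_le)
    then show False using ae \<open>e < b\<close> ab by simp
  qed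
  then show ?thesis using ab by blast
qed

text \<open>All other strings avoid \<open>q\<close> and \<open>Suc q\<close>, hence lie in the
  range of \<open>shift2 q\<close>.\<close>

lemma cupins_ex:
  assumes "pairing A P" "{q, Suc q} \<in> P"
  shows "\<exists>P0. P = cupins q P0"
proof -
  define d where "d p = (if p < q then p else p - 2)" for p
  have d: "shift2 q (d p) = p" if "p \<noteq> q" "p \<noteq> Suc q" for p
    using that by (auto simp: shift2_def d_def)
  have "shift2 q ` d ` s = s" if "s \<in> P - {{q, Suc q}}" for s
  proof -
    have "s \<inter> {q, Suc q} = {}" using pairing_disjoint[OF assms(1) _ assms(2), of s] that by simp
    then have "shift2 q (d p) = p" if "p \<in> s" for p using that by (intro d) auto
    then show ?thesis by (simp add: image_image)
  qed
  then have "(`) (shift2 q) ` (`) d ` (P - {{q, Suc q}}) = P - {{q, Suc q}}"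
    by (simp add: image_image[of "(`) (shift2 q)"])
  then show ?thesis using assms(2) unfolding cupins_def by (metis insert_Diff)
qed

theorem lnc_iff_line_pairing: "lnc c P \<longleftrightarrow> line_pairing c P"
proof
  show "lnc c P \<Longrightarrow> line_pairing c P"
  proof (induction rule: lnc.induct)
    case lnc_Nil
    show ?case by (auto simp: line_pairing_def pairing_def crossing_def monochromatic_def)
  next
    case (lnc_cup c1 c2 P x)
    then show ?case by (intro iffD2[OF line_pairing_cupins]) simp
  qed
  show "line_pairing c P \<Longrightarrow> lnc c P"
  proof (induction "length c" arbitrary: c P rule: less_induct)
    case less
    note lp = less.prems
    then have pr: "pairing {..<length c} P" by (simp add: line_pairing_def)
    show ?case
    proof (cases "c = []")
      case True
      then have "P = {}"
      proof -
        have "s = {}" if "s \<in> P" for s using pr True that by (auto simp: pairing_def)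
        moreover have "card s = 2" if "s \<in> P" for s using pr that by (auto simp: pairing_def)
        ultimately show ?thesis by fastforce
      qed
      then show ?thesis using True lnc_Nil by simp
    next
      case False
      then obtain q where q: "{q, Suc q} \<in> P"
        using ex_neighbours[OF pr] lp by (auto simp: line_pairing_def)
      obtain P0 where P0: "P = cupins q P0" using cupins_ex[OF pr q] by blast
      have "Suc q < length c" using pr q unfolding pairing_def by blast
      then have "length c = q + 2 + (length c - (q + 2))" by simp
      then obtain c1 x y c2 where c: "c = c1 @ [x, y] @ c2" "length c1 = q" by (rule split_word2)
      have "x = y" "line_pairing (c1 @ c2) P0"
        using lp line_pairing_cupins[of c1 x y c2 P0] unfolding c(1) P0 by (simp_all add: c(2))
      moreover have "lnc (c1 @ c2) P0" by (rule less.hyps) (use c \<open>line_pairing (c1 @ c2) P0\<close> in auto)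
      ultimately show ?thesis using lnc_cup[of c1 c2 P0 x] c P0 by simp
    qed
  qed
qed

section \<open>From the strip to the line\<close>

definition points :: "nat \<Rightarrow> nat \<Rightarrow> point set" where
  "points L K = Inl ` {..<L} \<union> Inr ` {..<K}"

text \<open>The points are read around the boundary of the strip: the lower row from left to right, then
  the upper row from right to left.\<close>

fun line_pos :: "nat \<Rightarrow> nat \<Rightarrow> point \<Rightarrow> nat" where
  "line_pos L K (Inl a) = K + (L - Suc a)"
| "line_pos L K (Inr b) = b"

abbreviation to_line :: "nat \<Rightarrow> nat \<Rightarrow> point set set \<Rightarrow> nat set set" where
  "to_line L K p \<equiv> (`) (line_pos L K) ` p"

lemma inj_line_pos: "inj_on (line_pos L K) (points L K)"
  by (auto simp: inj_on_def points_def)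

lemma line_pos_image: "line_pos L K ` points L K = {..<K + L}"
proof (intro equalityI subsetI)
  fix q assume q: "q \<in> {..<K + L}"
  show "q \<in> line_pos L K ` points L K"
  proof (cases "q < K")
    case True
    then show ?thesis by (intro image_eqI[of _ _ "Inr q"]) (auto simp: points_def)
  next
    case False
    then show ?thesis using q by (intro image_eqI[of _ _ "Inl (K + L - Suc q)"]) (auto simp: points_def)
  qed
qed (auto simp: points_def)

lemma boundary_pos_less_iff:
  assumes "x \<in> points L K" "y \<in> points L K"
  shows "boundary_pos L K x < boundary_pos L K y \<longleftrightarrow> line_pos L K y < line_pos L K x"
  using assms by (auto simp: points_def)

text \<open>\<open>boundary_pos\<close> and \<open>line_pos\<close> run around the boundary in
  opposite directions, and a crossing read backwards is a crossing with the two strings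
  exchanged.\<close>

lemma noncrossing_iff:
  assumes "p \<subseteq> Pow (points L K)"
  shows "noncrossing L K p \<longleftrightarrow> \<not> crossing (\<lambda>q. q) (to_line L K p)"
proof -
  have "boundary_pos L K x < boundary_pos L K y \<longleftrightarrow> line_pos L K y < line_pos L K x"
    if "s \<in> p" "t \<in> p" "x \<in> s" "y \<in> t" for s t x y
    using boundary_pos_less_iff[of x L K y] assms that by blast
  then show ?thesis
    unfolding noncrossing_def crossing_image unfolding crossing_def by (smt (verit, ccfv_threshold))
qed

text \<open>The condition on \<open>p\<close> keeps the strings within the two rows, where
  \<open>line_pos\<close> is injective; beyond them the truncated subtraction identifies
  points.\<close>

lemma nc_pairings_iff:
  assumes p: "p \<subseteq> Pow (points L K)" and c: "length c = K + L"
    and \<kappa>: "\<And>x. x \<in> points L K \<Longrightarrow> c ! line_pos L K x = \<kappa> x"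
  shows "p \<in> nc_pairings L K \<and> monochromatic \<kappa> p \<longleftrightarrow> lnc c (to_line L K p)"
proof -
  have "monochromatic ((!) c) (to_line L K p) \<longleftrightarrow> monochromatic \<kappa> p"
  proof -
    have pt: "x \<in> points L K" if "s \<in> p" "x \<in> s" for s x using p that by blast
    have "monochromatic (\<lambda>x. c ! line_pos L K x) p \<longleftrightarrow> monochromatic \<kappa> p"
      unfolding monochromatic_def by (intro ball_cong refl) (simp add: \<kappa> pt)
    then show ?thesis by (simp only: monochromatic_image)
  qed
  moreover have "pairing {..<K + L} (to_line L K p) \<longleftrightarrow> pairing (points L K) p"
    using pairing_image[OF inj_line_pos p] by (simp add: line_pos_image)
  ultimately show ?thesis
    unfolding lnc_iff_line_pairing line_pairing_def c nc_pairings_def pairings_def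
    using noncrossing_iff[OF p] by (auto simp: pairing_iff_partition points_def)
qed

lemma nc_pairings_points: "p \<in> nc_pairings L K \<Longrightarrow> p \<subseteq> Pow (points L K)"
  by (auto simp: nc_pairings_def pairings_def partition_on_def points_def)

lemma to_line_surj:
  assumes "lnc c P" "length c = K + L"
  shows "\<exists>p. p \<subseteq> Pow (points L K) \<and> to_line L K p = P"
proof -
  have "P \<subseteq> Pow (line_pos L K ` points L K)"
    using assms by (auto simp: lnc_iff_line_pairing line_pairing_def pairing_def line_pos_image)
  then have "P \<in> Pow (Pow (line_pos L K ` points L K))" by simp
  then have "P \<in> (`) ((`) (line_pos L K)) ` Pow (Pow (points L K))"
    by (metis image_Pow_surj)
  then show ?thesis by blast
qed

section \<open>The three species of diagrams on a line\<close>

text \<open>On the line all strings are arcs, so the two copies of any string are nested and one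
  clause covers the four of \<open>doubled\<close>; \<open>{a, b}\<close> is met in both orders,
  once for either copy.\<close>

definition line_doubled :: "nat set set \<Rightarrow> nat set set" where
  "line_doubled P = {{2 * a, Suc (2 * b)} | a b. {a, b} \<in> P}"

text \<open>The doubled neighbours \<open>q\<close>, \<open>Suc q\<close> become an outer string,
  inserted at \<open>2 * q\<close>, and an inner one, inserted at \<open>2 * q + 1\<close>; old
  positions from \<open>2 * q\<close> on move by 4.\<close>

lemma line_doubled_cupins:
  "line_doubled (cupins q P) = cupins (Suc (2 * q)) (cupins (2 * q) (line_doubled P))"
proof -
  define h where "h p = shift2 (Suc (2 * q)) (shift2 (2 * q) p)" for p
  have h: "h (2 * a) = 2 * shift2 q a" "h (Suc (2 * a)) = Suc (2 * shift2 q a)" for a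
    by (auto simp: h_def shift2_def)
  have img: "{a', b'} \<in> (`) (shift2 q) ` P \<longleftrightarrow> (\<exists>a b. {a, b} \<in> P \<and> a' = shift2 q a \<and> b' = shift2 q b)" for a' b'
  proof
    assume "{a', b'} \<in> (`) (shift2 q) ` P"
    then obtain s where s: "s \<in> P" "shift2 q ` s = {a', b'}" by auto
    have "a' \<in> shift2 q ` s" "b' \<in> shift2 q ` s" using s(2) by simp_all
    then obtain a b where ab: "a \<in> s" "b \<in> s" "a' = shift2 q a" "b' = shift2 q b" by blast
    have "shift2 q ` s = shift2 q ` {a, b}" using s ab by simp
    moreover have "inj (shift2 q)" by (auto simp: inj_def shift2_eq_iff)
    ultimately have "s = {a, b}" using inj_image_eq_iff[of "shift2 q" s "{a, b}"] by blast
    then show "\<exists>a b. {a, b} \<in> P \<and> a' = shift2 q a \<and> b' = shift2 q b" using s ab by blast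
  next
    assume "\<exists>a b. {a, b} \<in> P \<and> a' = shift2 q a \<and> b' = shift2 q b"
    then obtain a b where ab: "{a, b} \<in> P" "{a', b'} = shift2 q ` {a, b}" by auto
    then show "{a', b'} \<in> (`) (shift2 q) ` P" by (simp only: ab(2) imageI)
  qed
  have "line_doubled (cupins q P) = {{2 * a, Suc (2 * b)} | a b. {a, b} = {q, Suc q}} \<union>
      {{2 * a, Suc (2 * b)} | a b. {a, b} \<in> (`) (shift2 q) ` P}"
    by (simp only: line_doubled_def cupins_def insert_iff) blast
  also have "{{2 * a, Suc (2 * b)} | a b. {a, b} = {q, Suc q}} = {{2 * q, Suc (2 * Suc q)}, {2 * Suc q, Suc (2 * q)}}"
  proof -
    have "{a, b} = {q, Suc q} \<longleftrightarrow> a = q \<and> b = Suc q \<or> a = Suc q \<and> b = q" for a b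
      by (rule doubleton_eq_iff)
    then show ?thesis by (simp only:) blast
  qed
  also have "{{2 * a, Suc (2 * b)} | a b. {a, b} \<in> (`) (shift2 q) ` P} = (`) h ` line_doubled P"
  proof -
    have "{{2 * a, Suc (2 * b)} | a b. {a, b} \<in> (`) (shift2 q) ` P} =
        {{2 * shift2 q a, Suc (2 * shift2 q b)} | a b. {a, b} \<in> P}"
      unfolding img by blast
    also have "\<dots> = {h ` {2 * a, Suc (2 * b)} | a b. {a, b} \<in> P}" by (simp add: h)
    also have "\<dots> = (`) h ` line_doubled P"
      unfolding line_doubled_def by (blast intro: image_eqI)
    finally show ?thesis .
  qed
  also have "{{2 * q, Suc (2 * Suc q)}, {2 * Suc q, Suc (2 * q)}} \<union> (`) h ` line_doubled P =
      cupins (Suc (2 * q)) (cupins (2 * q) (line_doubled P))"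
  proof -
    have "shift2 (Suc (2 * q)) (2 * q) = 2 * q" "shift2 (Suc (2 * q)) (Suc (2 * q)) = Suc (2 * Suc q)"
      by (auto simp: shift2_def)
    then show ?thesis by (auto simp: cupins_def h_def image_image insert_commute)
  qed
  finally show ?thesis .
qed

lemma line_doubled_empty [simp]: "line_doubled {} = {}"
  by (simp add: line_doubled_def)

text \<open>Nested insertions read \<open>p q q p\<close>, so doubled diagrams are coloured; on
  doubled words the two copies of a string impose the same condition.\<close>

lemma lnc_line_doubled:
  assumes "lnc c P"
  shows "lnc (seg 0 (length c)) (line_doubled P)"
    and "length w = length c \<Longrightarrow> match (line_doubled P) (dbl w) = match P w"
proof -
  show "lnc (seg 0 (length c)) (line_doubled P)"
    using assms
  proof induction
    case lnc_Nil
    then show ?case using lnc.lnc_Nil by (simp add: seg_def)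
  next
    case (lnc_cup c1 c2 P x)
    have nO: "Cubic \<noteq> Ortho" by simp
    obtain A p q B where "col Cubic (length c1 + length c2) = A @ B"
      "col Cubic (length c1 + 2 + length c2) = A @ [p, q, q, p] @ B" "length A = 2 * length c1" "length B = 2 * length c2"
      by (rule col_insert2[OF nO])
    note AB = this[unfolded col.simps]
    have "lnc (A @ [p, p] @ B) (cupins (2 * length c1) (line_doubled P))"
      using lnc.lnc_cup[of A B _ p] lnc_cup.IH AB by simp
    then have "lnc (A @ [p, q, q, p] @ B) (cupins (Suc (2 * length c1)) (cupins (2 * length c1) (line_doubled P)))"
      using lnc.lnc_cup[of "A @ [p]" "p # B" _ q] AB(3) by simp
    then show ?case using AB(2) by (simp add: line_doubled_cupins)
  qed
  show "match (line_doubled P) (dbl w) = match P w" if "length w = length c" for w :: "'b list"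
    using assms that
  proof (induction arbitrary: w)
    case lnc_Nil
    then show ?case by simp
  next
    case (lnc_cup c1 c2 P x)
    have "length w = length c1 + 2 + length c2" using lnc_cup.prems by simp
    then obtain v a b u where w: "w = v @ [a, b] @ u" "length v = length c1" "length u = length c2"
      by (rule split_word2)
    show ?case
      unfolding line_doubled_cupins w(1) match_cupins[OF w(2)] match_cupins_odd[OF w(2)] match_cupins_even[OF w(2)]
      using lnc_cup.IH[of "v @ u"] w by simp
  qed
qed

text \<open>\<open>line_pos\<close> reverses the upper row, so the left copy of an upper point
  becomes the right one on the line. A string between the rows, whose copies join left to left and
  right to right, thus becomes a pair of arcs joining left to right copies, like the strings within
  a row.\<close>

lemma to_line_doubled:
  assumes Q: "Q \<subseteq> Pow (points l k)"
  shows "to_line (2 * l) (2 * k) (doubled Q) = line_doubled (to_line l k Q)"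
proof -
  define f where "f = line_pos (2 * l) (2 * k)"
  define g where "g = line_pos l k"
  have fg: "a < l \<Longrightarrow> f (Inl (2 * a)) = Suc (2 * g (Inl a))" "a < l \<Longrightarrow> f (Inl (Suc (2 * a))) = 2 * g (Inl a)"
    "f (Inr (2 * b)) = 2 * g (Inr b)" "f (Inr (Suc (2 * b))) = Suc (2 * g (Inr b))" for a b
    by (auto simp: f_def g_def)
  have in_l: "a < l" if "s \<in> Q" "Inl a \<in> s" for s a using Q that by (auto simp: points_def)
  have img: "{x', y'} \<in> (`) g ` Q \<longleftrightarrow> (\<exists>x y. {x, y} \<in> Q \<and> x' = g x \<and> y' = g y)" for x' y'
  proof
    assume "{x', y'} \<in> (`) g ` Q"
    then obtain s where s: "s \<in> Q" "g ` s = {x', y'}" by auto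
    have "x' \<in> g ` s" "y' \<in> g ` s" using s(2) by simp_all
    then obtain x y where xy: "x \<in> s" "y \<in> s" "x' = g x" "y' = g y" by blast
    have "s \<subseteq> points l k" using Q s by auto
    moreover have "g ` s = g ` {x, y}" using s xy by simp
    ultimately have "s = {x, y}"
      using inj_on_image_eq_iff[OF inj_line_pos[of l k], of s "{x, y}"] xy by (auto simp: g_def)
    then show "\<exists>x y. {x, y} \<in> Q \<and> x' = g x \<and> y' = g y" using s xy by blast
  next
    assume "\<exists>x y. {x, y} \<in> Q \<and> x' = g x \<and> y' = g y"
    then obtain x y where xy: "{x, y} \<in> Q" "{x', y'} = g ` {x, y}" by auto
    then show "{x', y'} \<in> (`) g ` Q" by (simp only: xy(2) imageI)
  qed
  have "(`) f ` doubled Q = {{2 * g x, Suc (2 * g y)} | x y. {x, y} \<in> Q}"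
  proof (intro equalityI subsetI)
    fix s assume "s \<in> (`) f ` doubled Q"
    then consider a b where "s = f ` {Inl (2 * a), Inr (2 * b)}" "{Inl a, Inr b} \<in> Q"
      | a b where "s = f ` {Inl (Suc (2 * a)), Inr (Suc (2 * b))}" "{Inl a, Inr b} \<in> Q"
      | a b where "s = f ` {Inl (2 * a), Inl (Suc (2 * b))}" "{Inl a, Inl b} \<in> Q"
      | a b where "s = f ` {Inr (2 * a), Inr (Suc (2 * b))}" "{Inr a, Inr b} \<in> Q"
      unfolding doubled_def by auto
    then show "s \<in> {{2 * g x, Suc (2 * g y)} | x y. {x, y} \<in> Q}"
    proof cases
      case 1
      then have "s = {2 * g (Inr b), Suc (2 * g (Inl a))}" "{Inr b, Inl a} \<in> Q"
        using in_l[of _ a] by (auto simp: fg insert_commute)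
      then show ?thesis by blast
    next
      case 2
      then have "s = {2 * g (Inl a), Suc (2 * g (Inr b))}" using in_l[of _ a] by (auto simp: fg)
      then show ?thesis using 2 by blast
    next
      case 3
      then have "s = {2 * g (Inl b), Suc (2 * g (Inl a))}" "{Inl b, Inl a} \<in> Q"
        using in_l[of "{Inl a, Inl b}"] by (auto simp: fg insert_commute)
      then show ?thesis by blast
    next
      case 4
      then have "s = {2 * g (Inr a), Suc (2 * g (Inr b))}" by (auto simp: fg)
      then show ?thesis using 4 by blast
    qed
  next
    fix s assume "s \<in> {{2 * g x, Suc (2 * g y)} | x y. {x, y} \<in> Q}"
    then obtain x y where xy: "s = {2 * g x, Suc (2 * g y)}" "{x, y} \<in> Q" by blast
    show "s \<in> (`) f ` doubled Q"
    proof (cases x; cases y)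
      fix a b assume ab: "x = Inl a" "y = Inl b"
      then have "{Inl b, Inl a} \<in> Q" using xy(2) by (simp add: insert_commute)
      then have "{Inl (2 * b), Inl (2 * a + 1)} \<in> doubled Q"
        unfolding doubled_def by blast
      moreover have "s = f ` {Inl (2 * b), Inl (2 * a + 1)}"
        using xy ab in_l[of "{x, y}"] by (auto simp: fg)
      ultimately show ?thesis by blast
    next
      fix a b assume ab: "x = Inl a" "y = Inr b"
      then have "{Inl (2 * a + 1), Inr (2 * b + 1)} \<in> doubled Q"
        using xy(2) unfolding doubled_def by blast
      moreover have "s = f ` {Inl (2 * a + 1), Inr (2 * b + 1)}"
        using xy ab in_l[of "{x, y}"] by (auto simp: fg)
      ultimately show ?thesis by blast
    next
      fix a b assume ab: "x = Inr a" "y = Inl b"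
      then have "{Inl b, Inr a} \<in> Q" using xy(2) by (simp add: insert_commute)
      then have "{Inl (2 * b), Inr (2 * a)} \<in> doubled Q"
        unfolding doubled_def by blast
      moreover have "s = f ` {Inl (2 * b), Inr (2 * a)}"
        using xy ab in_l[of "{x, y}"] by (auto simp: fg)
      ultimately show ?thesis by blast
    next
      fix a b assume ab: "x = Inr a" "y = Inr b"
      then have "{Inr (2 * a), Inr (2 * b + 1)} \<in> doubled Q"
        using xy(2) unfolding doubled_def by blast
      moreover have "s = f ` {Inr (2 * a), Inr (2 * b + 1)}"
        using xy ab by (auto simp: fg)
      ultimately show ?thesis by blast
    qed
  qed
  also have "\<dots> = line_doubled ((`) g ` Q)"
    unfolding line_doubled_def img by blast
  finally show ?thesis by (simp only: f_def g_def)
qed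

lemma doubled_points: "Q \<subseteq> Pow (points l k) \<Longrightarrow> doubled Q \<subseteq> Pow (points (2 * l) (2 * k))"
  unfolding doubled_def points_def by fastforce

definition row_colours :: "nat \<Rightarrow> nat \<Rightarrow> colour list" where
  "row_colours l k = seg 0 k @ rev (seg 0 l)"

text \<open>For even \<open>k + l\<close> the upper row read backwards continues the pattern of the
  lower row. For odd \<open>k + l\<close> either pattern has an odd number of points of colour
  \<open>Col_a\<close>, so neither admits a diagram.\<close>

lemma lnc_row_colours: "lnc (row_colours l k) P \<longleftrightarrow> lnc (col Cubic (k + l)) P"
proof (cases "even (k + l)")
  case True
  have "row_colours l k = seg 0 (k + l)"
  proof (cases "even k")
    case True
    then show ?thesis using \<open>even (k + l)\<close> seg_append[of 0 k l] seg_shift[of k 0 l]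
      by (simp add: row_colours_def rev_seg mod_2_eq_odd)
  next
    case False
    then obtain j where j: "k = 1 + 2 * j" by (metis oddE add.commute)
    have "seg k l = seg 1 l" using seg_shift[of "2 * j" 1 l] by (simp add: j)
    then show ?thesis using \<open>even (k + l)\<close> False seg_append[of 0 k l]
      by (simp add: row_colours_def rev_seg mod_2_eq_odd)
  qed
  then show ?thesis by simp
next
  case False
  have "count_list (row_colours l k) Col_a = k + l" by (simp add: row_colours_def count_seg)
  then show ?thesis
    using False lnc_count_even[of "row_colours l k" P Col_a] lnc_count_even[of "seg 0 (k + l)" P Col_a]
    by (auto simp: count_seg)
qed

lemma point_colour_row:
  assumes "x \<in> points (2 * l) (2 * k)"
  shows "row_colours l k ! line_pos (2 * l) (2 * k) x = point_colour x"
proof (cases x)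
  case (Inl a)
  then have "a < 2 * l" using assms by (auto simp: points_def)
  then show ?thesis by (simp add: Inl row_colours_def nth_append rev_nth nth_seg colour_at_def)
next
  case (Inr b)
  then have "b < 2 * k" using assms by (auto simp: points_def)
  then show ?thesis by (simp add: Inr row_colours_def nth_append nth_seg colour_at_def)
qed

lemma coloured_eq: "coloured p \<longleftrightarrow> monochromatic point_colour p"
  by (simp add: coloured_def monochromatic_def)

lemma TL_Cubic_iff:
  assumes "p \<subseteq> Pow (points (2 * l) (2 * k))"
  shows "p \<in> TL Cubic l k \<longleftrightarrow> lnc (col Cubic (k + l)) (to_line (2 * l) (2 * k) p)"
  using nc_pairings_iff[OF assms, of "row_colours l k" point_colour] point_colour_row
  by (simp add: coloured_eq lnc_row_colours) (simp add: row_colours_def)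

lemma TL_Magic_iff:
  assumes "p \<subseteq> Pow (points (2 * l) (2 * k))"
  shows "p \<in> TL Magic l k \<longleftrightarrow> lnc (col Magic (k + l)) (to_line (2 * l) (2 * k) p)"
proof -
  have "replicate (2 * (k + l)) Col_a ! line_pos (2 * l) (2 * k) x = Col_a" if "x \<in> points (2 * l) (2 * k)" for x
    using imageI[OF that, of "line_pos (2 * l) (2 * k)"] by (simp add: line_pos_image)
  then show ?thesis
    using nc_pairings_iff[OF assms, of "replicate (2 * (k + l)) Col_a" "\<lambda>_. Col_a"]
    by (simp add: monochromatic_def)
qed

lemma nc_pairings_plain_iff:
  assumes "Q \<subseteq> Pow (points l k)"
  shows "Q \<in> nc_pairings l k \<longleftrightarrow> lnc (col Ortho (k + l)) (to_line l k Q)"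
proof -
  have "replicate (k + l) Col_a ! line_pos l k x = Col_a" if "x \<in> points l k" for x
    using imageI[OF that, of "line_pos l k"] by (simp add: line_pos_image)
  then show ?thesis
    using nc_pairings_iff[OF assms, of "replicate (k + l) Col_a" "\<lambda>_. Col_a"]
    by (simp add: monochromatic_def)
qed

lemma doubled_in_TL_Cubic:
  assumes "Q \<in> nc_pairings l k"
  shows "doubled Q \<in> TL Cubic l k"
proof -
  have Q: "Q \<subseteq> Pow (points l k)" by (rule nc_pairings_points[OF assms])
  have "lnc (replicate (k + l) Col_a) (to_line l k Q)" using assms nc_pairings_plain_iff[OF Q] by simp
  from lnc_line_doubled(1)[OF this] show ?thesis
    unfolding TL_Cubic_iff[OF doubled_points[OF Q]] to_line_doubled[OF Q] by simp
qed

lemma TL_Ortho_eq: "TL Ortho l k = doubled ` nc_pairings l k"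
  using doubled_in_TL_Cubic by auto

lemma TL_mono: "TL Ortho l k \<subseteq> TL Cubic l k" "TL Cubic l k \<subseteq> TL Magic l k"
  using doubled_in_TL_Cubic by auto

lemma nth_dbl: "q < 2 * length w \<Longrightarrow> dbl w ! q = w ! (q div 2)"
proof (induction w arbitrary: q)
  case (Cons a w)
  then show ?case by (cases q; cases "q - 1") (auto simp: nth_Cons')
qed simp

lemma diagram_symbol_eq_match:
  assumes p: "p \<subseteq> Pow (points (2 * l) (2 * k))" and len: "length i = l" "length j = k"
  shows "diagram_symbol i p j = match (to_line (2 * l) (2 * k) p) (dbl (j @ rev i))"
proof -
  have idx: "dbl (j @ rev i) ! line_pos (2 * l) (2 * k) x = point_index i j x" if "x \<in> points (2 * l) (2 * k)" for x
  proof (cases x)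
    case (Inl a)
    then have a: "a < 2 * l" using that by (auto simp: points_def)
    have "(2 * k + (2 * l - Suc a)) div 2 = k + (l - Suc (a div 2))" using a by presburger
    moreover have "a div 2 < l" using a by presburger
    moreover have "(j @ rev i) ! (length j + (l - Suc b)) = rev i ! (l - Suc b)" for b
      by (rule nth_append_length_plus)
    ultimately show ?thesis using a len Inl by (simp add: nth_dbl rev_nth del: dbl_simps add_diff_assoc add_diff_assoc2)
  next
    case (Inr b)
    then have "b < 2 * k" using that by (auto simp: points_def)
    then show ?thesis using len Inr by (simp add: nth_dbl nth_append del: dbl_simps) linarith
  qed
  have pt: "x \<in> points (2 * l) (2 * k)" if "s \<in> p" "x \<in> s" for s x using p that by blast
  have "monochromatic ((!) (dbl (j @ rev i))) (to_line (2 * l) (2 * k) p) \<longleftrightarrow> monochromatic (point_index i j) p"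
    unfolding monochromatic_image unfolding monochromatic_def
    by (intro ball_cong refl) (simp add: idx pt del: dbl_simps)
  then show ?thesis by (simp add: diagram_symbol_def match_def monochromatic_def del: dbl_simps)
qed

text \<open>The dictionary between strip and line at the level of symbols. For \<open>Ortho\<close>
  the line diagram is the pairing before doubling; its symbol on single letters equals that of the
  doubled diagram on doubled letters.\<close>

lemma TL_iff_line:
  shows "p \<in> TL x l k \<Longrightarrow> \<exists>P. lnc (col x (k + l)) P \<and> (\<forall>i j :: 'n list. length i = l \<longrightarrow> length j = k \<longrightarrow>
      diagram_symbol i p j = match P (enc x (j @ rev i)))"
    and "lnc (col x (k + l)) P \<Longrightarrow> \<exists>p\<in>TL x l k. \<forall>i j :: 'n list. length i = l \<longrightarrow> length j = k \<longrightarrow>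
      diagram_symbol i p j = match P (enc x (j @ rev i))"
proof -
  have iff: "q \<in> TL x l k \<longleftrightarrow> lnc (col x (k + l)) (to_line (2 * l) (2 * k) q)"
    if "q \<subseteq> Pow (points (2 * l) (2 * k))" "x \<noteq> Ortho" for q
    using TL_Cubic_iff[OF that(1)] TL_Magic_iff[OF that(1)] that(2) by (cases x) auto
  have e: "enc x u = dbl u" if "x \<noteq> Ortho" for u :: "'n list" using that by (cases x) auto
  have dbl_sym: "diagram_symbol i (doubled Q) j = match (to_line l k Q) (j @ rev i)"
    if Q: "Q \<in> nc_pairings l k" and len: "length i = l" "length j = k" for Q and i j :: "'n list"
  proof -
    have pw: "Q \<subseteq> Pow (points l k)" by (rule nc_pairings_points[OF Q])
    have l: "lnc (replicate (k + l) Col_a) (to_line l k Q)" using Q nc_pairings_plain_iff[OF pw] by simp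
    show ?thesis
      using diagram_symbol_eq_match[OF doubled_points[OF pw] len] lnc_line_doubled(2)[OF l, of "j @ rev i"] len
      by (simp add: to_line_doubled[OF pw] del: dbl_simps)
  qed
  {
    assume p: "p \<in> TL x l k"
    show "\<exists>P. lnc (col x (k + l)) P \<and> (\<forall>i j :: 'n list. length i = l \<longrightarrow> length j = k \<longrightarrow>
      diagram_symbol i p j = match P (enc x (j @ rev i)))"
    proof (cases "x = Ortho")
      case True
      then obtain Q where Q: "Q \<in> nc_pairings l k" "p = doubled Q" using p by auto
      then show ?thesis
        using dbl_sym[OF Q(1)] nc_pairings_plain_iff[OF nc_pairings_points[OF Q(1)]] True
        by (intro exI[of _ "to_line l k Q"]) simp
    next
      case False
      then have pw: "p \<subseteq> Pow (points (2 * l) (2 * k))"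
        using p by (intro nc_pairings_points) (cases x; simp)
      show ?thesis
        using iff[OF pw False] p diagram_symbol_eq_match[where 'a = 'n, OF pw] e[OF False]
        by (intro exI[of _ "to_line (2 * l) (2 * k) p"]) simp
    qed
  }
  {
    assume P: "lnc (col x (k + l)) P"
    show "\<exists>p\<in>TL x l k. \<forall>i j :: 'n list. length i = l \<longrightarrow> length j = k \<longrightarrow>
      diagram_symbol i p j = match P (enc x (j @ rev i))"
    proof (cases "x = Ortho")
      case True
      have "length (col x (k + l)) = k + l" using True by simp
      then obtain Q where Q: "Q \<subseteq> Pow (points l k)" "to_line l k Q = P"
        using to_line_surj[where K = k and L = l, OF P] by blast
      then have "Q \<in> nc_pairings l k" using nc_pairings_plain_iff[OF Q(1)] P True by simp
      then show ?thesis using dbl_sym Q(2) True TL_Ortho_eq by (intro bexI[of _ "doubled Q"]) auto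
    next
      case False
      then have "length (col x (k + l)) = 2 * k + 2 * l" by (cases x) auto
      then obtain p where p: "p \<subseteq> Pow (points (2 * l) (2 * k))" "to_line (2 * l) (2 * k) p = P"
        using to_line_surj[where K = "2 * k" and L = "2 * l", OF P] by blast
      then show ?thesis
        using iff[OF p(1) False] P diagram_symbol_eq_match[where 'a = 'n, OF p(1)] e[OF False]
        by (intro bexI[of _ p]) auto
    qed
  }
qed

lemma diagram_maps_eq:
  "(diagram_map l k ` TL x l k :: ('n::finite tensor \<Rightarrow> 'n tensor) set) =
    line_map l k ` pvec x (k + l) ` {P. lnc (col x (k + l)) P}"
proof (intro equalityI subsetI)
  fix T :: "'n tensor \<Rightarrow> 'n tensor"
  assume "T \<in> diagram_map l k ` TL x l k"
  then obtain p where p: "p \<in> TL x l k" "T = diagram_map l k p" by blast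
  obtain P where P: "lnc (col x (k + l)) P" "\<And>i j :: 'n list. length i = l \<Longrightarrow> length j = k \<Longrightarrow>
      diagram_symbol i p j = match P (enc x (j @ rev i))"
    using TL_iff_line(1)[where 'n = 'n, OF p(1)] by blast
  have "T = line_map l k (pvec x (k + l) P)"
    unfolding p(2) by (rule diagram_map_eq_line_map) (rule P(2))
  then show "T \<in> line_map l k ` pvec x (k + l) ` {P. lnc (col x (k + l)) P}"
    using P(1) by blast
next
  fix T :: "'n tensor \<Rightarrow> 'n tensor"
  assume "T \<in> line_map l k ` pvec x (k + l) ` {P. lnc (col x (k + l)) P}"
  then obtain P where P: "lnc (col x (k + l)) P" "T = line_map l k (pvec x (k + l) P)" by blast
  obtain p where p: "p \<in> TL x l k" "\<And>i j :: 'n list. length i = l \<Longrightarrow> length j = k \<Longrightarrow>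
      diagram_symbol i p j = match P (enc x (j @ rev i))"
    using TL_iff_line(2)[where 'n = 'n, OF P(1)] by blast
  have "diagram_map l k p = T"
    unfolding P(2) by (rule diagram_map_eq_line_map) (rule p(2))
  then show "T \<in> diagram_map l k ` TL x l k"
    using p(1) by blast
qed

theorem Hom_eq_diagram_span:
  "Hom (qalg x) (fund x :: 'n::finite \<times> 'n \<Rightarrow> _) l k = maps.span (diagram_map l k ` TL x l k)"
  unfolding Hom_eq_line_map line_map_line_span diagram_maps_eq ..

section \<open>The inclusions induced by the quotient maps\<close>

lemma is_matrix_weaken:
  assumes "(x, y) \<in> {(Ortho, Cubic), (Cubic, Magic)}"
  shows "is_matrix x (qalg y) (fund y :: 'n::finite \<times> 'n \<Rightarrow> _)"
proof (cases "x = Ortho")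
  case True
  then show ?thesis using is_matrix_fund[of Cubic] assms by (auto simp: cubic_matrix_def)
next
  case False
  then have xy: "x = Cubic" "y = Magic" using assms by auto
  let ?U = "univ Magic :: ('n \<times> 'n) free_star \<Rightarrow> real"
  interpret seminorm_cstar ?U by unfold_locales (rule cstar_seminorm_U)
  have "gen_rel Cubic eqv" by (rule gen_rel_Magic_imp_Cubic[OF p gen_rel_univ])
  then have "gen_rel Cubic (\<lambda>a b. ?U (a - b) = 0)" by (simp only: eqv_def[abs_def])
  then show ?thesis
    unfolding xy qalg_def fund_def using is_matrix_completion_iff[OF p, of Cubic] by blast
qed

text \<open>A linear map that fixes every \<open>T_p\<close> fixes their span; outside of it the
  value is determined by extensionality. Conversely the identity qualifies because the spans are
  nested.\<close>

lemma diagram_inclusion_iff: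
  fixes J :: "('n::finite tensor \<Rightarrow> 'n tensor) \<Rightarrow> 'n tensor \<Rightarrow> 'n tensor"
  assumes sub: "TL x l k \<subseteq> TL y l k"
  shows "diagram_inclusion x y l k J \<longleftrightarrow> J = (\<lambda>T\<in>diagram_span x l k. T)"
proof
  assume J: "diagram_inclusion x y l k J"
  have add: "J (S + T) = J S + J T" if "S \<in> diagram_span x l k" "T \<in> diagram_span x l k" for S T
    using J that unfolding diagram_inclusion_def by blast
  have scale: "J (map_scale c T) = map_scale c (J T)" if "T \<in> diagram_span x l k" for c T
    using J that unfolding diagram_inclusion_def by blast
  have z: "0 \<in> (diagram_span x l k :: ('n tensor \<Rightarrow> 'n tensor) set)"
    unfolding diagram_span_def by (rule maps.span_zero)
  have "T \<in> diagram_span x l k \<and> J T = T" if "T \<in> maps.span (diagram_map l k ` TL x l k)" for T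
    using that
  proof (induction rule: maps.span_induct_alt)
    case base
    have "J (0 + 0) = J 0 + J 0" by (rule add[OF z z])
    then have "J 0 = 0" by simp
    then show ?case using z by (simp add: zero_fun_def)
  next
    case (step c g h)
    then have "J g = g" using J unfolding diagram_inclusion_def by blast
    moreover have g: "g \<in> diagram_span x l k" using step(1) unfolding diagram_span_def by (rule maps.span_base)
    moreover have cg: "map_scale c g \<in> diagram_span x l k"
      using g unfolding diagram_span_def by (rule maps.span_scale)
    moreover have "map_scale c g + h \<in> diagram_span x l k"
      using cg step(2) unfolding diagram_span_def by (blast intro: maps.span_add)
    ultimately show ?case using add[OF cg, of h] scale[OF g, of c] step(2) by metis
  qed
  then have "J T = T" if "T \<in> diagram_span x l k" for T
    using that unfolding diagram_span_def by blast
  moreover have "J T = undefined" if "T \<notin> diagram_span x l k" for T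
    using J that unfolding diagram_inclusion_def by (meson PiE_arb)
  ultimately show "J = (\<lambda>T\<in>diagram_span x l k. T)" by (auto simp: fun_eq_iff restrict_def)
next
  assume J: "J = (\<lambda>T\<in>diagram_span x l k. T)"
  have le: "diagram_span x l k \<subseteq> (diagram_span y l k :: ('n tensor \<Rightarrow> 'n tensor) set)"
    unfolding diagram_span_def by (intro maps.span_mono image_mono sub)
  have "S + T \<in> diagram_span x l k" if "S \<in> diagram_span x l k" "T \<in> diagram_span x l k"
    for S T :: "'n tensor \<Rightarrow> 'n tensor" using that unfolding diagram_span_def by (rule maps.span_add)
  moreover have "map_scale c T \<in> diagram_span x l k" if "T \<in> diagram_span x l k"
    for c and T :: "'n tensor \<Rightarrow> 'n tensor" using that unfolding diagram_span_def by (rule maps.span_scale)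
  moreover have "diagram_map l k p \<in> (diagram_span x l k :: ('n tensor \<Rightarrow> 'n tensor) set)" if "p \<in> TL x l k" for p
    using that unfolding diagram_span_def by (intro maps.span_base imageI)
  moreover have "J \<in> diagram_span x l k \<rightarrow>\<^sub>E diagram_span y l k" unfolding J using le by auto
  ultimately show "diagram_inclusion x y l k J"
    unfolding diagram_inclusion_def using sub by (auto simp: J)
qed

lemma quotient_map_inclusion:
  assumes xy: "(x, y) \<in> {(Ortho, Cubic), (Cubic, Magic)}"
  shows "\<exists>\<pi>. cstar_hom (qalg x) (qalg y) \<pi> \<and> (\<forall>ij :: 'n::finite \<times> 'n. \<pi> (fund x ij) = fund y ij) \<and>
    (\<forall>l k. TL x l k \<subseteq> TL y l k \<and>
       Hom (qalg x) (fund x :: 'n \<times> 'n \<Rightarrow> _) l k \<subseteq> Hom (qalg y) (\<pi> \<circ> fund x) l k \<and>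
       (\<forall>J. diagram_inclusion x y l k J \<longleftrightarrow>
          J = (\<lambda>T\<in>Hom (qalg x) (fund x :: 'n \<times> 'n \<Rightarrow> _) l k. T)))"
proof -
  obtain \<pi> where \<pi>: "cstar_hom (qalg x) (qalg y) \<pi>" "\<And>ij :: 'n \<times> 'n. \<pi> (fund x ij) = fund y ij"
    using qalg_universal[OF cstar_algebra_qalg is_matrix_weaken[OF xy]] by blast
  \<comment> \<open>The image of the fundamental matrix under the quotient map is the fundamental
    matrix of \<open>qalg y\<close>, so the second Hom space is the one already computed for
    \<open>y\<close>.\<close>
  have comp: "\<pi> \<circ> fund x = (fund y :: 'n \<times> 'n \<Rightarrow> _)" using \<pi>(2) by auto
  have TL: "TL x l k \<subseteq> TL y l k" for l k using xy TL_mono[of l k] by (auto simp del: TL.simps)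
  have "maps.span (diagram_map l k ` TL x l k) \<subseteq> maps.span (diagram_map l k ` TL y l k :: ('n tensor \<Rightarrow> 'n tensor) set)" for l k
    by (intro maps.span_mono image_mono TL)
  then have "Hom (qalg x) (fund x :: 'n \<times> 'n \<Rightarrow> _) l k \<subseteq> Hom (qalg y) (\<pi> \<circ> fund x) l k" for l k
    unfolding comp Hom_eq_diagram_span .
  moreover have "diagram_inclusion x y l k J \<longleftrightarrow>
      J = (\<lambda>T\<in>Hom (qalg x) (fund x :: 'n \<times> 'n \<Rightarrow> _) l k. T)" for l k J
    using diagram_inclusion_iff[OF TL, of l k J] by (simp only: Hom_eq_diagram_span diagram_span_def)
  ultimately show ?thesis using \<pi> TL by blast
qed

theorem theorem7p4:
  assumes "CARD('n::finite) \<ge> 4"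
  shows
    "(\<forall>x l k. Hom (qalg x) (fund x :: 'n \<times> 'n \<Rightarrow> _) l k =
        maps.span (diagram_map l k ` TL x l k)) \<and>
     (\<forall>(x, y) \<in> {(Ortho, Cubic), (Cubic, Magic)}. \<exists>\<pi>.
        cstar_hom (qalg x) (qalg y) \<pi> \<and>
        (\<forall>ij :: 'n \<times> 'n. \<pi> (fund x ij) = fund y ij) \<and>
        (\<forall>l k. TL x l k \<subseteq> TL y l k \<and>
           Hom (qalg x) (fund x :: 'n \<times> 'n \<Rightarrow> _) l k \<subseteq> Hom (qalg y) (\<pi> \<circ> fund x) l k \<and>
           (\<forall>J. diagram_inclusion x y l k J \<longleftrightarrow>
              J = (\<lambda>T\<in>Hom (qalg x) (fund x :: 'n \<times> 'n \<Rightarrow> _) l k. T))))"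
  by (intro conjI allI ballI case_prodI2 Hom_eq_diagram_span quotient_map_inclusion) simp

end
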